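(* Let $\mu_n^\pm$ be one of the edges of a non-degenerate lacuna in the spectrum of $\mathcal{H}_0$ (the upper, respectively lower, sign is taken throughout). (a) If for some function $C(\varepsilon)$ with $C(\varepsilon)\to+\infty$ as $\varepsilon\to0$ $$\operatorname{Re}\big(k_{n,\varepsilon}^{\pm,1}+\varepsilon k_{n,\varepsilon}^{\pm,2}\big)\geq C(\varepsilon)\varepsilon^2$$ for all small $\varepsilon>0$, then for all sufficiently small $\varepsilon$ the operator $\mathcal{H}_\varepsilon$ has an eigenvalue $\lambda_{\varepsilon,n}^\pm$ converging to $\mu_n^\pm$ as $\varepsilon\to0$, and $$\lambda_{\varepsilon,n}^\pm=\mu_n^\pm\mp\frac{\varepsilon^2}{4|\dot D(\mu_n^\pm)|}\big(\mathcal{A}_n^\pm(\varepsilon,0)\mathcal{L}_\varepsilon\phi_n^\pm,\phi_n^\pm\big)_{L_2(Q)}^2\,(1+\mathcal{O}(\varepsilon^2)),$$ $$\lambda_{\varepsilon,n}^\pm=\mu_n^\pm\mp\varepsilon^2\big(k_{n,\varepsilon}^{\pm,1}+\varepsilon k_{n,\varepsilon}^{\pm,2}\big)^2+\mathcal{O}\big(\varepsilon^4|k_{n,\varepsilon}^{\pm,1}|+\varepsilon^5\big).$$ (b) If for some function $C(\varepsilon)$ with $C(\varepsilon)\to+\infty$ as $\varepsilon\to0$ $$\operatorname{Re}\big(k_{n,\varepsilon}^{\pm,1}+\varepsilon k_{n,\varepsilon}^{\pm,2}\big)\leq -C(\varepsilon)\varepsilon^2$$ for all small $\varepsilon>0$,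 then $\mathcal{H}_\varepsilon$ has no eigenvalues converging to $\mu_n^\pm$ as $\varepsilon\to0$; that is, there are $r>0$, $\varepsilon_0>0$ such that for $\varepsilon\in(0,\varepsilon_0)$ the disk $\{|\lambda-\mu_n^\pm|<r\}$ contains no eigenvalue of $\mathcal{H}_\varepsilon$.
   Context: Let $p,q:\mathbb{R}\to\mathbb{R}$ be $1$-periodic, $p$ piecewise continuously differentiable (continuous with piecewise continuous derivative), $q$ piecewise continuous, $p(x)\geq p_0>0$ for all $x$, and $p(0)=1$. Let $\mathcal{H}_0:=-\frac{d}{dx}p\frac{d}{dx}+q$ be the self-adjoint operator in $L_2(\mathbb{R})$ with domain $W_2^2(\mathbb{R})$. Let $Q\subset\mathbb{R}$ be a fixed bounded open interval. For each small $\varepsilon>0$ let $\mathcal{L}_\varepsilon:W_2^2(Q)\to L_2(Q)$ be a linear operator, bounded uniformly in $\varepsilon$ (operator norms bounded by a constant independent of $\varepsilon$). Denote also by $\mathcal{L}_\varepsilon$ the operator $W_{2,loc}^2(\mathbb{R})\to L_2(\mathbb{R})$ that restricts a function to $Q$, applies $\mathcal{L}_\varepsilon$, and extends the result by zero outside $Q$. Set $\mathcal{H}_\varepsilon:=\mathcal{H}_0-\varepsilon\mathcal{L}_\varepsilon$, an operator in $L_2(\mathbb{R})$ with domain $W_2^2(\mathbb{R})$. The inner product is $(f,g)_{L_2(Q)}=\int_Q f\overline{g}\,dx$. It is known that $\sigma(\mathcal{H}_0)=\bigcup_{n=0}^\infty[\mu_n^+,\mu_{n+1}^-]$, where $\mu_0^+<\mu_1^-\leq\mu_1^+<\mu_2^-\leq\mu_2^+<\dots$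 are the eigenvalues (listed with multiplicity) of $\left(-\frac{d}{dx}p\frac{d}{dx}+q\right)\phi=\mu\phi$ on $(0,1)$ with $\phi(0)+(-1)^{n+1}\phi(1)=0$, $\phi'(0)+(-1)^{n+1}\phi'(1)=0$; $\mu_n^\pm$ corresponds to periodic conditions for even $n$ and antiperiodic ones for odd $n$. The lacunas are $(-\infty,\mu_0^+)$, non-degenerate with only edge $\mu_0^+$, and $(\mu_n^-,\mu_n^+)$, $n\geq1$, with edges $\mu_n^\pm$, non-degenerate if $\mu_n^-<\mu_n^+$. Let $\theta_1(x,\lambda),\theta_2(x,\lambda)$ be the solutions of $\left(-\frac{d}{dx}p\frac{d}{dx}+q-\lambda\right)v=0$ on $\mathbb{R}$ with $\theta_1(0,\lambda)=1$, $\theta_1'(0,\lambda)=0$, $\theta_2(0,\lambda)=0$, $\theta_2'(0,\lambda)=1$. Write $\theta_i(\lambda):=\theta_i(1,\lambda)$, $\theta_i'(\lambda):=\frac{d\theta_i}{dx}(1,\lambda)$, $D(\lambda):=\theta_1(\lambda)+\theta_2'(\lambda)$, and $\dot D:=dD/d\lambda$ (one has $\dot D(\mu_n^\pm)\neq0$ at edges of non-degenerate lacunas). For an edge $\mu_n^\pm$ of a non-degenerate lacuna, $\phi_n^\pm$ is the real eigenfunction of the boundary value problem above for $\mu_n^\pm$, continued to $\mathbb{R}$ $1$-periodically for even $n$ and $1$-antiperiodically for odd $n$, and normalized by $|\phi_n^\pm(0)|^2+\left|\frac{d\phi_n^\pm}{dx}(0)\right|^2=|\theta_1'(\mu_n^\pm)|+|\theta_2(\mu_n^\pm)|$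 (the right side is non-zero). For $f\in L_2(Q)$ and $x\in\mathbb{R}$, $(\mathcal{G}_{n,0}^\pm f)(x):=\int_Q G_{n,0}^\pm(x,t)f(t)\,dt$, where $$G_{n,0}^\pm(x,t):=\tfrac12\big(\theta_1(t,\mu_n^\pm)\theta_2(x,\mu_n^\pm)-\theta_1(x,\mu_n^\pm)\theta_2(t,\mu_n^\pm)\big)\ \text{ for } t>x,$$ $$G_{n,0}^\pm(x,t):=\tfrac12\big(\theta_1(x,\mu_n^\pm)\theta_2(t,\mu_n^\pm)-\theta_1(t,\mu_n^\pm)\theta_2(x,\mu_n^\pm)\big)\ \text{ for } t<x.$$ For small $\varepsilon$, $\mathcal{A}_n^\pm(\varepsilon,0):=\left(\mathrm{I}-\varepsilon\mathcal{L}_\varepsilon\mathcal{G}_{n,0}^\pm\right)^{-1}$ is a well-defined bounded operator in $L_2(Q)$. Finally, $$k_{n,\varepsilon}^{\pm,1}:=\pm\frac{(\mathcal{L}_\varepsilon\phi_n^\pm,\phi_n^\pm)_{L_2(Q)}}{2\sqrt{|\dot D(\mu_n^\pm)|}},\qquad k_{n,\varepsilon}^{\pm,2}:=\pm\frac{(\mathcal{L}_\varepsilon\mathcal{G}_{n,0}^\pm\mathcal{L}_\varepsilon\phi_n^\pm,\phi_n^\pm)_{L_2(Q)}}{2\sqrt{|\dot D(\mu_n^\pm)|}}.$$ *)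

theory Defs
  imports "HOL-Analysis.Analysis" "HOL-Library.Function_Algebras" "HOL-Library.Landau_Symbols"
begin

text \<open>
  Elements of \<open>L\<^sub>2(S)\<close> are represented by functions \<open>real \<Rightarrow> complex\<close> of which only the
  almost-everywhere class on \<open>S\<close> matters; values outside \<open>S\<close> are irrelevant.  Equality of
  elements is expressed by \<open>AE x in lebesgue_on S\<close>.
\<close>

definition L2 :: "real set \<Rightarrow> (real \<Rightarrow> complex) set" where
  "L2 S = {f. f \<in> borel_measurable (lebesgue_on S) \<and>
              integrable (lebesgue_on S) (\<lambda>x. (cmod (f x))\<^sup>2)}"

definition L2_inner :: "real set \<Rightarrow> (real \<Rightarrow> complex) \<Rightarrow> (real \<Rightarrow> complex) \<Rightarrow> complex" where
  "L2_inner S f g = (\<integral>x. f x * cnj (g x) \<partial>lebesgue_on S)"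

definition L2_norm :: "real set \<Rightarrow> (real \<Rightarrow> complex) \<Rightarrow> real" where
  "L2_norm S f = sqrt (\<integral>x. (cmod (f x))\<^sup>2 \<partial>lebesgue_on S)"


definition test_function :: "real set \<Rightarrow> (real \<Rightarrow> real) \<Rightarrow> bool" where
  "test_function S \<phi> \<longleftrightarrow> (\<forall>k. (deriv ^^ k) \<phi> differentiable_on UNIV) \<and>
     (\<exists>K. compact K \<and> K \<subseteq> S \<and> (\<forall>x. x \<notin> K \<longrightarrow> \<phi> x = 0))"

definition locally_integrable :: "real set \<Rightarrow> (real \<Rightarrow> complex) \<Rightarrow> bool" where
  "locally_integrable S f \<longleftrightarrow> (\<forall>K. compact K \<and> K \<subseteq> S \<longrightarrow> integrable (lebesgue_on K) f)"

definition has_weak_deriv :: "real set \<Rightarrow> (real \<Rightarrow> complex) \<Rightarrow> (real \<Rightarrow> complex) \<Rightarrow> bool" where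
  "has_weak_deriv S u v \<longleftrightarrow> locally_integrable S u \<and> locally_integrable S v \<and>
     (\<forall>\<phi>. test_function S \<phi> \<longrightarrow>
        (\<integral>x. deriv \<phi> x *\<^sub>R u x \<partial>lebesgue_on S) = - (\<integral>x. \<phi> x *\<^sub>R v x \<partial>lebesgue_on S))"

text \<open>A weak derivative is unique up to null sets, so the choice below is immaterial.\<close>

definition weak_deriv :: "real set \<Rightarrow> (real \<Rightarrow> complex) \<Rightarrow> real \<Rightarrow> complex" where
  "weak_deriv S u = (SOME v. has_weak_deriv S u v)"

definition W22 :: "real set \<Rightarrow> (real \<Rightarrow> complex) set" where
  "W22 S = {u \<in> L2 S. \<exists>v\<in>L2 S. \<exists>w\<in>L2 S. has_weak_deriv S u v \<and> has_weak_deriv S v w}"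

definition W22_norm :: "real set \<Rightarrow> (real \<Rightarrow> complex) \<Rightarrow> real" where
  "W22_norm S u = sqrt ((L2_norm S u)\<^sup>2 + (L2_norm S (weak_deriv S u))\<^sup>2
                        + (L2_norm S (weak_deriv S (weak_deriv S u)))\<^sup>2)"

text \<open>
  Linear operators \<open>W\<^sub>2\<^sup>2(S) \<rightarrow> L\<^sub>2(S)\<close> of norm at most \<open>M\<close>.  Independence of the
  chosen representative of the argument follows from linearity and the norm bound.
\<close>

definition bounded_operator_W22_L2 ::
    "real set \<Rightarrow> real \<Rightarrow> ((real \<Rightarrow> complex) \<Rightarrow> real \<Rightarrow> complex) \<Rightarrow> bool" where
  "bounded_operator_W22_L2 S M T \<longleftrightarrow>
     (\<forall>u\<in>W22 S. T u \<in> L2 S) \<and>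
     (\<forall>u\<in>W22 S. \<forall>v\<in>W22 S. \<forall>a b. AE x in lebesgue_on S.
        T (\<lambda>y. a * u y + b * v y) x = a * T u x + b * T v x) \<and>
     (\<forall>u\<in>W22 S. L2_norm S (T u) \<le> M * W22_norm S u)"

definition eigenvalue ::
    "(real \<Rightarrow> complex) set \<Rightarrow> ((real \<Rightarrow> complex) \<Rightarrow> real \<Rightarrow> complex) \<Rightarrow> complex \<Rightarrow> bool" where
  "eigenvalue V T l \<longleftrightarrow>
     (\<exists>u\<in>V. \<not> (AE x in lebesgue. u x = 0) \<and> (AE x in lebesgue. T u x = l * u x))"

text \<open>A choice of preimage; where \<open>T\<close> is invertible in \<open>L\<^sub>2(S)\<close> this is its inverse.\<close>

definition L2_inverse ::
    "real set \<Rightarrow> ((real \<Rightarrow> complex) \<Rightarrow> real \<Rightarrow> complex) \<Rightarrow> (real \<Rightarrow> complex) \<Rightarrow> real \<Rightarrow> complex" where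
  "L2_inverse S T f = (SOME g. g \<in> L2 S \<and> (AE x in lebesgue_on S. T g x = f x))"


definition locally_finite_set :: "real set \<Rightarrow> bool" where
  "locally_finite_set E \<longleftrightarrow> (\<forall>a b. finite (E \<inter> {a..b}))"

definition piecewise_continuous :: "(real \<Rightarrow> real) \<Rightarrow> bool" where
  "piecewise_continuous f \<longleftrightarrow>
     (\<exists>E. locally_finite_set E \<and> (\<forall>x. x \<notin> E \<longrightarrow> isCont f x)) \<and>
     (\<forall>x. (\<exists>l. (f \<longlongrightarrow> l) (at_left x)) \<and> (\<exists>l. (f \<longlongrightarrow> l) (at_right x)))"

definition piecewise_C1 :: "(real \<Rightarrow> real) \<Rightarrow> bool" where
  "piecewise_C1 f \<longleftrightarrow> continuous_on UNIV f \<and>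
     (\<exists>E f'. locally_finite_set E \<and> (\<forall>x. x \<notin> E \<longrightarrow> (f has_real_derivative f' x) (at x)) \<and>
             piecewise_continuous f')"

definition H0 :: "(real \<Rightarrow> real) \<Rightarrow> (real \<Rightarrow> real) \<Rightarrow> (real \<Rightarrow> complex) \<Rightarrow> real \<Rightarrow> complex" where
  "H0 p q u = (\<lambda>x. - weak_deriv UNIV (\<lambda>y. of_real (p y) * weak_deriv UNIV u y) x
                   + of_real (q x) * u x)"

definition extend_by_zero :: "real set \<Rightarrow> (real \<Rightarrow> complex) \<Rightarrow> real \<Rightarrow> complex" where
  "extend_by_zero S f = (\<lambda>x. if x \<in> S then f x else 0)"

definition H_pert ::
    "(real \<Rightarrow> real) \<Rightarrow> (real \<Rightarrow> real) \<Rightarrow> real set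
     \<Rightarrow> (real \<Rightarrow> (real \<Rightarrow> complex) \<Rightarrow> real \<Rightarrow> complex) \<Rightarrow> real
     \<Rightarrow> (real \<Rightarrow> complex) \<Rightarrow> real \<Rightarrow> complex" where
  "H_pert p q Q L \<epsilon> u = (\<lambda>x. H0 p q u x - of_real \<epsilon> * extend_by_zero Q (L \<epsilon> u) x)"

text \<open>
  Solutions of \<open>- (p v')' + (q - l) v = 0\<close> on the interval \<open>S\<close>: \<open>v\<close> is
  continuously differentiable and the equation holds off a locally finite set, which has to
  be admitted since \<open>q\<close> and \<open>p'\<close> may jump.
\<close>

definition ode_solution ::
    "real set \<Rightarrow> (real \<Rightarrow> real) \<Rightarrow> (real \<Rightarrow> real) \<Rightarrow> complex \<Rightarrow> (real \<Rightarrow> complex) \<Rightarrow> bool" where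
  "ode_solution S p q l v \<longleftrightarrow>
     (\<exists>v' E. (\<forall>x\<in>S. (v has_vector_derivative v' x) (at x within S)) \<and> continuous_on S v' \<and>
        locally_finite_set E \<and>
        (\<forall>x\<in>S - E. ((\<lambda>y. of_real (p y) * v' y) has_vector_derivative
                       (of_real (q x) - l) * v x) (at x within S)))"

definition fundamental_solutions ::
    "(real \<Rightarrow> real) \<Rightarrow> (real \<Rightarrow> real) \<Rightarrow> (complex \<Rightarrow> real \<Rightarrow> complex)
     \<Rightarrow> (complex \<Rightarrow> real \<Rightarrow> complex) \<Rightarrow> bool" where
  "fundamental_solutions p q \<theta>1 \<theta>2 \<longleftrightarrow>
     (\<forall>l. ode_solution UNIV p q l (\<theta>1 l) \<and> \<theta>1 l 0 = 1 \<and> vector_derivative (\<theta>1 l) (at 0) = 0 \<and>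
          ode_solution UNIV p q l (\<theta>2 l) \<and> \<theta>2 l 0 = 0 \<and> vector_derivative (\<theta>2 l) (at 0) = 1)"

definition discriminant ::
    "(complex \<Rightarrow> real \<Rightarrow> complex) \<Rightarrow> (complex \<Rightarrow> real \<Rightarrow> complex) \<Rightarrow> complex \<Rightarrow> complex" where
  "discriminant \<theta>1 \<theta>2 l = \<theta>1 l 1 + vector_derivative (\<theta>2 l) (at 1)"

text \<open>
  Functions on \<open>[0,1]\<close> are represented as vanishing outside \<open>[0,1]\<close>, so that the
  eigenspace has the right dimension.
\<close>

definition bvp_eigenspace ::
    "(real \<Rightarrow> real) \<Rightarrow> (real \<Rightarrow> real) \<Rightarrow> nat \<Rightarrow> complex \<Rightarrow> (real \<Rightarrow> complex) set" where
  "bvp_eigenspace p q n l =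
     {\<phi>. ode_solution {0..1} p q l \<phi> \<and> (\<forall>x. x \<notin> {0..1} \<longrightarrow> \<phi> x = 0) \<and>
         \<phi> 0 + (-1) ^ (n + 1) * \<phi> 1 = 0 \<and>
         vector_derivative \<phi> (at 0 within {0..1})
           + (-1) ^ (n + 1) * vector_derivative \<phi> (at 1 within {0..1}) = 0}"

datatype edge = Lower | Upper

fun pm :: "edge \<Rightarrow> real" where
  "pm Lower = -1"
| "pm Upper = 1"

text \<open>
  \<open>\<mu> Upper n\<close> and \<open>\<mu> Lower n\<close> are \<open>\<mu>\<^sub>n\<^sup>+\<close> and \<open>\<mu>\<^sub>n\<^sup>-\<close>; the value \<open>\<mu> Lower 0\<close> is meaningless.
  The indices of each parity enumerate the eigenvalues of the corresponding boundary value
  problem, each repeated according to its multiplicity.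
\<close>

definition band_edges :: "(real \<Rightarrow> real) \<Rightarrow> (real \<Rightarrow> real) \<Rightarrow> (edge \<Rightarrow> nat \<Rightarrow> real) \<Rightarrow> bool" where
  "band_edges p q \<mu> \<longleftrightarrow>
     (\<forall>n. \<mu> Upper n < \<mu> Lower (Suc n)) \<and> (\<forall>n\<ge>1. \<mu> Lower n \<le> \<mu> Upper n) \<and>
     (\<forall>n l. card {(s, m). (even m \<longleftrightarrow> even n) \<and> (m = 0 \<longrightarrow> s = Upper) \<and> complex_of_real (\<mu> s m) = l}
          = vector_space.dim (\<lambda>(c::complex) (f::real \<Rightarrow> complex) x. c * f x) (bvp_eigenspace p q n l))"

definition nondegenerate_edge :: "(edge \<Rightarrow> nat \<Rightarrow> real) \<Rightarrow> edge \<Rightarrow> nat \<Rightarrow> bool" where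
  "nondegenerate_edge \<mu> s n \<longleftrightarrow> (n = 0 \<and> s = Upper) \<or> (n \<ge> 1 \<and> \<mu> Lower n < \<mu> Upper n)"

definition edge_eigenfunction ::
    "(real \<Rightarrow> real) \<Rightarrow> (real \<Rightarrow> real) \<Rightarrow> (complex \<Rightarrow> real \<Rightarrow> complex) \<Rightarrow> (complex \<Rightarrow> real \<Rightarrow> complex)
     \<Rightarrow> nat \<Rightarrow> real \<Rightarrow> (real \<Rightarrow> real) \<Rightarrow> bool" where
  "edge_eigenfunction p q \<theta>1 \<theta>2 n m \<phi> \<longleftrightarrow>
     (\<lambda>x. if x \<in> {0..1} then of_real (\<phi> x) else 0) \<in> bvp_eigenspace p q n (of_real m) \<and>
     (\<forall>x. \<phi> (x + 1) = (-1) ^ n * \<phi> x) \<and>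
     \<bar>\<phi> 0\<bar>\<^sup>2 + \<bar>deriv \<phi> 0\<bar>\<^sup>2
       = cmod (vector_derivative (\<theta>1 (of_real m)) (at 1)) + cmod (\<theta>2 (of_real m) 1)"

text \<open>The two defining formulas agree (both vanish) on the diagonal \<open>t = x\<close>.\<close>

definition green_kernel ::
    "(complex \<Rightarrow> real \<Rightarrow> complex) \<Rightarrow> (complex \<Rightarrow> real \<Rightarrow> complex) \<Rightarrow> real \<Rightarrow> real \<Rightarrow> real \<Rightarrow> complex" where
  "green_kernel \<theta>1 \<theta>2 m x t =
     (let a = \<theta>1 (of_real m); b = \<theta>2 (of_real m)
      in if t > x then 1/2 * (a t * b x - a x * b t) else 1/2 * (a x * b t - a t * b x))"

definition green_operator ::
    "real set \<Rightarrow> (complex \<Rightarrow> real \<Rightarrow> complex) \<Rightarrow> (complex \<Rightarrow> real \<Rightarrow> complex) \<Rightarrow> real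
     \<Rightarrow> (real \<Rightarrow> complex) \<Rightarrow> real \<Rightarrow> complex" where
  "green_operator Q \<theta>1 \<theta>2 m f = (\<lambda>x. \<integral>t. green_kernel \<theta>1 \<theta>2 m x t * f t \<partial>lebesgue_on Q)"

text \<open>\<open>A\<close> is \<open>(I - \<epsilon> L\<^sub>\<epsilon> G)\<^sup>-\<^sup>1\<close> for the operator \<open>G\<close> on \<open>L\<^sub>2(Q)\<close>.\<close>

definition A_op ::
    "real set \<Rightarrow> (real \<Rightarrow> (real \<Rightarrow> complex) \<Rightarrow> real \<Rightarrow> complex)
     \<Rightarrow> ((real \<Rightarrow> complex) \<Rightarrow> real \<Rightarrow> complex) \<Rightarrow> real \<Rightarrow> (real \<Rightarrow> complex) \<Rightarrow> real \<Rightarrow> complex" where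
  "A_op Q L G \<epsilon> = L2_inverse Q (\<lambda>g x. g x - of_real \<epsilon> * L \<epsilon> (G g) x)"

definition k1 ::
    "real set \<Rightarrow> (real \<Rightarrow> (real \<Rightarrow> complex) \<Rightarrow> real \<Rightarrow> complex) \<Rightarrow> edge
     \<Rightarrow> complex \<Rightarrow> (real \<Rightarrow> complex) \<Rightarrow> real \<Rightarrow> complex" where
  "k1 Q L s dD \<phi> \<epsilon> = of_real (pm s) * L2_inner Q (L \<epsilon> \<phi>) \<phi> / of_real (2 * sqrt (cmod dD))"

definition k2 ::
    "real set \<Rightarrow> (real \<Rightarrow> (real \<Rightarrow> complex) \<Rightarrow> real \<Rightarrow> complex)
     \<Rightarrow> ((real \<Rightarrow> complex) \<Rightarrow> real \<Rightarrow> complex) \<Rightarrow> edge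
     \<Rightarrow> complex \<Rightarrow> (real \<Rightarrow> complex) \<Rightarrow> real \<Rightarrow> complex" where
  "k2 Q L G s dD \<phi> \<epsilon> =
     of_real (pm s) * L2_inner Q (L \<epsilon> (G (L \<epsilon> \<phi>))) \<phi> / of_real (2 * sqrt (cmod dD))"

end

theory Submission
  imports Defs "HOL-Complex_Analysis.Complex_Analysis"
begin

text \<open>
  With \<open>z\<^sup>2 = D\<^sup>2/4 - 1\<close> the multipliers of the Hill equation are \<open>(-1)\<^sup>n (w \<plusminus> z)\<close>, and
  \<open>Re z > 0\<close> selects the solutions decaying at either end.  An eigenfunction \<open>u\<close> of the perturbed
  operator is therefore determined by \<open>g = \<epsilon> L\<^sub>\<epsilon> u\<close> on \<open>Q\<close>, which satisfies
  \<open>g = \<epsilon> L\<^sub>\<epsilon> (G\<^sub>0 + (-1)\<^sup>n B / (2 z)) g\<close> with entire families \<open>G\<^sub>0\<close> and \<open>B\<close>; at the edge \<open>B\<close>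
  degenerates to \<open>\<plusminus> (-1)\<^sup>n (g, \<phi>) \<phi>\<close>.  Removing this singular rank-one part leaves a family
  \<open>T(z)\<close> bounded and Lipschitz near \<open>z = 0\<close> (the spectral parameter is an analytic function of
  \<open>z\<^sup>2\<close>), and what remains is the scalar equation \<open>z = \<epsilon> F(z)\<close> with
  \<open>F(z) = \<plusminus> ((I - \<epsilon> T(z))\<^sup>-\<^sup>1 L\<^sub>\<epsilon> \<phi>, \<phi>) / 2\<close>.  Its small root is \<open>\<epsilon> F(0) (1 + O(\<epsilon>\<^sup>2))\<close>, where
  \<open>F(0) = \<bar>D'\<bar>\<^sup>1\<^sup>/\<^sup>2 (k\<^sub>1 + \<epsilon> k\<^sub>2) + O(\<epsilon>\<^sup>2)\<close>, and it yields an eigenvalue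
  \<open>\<mu> \<minusplus> z\<^sup>2 / \<bar>D'\<bar> + O(z\<^sup>4)\<close> precisely when \<open>Re z > 0\<close>.
\<close>

section \<open>Absolutely continuous functions\<close>

text \<open>No symmetry of \<open>L \<epsilon>\<close> is assumed, so eigenvalues may be complex and
  no variational argument is available; the equation on the bounded interval has to carry the whole
  spectral content. The spectral parameter itself is a poor coordinate: near the edge the
  multipliers branch like a square root and the resolvent kernel behaves like 1/z. In the variable z
  the operators differ from their edge values by O(z^2), which beats the factor 1/z. Since F depends
  on z only through \<epsilon> T(z), its Lipschitz constant is O(\<epsilon>); together with the
  prefactor in z = \<epsilon> F(z) this makes the relative error of the root O(\<epsilon>^2).
  Comparing F(0) with k1 + \<epsilon> k2 costs O(\<epsilon>^2) in absolute terms, and the growth of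
  C(\<epsilon>) is what lets the sign of the real part survive that error. The line Re z = 0 is a
  separate case: both multipliers have modulus one, no non-zero tail is square integrable, and a
  contraction excludes eigenvalues. The prescribed normalisation of \<phi> is the one for which the
  degenerate form at the edge is exactly \<phi>(x) \<phi>(t) up to sign; |D'| is then the integral
  of \<phi>^2 over a period.\<close>

lemma AE_lebesgue_iff_negligible:
  "(AE x in lebesgue. P x) \<longleftrightarrow> negligible {x::real. \<not> P x}"
proof
  assume "AE x in lebesgue. P x"
  then obtain N where "N \<in> null_sets lebesgue" "{x. \<not> P x} \<subseteq> N"
    by (auto simp: eventually_ae_filter)
  then show "negligible {x. \<not> P x}"
    by (metis negligible_iff_null_sets negligible_subset)
next
  assume "negligible {x. \<not> P x}"
  then show "AE x in lebesgue. P x"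
    by (intro AE_I') (auto simp: negligible_iff_null_sets)
qed

lemma AE_lebesgue_on_iff:
  assumes "S \<in> sets lebesgue"
  shows "(AE x in lebesgue_on S. P x) \<longleftrightarrow> (AE x in lebesgue. x \<in> S \<longrightarrow> P (x::real))"
  using AE_restrict_space_iff[of S lebesgue P] assms by simp

definition loc_abs_int :: "(real \<Rightarrow> complex) \<Rightarrow> bool" where
  "loc_abs_int v \<longleftrightarrow> (\<forall>x y. v absolutely_integrable_on {x..y})"

definition has_ac_deriv :: "(real \<Rightarrow> complex) \<Rightarrow> (real \<Rightarrow> complex) \<Rightarrow> bool" where
  "has_ac_deriv u v \<longleftrightarrow> loc_abs_int v \<and> (\<forall>x y. x \<le> y \<longrightarrow> (v has_integral (u y - u x)) {x..y})"

lemma loc_abs_intD: "loc_abs_int v \<Longrightarrow> v absolutely_integrable_on {x..y}"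
  by (simp add: loc_abs_int_def)

lemma loc_abs_int_integrable: "loc_abs_int v \<Longrightarrow> v integrable_on {x..y}"
  using loc_abs_intD absolutely_integrable_on_def by blast

lemma loc_abs_int_norm: "loc_abs_int v \<Longrightarrow> (\<lambda>x. cmod (v x)) integrable_on {x..y}"
  using loc_abs_intD absolutely_integrable_on_def by blast

lemma loc_abs_int_add: "loc_abs_int f \<Longrightarrow> loc_abs_int g \<Longrightarrow> loc_abs_int (\<lambda>x. f x + g x)"
  by (auto simp: loc_abs_int_def intro: set_integral_add)

lemma loc_abs_int_diff: "loc_abs_int f \<Longrightarrow> loc_abs_int g \<Longrightarrow> loc_abs_int (\<lambda>x. f x - g x)"
  by (auto simp: loc_abs_int_def intro: set_integral_diff)

lemma loc_abs_int_measurable: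
  assumes "loc_abs_int f"
  shows "f \<in> borel_measurable lebesgue"
proof -
  have "(\<lambda>x. f x) \<in> borel_measurable lebesgue"
  proof (rule borel_measurable_LIMSEQ_metric)
    fix i :: nat
    show "(\<lambda>x. indicator {- real i..real i} x *\<^sub>R f x) \<in> borel_measurable lebesgue"
      using loc_abs_intD[OF assms, of "- real i" "real i"]
      by (simp add: set_integrable_def)
  next
    fix x :: real
    obtain k :: nat where k: "\<bar>x\<bar> \<le> real k" using real_arch_simple[of "\<bar>x\<bar>"] by auto
    have "eventually (\<lambda>i. indicator {- real i..real i} x *\<^sub>R f x = f x) sequentially"
      using eventually_ge_at_top[of k] by eventually_elim (use k in \<open>auto simp: indicator_def\<close>)
    then show "(\<lambda>i. indicator {- real i..real i} x *\<^sub>R f x) \<longlonglongrightarrow> f x"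
      by (rule tendsto_eventually)
  qed
  then show ?thesis by simp
qed

lemma loc_abs_int_mult_bounded:
  assumes f: "f \<in> borel_measurable lebesgue" and b: "\<And>x y. bounded (f ` {x..y})" and g: "loc_abs_int g"
  shows "loc_abs_int (\<lambda>x. f x * g x)"
  unfolding loc_abs_int_def
proof (intro allI)
  fix x y :: real
  have "f \<in> borel_measurable (lebesgue_on {x..y})"
    using f by (simp add: measurable_restrict_space1)
  then show "(\<lambda>x. f x * g x) absolutely_integrable_on {x..y}"
    by (intro absolutely_integrable_bounded_measurable_product[OF bilinear_times])
       (use b loc_abs_intD[OF g] in auto)
qed

lemma loc_abs_int_continuous: "continuous_on UNIV f \<Longrightarrow> loc_abs_int f"
  by (auto simp: loc_abs_int_def intro!: absolutely_integrable_continuous_real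
        intro: continuous_on_subset)

lemma continuous_measurable_lebesgue:
  "continuous_on UNIV (f :: real \<Rightarrow> 'a::real_normed_vector) \<Longrightarrow> f \<in> borel_measurable lebesgue"
  using borel_measurable_continuous_onI[of f] by (simp add: measurable_completion)

lemma loc_abs_int_mult_continuous:
  assumes "continuous_on UNIV f" "loc_abs_int g"
  shows "loc_abs_int (\<lambda>x. f x * g x)"
proof (rule loc_abs_int_mult_bounded[OF _ _ assms(2)])
  show "f \<in> borel_measurable lebesgue"
    using assms(1) by (rule continuous_measurable_lebesgue)
  fix x y show "bounded (f ` {x..y})"
    by (meson assms(1) compact_Icc compact_continuous_image compact_imp_bounded continuous_on_subset subset_UNIV)
qed

lemma loc_abs_int_cmult: "loc_abs_int g \<Longrightarrow> loc_abs_int (\<lambda>x. c * g x)"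
  using loc_abs_int_mult_continuous[of "\<lambda>_. c" g] by simp

lemma loc_abs_int_cong_AE:
  assumes "loc_abs_int f" "AE x in lebesgue. f x = g x"
  shows "loc_abs_int g"
  unfolding loc_abs_int_def
proof (intro allI)
  fix x y :: real
  have "negligible {x. f x \<noteq> g x}" using assms(2) by (simp add: AE_lebesgue_iff_negligible)
  from absolutely_integrable_spike[OF loc_abs_intD[OF assms(1)] this]
  show "g absolutely_integrable_on {x..y}" by fastforce
qed

lemma has_ac_derivI:
  "loc_abs_int v \<Longrightarrow> (\<And>x y. x \<le> y \<Longrightarrow> (v has_integral (u y - u x)) {x..y}) \<Longrightarrow> has_ac_deriv u v"
  by (simp add: has_ac_deriv_def)

lemma has_ac_derivD:
  assumes "has_ac_deriv u v"
  shows "loc_abs_int v" "x \<le> y \<Longrightarrow> (v has_integral (u y - u x)) {x..y}"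
    "x \<le> y \<Longrightarrow> integral {x..y} v = u y - u x"
  using assms by (auto simp: has_ac_deriv_def)

lemma has_ac_deriv_add:
  "has_ac_deriv u v \<Longrightarrow> has_ac_deriv f g \<Longrightarrow> has_ac_deriv (\<lambda>x. u x + f x) (\<lambda>x. v x + g x)"
  by (rule has_ac_derivI)
    (use has_integral_add[of v _ _ g] in \<open>auto simp: has_ac_deriv_def loc_abs_int_add add_diff_add\<close>)

lemma has_ac_deriv_cmult:
  assumes "has_ac_deriv u v" shows "has_ac_deriv (\<lambda>x. c * u x) (\<lambda>x. c * v x)"
proof (rule has_ac_derivI)
  show "loc_abs_int (\<lambda>x. c * v x)" using assms by (simp add: has_ac_derivD(1) loc_abs_int_cmult)
  fix x y :: real assume "x \<le> y"
  then show "((\<lambda>x. c * v x) has_integral c * u y - c * u x) {x..y}"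
    using has_integral_mult_right[OF has_ac_derivD(2)[OF assms]] by (simp add: right_diff_distrib)
qed

lemma has_ac_deriv_diff:
  "has_ac_deriv u v \<Longrightarrow> has_ac_deriv f g \<Longrightarrow> has_ac_deriv (\<lambda>x. u x - f x) (\<lambda>x. v x - g x)"
  using has_ac_deriv_add[of u v "\<lambda>x. (-1) * f x" "\<lambda>x. (-1) * g x"] has_ac_deriv_cmult[of f g "-1"] by simp

lemma has_ac_deriv_const: "has_ac_deriv (\<lambda>_. c) (\<lambda>_. 0)"
  by (auto simp: has_ac_deriv_def loc_abs_int_continuous)

lemma has_ac_deriv_cong_AE:
  assumes "has_ac_deriv u v" "AE x in lebesgue. v x = w x"
  shows "has_ac_deriv u w"
proof (rule has_ac_derivI)
  show "loc_abs_int w" by (rule loc_abs_int_cong_AE[OF has_ac_derivD(1)[OF assms(1)] assms(2)])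
  fix x y :: real assume "x \<le> y"
  have neg: "negligible {x. v x \<noteq> w x}" using assms(2) by (simp add: AE_lebesgue_iff_negligible)
  show "(w has_integral u y - u x) {x..y}"
    by (rule has_integral_spike[OF neg _ has_ac_derivD(2)[OF assms(1) \<open>x \<le> y\<close>]]) auto
qed

lemma has_ac_deriv_continuous:
  assumes "has_ac_deriv u v"
  shows "continuous_on UNIV u"
proof -
  have "isCont u x" for x
  proof -
    have eq: "u t = u (x-1) + integral {x-1..t} v" if "t \<in> {x-1..x+1}" for t
      using has_ac_derivD(3)[OF assms, of "x-1" t] that by auto
    have "continuous_on {x-1..x+1} (\<lambda>t. integral {x-1..t} v)"
      using loc_abs_int_integrable[OF has_ac_derivD(1)[OF assms]] by (rule indefinite_integral_continuous_1)
    then have "continuous_on {x-1..x+1} (\<lambda>t. u (x-1) + integral {x-1..t} v)"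
      by (intro continuous_intros)
    then have "continuous_on {x-1..x+1} u"
      by (rule continuous_on_eq) (rule eq[symmetric])
    then show "isCont u x"
      by (rule continuous_on_interior) (auto simp: interior_atLeastAtMost_real)
  qed
  then show ?thesis by (simp add: continuous_at_imp_continuous_on)
qed

lemma has_ac_deriv_zero:
  assumes "has_ac_deriv u v" "AE x in lebesgue. v x = 0"
  shows "u x = u y"
proof -
  have "has_ac_deriv u (\<lambda>_. 0)" using has_ac_deriv_cong_AE[OF assms] .
  from has_ac_derivD(3)[OF this, of x y] has_ac_derivD(3)[OF this, of y x] show ?thesis
    by (cases "x \<le> y") auto
qed

lemma has_ac_deriv_cong: "has_ac_deriv u v \<Longrightarrow> (\<And>x. u x = u' x) \<Longrightarrow> (\<And>x. v x = v' x) \<Longrightarrow> has_ac_deriv u' v'"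
  using ext[of u u'] ext[of v v'] by simp

lemma has_ac_deriv_vderiv:
  assumes "has_ac_deriv u v" "continuous_on UNIV v"
  shows "(u has_vector_derivative v x) (at x)"
proof -
  have "continuous_on {x-1..x+1} v" using assms(2) continuous_on_subset by blast
  then have "((\<lambda>t. integral {x-1..t} v) has_vector_derivative v x) (at x within {x-1..x+1})"
    by (rule integral_has_vector_derivative) auto
  then have "((\<lambda>t. u (x-1) + integral {x-1..t} v) has_vector_derivative v x) (at x within {x-1..x+1})"
    by (auto intro!: derivative_eq_intros)
  then have "(u has_vector_derivative v x) (at x within {x-1..x+1})"
  proof (rule has_vector_derivative_transform[rotated 2])
    show "u t = u (x - 1) + integral {x - 1..t} v" if "t \<in> {x-1..x+1}" for t
      using has_ac_derivD(3)[OF assms(1), of "x-1" t] that by auto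
  qed auto
  then show ?thesis
    by (simp add: at_within_Icc_at)
qed

text \<open>The defect of the product rule is additive over intervals and \<open>o\<close> of an additive quantity,
  so subdivision shows that it vanishes.\<close>

lemma has_ac_deriv_mult:
  assumes uv: "has_ac_deriv u v" and fg: "has_ac_deriv f g"
  shows "has_ac_deriv (\<lambda>x. u x * f x) (\<lambda>x. v x * f x + u x * g x)"
proof (rule has_ac_derivI)
  have cu: "continuous_on UNIV u" and cf: "continuous_on UNIV f"
    using has_ac_deriv_continuous assms by auto
  have lv: "loc_abs_int v" and lg: "loc_abs_int g" using assms has_ac_derivD by auto
  let ?h = "\<lambda>x. v x * f x + u x * g x"
  show lh: "loc_abs_int ?h"
    using loc_abs_int_mult_continuous[OF cf lv] loc_abs_int_mult_continuous[OF cu lg]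
    by (simp add: loc_abs_int_add mult.commute)
  fix x y :: real assume xy: "x \<le> y"
  define \<Delta> where "\<Delta> s t = u t * f t - u s * f s - integral {s..t} ?h" for s t
  define A where "A s t = integral {s..t} (\<lambda>x. cmod (v x)) + integral {s..t} (\<lambda>x. cmod (g x))" for s t
  have comb: "\<Delta> r t = \<Delta> r s + \<Delta> s t" "A r t = A r s + A s t" if "r \<le> s" "s \<le> t" for r s t
    using Henstock_Kurzweil_Integration.integral_combine[OF that loc_abs_int_integrable[OF lh], symmetric]
      Henstock_Kurzweil_Integration.integral_combine[OF that loc_abs_int_norm[OF lv], symmetric]
      Henstock_Kurzweil_Integration.integral_combine[OF that loc_abs_int_norm[OF lg], symmetric]
    by (auto simp: \<Delta>_def A_def)
  \<comment> \<open>The split u(t) f(t) - u(s) f(s) = (u(t) - u(s)) f(t) + u(s) (f(t) - f(s))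
    freezes \<open>f\<close> at the right end and \<open>u\<close> at the left end, so that only
    oscillations of \<open>u\<close> and \<open>f\<close>, at most \<open>e\<close>, multiply
    \<open>g\<close> and \<open>v\<close>.\<close>
  have loc: "cmod (\<Delta> s t) \<le> e * A s t"
    if st: "s \<le> t" and e: "\<And>r. r \<in> {s..t} \<Longrightarrow> cmod (f t - f r) \<le> e"
      "\<And>r. r \<in> {s..t} \<Longrightarrow> cmod (u s - u r) \<le> e" for s t e
  proof -
    have 1: "((\<lambda>r. v r * f t) has_integral ((u t - u s) * f t)) {s..t}"
      by (intro has_integral_mult_left has_ac_derivD(2)[OF uv st])
    have 2: "((\<lambda>r. u s * g r) has_integral (u s * (f t - f s))) {s..t}"
      by (intro has_integral_mult_right has_ac_derivD(2)[OF fg st])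
    have 3: "(?h has_integral integral {s..t} ?h) {s..t}"
      using loc_abs_int_integrable[OF lh] by (rule integrable_integral)
    have "((\<lambda>r. v r * f t + u s * g r - ?h r) has_integral
            ((u t - u s) * f t + u s * (f t - f s) - integral {s..t} ?h)) {s..t}"
      by (intro has_integral_diff has_integral_add 1 2 3)
    then have D: "((\<lambda>r. v r * (f t - f r) + (u s - u r) * g r) has_integral \<Delta> s t) {s..t}"
      by (auto simp: \<Delta>_def algebra_simps)
    have eA: "((\<lambda>r. e * cmod (v r) + e * cmod (g r)) has_integral (e * A s t)) {s..t}"
      unfolding A_def distrib_left
      by (intro has_integral_add has_integral_mult_right integrable_integral loc_abs_int_norm lv lg)
    have "cmod (integral {s..t} (\<lambda>r. v r * (f t - f r) + (u s - u r) * g r))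
        \<le> integral {s..t} (\<lambda>r. e * cmod (v r) + e * cmod (g r))"
    proof (rule integral_norm_bound_integral)
      fix r assume r: "r \<in> {s..t}"
      have "cmod (v r * (f t - f r) + (u s - u r) * g r)
          \<le> cmod (v r) * cmod (f t - f r) + cmod (u s - u r) * cmod (g r)"
        by (metis norm_mult norm_triangle_ineq)
      also have "\<dots> \<le> cmod (v r) * e + e * cmod (g r)"
        using e[OF r] by (intro add_mono mult_left_mono mult_right_mono) auto
      finally show "cmod (v r * (f t - f r) + (u s - u r) * g r) \<le> e * cmod (v r) + e * cmod (g r)"
        by (simp add: mult.commute)
    qed (use D eA in auto)
    then show ?thesis using D eA by (simp add: integral_unique)
  qed
  have Apos: "A x y \<ge> 0" unfolding A_def by (intro add_nonneg_nonneg integral_nonneg loc_abs_int_norm lv lg) auto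
  have "cmod (\<Delta> x y) \<le> e * A x y" if e: "e > 0" for e
  proof (rule Bolzano[of x y "\<lambda>s t. cmod (\<Delta> s t) \<le> e * A s t", OF xy])
    fix a b c
    assume trans: "cmod (\<Delta> a b) \<le> e * A a b" "cmod (\<Delta> b c) \<le> e * A b c" "a \<le> b" "b \<le> c"
    then have "cmod (\<Delta> a c) \<le> cmod (\<Delta> a b) + cmod (\<Delta> b c)"
      by (simp add: comb(1)[OF trans(3,4)] norm_triangle_ineq)
    also have "\<dots> \<le> e * A a c" using trans by (simp add: comb(2)[OF trans(3,4)] distrib_left)
    finally show "cmod (\<Delta> a c) \<le> e * A a c" .
  next
    fix z
    have "isCont u z" "isCont f z" using cu cf by (auto simp: continuous_on_eq_continuous_at)
    then obtain d1 d2 where d: "d1 > 0" "\<And>r. dist r z < d1 \<Longrightarrow> dist (u r) (u z) < e/2"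
      "d2 > 0" "\<And>r. dist r z < d2 \<Longrightarrow> dist (f r) (f z) < e/2"
      using half_gt_zero[OF e] unfolding continuous_at_eps_delta by blast
    show "\<exists>d>0. \<forall>a b. a \<le> z \<and> z \<le> b \<and> b - a < d \<longrightarrow> cmod (\<Delta> a b) \<le> e * A a b"
    proof (intro exI[of _ "min d1 d2"] conjI allI impI)
      fix s t :: real assume st: "s \<le> z \<and> z \<le> t \<and> t - s < min d1 d2"
      show "cmod (\<Delta> s t) \<le> e * A s t"
      proof (rule loc)
        fix r assume r: "r \<in> {s..t}"
        have dd: "dist t z < d2" "dist r z < d2" "dist s z < d1" "dist r z < d1"
          using st r by (auto simp: dist_real_def)
        have "dist (f t) (f z) < e/2" "dist (f r) (f z) < e/2" "dist (u s) (u z) < e/2" "dist (u r) (u z) < e/2"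
          using dd by (simp_all only: d)
        then have "dist (f t) (f r) < e" "dist (u s) (u r) < e"
          using dist_triangle_half_l[of "f t" "f z" e "f r"] dist_triangle_half_l[of "u s" "u z" e "u r"]
          by (auto simp: dist_commute)
        then show "cmod (f t - f r) \<le> e" "cmod (u s - u r) \<le> e"
          by (auto simp: dist_norm)
      qed (use st in auto)
    qed (use d in auto)
  qed
  note bd = this
  have "cmod (\<Delta> x y) \<le> 0 + e" if "e > 0" for e
  proof -
    \<comment> \<open>The summand 1 in the denominator covers the case
      \<open>A x y = 0\<close>.\<close>
    have "cmod (\<Delta> x y) \<le> (e / (A x y + 1)) * A x y" using that Apos by (intro bd) auto
    also have "\<dots> \<le> e" using that Apos by (simp add: field_simps)
    finally show ?thesis by simp
  qed
  then have "cmod (\<Delta> x y) \<le> 0" by (rule field_le_epsilon)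
  then have "integral {x..y} ?h = u y * f y - u x * f x" by (simp add: \<Delta>_def)
  then show "(?h has_integral u y * f y - u x * f x) {x..y}"
    using loc_abs_int_integrable[OF lh] by (metis integrable_integral)
qed

lemma locally_finite_union: "locally_finite_set A \<Longrightarrow> locally_finite_set B \<Longrightarrow> locally_finite_set (A \<union> B)"
  by (simp add: locally_finite_set_def Int_Un_distrib2)

text \<open>A compact interval meets a locally finite set in finitely many points, which the
  fundamental theorem tolerates for continuous \<open>u\<close>. Classical solutions, whose equation
  may fail where \<open>q\<close> or p' jumps, enter the calculus through this.\<close>

lemma has_ac_deriv_piecewise:
  assumes c: "continuous_on UNIV u" and E: "locally_finite_set E"
    and d: "\<And>x. x \<notin> E \<Longrightarrow> (u has_vector_derivative v x) (at x)" and v: "loc_abs_int v"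
  shows "has_ac_deriv u v"
proof (rule has_ac_derivI[OF v])
  fix x y :: real assume "x \<le> y"
  show "(v has_integral u y - u x) {x..y}"
    by (rule fundamental_theorem_of_calculus_interior_strong[of "E \<inter> {x..y}"])
       (use E d \<open>x \<le> y\<close> c in \<open>auto simp: locally_finite_set_def intro: continuous_on_subset\<close>)
qed

lemma has_ac_deriv_indefinite:
  assumes "loc_abs_int v"
  obtains u where "has_ac_deriv u v" "u c = 0"
proof
  define u where "u x = (if c \<le> x then integral {c..x} v else - integral {x..c} v)" for x
  note i = loc_abs_int_integrable[OF assms]
  show "has_ac_deriv u v"
  proof (rule has_ac_derivI[OF assms])
    fix x y :: real assume xy: "x \<le> y"
    have "integral {x..y} v = u y - u x"
      using xy Henstock_Kurzweil_Integration.integral_combine[of c x y v] 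
        Henstock_Kurzweil_Integration.integral_combine[of x c y v]
        Henstock_Kurzweil_Integration.integral_combine[of x y c v] i
      by (auto simp: u_def algebra_simps not_le) 
    then show "(v has_integral u y - u x) {x..y}" using i by (metis integrable_integral)
  qed
  show "u c = 0" by (simp add: u_def)
qed

section \<open>Test functions and weak derivatives\<close>

definition smooth :: "(real \<Rightarrow> real) \<Rightarrow> bool" where
  "smooth f \<longleftrightarrow> (\<forall>k. (deriv ^^ k) f differentiable_on UNIV)"

text \<open>Smoothness as a greatest fixed point: a class of differentiable functions closed under
  \<open>deriv\<close> contains all iterated derivatives of its members. Concrete functions are
  shown smooth by exhibiting such a class, without formulas for higher derivatives.\<close>

lemma smooth_coinduct:
  assumes "f \<in> A" and A: "\<And>g. g \<in> A \<Longrightarrow> g differentiable_on UNIV \<and> deriv g \<in> A"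
  shows "smooth f"
proof -
  have "(deriv ^^ k) f \<in> A" for k
    by (induction k) (use assms in auto)
  then show ?thesis using A by (simp add: smooth_def)
qed

lemma smooth_differentiable: "smooth f \<Longrightarrow> f differentiable_on UNIV"
  unfolding smooth_def by (metis funpow_0)

lemma smooth_DERIV: "smooth f \<Longrightarrow> (f has_real_derivative deriv f x) (at x)"
  using smooth_differentiable[of f]
  by (simp add: differentiable_on_def DERIV_deriv_iff_real_differentiable)

lemma smooth_deriv: "smooth f \<Longrightarrow> smooth (deriv f)"
  unfolding smooth_def
proof
  fix k assume "\<forall>k. (deriv ^^ k) f differentiable_on UNIV"
  then have "(deriv ^^ Suc k) f differentiable_on UNIV" by blast
  then show "(deriv ^^ k) (deriv f) differentiable_on UNIV" by (simp add: funpow_swap1)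
qed

lemma smooth_continuous: "smooth f \<Longrightarrow> continuous_on UNIV f"
  by (simp add: smooth_differentiable differentiable_imp_continuous_on)

lemma smoothI: "(\<And>x. (f has_real_derivative f' x) (at x)) \<Longrightarrow> smooth f' \<Longrightarrow> smooth f"
proof (rule smooth_coinduct[of _ "insert f {g. smooth g}"])
  fix g assume d: "\<And>x. (f has_real_derivative f' x) (at x)" and s: "smooth f'"
    and g: "g \<in> insert f {g. smooth g}"
  have "deriv f = f'" using d DERIV_imp_deriv by blast
  moreover have "f differentiable_on UNIV" 
    using d by (meson differentiable_on_def real_differentiable_def differentiable_at_withinI)
  ultimately show "g differentiable_on UNIV \<and> deriv g \<in> insert f {g. smooth g}"
    using g s smooth_deriv smooth_differentiable by auto
qed auto

text \<open>Finite sums of scaled products are closed under the Leibniz rule, whereas single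
  products are not. This class is the coinduction invariant that gives products, sums and scalar
  multiples at once.\<close>

inductive_set smooth_products :: "(real \<Rightarrow> real) set" where
  prod: "smooth f \<Longrightarrow> smooth g \<Longrightarrow> (\<lambda>x. c * (f x * g x)) \<in> smooth_products"
| add: "f \<in> smooth_products \<Longrightarrow> g \<in> smooth_products \<Longrightarrow> (\<lambda>x. f x + g x) \<in> smooth_products"

lemma smooth_products_deriv:
  "f \<in> smooth_products \<Longrightarrow> \<exists>f'\<in>smooth_products. \<forall>x. (f has_real_derivative f' x) (at x)"
proof (induction rule: smooth_products.induct)
  case (prod f g c)
  have "((\<lambda>x. c * (f x * g x)) has_real_derivative c * (deriv f x * g x) + c * (f x * deriv g x)) (at x)" for x
    by (rule derivative_eq_intros smooth_DERIV[OF prod(1)] smooth_DERIV[OF prod(2)] refl)+ (simp add: algebra_simps)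
  then show ?case
    by (intro bexI[OF _ smooth_products.add[OF smooth_products.prod[of "deriv f" g c] smooth_products.prod[of f "deriv g" c]]])
       (use prod smooth_deriv in auto)
next
  case (add f g)
  then obtain f' g' where "f' \<in> smooth_products" "g' \<in> smooth_products" "\<forall>x. (f has_real_derivative f' x) (at x)"
    "\<forall>x. (g has_real_derivative g' x) (at x)" by blast
  then show ?case
    by (intro bexI[of _ "\<lambda>x. f' x + g' x"] smooth_products.add) (auto intro!: derivative_eq_intros)
qed

lemma smooth_products_smooth: "f \<in> smooth_products \<Longrightarrow> smooth f"
proof (erule smooth_coinduct)
  fix g assume "g \<in> smooth_products"
  then obtain g' where g': "g' \<in> smooth_products" "\<And>x. (g has_real_derivative g' x) (at x)"
    using smooth_products_deriv by blast
  then have "deriv g = g'" using DERIV_imp_deriv by blast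
  with g' show "g differentiable_on UNIV \<and> deriv g \<in> smooth_products"
    by (metis differentiable_on_def real_differentiable_def differentiable_at_withinI)
qed

lemma smooth_const: "smooth (\<lambda>_. c)"
  by (rule smooth_coinduct[of _ "range (\<lambda>c _. c)"]) auto

lemma smooth_mult: "smooth f \<Longrightarrow> smooth g \<Longrightarrow> smooth (\<lambda>x. f x * g x)"
  using smooth_products_smooth[OF smooth_products.prod[of f g 1]] by simp

lemma smooth_cmult: "smooth f \<Longrightarrow> smooth (\<lambda>x. c * f x)"
  using smooth_mult[OF smooth_const] .

lemma smooth_diff: "smooth f \<Longrightarrow> smooth g \<Longrightarrow> smooth (\<lambda>x. f x - g x)"
  using smooth_products_smooth[OF smooth_products.add[OF smooth_products.prod[of f "\<lambda>_. 1" 1] smooth_products.prod[of g "\<lambda>_. 1" "-1"]]]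
  by (simp add: smooth_const)

lemma smooth_affine:
  assumes "smooth f" shows "smooth (\<lambda>x. f (m * x + c))"
proof (rule smooth_coinduct[of _ "{\<lambda>x. k * g (m * x + c) |k g. smooth g}"])
  show "(\<lambda>x. f (m * x + c)) \<in> {\<lambda>x. k * g (m * x + c) |k g. smooth g}"
    using assms by (auto intro!: exI[of _ 1] exI[of _ f])
  fix h assume "h \<in> {\<lambda>x. k * g (m * x + c) |k g. smooth g}"
  then obtain k g where h: "h = (\<lambda>x. k * g (m * x + c))" "smooth g" by auto
  have d: "(h has_real_derivative (k * m) * deriv g (m * x + c)) (at x)" for x
    unfolding h(1)
    by (rule derivative_eq_intros DERIV_chain2[OF smooth_DERIV[OF h(2)]] refl)+ simp
  then have "deriv h = (\<lambda>x. (k * m) * deriv g (m * x + c))" using DERIV_imp_deriv by blast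
  moreover have "h differentiable_on UNIV"
    using d by (meson differentiable_on_def real_differentiable_def differentiable_at_withinI)
  ultimately show "h differentiable_on UNIV \<and> deriv h \<in> {\<lambda>x. k * g (m * x + c) |k g. smooth g}"
    using smooth_deriv[OF h(2)] by auto
qed

text \<open>Induction over the coefficients; the free power \<open>y ^ k\<close> absorbs the factor
  y in the step from P to a + y P.\<close>

lemma poly_exp_decay:
  assumes "t > 0"
  shows "((\<lambda>y::real. y ^ k * poly P y * exp (- t * y)) \<longlongrightarrow> 0) at_top"
proof (induction P arbitrary: k)
  case 0 show ?case by simp
next
  case (pCons a P)
  have "((\<lambda>y. (t * y) ^ k / exp (t * y)) \<longlongrightarrow> 0) at_top"
    by (rule filterlim_compose[OF tendsto_power_div_exp_0])
       (use assms in \<open>auto intro!: filterlim_tendsto_pos_mult_at_top[OF tendsto_const] filterlim_ident\<close>)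
  then have "((\<lambda>y. (a / t ^ k) * ((t * y) ^ k / exp (t * y)) + y ^ Suc k * poly P y * exp (- t * y)) \<longlongrightarrow> (a / t ^ k) * 0 + 0) at_top"
    by (intro tendsto_intros pCons.IH)
  moreover have "(a / t ^ k) * ((t * y) ^ k / exp (t * y)) + y ^ Suc k * poly P y * exp (- t * y)
     = y ^ k * poly (pCons a P) y * exp (- t * y)" for y
    using assms by (simp add: exp_minus field_simps power_mult_distrib)
  ultimately show ?case by simp
qed

definition halfbump :: "real \<Rightarrow> real poly \<Rightarrow> real \<Rightarrow> real" where
  "halfbump t P x = (if x > 0 then poly P (1 / x) * exp (- t * (1 / x)) else 0)"

text \<open>With y = 1/x one has d/dx = - y^2 d/dy, so P(y) exp(-t y) becomes y^2 (t P - P')(y)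
  exp(-t y), again of the same shape. Allowing an arbitrary polynomial is what closes the family
  under differentiation; at 0 the exponential flattens every power of 1/x.\<close>

lemma halfbump_DERIV:
  assumes t: "t > 0"
  shows "(halfbump t P has_real_derivative halfbump t ([:0,0,1:] * (smult t P - pderiv P)) x) (at x)"
proof -
  consider "x > 0" | "x < 0" | "x = 0" by linarith
  then show ?thesis
  proof cases
    case 1
    have "((\<lambda>x. poly P (1 / x) * exp (- t * (1 / x))) has_real_derivative halfbump t ([:0,0,1:] * (smult t P - pderiv P)) x) (at x)"
      using 1
      by (auto intro!: derivative_eq_intros DERIV_chain2[OF poly_DERIV] simp: halfbump_def field_simps power2_eq_square)
    then show ?thesis
      by (rule has_field_derivative_transform_within_open[of _ _ _ "{0<..}"]) (use 1 in \<open>auto simp: halfbump_def\<close>)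
  next
    case 2
    have "((\<lambda>x. 0) has_real_derivative 0) (at x)" by simp
    then have "(halfbump t P has_real_derivative 0) (at x)"
      by (rule has_field_derivative_transform_within_open[of _ _ _ "{..<0}"]) (use 2 in \<open>auto simp: halfbump_def\<close>)
    then show ?thesis using 2 by (simp add: halfbump_def)
  next
    case 3
    have "((\<lambda>h. halfbump t P h / h) \<longlongrightarrow> 0) (at_right 0)"
    proof -
      have "((\<lambda>h. (1/h) ^ 1 * poly P (1/h) * exp (- t * (1/h))) \<longlongrightarrow> 0) (at_right 0)"
        by (rule filterlim_compose[OF poly_exp_decay[OF t, of 1 P]])
           (simp add: inverse_eq_divide[symmetric] filterlim_inverse_at_top_right)
      moreover have "eventually (\<lambda>h. (1/h) ^ 1 * poly P (1/h) * exp (- t * (1/h)) = halfbump t P h / h) (at_right 0)"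
        using eventually_at_right_less[of "0::real"] by eventually_elim (simp add: halfbump_def)
      ultimately show ?thesis by (rule Lim_transform_eventually)
    qed
    moreover have "((\<lambda>h. halfbump t P h / h) \<longlongrightarrow> 0) (at_left 0)"
    proof (rule tendsto_eventually)
      show "\<forall>\<^sub>F h in at_left 0. halfbump t P h / h = 0"
        by (auto simp: eventually_at_filter halfbump_def)
    qed
    ultimately have "((\<lambda>h. halfbump t P h / h) \<longlongrightarrow> 0) (at 0)"
      by (simp add: filterlim_at_split)
    then show ?thesis using 3 by (simp add: DERIV_def halfbump_def)
  qed
qed

lemma halfbump_smooth: "t > 0 \<Longrightarrow> smooth (halfbump t P)"
proof (rule smooth_coinduct[of _ "range (halfbump t)"])
  fix g assume "t > 0" "g \<in> range (halfbump t)"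
  then obtain P where P: "g = halfbump t P" by auto
  note d = halfbump_DERIV[OF \<open>t > 0\<close>, of P]
  have "deriv g = halfbump t ([:0,0,1:] * (smult t P - pderiv P))"
    using d DERIV_imp_deriv P by blast
  moreover have "g differentiable_on UNIV"
    using d P by (meson differentiable_on_def real_differentiable_def differentiable_at_withinI)
  ultimately show "g differentiable_on UNIV \<and> deriv g \<in> range (halfbump t)" by blast
qed auto

text \<open>The parameter \<open>t\<close> replaces mollification: as it tends to 0 the bump
  increases to the indicator of the open interval while staying below 1, so dominated convergence
  transfers statements about test functions to intervals.\<close>

definition bump :: "real \<Rightarrow> real \<Rightarrow> real \<Rightarrow> real \<Rightarrow> real" where
  "bump c d t x = halfbump t 1 (x - c) * halfbump t 1 (d - x)"

lemma bump_smooth: "t > 0 \<Longrightarrow> smooth (bump c d t)"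
  unfolding bump_def
  using smooth_mult[OF smooth_affine[OF halfbump_smooth, of t 1 1 "-c"] smooth_affine[OF halfbump_smooth, of t 1 "-1" d]]
  by simp

lemma bump_outside: "x \<notin> {c<..<d} \<Longrightarrow> bump c d t x = 0"
  by (auto simp: bump_def halfbump_def)

lemma bump_pos: "x \<in> {c<..<d} \<Longrightarrow> bump c d t x > 0"
  by (auto simp: bump_def halfbump_def)

lemma bump_le_1: "t > 0 \<Longrightarrow> \<bar>bump c d t x\<bar> \<le> 1"
  by (auto simp: bump_def halfbump_def abs_mult intro!: mult_le_one)

lemma bump_test_function: "{c..d} \<subseteq> S \<Longrightarrow> t > 0 \<Longrightarrow> test_function S (bump c d t)"
  unfolding test_function_def
  by (intro conjI exI[of _ "{c..d}"]) (use bump_smooth bump_outside in \<open>auto simp: smooth_def\<close>)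

lemma bump_tendsto: "(\<lambda>n. bump c d (1 / real (Suc n)) x) \<longlonglongrightarrow> indicator {c<..<d} x"
proof (cases "x \<in> {c<..<d}")
  case True
  have "(\<lambda>n. exp (- (1 / real (Suc n)) * (1 / (x - c))) * exp (- (1 / real (Suc n)) * (1 / (d - x)))) \<longlonglongrightarrow> exp (- 0 * (1 / (x - c))) * exp (- 0 * (1 / (d - x)))"
    by (intro tendsto_intros lim_1_over_n[THEN LIMSEQ_Suc])
  then show ?thesis using True by (simp add: bump_def halfbump_def)
qed (auto simp: bump_outside)

section \<open>Local integrability and the fundamental lemma of the calculus of variations\<close>

lemma compact_subset_Icc: "compact (K::real set) \<Longrightarrow> \<exists>x y. x \<le> y \<and> K \<subseteq> {x..y}"
proof -
  assume "compact K"
  then obtain B where "\<And>x. x \<in> K \<Longrightarrow> \<bar>x\<bar> \<le> B"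
    using compact_imp_bounded bounded_real by metis
  then show ?thesis
    by (intro exI[of _ "- max B 0"] exI[of _ "max B 0"]) force
qed

lemma locally_integrable_iff:
  "locally_integrable S f \<longleftrightarrow> (\<forall>K. compact K \<and> K \<subseteq> S \<longrightarrow> f absolutely_integrable_on K)"
proof -
  have "integrable (lebesgue_on K) f \<longleftrightarrow> f absolutely_integrable_on K" if "compact K" for K
    using that by (simp add: integrable_restrict_space set_integrable_def compact_imp_closed)
  then show ?thesis unfolding locally_integrable_def by blast
qed

lemma loc_abs_int_imp_locally_integrable: "loc_abs_int f \<Longrightarrow> locally_integrable S f"
  unfolding locally_integrable_iff
proof (intro allI impI)
  fix K assume f: "loc_abs_int f" and K: "compact K \<and> K \<subseteq> S"
  then obtain x y where "K \<subseteq> {x..y}" using compact_subset_Icc by blast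
  then show "f absolutely_integrable_on K"
    using set_integrable_subset[OF loc_abs_intD[OF f]] K by (simp add: compact_imp_closed)
qed

lemma locally_integrable_UNIV: "locally_integrable UNIV f \<longleftrightarrow> loc_abs_int f"
  using loc_abs_int_imp_locally_integrable[of f UNIV]
  by (auto simp: locally_integrable_iff loc_abs_int_def)

lemma locally_integrable_restrict:
  assumes "locally_integrable S f" "{c..d} \<subseteq> S"
  shows "loc_abs_int (\<lambda>x. indicator {c..d} x *\<^sub>R f x)"
  unfolding loc_abs_int_def
proof (intro allI)
  fix x y :: real
  have "f absolutely_integrable_on ({x..y} \<inter> {c..d})"
    using assms unfolding locally_integrable_iff by (meson compact_Icc compact_Int inf.coboundedI2 inf.cobounded2 subset_trans)
  then show "(\<lambda>x. indicator {c..d} x *\<^sub>R f x) absolutely_integrable_on {x..y}"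
    unfolding set_integrable_def scaleR_scaleR indicator_inter_arith .
qed

text \<open>Bridge between two integrals: pairings with test functions are Bochner integrals over
  \<open>S\<close>, while the absolutely continuous calculus uses gauge integrals over intervals.
  Compact support of the factor lets one pass from one to the other.\<close>

lemma supported_product:
  fixes \<phi> :: "real \<Rightarrow> real"
  assumes w: "locally_integrable S w" and \<phi>: "continuous_on UNIV \<phi>" "\<And>x. x \<notin> K \<Longrightarrow> \<phi> x = 0"
    and K: "compact K" "K \<subseteq> S" and S: "S \<in> sets lebesgue"
  shows "(\<lambda>x. \<phi> x *\<^sub>R w x) absolutely_integrable_on K"
    and "integrable (lebesgue_on S) (\<lambda>x. \<phi> x *\<^sub>R w x)"
    and "(\<integral>x. \<phi> x *\<^sub>R w x \<partial>lebesgue_on S) = integral K (\<lambda>x. \<phi> x *\<^sub>R w x)"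
proof -
  have wK: "w absolutely_integrable_on K" using w K by (simp add: locally_integrable_iff)
  have "\<phi> \<in> borel_measurable (lebesgue_on K)"
    using continuous_measurable_lebesgue[OF \<phi>(1)] by (simp add: measurable_restrict_space1)
  moreover have "bounded (\<phi> ` K)"
    using K \<phi>(1) by (meson compact_continuous_image compact_imp_bounded continuous_on_subset subset_UNIV)
  ultimately show 1: "(\<lambda>x. \<phi> x *\<^sub>R w x) absolutely_integrable_on K"
    using K wK \<phi>(1) 
    by (intro absolutely_integrable_bounded_measurable_product[OF bilinear_conv_bounded_bilinear[THEN iffD2, OF bounded_bilinear_scaleR]])
       (auto simp: compact_imp_closed compact_imp_bounded compact_continuous_image intro: continuous_on_subset)
  have eq: "indicator S x * \<phi> x = indicator K x * \<phi> x" for x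
    using K \<phi>(2)[of x] by (auto simp: indicator_def)
  show 2: "integrable (lebesgue_on S) (\<lambda>x. \<phi> x *\<^sub>R w x)"
    using 1 S by (simp add: integrable_restrict_space set_integrable_def eq)
  show "(\<integral>x. \<phi> x *\<^sub>R w x \<partial>lebesgue_on S) = integral K (\<lambda>x. \<phi> x *\<^sub>R w x)"
    using set_lebesgue_integral_eq_integral(2)[OF 1] S
    by (simp add: integral_restrict_space set_lebesgue_integral_def eq)
qed

lemma test_function_smooth: "test_function S \<phi> \<Longrightarrow> smooth \<phi>"
  by (simp add: test_function_def smooth_def)

lemma deriv_zero_outside:
  assumes "closed K" "\<And>x. x \<notin> K \<Longrightarrow> \<phi> x = 0" "x \<notin> K"
  shows "deriv \<phi> x = (0::real)"
proof -
  have "((\<lambda>_. 0) has_real_derivative 0) (at x)" by simp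
  then have "(\<phi> has_real_derivative 0) (at x)"
    by (rule has_field_derivative_transform_within_open[of _ _ _ "- K"]) (use assms in auto)
  then show ?thesis by (rule DERIV_imp_deriv)
qed

lemma integral_cont_times_zero:
  assumes v: "loc_abs_int v" and z: "\<And>x y. x \<le> y \<Longrightarrow> integral {x..y} v = 0"
    and g: "continuous_on UNIV g"
  shows "integral {x..y} (\<lambda>x. g x * v x) = 0"
proof (cases "x \<le> y")
  case True
  have lh: "loc_abs_int (\<lambda>x. g x * v x)" using loc_abs_int_mult_continuous[OF g v] .
  define \<Delta> where "\<Delta> s t = integral {s..t} (\<lambda>x. g x * v x)" for s t
  define A where "A s t = integral {s..t} (\<lambda>x. cmod (v x))" for s t
  have comb: "\<Delta> r t = \<Delta> r s + \<Delta> s t" "A r t = A r s + A s t" if "r \<le> s" "s \<le> t" for r s t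
    using Henstock_Kurzweil_Integration.integral_combine[OF that loc_abs_int_integrable[OF lh], symmetric]
      Henstock_Kurzweil_Integration.integral_combine[OF that loc_abs_int_norm[OF v], symmetric]
    by (auto simp: \<Delta>_def A_def)
  have Apos: "A x y \<ge> 0" unfolding A_def by (intro integral_nonneg loc_abs_int_norm v) auto
  have bd: "cmod (\<Delta> x y) \<le> e * A x y" if e: "e > 0" for e
  proof (rule Bolzano[of x y "\<lambda>s t. cmod (\<Delta> s t) \<le> e * A s t", OF True])
    fix a b c
    assume trans: "cmod (\<Delta> a b) \<le> e * A a b" "cmod (\<Delta> b c) \<le> e * A b c" "a \<le> b" "b \<le> c"
    then have "cmod (\<Delta> a c) \<le> cmod (\<Delta> a b) + cmod (\<Delta> b c)"
      by (simp add: comb(1)[OF trans(3,4)] norm_triangle_ineq)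
    also have "\<dots> \<le> e * A a c" using trans by (simp add: comb(2)[OF trans(3,4)] distrib_left)
    finally show "cmod (\<Delta> a c) \<le> e * A a c" .
  next
    fix c
    have "isCont g c" using g by (auto simp: continuous_on_eq_continuous_at)
    then obtain d where d: "d > 0" "\<And>r. dist r c < d \<Longrightarrow> dist (g r) (g c) < e"
      using e unfolding continuous_at_eps_delta by blast
    show "\<exists>d>0. \<forall>a b. a \<le> c \<and> c \<le> b \<and> b - a < d \<longrightarrow> cmod (\<Delta> a b) \<le> e * A a b"
    proof (intro exI[of _ d] conjI allI impI)
      fix s t :: real assume st: "s \<le> c \<and> c \<le> t \<and> t - s < d"
      have 1: "((\<lambda>r. g r * v r - g c * v r) has_integral (\<Delta> s t - g c * 0)) {s..t}"
        unfolding \<Delta>_def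
        using z[of s t] st loc_abs_int_integrable[OF v, of s t]
        by (intro has_integral_diff has_integral_mult_right integrable_integral loc_abs_int_integrable lh)
           (metis integrable_integral order_trans)
      have "cmod (integral {s..t} (\<lambda>r. g r * v r - g c * v r)) \<le> integral {s..t} (\<lambda>r. e * cmod (v r))"
      proof (rule integral_norm_bound_integral)
        show "(\<lambda>r. g r * v r - g c * v r) integrable_on {s..t}" using 1 by blast
        show "(\<lambda>r. e * cmod (v r)) integrable_on {s..t}"
          by (intro integrable_on_mult_right loc_abs_int_norm v)
        fix r assume "r \<in> {s..t}"
        then have "dist r c < d" using st by (auto simp: dist_real_def)
        then have "cmod (g r - g c) \<le> e" using d(2) by (simp add: dist_norm less_imp_le)
        then show "cmod (g r * v r - g c * v r) \<le> e * cmod (v r)"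
          by (simp add: norm_mult mult_right_mono flip: left_diff_distrib)
      qed
      moreover have "integral {s..t} (\<lambda>r. g r * v r - g c * v r) = \<Delta> s t"
        using 1 by (simp add: integral_unique)
      ultimately show "cmod (\<Delta> s t) \<le> e * A s t" by (simp add: A_def)
    qed (use d in auto)
  qed
  have "cmod (\<Delta> x y) \<le> 0 + e" if "e > 0" for e
  proof -
    have "cmod (\<Delta> x y) \<le> (e / (A x y + 1)) * A x y" using that Apos by (intro bd) auto
    also have "\<dots> \<le> e" using that Apos by (simp add: field_simps)
    finally show ?thesis by simp
  qed
  then have "cmod (\<Delta> x y) \<le> 0" by (rule field_le_epsilon)
  then show ?thesis by (simp add: \<Delta>_def)
qed simp

text \<open>Testing against the conjugate sign of \<open>v\<close> would give the integral of |v|.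
  That sign is merely measurable, so it is approximated almost everywhere by continuous functions,
  for which the pairing vanishes.\<close>

lemma zero_integrals_imp_AE_zero:
  assumes v: "loc_abs_int v" and z: "\<And>x y. x \<le> y \<Longrightarrow> integral {x..y} v = 0"
  shows "AE x in lebesgue. v x = 0"
proof -
  define f where "f x = cnj (sgn (v x))" for x
  have fv: "f x * v x = of_real (cmod (v x))" for x
  proof (cases "v x = 0")
    case False
    have "f x * v x = (v x * cnj (v x)) / of_real (cmod (v x))"
      by (simp add: f_def sgn_div_norm scaleR_conv_of_real divide_inverse)
    also have "\<dots> = of_real (cmod (v x))"
      using False by (simp add: complex_norm_square[symmetric] power2_eq_square)
    finally show ?thesis .
  qed (simp add: f_def)
  have "f \<in> borel_measurable lebesgue"
  proof -
    have "v \<in> borel_measurable lebesgue" using v by (rule loc_abs_int_measurable)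
    then have "(\<lambda>x. v x /\<^sub>R norm (v x)) \<in> borel_measurable lebesgue"
      by measurable
    then have "(\<lambda>x. cnj (v x /\<^sub>R norm (v x))) \<in> borel_measurable lebesgue"
      by (rule measurable_compose) (intro borel_measurable_continuous_onI continuous_intros)
    then show ?thesis by (simp add: f_def[abs_def] sgn_div_norm)
  qed
  then have "f measurable_on UNIV"
    by (simp add: measurable_on_iff_borel_measurable lebesgue_on_UNIV_eq)
  then obtain N g where N: "negligible N" and g: "\<And>n. continuous_on UNIV (g n)"
    and lim: "\<And>x. x \<notin> N \<Longrightarrow> (\<lambda>n. g n x) \<longlonglongrightarrow> f x"
    unfolding measurable_on_def by auto
  \<comment> \<open>Truncation to modulus at most 1 provides the majorant |v| for dominated
    convergence and does not disturb the limit, whose modulus is at most 1.\<close>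
  define h where "h n x = g n x / of_real (max 1 (cmod (g n x)))" for n x
  have h_cont: "continuous_on UNIV (h n)" for n
    unfolding h_def by (intro continuous_intros g) auto
  have h_le: "cmod (h n x) \<le> 1" for n x
    by (auto simp: h_def norm_divide divide_le_eq max_def)
  have h_lim: "(\<lambda>n. h n x) \<longlonglongrightarrow> f x" if "x \<notin> N" for x
  proof -
    have "(\<lambda>n. h n x) \<longlonglongrightarrow> f x / of_real (max 1 (cmod (f x)))"
      unfolding h_def by (intro tendsto_intros lim[OF that]) auto
    moreover have "max 1 (cmod (f x)) = 1" by (simp add: f_def norm_sgn)
    ultimately show ?thesis by simp
  qed
  have int0: "integral {x..y} (\<lambda>x. cmod (v x)) = 0" if "x \<le> y" for x y
  proof -
    define F where "F n x = (if x \<in> N then 0 else h n x * v x)" for n x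
    have F: "F n integrable_on {x..y}" "integral {x..y} (F n) = 0" for n
    proof -
      have i: "(\<lambda>x. h n x * v x) integrable_on {x..y}"
        by (intro loc_abs_int_integrable loc_abs_int_mult_continuous h_cont v)
      show "F n integrable_on {x..y}"
        by (rule integrable_spike[OF i N]) (auto simp: F_def)
      have "integral {x..y} (\<lambda>x. h n x * v x) = integral {x..y} (F n)"
        by (rule integral_spike[OF N]) (auto simp: F_def)
      then show "integral {x..y} (F n) = 0"
        using integral_cont_times_zero[OF v z h_cont[of n], of x y] by simp
    qed
    have "(\<lambda>n. integral {x..y} (F n)) \<longlonglongrightarrow> integral {x..y} (\<lambda>x. if x \<in> N then 0 else f x * v x)"
    proof (rule dominated_convergence(2)[OF F(1) loc_abs_int_norm[OF v]])
      fix n t show "norm (F n t) \<le> cmod (v t)"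
        using h_le[of n t] by (auto simp: F_def norm_mult mult_left_le_one_le)
      show "(\<lambda>n. F n t) \<longlonglongrightarrow> (if t \<in> N then 0 else f t * v t)"
        by (auto simp: F_def intro!: tendsto_intros h_lim)
    qed
    then have "integral {x..y} (\<lambda>x. if x \<in> N then 0 else f x * v x) = 0"
      by (simp add: F(2) LIMSEQ_const_iff)
    moreover have "integral {x..y} (\<lambda>x. f x * v x) = integral {x..y} (\<lambda>x. if x \<in> N then 0 else f x * v x)"
      by (rule integral_spike[OF N]) auto
    moreover have "integral {x..y} (\<lambda>x. complex_of_real (cmod (v x))) = of_real (integral {x..y} (\<lambda>x. cmod (v x)))"
      using integral_linear[OF loc_abs_int_norm[OF v] bounded_linear_of_real, of x y] by (simp add: o_def)
    ultimately show ?thesis by (simp add: fv)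
  qed
  have neg: "negligible {t \<in> {x..y}. v t \<noteq> 0}" if "x \<le> y" for x y
  proof -
    have ai: "integrable (lebesgue_on {x..y}) (\<lambda>t. cmod (v t))"
      using set_integrable_norm[OF loc_abs_intD[OF v, of x y]] by (simp add: integrable_restrict_space set_integrable_def)
    have "integral\<^sup>L (lebesgue_on {x..y}) (\<lambda>t. cmod (v t)) = 0"
      using lebesgue_integral_eq_integral[OF ai] int0[OF that] by simp
    then have "AE t in lebesgue_on {x..y}. cmod (v t) = 0"
      using integral_nonneg_eq_0_iff_AE[OF ai] by simp
    then have "AE t in lebesgue. t \<in> {x..y} \<longrightarrow> v t = 0" by (simp add: AE_lebesgue_on_iff)
    then show ?thesis by (simp add: AE_lebesgue_iff_negligible)
  qed
  have "negligible (\<Union>k::nat. {t \<in> {- real k..real k}. v t \<noteq> 0})"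
    by (intro negligible_countable_Union) (use neg in auto)
  moreover have "{t. v t \<noteq> 0} \<subseteq> (\<Union>k::nat. {t \<in> {- real k..real k}. v t \<noteq> 0})"
  proof safe
    fix t assume "v t \<noteq> 0"
    obtain k :: nat where "\<bar>t\<bar> \<le> real k" using real_arch_simple by blast
    then show "t \<in> (\<Union>k::nat. {t \<in> {- real k..real k}. v t \<noteq> 0})" using \<open>v t \<noteq> 0\<close> by (auto intro!: exI[of _ k])
  qed
  ultimately show ?thesis
    unfolding AE_lebesgue_iff_negligible by (rule negligible_subset)
qed

text \<open>Bumps converge boundedly to indicators, so all integrals of \<open>w\<close> over
  compact intervals inside \<open>S\<close> vanish and \<open>w\<close> is 0 almost everywhere on
  each of them. Rational intervals cover the open set \<open>S\<close> countably.\<close>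

lemma fundamental_lemma:
  assumes w: "locally_integrable S w" and S: "open S"
    and z: "\<And>\<phi>. test_function S \<phi> \<Longrightarrow> (\<integral>x. \<phi> x *\<^sub>R w x \<partial>lebesgue_on S) = 0"
  shows "AE x in lebesgue_on S. w x = 0"
proof -
  have Sm: "S \<in> sets lebesgue" using S by simp
  have zero: "integral {x..y} w = 0" if xy: "{x..y} \<subseteq> S" for x y
  proof (cases "x < y")
    case True
    have wi: "w absolutely_integrable_on {x..y}" using w xy by (simp add: locally_integrable_iff)
    have "(\<lambda>n. integral {x..y} (\<lambda>t. bump x y (1 / real (Suc n)) t *\<^sub>R w t)) \<longlonglongrightarrow>
       integral {x..y} (\<lambda>t. indicator {x<..<y} t *\<^sub>R w t)"
    proof (rule dominated_convergence(2))
      have K: "compact {x..y}" by simp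
      show "(\<lambda>t. bump x y (1 / real (Suc n)) t *\<^sub>R w t) integrable_on {x..y}" for n
      proof -
        have "(\<lambda>t. bump x y (1 / real (Suc n)) t *\<^sub>R w t) absolutely_integrable_on {x..y}"
          by (rule supported_product(1)[OF w smooth_continuous[OF bump_smooth] _ K xy Sm]) (auto simp: bump_outside)
        then show ?thesis by (simp add: absolutely_integrable_on_def)
      qed
      show "(\<lambda>t. cmod (w t)) integrable_on {x..y}" using wi by (simp add: absolutely_integrable_on_def)
      show "norm (bump x y (1 / real (Suc n)) t *\<^sub>R w t) \<le> cmod (w t)" for n t
        using bump_le_1[of "1 / real (Suc n)" x y t] by (simp add: mult_left_le_one_le)
      show "(\<lambda>n. bump x y (1 / real (Suc n)) t *\<^sub>R w t) \<longlonglongrightarrow> indicator {x<..<y} t *\<^sub>R w t" for t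
        by (intro tendsto_intros bump_tendsto)
    qed
    moreover have "integral {x..y} (\<lambda>t. bump x y (1 / real (Suc n)) t *\<^sub>R w t) = 0" for n
    proof -
      have "(\<integral>t. bump x y (1 / real (Suc n)) t *\<^sub>R w t \<partial>lebesgue_on S) = integral {x..y} (\<lambda>t. bump x y (1 / real (Suc n)) t *\<^sub>R w t)"
        by (rule supported_product(3)[OF w smooth_continuous[OF bump_smooth] _ _ xy Sm]) (auto simp: bump_outside)
      then show ?thesis using z[OF bump_test_function[OF xy]] by simp
    qed
    ultimately have "integral {x..y} (\<lambda>t. indicator {x<..<y} t *\<^sub>R w t) = 0"
      by (simp add: LIMSEQ_const_iff)
    moreover have "integral {x..y} w = integral {x..y} (\<lambda>t. indicator {x<..<y} t *\<^sub>R w t)"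
      by (rule integral_spike[of "{x,y}"]) (auto simp: indicator_def)
    ultimately show ?thesis by simp
  next
    case False
    then show ?thesis by (cases "x = y") auto
  qed
  have ae: "negligible {t \<in> {c..d}. w t \<noteq> 0}" if cd: "{c..d} \<subseteq> S" for c d
  proof -
    have "AE x in lebesgue. indicator {c..d} x *\<^sub>R w x = 0"
    proof (rule zero_integrals_imp_AE_zero)
      show "loc_abs_int (\<lambda>x. indicator {c..d} x *\<^sub>R w x)" using w cd by (rule locally_integrable_restrict)
      fix x y :: real
      have "integral {x..y} (\<lambda>x. indicator {c..d} x *\<^sub>R w x) = integral {x..y} (\<lambda>t. if t \<in> {c..d} then w t else 0)"
        by (rule integral_cong) (simp add: indicator_def)
      also have "\<dots> = integral ({x..y} \<inter> {c..d}) w"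
        using integral_restrict_Int[of "{x..y}" "{c..d}" w] by (simp add: Int_commute)
      also have "{x..y} \<inter> {c..d} = {max x c..min y d}" by auto
      also have "integral \<dots> w = 0" using cd by (intro zero) auto
      finally show "integral {x..y} (\<lambda>x. indicator {c..d} x *\<^sub>R w x) = 0" .
    qed
    then show ?thesis
      unfolding AE_lebesgue_iff_negligible by (rule negligible_subset) (auto simp: indicator_def)
  qed
  have "negligible (\<Union>(r,s)\<in>{(r,s). r \<in> \<rat> \<and> s \<in> \<rat> \<and> {r..s} \<subseteq> S}. {t \<in> {r..s}. w t \<noteq> 0})"
  proof (rule negligible_countable_Union)
    have "countable ((\<rat>::real set) \<times> (\<rat>::real set))" by (intro countable_SIGMA countable_rat)
    then have "countable {(r::real,s::real). r \<in> \<rat> \<and> s \<in> \<rat> \<and> {r..s} \<subseteq> S}"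
      by (rule countable_subset[rotated]) auto
    then show "countable ((\<lambda>(r, s). {t \<in> {r..s}. w t \<noteq> 0}) ` {(r,s). r \<in> \<rat> \<and> s \<in> \<rat> \<and> {r..s} \<subseteq> S})"
      by (rule countable_image)
  qed (use ae in auto)
  moreover have "{t. \<not> (t \<in> S \<longrightarrow> w t = 0)} \<subseteq> (\<Union>(r,s)\<in>{(r,s). r \<in> \<rat> \<and> s \<in> \<rat> \<and> {r..s} \<subseteq> S}. {t \<in> {r..s}. w t \<noteq> 0})"
  proof (rule subsetI)
    fix t assume "t \<in> {t. \<not> (t \<in> S \<longrightarrow> w t = 0)}"
    then have t: "t \<in> S" "w t \<noteq> 0" by auto
    obtain e where e: "e > 0" "cball t e \<subseteq> S" using S t open_contains_cball by blast
    obtain r where r: "r \<in> \<rat>" "t - e < r" "r < t" using Rats_dense_in_real[of "t - e" t] e by auto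
    obtain s where s: "s \<in> \<rat>" "t < s" "s < t + e" using Rats_dense_in_real[of t "t + e"] e by auto
    have "{r..s} \<subseteq> cball t e" using r s by (auto simp: dist_real_def)
    then have "{r..s} \<subseteq> S" using e by blast
    then show "t \<in> (\<Union>(r,s)\<in>{(r,s). r \<in> \<rat> \<and> s \<in> \<rat> \<and> {r..s} \<subseteq> S}. {t \<in> {r..s}. w t \<noteq> 0})"
      using r s t by (intro UN_I[of "(r,s)"]) auto
  qed
  ultimately show ?thesis
    unfolding AE_lebesgue_on_iff[OF Sm] AE_lebesgue_iff_negligible by (rule negligible_subset)
qed

text \<open>Elements of the function spaces are plain functions, so insensitivity to null sets has
  to be proved: each test integral lives on a compact support, where the integrands agree off a
  negligible set.\<close>

lemma has_weak_deriv_cong_AE: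
  assumes uv: "has_weak_deriv S u v" and S: "open S"
    and u: "AE x in lebesgue_on S. u x = u' x" and v: "AE x in lebesgue_on S. v x = v' x"
  shows "has_weak_deriv S u' v'"
proof -
  have Sm: "S \<in> sets lebesgue" using S by simp
  have li: "locally_integrable S g" if f: "locally_integrable S f" and e: "AE x in lebesgue_on S. f x = g x" for f g
    unfolding locally_integrable_iff
  proof (intro allI impI)
    fix K assume K: "compact K \<and> K \<subseteq> S"
    have n: "negligible {x. \<not> (x \<in> S \<longrightarrow> f x = g x)}" using e Sm by (simp add: AE_lebesgue_on_iff AE_lebesgue_iff_negligible)
    show "g absolutely_integrable_on K"
      by (rule absolutely_integrable_spike[OF _ n, where f=f]) (use f K in \<open>auto simp: locally_integrable_iff\<close>)
  qed
  have eq: "(\<integral>x. \<phi> x *\<^sub>R f x \<partial>lebesgue_on S) = (\<integral>x. \<phi> x *\<^sub>R g x \<partial>lebesgue_on S)"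
    if f: "locally_integrable S f" and e: "AE x in lebesgue_on S. f x = g x"
      and \<phi>: "continuous_on UNIV \<phi>" "\<And>x. x \<notin> K \<Longrightarrow> \<phi> x = 0" and K: "compact K" "K \<subseteq> S" for f g K and \<phi> :: "real \<Rightarrow> real"
  proof -
    have n: "negligible {x. \<not> (x \<in> S \<longrightarrow> f x = g x)}" using e Sm by (simp add: AE_lebesgue_on_iff AE_lebesgue_iff_negligible)
    have "integral K (\<lambda>x. \<phi> x *\<^sub>R f x) = integral K (\<lambda>x. \<phi> x *\<^sub>R g x)"
      by (rule integral_spike[OF n]) (use K in auto)
    then show ?thesis
      using supported_product(3)[OF f \<phi> K Sm] supported_product(3)[OF li[OF f e] \<phi> K Sm] by simp
  qed
  have l: "locally_integrable S u" "locally_integrable S v" using uv by (auto simp: has_weak_deriv_def)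
  show ?thesis
    unfolding has_weak_deriv_def
  proof (intro conjI allI impI)
    show "locally_integrable S u'" "locally_integrable S v'" using li l u v by auto
    fix \<phi> assume t: "test_function S \<phi>"
    then obtain K where K: "compact K" "K \<subseteq> S" "\<And>x. x \<notin> K \<Longrightarrow> \<phi> x = 0" by (auto simp: test_function_def)
    have d0: "deriv \<phi> x = 0" if "x \<notin> K" for x
      using deriv_zero_outside[of K \<phi> x] K that by (simp add: compact_imp_closed)
    note sm = test_function_smooth[OF t]
    show "(\<integral>x. deriv \<phi> x *\<^sub>R u' x \<partial>lebesgue_on S) = - (\<integral>x. \<phi> x *\<^sub>R v' x \<partial>lebesgue_on S)"
      using uv t eq[OF l(1) u smooth_continuous[OF smooth_deriv[OF sm]] d0 K(1,2)]
        eq[OF l(2) v smooth_continuous[OF sm] K(3) K(1,2)]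
      by (simp add: has_weak_deriv_def)
  qed
qed

lemma locally_integrable_diff:
  "locally_integrable S f \<Longrightarrow> locally_integrable S g \<Longrightarrow> locally_integrable S (\<lambda>x. f x - g x)"
  unfolding locally_integrable_iff using set_integral_diff(1) by blast

lemma has_weak_deriv_unique:
  assumes v: "has_weak_deriv S u v" and w: "has_weak_deriv S u w" and S: "open S"
  shows "AE x in lebesgue_on S. v x = w x"
proof -
  have Sm: "S \<in> sets lebesgue" using S by simp
  have l: "locally_integrable S v" "locally_integrable S w" using v w by (auto simp: has_weak_deriv_def)
  have "AE x in lebesgue_on S. v x - w x = 0"
  proof (rule fundamental_lemma[OF locally_integrable_diff[OF l] S])
    fix \<phi> assume t: "test_function S \<phi>"
    then obtain K where K: "compact K" "K \<subseteq> S" "\<And>x. x \<notin> K \<Longrightarrow> \<phi> x = 0" by (auto simp: test_function_def)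
    note i = supported_product(2)[OF _ smooth_continuous[OF test_function_smooth[OF t]] K(3) K(1,2) Sm]
    have "(\<integral>x. \<phi> x *\<^sub>R (v x - w x) \<partial>lebesgue_on S) = (\<integral>x. \<phi> x *\<^sub>R v x \<partial>lebesgue_on S) - (\<integral>x. \<phi> x *\<^sub>R w x \<partial>lebesgue_on S)"
      unfolding scaleR_diff_right using i[OF l(1)] i[OF l(2)] by (rule Bochner_Integration.integral_diff)
    also have "\<dots> = 0"
    proof -
      have "- (\<integral>x. \<phi> x *\<^sub>R v x \<partial>lebesgue_on S) = - (\<integral>x. \<phi> x *\<^sub>R w x \<partial>lebesgue_on S)"
        using v w t by (simp add: has_weak_deriv_def)
      then show ?thesis by simp
    qed
    finally show "(\<integral>x. \<phi> x *\<^sub>R (v x - w x) \<partial>lebesgue_on S) = 0" .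
  qed
  then show ?thesis by simp
qed

lemma weak_deriv_AE:
  assumes "has_weak_deriv S u v" "open S"
  shows "has_weak_deriv S u (weak_deriv S u)" "AE x in lebesgue_on S. weak_deriv S u x = v x"
proof -
  show 1: "has_weak_deriv S u (weak_deriv S u)"
    unfolding weak_deriv_def by (rule someI[where P="has_weak_deriv S u", OF assms(1)])
  show "AE x in lebesgue_on S. weak_deriv S u x = v x"
    using has_weak_deriv_unique[OF 1 assms] .
qed

lemma has_ac_deriv_smooth: "smooth f \<Longrightarrow> has_ac_deriv (\<lambda>x. of_real (f x)) (\<lambda>x. of_real (deriv f x))"
proof (rule has_ac_deriv_piecewise[of _ "{}"])
  assume f: "smooth f"
  show "continuous_on UNIV (\<lambda>x. complex_of_real (f x))" by (intro continuous_intros smooth_continuous f)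
  show "loc_abs_int (\<lambda>x. complex_of_real (deriv f x))"
    by (intro loc_abs_int_continuous continuous_intros smooth_continuous smooth_deriv f)
  show "((\<lambda>x. complex_of_real (f x)) has_vector_derivative of_real (deriv f x)) (at x)" for x
    using smooth_DERIV[OF f] by (simp add: has_vector_derivative_of_real has_real_derivative_iff_has_vector_derivative)
qed (auto simp: locally_finite_set_def)

text \<open>Integration by parts: the product rule is integrated over an interval that strictly
  contains the support of the test function, so the boundary terms vanish.\<close>

lemma has_ac_deriv_imp_weak:
  assumes ac: "has_ac_deriv u v" and S: "open S"
  shows "has_weak_deriv S u v"
  unfolding has_weak_deriv_def
proof (intro conjI allI impI)
  have Sm: "S \<in> sets lebesgue" using S by simp
  have lu: "loc_abs_int u" using ac has_ac_deriv_continuous loc_abs_int_continuous by blast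
  have lv: "loc_abs_int v" using ac by (rule has_ac_derivD)
  show l: "locally_integrable S u" "locally_integrable S v"
    using lu lv by (simp_all add: loc_abs_int_imp_locally_integrable)
  fix \<phi> assume t: "test_function S \<phi>"
  then obtain K where K: "compact K" "K \<subseteq> S" "\<And>x. x \<notin> K \<Longrightarrow> \<phi> x = 0" by (auto simp: test_function_def)
  have d0: "deriv \<phi> x = 0" if "x \<notin> K" for x
    using deriv_zero_outside[of K \<phi> x] K that by (simp add: compact_imp_closed)
  note sm = test_function_smooth[OF t]
  obtain x0 y0 where xy0: "x0 \<le> y0" "K \<subseteq> {x0..y0}" using compact_subset_Icc[OF K(1)] by blast
  \<comment> \<open>The margin of 1 puts both endpoints outside the support.\<close>
  define x y where "x = x0 - 1" and "y = y0 + 1"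
  have xy: "x \<le> y" "K \<subseteq> {x..y}" "x \<notin> K" "y \<notin> K" using xy0 by (auto simp: x_def y_def)
  have ext: "(\<integral>t. \<psi> t *\<^sub>R f t \<partial>lebesgue_on S) = integral {x..y} (\<lambda>t. of_real (\<psi> t) * f t)"
    if "locally_integrable S f" "continuous_on UNIV \<psi>" "\<And>t. t \<notin> K \<Longrightarrow> \<psi> t = 0" for f and \<psi> :: "real \<Rightarrow> real"
  proof -
    have "(\<integral>t. \<psi> t *\<^sub>R f t \<partial>lebesgue_on S) = integral K (\<lambda>t. \<psi> t *\<^sub>R f t)"
      using supported_product(3)[OF that K(1,2) Sm] .
    also have "\<dots> = integral {x..y} (\<lambda>t. if t \<in> K then \<psi> t *\<^sub>R f t else 0)"
      using integral_restrict_Int[of "{x..y}" K "\<lambda>t. \<psi> t *\<^sub>R f t"] xy by (simp add: Int_absorb2)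
    also have "\<dots> = integral {x..y} (\<lambda>t. of_real (\<psi> t) * f t)"
      by (rule integral_cong) (use that(3) in \<open>auto simp: scaleR_conv_of_real\<close>)
    finally show ?thesis .
  qed
  have P: "has_ac_deriv (\<lambda>x. of_real (\<phi> x) * u x) (\<lambda>x. of_real (deriv \<phi> x) * u x + of_real (\<phi> x) * v x)"
    using has_ac_deriv_mult[OF has_ac_deriv_smooth[OF sm] ac] .
  have "integral {x..y} (\<lambda>x. of_real (deriv \<phi> x) * u x + of_real (\<phi> x) * v x) = 0"
    using has_ac_derivD(3)[OF P xy(1)] K(3) xy by simp
  moreover have "integral {x..y} (\<lambda>x. of_real (deriv \<phi> x) * u x + of_real (\<phi> x) * v x) =
      integral {x..y} (\<lambda>x. of_real (deriv \<phi> x) * u x) + integral {x..y} (\<lambda>x. of_real (\<phi> x) * v x)"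
    by (intro Henstock_Kurzweil_Integration.integral_add loc_abs_int_integrable loc_abs_int_mult_continuous
        continuous_intros smooth_continuous smooth_deriv sm lu lv)
  ultimately show "(\<integral>x. deriv \<phi> x *\<^sub>R u x \<partial>lebesgue_on S) = - (\<integral>x. \<phi> x *\<^sub>R v x \<partial>lebesgue_on S)"
    using ext[OF l(1) smooth_continuous[OF smooth_deriv[OF sm]] d0] ext[OF l(2) smooth_continuous[OF sm] K(3)]
    by (simp add: eq_neg_iff_add_eq_0)
qed

text \<open>The du Bois-Reymond argument: a test function is a derivative of a test function exactly
  when its integral is 0. Subtracting a multiple of a fixed bump of integral 1 achieves this, and
  the constant is the pairing of \<open>u\<close> with that bump.\<close>

lemma weak_deriv_zero_const:
  assumes u: "loc_abs_int u" and z: "\<And>\<phi>. test_function UNIV \<phi> \<Longrightarrow> (\<integral>x. deriv \<phi> x *\<^sub>R u x \<partial>lebesgue) = 0"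
  shows "\<exists>c. AE x in lebesgue. u x = c"
proof -
  define \<eta>0 where "\<eta>0 = bump 0 1 1"
  have \<eta>0: "smooth \<eta>0" "continuous_on UNIV \<eta>0" "\<And>x. x \<notin> {0<..<1} \<Longrightarrow> \<eta>0 x = 0" "\<And>x. x \<in> {0<..<1} \<Longrightarrow> \<eta>0 x > 0"
    using bump_smooth[of 1 0 1] smooth_continuous[OF bump_smooth, of 1 0 1] bump_outside bump_pos by (auto simp: \<eta>0_def)
  have ci: "f integrable_on {x..y}" if "continuous_on UNIV f" for f :: "real \<Rightarrow> real" and x y
    using that continuous_on_subset integrable_continuous_real by blast
  define J where "J = integral {0..1} \<eta>0"
  have Jpos: "J > 0"
  proof -
    have nn: "\<eta>0 x \<ge> 0" for x using \<eta>0(3,4)[of x] by (cases "x \<in> {0<..<1}") auto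
    have "J \<ge> 0" unfolding J_def by (rule integral_nonneg[OF ci[OF \<eta>0(2)]]) (rule nn)
    moreover have "J \<noteq> 0"
    proof
      assume "J = 0"
      then have "(\<eta>0 has_integral 0) {0..1}" using integrable_integral[OF ci[OF \<eta>0(2), of 0 1]] by (simp add: J_def)
      then have "(\<eta>0 has_integral 0) (cbox 0 1)" by simp
      then have "\<eta>0 (1/2) = 0"
        by (rule has_integral_0_cbox_imp_0[rotated 2]) (use \<eta>0(2) nn in \<open>auto intro: continuous_on_subset\<close>)
      then show False using \<eta>0(4)[of "1/2"] by simp
    qed
    ultimately show ?thesis by simp
  qed
  define \<eta> where "\<eta> x = (1 / J) * \<eta>0 x" for x
  have \<eta>s: "smooth \<eta>" unfolding \<eta>_def using smooth_cmult[OF \<eta>0(1)] .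
  have \<eta>_out: "x \<notin> {0..1} \<Longrightarrow> \<eta> x = 0" for x using \<eta>0(3)[of x] by (auto simp: \<eta>_def)
  have Um: "(UNIV :: real set) \<in> sets lebesgue" by simp
  have lu: "locally_integrable UNIV u" using u by (simp add: locally_integrable_UNIV)
  define c where "c = (\<integral>x. \<eta> x *\<^sub>R u x \<partial>lebesgue)"
  have "AE x in lebesgue_on UNIV. u x - c = 0"
  proof (rule fundamental_lemma)
    show luc: "locally_integrable UNIV (\<lambda>x. u x - c)"
      using loc_abs_int_diff[OF u loc_abs_int_continuous, of "\<lambda>_. c"] by (simp add: locally_integrable_UNIV)
    fix \<phi> assume t: "test_function UNIV \<phi>"
    note sm = test_function_smooth[OF t]
    obtain K where K: "compact K" "\<And>x. x \<notin> K \<Longrightarrow> \<phi> x = 0" using t by (auto simp: test_function_def)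
    obtain x0 y0 where xy0: "x0 \<le> y0" "K \<subseteq> {x0..y0}" using compact_subset_Icc[OF K(1)] by blast
    define x y where "x = min x0 0 - 1" and "y = max y0 1 + 1"
    have xy: "x \<le> y" "x < 0" "1 < y" by (auto simp: x_def y_def)
    have \<phi>_out: "\<phi> r = 0" if "r \<notin> {x<..<y}" for r
      using that subsetD[OF xy0(2), of r] by (intro K(2)) (auto simp: x_def y_def)
    define I where "I = integral {x..y} \<phi>"
    define g where "g r = \<phi> r - I * \<eta> r" for r
    have gs: "smooth g" unfolding g_def by (intro smooth_diff smooth_cmult sm \<eta>s)
    have g_out: "g r = 0" if "r \<notin> {x<..<y}" for r
      using \<phi>_out[OF that] \<eta>_out[of r] that xy by (auto simp: g_def)
    have gc: "continuous_on A g" for A using smooth_continuous[OF gs] continuous_on_subset by blast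
    have "integral {x..y} \<eta> = 1"
    proof -
      have "integral {x..y} \<eta>0 = J"
      proof -
        have "integral {0..1} \<eta>0 = integral {x..y} (\<lambda>r. if r \<in> {0..1} then \<eta>0 r else 0)"
          using integral_restrict_Int[of "{x..y}" "{0..1}" \<eta>0] xy by (simp add: Int_absorb2)
        also have "\<dots> = integral {x..y} \<eta>0" by (rule integral_cong) (use \<eta>0(3) in auto)
        finally show ?thesis by (simp add: J_def)
      qed
      then show ?thesis using Jpos unfolding \<eta>_def by simp
    qed
    then have g0: "integral {x..y} g = 0"
      unfolding g_def using Henstock_Kurzweil_Integration.integral_diff[OF ci[OF smooth_continuous[OF sm]] ci[OF smooth_continuous[OF smooth_cmult[OF \<eta>s]]], of x y I]
      by (simp add: I_def)
    \<comment> \<open>The primitive of \<open>g\<close> has compact support because the total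
      integral of \<open>g\<close> is 0; it is the test function to which the hypothesis is
      applied.\<close>
    define \<Psi> where "\<Psi> r = (if r < x then 0 else integral {x..r} g)" for r
    have \<Psi>_out: "\<Psi> r = 0" if "r \<notin> {x..y}" for r
    proof (cases "r < x")
      case False
      then have "r > y" using that by auto
      then have "integral {x..r} g = integral {x..y} g + integral {y..r} g"
        using Henstock_Kurzweil_Integration.integral_combine[of x y r g] xy integrable_continuous_real[OF gc] by simp
      moreover have "integral {y..r} g = integral {y..r} (\<lambda>_. 0)"
        by (rule integral_cong) (use g_out in auto)
      ultimately show ?thesis using g0 False by (simp add: \<Psi>_def)
    qed (simp add: \<Psi>_def)
    have \<Psi>': "(\<Psi> has_real_derivative g r) (at r)" for r
    proof -
      define w where "w = min x r - 1"
      have eq: "\<Psi> s = integral {w..s} g" if "s \<in> {w<..<r+1}" for s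
      proof (cases "s < x")
        case True
        have "integral {w..s} g = integral {w..s} (\<lambda>_. 0)"
          by (rule integral_cong) (use True g_out in auto)
        then show ?thesis using True by (simp add: \<Psi>_def)
      next
        case False
        have "integral {w..s} g = integral {w..x} g + integral {x..s} g"
          using Henstock_Kurzweil_Integration.integral_combine[of w x s g] False integrable_continuous_real[OF gc] by (simp add: w_def)
        moreover have "integral {w..x} g = integral {w..x} (\<lambda>_. 0)"
          by (rule integral_cong) (use g_out in auto)
        ultimately show ?thesis using False by (simp add: \<Psi>_def)
      qed
      have "((\<lambda>s. integral {w..s} g) has_real_derivative g r) (at r within {w..r+1})"
        by (rule integral_has_real_derivative[OF gc]) (auto simp: w_def)
      then have "((\<lambda>s. integral {w..s} g) has_real_derivative g r) (at r)"
        by (simp add: at_within_Icc_at w_def min_def split: if_splits)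
      then show ?thesis
        by (rule has_field_derivative_transform_within_open[of _ _ _ "{w<..<r+1}"]) (use eq in \<open>auto simp: w_def\<close>)
    qed
    have tP: "test_function UNIV \<Psi>"
      unfolding test_function_def using smoothI[OF \<Psi>' gs] \<Psi>_out
      by (auto simp: smooth_def intro!: exI[of _ "{x..y}"])
    have dP: "deriv \<Psi> = g" using \<Psi>' DERIV_imp_deriv by blast
    have o: "r \<notin> {x..y} \<Longrightarrow> \<phi> r = 0" for r using \<phi>_out by auto
    have "integrable (lebesgue_on UNIV) (\<lambda>r. \<phi> r *\<^sub>R u r)"
      by (rule supported_product(2)[OF lu smooth_continuous[OF sm] _ compact_Icc subset_UNIV Um]) (rule o)
    then have i1: "integrable lebesgue (\<lambda>r. \<phi> r *\<^sub>R u r)" by (simp add: lebesgue_on_UNIV_eq)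
    have "integrable (lebesgue_on UNIV) (\<lambda>r. \<eta> r *\<^sub>R u r)"
      by (rule supported_product(2)[OF lu smooth_continuous[OF \<eta>s] _ compact_Icc subset_UNIV Um]) (rule \<eta>_out)
    then have i2: "integrable lebesgue (\<lambda>r. \<eta> r *\<^sub>R u r)" by (simp add: lebesgue_on_UNIV_eq)
    have l1: "locally_integrable UNIV (\<lambda>_. c)" by (simp add: locally_integrable_UNIV loc_abs_int_continuous)
    have i3: "integrable lebesgue (\<lambda>r. \<phi> r *\<^sub>R c)" "(\<integral>r. \<phi> r *\<^sub>R c \<partial>lebesgue) = I *\<^sub>R c"
    proof -
      have "integrable (lebesgue_on UNIV) (\<lambda>r. \<phi> r *\<^sub>R c)"
        by (rule supported_product(2)[OF l1 smooth_continuous[OF sm] _ compact_Icc subset_UNIV Um]) (rule o)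
      then show "integrable lebesgue (\<lambda>r. \<phi> r *\<^sub>R c)" by (simp add: lebesgue_on_UNIV_eq)
      have "(\<integral>r. \<phi> r *\<^sub>R c \<partial>lebesgue_on UNIV) = integral {x..y} (\<lambda>r. \<phi> r *\<^sub>R c)"
        by (rule supported_product(3)[OF l1 smooth_continuous[OF sm] _ compact_Icc subset_UNIV Um]) (rule o)
      then have "(\<integral>r. \<phi> r *\<^sub>R c \<partial>lebesgue) = integral {x..y} (\<lambda>r. \<phi> r *\<^sub>R c)" by (simp add: lebesgue_on_UNIV_eq)
      also have "\<dots> = I *\<^sub>R c"
        using integral_linear[OF ci[OF smooth_continuous[OF sm]] bounded_linear_scaleR_left, of x y c]
        by (simp add: o_def I_def)
      finally show "(\<integral>r. \<phi> r *\<^sub>R c \<partial>lebesgue) = I *\<^sub>R c" .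
    qed
    have "0 = (\<integral>r. g r *\<^sub>R u r \<partial>lebesgue)" using z[OF tP] dP by simp
    also have "\<dots> = (\<integral>r. \<phi> r *\<^sub>R u r - I *\<^sub>R (\<eta> r *\<^sub>R u r) \<partial>lebesgue)"
      by (simp add: g_def scaleR_diff_left)
    also have "\<dots> = (\<integral>r. \<phi> r *\<^sub>R u r \<partial>lebesgue) - I *\<^sub>R c"
      using Bochner_Integration.integral_diff[OF i1 integrable_scaleR_right[OF i2, of I]] by (simp add: c_def del: scaleR_scaleR)
    also have "\<dots> = (\<integral>r. \<phi> r *\<^sub>R (u r - c) \<partial>lebesgue)"
      unfolding scaleR_diff_right using Bochner_Integration.integral_diff[OF i1 i3(1)] i3(2) by simp
    finally show "(\<integral>r. \<phi> r *\<^sub>R (u r - c) \<partial>lebesgue_on UNIV) = 0" by (simp add: lebesgue_on_UNIV_eq)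
  qed simp
  then have "AE x in lebesgue. u x = c" by (subst (asm) AE_lebesgue_on_iff) auto
  then show ?thesis by blast
qed

text \<open>A primitive of \<open>v\<close> has the same weak derivative as \<open>u\<close>, so the
  two differ by a constant almost everywhere. Sobolev functions thereby acquire continuous
  representatives with values at points.\<close>

lemma weak_deriv_UNIV_imp_ac:
  assumes uv: "has_weak_deriv UNIV u v"
  obtains U where "has_ac_deriv U v" "AE x in lebesgue. u x = U x"
proof -
  have l: "loc_abs_int u" "loc_abs_int v" using uv by (auto simp: has_weak_deriv_def locally_integrable_UNIV)
  obtain W where W: "has_ac_deriv W v" using has_ac_deriv_indefinite[OF l(2)] by blast
  have Wl: "loc_abs_int W" using W has_ac_deriv_continuous loc_abs_int_continuous by blast
  have Um: "(UNIV :: real set) \<in> sets lebesgue" by simp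
  have "\<exists>c. AE x in lebesgue. u x - W x = c"
  proof (rule weak_deriv_zero_const[OF loc_abs_int_diff[OF l(1) Wl]])
    fix \<phi> assume t: "test_function UNIV \<phi>"
    note sm = test_function_smooth[OF t]
    obtain K where K: "compact K" "\<And>x. x \<notin> K \<Longrightarrow> \<phi> x = 0" using t by (auto simp: test_function_def)
    have d0: "deriv \<phi> x = 0" if "x \<notin> K" for x
      using deriv_zero_outside[of K \<phi> x] K that by (simp add: compact_imp_closed)
    note i = supported_product(2)[OF _ smooth_continuous[OF smooth_deriv[OF sm]] d0 K(1) _ Um]
    have "(\<integral>x. deriv \<phi> x *\<^sub>R (u x - W x) \<partial>lebesgue_on UNIV) = (\<integral>x. deriv \<phi> x *\<^sub>R u x \<partial>lebesgue_on UNIV) - (\<integral>x. deriv \<phi> x *\<^sub>R W x \<partial>lebesgue_on UNIV)"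
      unfolding scaleR_diff_right by (intro Bochner_Integration.integral_diff i) (auto simp: locally_integrable_UNIV l Wl)
    also have "\<dots> = 0"
      using uv has_ac_deriv_imp_weak[OF W open_UNIV] t by (simp add: has_weak_deriv_def)
    finally show "(\<integral>x. deriv \<phi> x *\<^sub>R (u x - W x) \<partial>lebesgue) = 0" by (simp add: lebesgue_on_UNIV_eq)
  qed
  then obtain c where c: "AE x in lebesgue. u x - W x = c" by blast
  show ?thesis
  proof
    show "has_ac_deriv (\<lambda>x. W x + c) v"
      using has_ac_deriv_add[OF W has_ac_deriv_const[of c]] by simp
    show "AE x in lebesgue. u x = W x + c" using c by eventually_elim (simp add: diff_eq_eq add.commute)
  qed
qed

section \<open>Fixed points in the Lebesgue space\<close>

lemma L2D: "f \<in> L2 S \<Longrightarrow> f \<in> borel_measurable (lebesgue_on S)"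
  "f \<in> L2 S \<Longrightarrow> integrable (lebesgue_on S) (\<lambda>x. (cmod (f x))\<^sup>2)"
  by (auto simp: L2_def)

lemma L2I_bound:
  assumes "f \<in> borel_measurable (lebesgue_on S)" "integrable (lebesgue_on S) w"
    "AE x in lebesgue_on S. (cmod (f x))\<^sup>2 \<le> w x"
  shows "f \<in> L2 S"
proof -
  have "integrable (lebesgue_on S) (\<lambda>x. (cmod (f x))\<^sup>2)"
  proof (rule Bochner_Integration.integrable_bound[OF assms(2)])
    show "(\<lambda>x. (cmod (f x))\<^sup>2) \<in> borel_measurable (lebesgue_on S)" using assms(1) by measurable
    show "AE x in lebesgue_on S. norm ((cmod (f x))\<^sup>2) \<le> norm (w x)" using assms(3) by eventually_elim auto
  qed
  then show ?thesis using assms(1) by (simp add: L2_def)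
qed

lemma sum_sq_le: "(a + b)\<^sup>2 \<le> 2 * a\<^sup>2 + 2 * b\<^sup>2" for a b :: real
  using zero_le_power2[of "a - b"] by (simp add: power2_eq_square algebra_simps)

lemma L2_add:
  assumes "f \<in> L2 S" "g \<in> L2 S" shows "(\<lambda>x. f x + g x) \<in> L2 S"
proof (rule L2I_bound)
  show "(\<lambda>x. f x + g x) \<in> borel_measurable (lebesgue_on S)" using L2D(1)[OF assms(1)] L2D(1)[OF assms(2)] by measurable
  show "integrable (lebesgue_on S) (\<lambda>x. 2 * (cmod (f x))\<^sup>2 + 2 * (cmod (g x))\<^sup>2)"
    by (intro Bochner_Integration.integrable_add integrable_mult_right L2D assms)
  show "AE x in lebesgue_on S. (cmod (f x + g x))\<^sup>2 \<le> 2 * (cmod (f x))\<^sup>2 + 2 * (cmod (g x))\<^sup>2"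
    by (intro AE_I2 order_trans[OF power_mono[OF norm_triangle_ineq] sum_sq_le]) auto
qed

lemma L2_cmult: assumes "f \<in> L2 S" shows "(\<lambda>x. c * f x) \<in> L2 S"
  using assms by (auto simp: L2_def norm_mult power_mult_distrib)

lemma L2_zero: "(\<lambda>_. 0) \<in> L2 S" by (simp add: L2_def)

lemma L2_lincomb: "f \<in> L2 S \<Longrightarrow> g \<in> L2 S \<Longrightarrow> (\<lambda>x. f x + c * g x) \<in> L2 S"
  by (intro L2_add L2_cmult)

lemma L2_diff: "f \<in> L2 S \<Longrightarrow> g \<in> L2 S \<Longrightarrow> (\<lambda>x. f x - g x) \<in> L2 S"
  using L2_lincomb[of f S g "-1"] by simp

lemma L2_sum: "(\<And>i. i \<in> I \<Longrightarrow> f i \<in> L2 S) \<Longrightarrow> (\<lambda>x. \<Sum>i\<in>I. f i x) \<in> L2 S"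
  by (induction I rule: infinite_finite_induct) (auto simp: L2_zero L2_add)

lemma L2_norm_nonneg: "L2_norm S f \<ge> 0"
  by (simp add: L2_norm_def)

lemma L2_norm_sq: "(L2_norm S f)\<^sup>2 = (\<integral>x. (cmod (f x))\<^sup>2 \<partial>lebesgue_on S)"
  by (simp add: L2_norm_def)

lemma L2_mult_integrable:
  assumes "f \<in> L2 S" "g \<in> L2 S"
  shows "integrable (lebesgue_on S) (\<lambda>x. f x * g x)"
proof (rule Bochner_Integration.integrable_bound)
  show "integrable (lebesgue_on S) (\<lambda>x. (cmod (f x))\<^sup>2 + (cmod (g x))\<^sup>2)"
    by (intro Bochner_Integration.integrable_add L2D assms)
  show "(\<lambda>x. f x * g x) \<in> borel_measurable (lebesgue_on S)" using L2D(1)[OF assms(1)] L2D(1)[OF assms(2)] by measurable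
  have "a * b \<le> a\<^sup>2 + b\<^sup>2" if "a \<ge> 0" "b \<ge> 0" for a b :: real
    using sum_squares_bound[of a b] mult_nonneg_nonneg[OF that] by simp
  then show "AE x in lebesgue_on S. cmod (f x * g x) \<le> norm ((cmod (f x))\<^sup>2 + (cmod (g x))\<^sup>2)"
    by (simp add: norm_mult)
qed

text \<open>The quadratic t \<mapsto> A - 2 t C + t^2 B is non-negative as the integral of a square;
  t = C / B gives the claim unless B = 0.\<close>

lemma L2_Cauchy_Schwarz:
  assumes "f \<in> L2 S" "g \<in> L2 S"
  shows "(\<integral>x. cmod (f x) * cmod (g x) \<partial>lebesgue_on S) \<le> L2_norm S f * L2_norm S g"
proof -
  define A B C where "A = (L2_norm S f)\<^sup>2" and "B = (L2_norm S g)\<^sup>2"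
    and "C = (\<integral>x. cmod (f x) * cmod (g x) \<partial>lebesgue_on S)"
  have iC: "integrable (lebesgue_on S) (\<lambda>x. cmod (f x) * cmod (g x))"
    using integrable_norm[OF L2_mult_integrable[OF assms]] by (simp add: norm_mult)
  have C0: "C \<ge> 0" unfolding C_def by (rule integral_nonneg_AE) auto
  have q: "0 \<le> A - 2 * t * C + t\<^sup>2 * B" for t
  proof -
    have "0 \<le> (\<integral>x. (cmod (f x) - t * cmod (g x))\<^sup>2 \<partial>lebesgue_on S)" by (rule integral_nonneg_AE) auto
    also have "\<dots> = (\<integral>x. (cmod (f x))\<^sup>2 - 2 * t * (cmod (f x) * cmod (g x)) + t\<^sup>2 * (cmod (g x))\<^sup>2 \<partial>lebesgue_on S)"
      by (rule Bochner_Integration.integral_cong) (auto simp: power2_eq_square algebra_simps)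
    also have "\<dots> = A - 2 * t * C + t\<^sup>2 * B"
      unfolding A_def B_def C_def L2_norm_sq using iC assms by (simp add: L2D)
    finally show ?thesis .
  qed
  have "C\<^sup>2 \<le> A * B"
  proof (cases "B = 0")
    case True
    have "C = 0"
    proof (rule ccontr)
      assume "C \<noteq> 0"
      \<comment> \<open>With B = 0 the inequality at this \<open>t\<close> reads 0 \<le> - A -
        2.\<close>
      then show False using q[of "(A + 1) / C"] C0 True zero_le_power2[of "L2_norm S f"] by (simp add: A_def)
    qed
    then show ?thesis using True by simp
  next
    case False
    then have "B > 0" by (simp add: B_def)
    then show ?thesis using q[of "C / B"] by (simp add: field_simps power2_eq_square)
  qed
  then have "C\<^sup>2 \<le> (L2_norm S f * L2_norm S g)\<^sup>2" by (simp add: A_def B_def power_mult_distrib)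
  then show ?thesis using power2_le_imp_le L2_norm_nonneg by (metis C_def mult_nonneg_nonneg)
qed

lemma L2_norm_triangle:
  assumes "f \<in> L2 S" "g \<in> L2 S"
  shows "L2_norm S (\<lambda>x. f x + g x) \<le> L2_norm S f + L2_norm S g"
proof -
  have iC: "integrable (lebesgue_on S) (\<lambda>x. cmod (f x) * cmod (g x))"
    using integrable_norm[OF L2_mult_integrable[OF assms]] by (simp add: norm_mult)
  have i: "integrable (lebesgue_on S) (\<lambda>x. (cmod (f x))\<^sup>2 + 2 * (cmod (f x) * cmod (g x)) + (cmod (g x))\<^sup>2)"
    using iC assms by (simp add: L2D)
  have "(L2_norm S (\<lambda>x. f x + g x))\<^sup>2 \<le> (\<integral>x. (cmod (f x))\<^sup>2 + 2 * (cmod (f x) * cmod (g x)) + (cmod (g x))\<^sup>2 \<partial>lebesgue_on S)"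
    unfolding L2_norm_sq
  proof (rule integral_mono[OF L2D(2)[OF L2_add[OF assms]] i])
    fix x
    have "(cmod (f x + g x))\<^sup>2 \<le> (cmod (f x) + cmod (g x))\<^sup>2" by (intro power_mono norm_triangle_ineq) auto
    then show "(cmod (f x + g x))\<^sup>2 \<le> (cmod (f x))\<^sup>2 + 2 * (cmod (f x) * cmod (g x)) + (cmod (g x))\<^sup>2"
      by (simp add: power2_sum mult.assoc)
  qed
  also have "\<dots> = (L2_norm S f)\<^sup>2 + 2 * (\<integral>x. cmod (f x) * cmod (g x) \<partial>lebesgue_on S) + (L2_norm S g)\<^sup>2"
    unfolding L2_norm_sq using iC assms by (simp add: L2D)
  also have "\<dots> \<le> (L2_norm S f + L2_norm S g)\<^sup>2"
    using L2_Cauchy_Schwarz[OF assms] by (simp add: power2_sum)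
  finally show ?thesis using L2_norm_nonneg power2_le_imp_le by (metis add_nonneg_nonneg)
qed

lemma L2_norm_cmult: "L2_norm S (\<lambda>x. c * f x) = cmod c * L2_norm S f"
  by (simp add: L2_norm_def norm_mult power_mult_distrib real_sqrt_mult)

lemma L2_norm_triangle_diff:
  assumes "f \<in> L2 S" "g \<in> L2 S"
  shows "L2_norm S (\<lambda>x. f x - g x) \<le> L2_norm S f + L2_norm S g"
  using L2_norm_triangle[OF assms(1) L2_cmult[OF assms(2), of "-1"]] L2_norm_cmult[of S "-1" g] by simp

lemma L2_norm_cong_AE:
  assumes "f \<in> L2 S" "g \<in> L2 S" "AE x in lebesgue_on S. f x = g x"
  shows "L2_norm S f = L2_norm S g"
proof -
  have "(\<integral>x. (cmod (f x))\<^sup>2 \<partial>lebesgue_on S) = (\<integral>x. (cmod (g x))\<^sup>2 \<partial>lebesgue_on S)"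
  proof (rule integral_cong_AE)
    show "AE x in lebesgue_on S. (cmod (f x))\<^sup>2 = (cmod (g x))\<^sup>2" using assms(3) by eventually_elim simp
  qed (rule borel_measurable_integrable[OF L2D(2)[OF assms(1)]] borel_measurable_integrable[OF L2D(2)[OF assms(2)]])+
  then show ?thesis by (simp add: L2_norm_def)
qed

lemma L2_norm_le_AE:
  assumes "f \<in> L2 S" "g \<in> L2 S" "AE x in lebesgue_on S. cmod (f x) \<le> cmod (g x)"
  shows "L2_norm S f \<le> L2_norm S g"
  unfolding L2_norm_def
proof (intro real_sqrt_le_mono integral_mono_AE L2D assms)
  show "AE x in lebesgue_on S. (cmod (f x))\<^sup>2 \<le> (cmod (g x))\<^sup>2"
    using assms(3) by eventually_elim (auto intro: power_mono)
qed

lemma L2_norm_zero_iff: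
  assumes "f \<in> L2 S" shows "L2_norm S f = 0 \<longleftrightarrow> (AE x in lebesgue_on S. f x = 0)"
  using integral_nonneg_eq_0_iff_AE[OF L2D(2)[OF assms]] by (simp add: L2_norm_def)

lemma L2_measurable_cong_AE:
  assumes "f \<in> borel_measurable (lebesgue_on S)" "AE x in lebesgue_on S. f x = g x" "S \<in> sets lebesgue"
  shows "(g :: real \<Rightarrow> complex) \<in> borel_measurable (lebesgue_on S)"
proof -
  have 1: "(\<lambda>x. if x \<in> S then f x else 0) \<in> borel_measurable lebesgue"
    using assms(1,3) by (rule borel_measurable_if_I)
  have neg: "negligible {x. \<not> (x \<in> S \<longrightarrow> f x = g x)}"
    using assms(2,3) by (simp add: AE_lebesgue_on_iff AE_lebesgue_iff_negligible)
  have "(\<lambda>x. if x \<in> S then g x else 0) \<in> borel_measurable (lebesgue_on UNIV)"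
  proof (rule measurable_on_iff_borel_measurable[THEN iffD1])
    show "(\<lambda>x. if x \<in> S then g x else 0) measurable_on UNIV"
    proof (rule measurable_on_spike[OF _ neg])
      show "(\<lambda>x. if x \<in> S then f x else 0) measurable_on UNIV"
        using 1 by (simp add: measurable_on_iff_borel_measurable lebesgue_on_UNIV_eq)
    qed auto
  qed simp
  then show ?thesis by (simp add: lebesgue_on_UNIV_eq borel_measurable_if_D)
qed

lemma L2_cong_AE:
  assumes "f \<in> L2 S" "AE x in lebesgue_on S. f x = g x" "S \<in> sets lebesgue"
  shows "g \<in> L2 S"
proof (rule L2I_bound[OF L2_measurable_cong_AE[OF L2D(1)[OF assms(1)] assms(2,3)] L2D(2)[OF assms(1)]])
  show "AE x in lebesgue_on S. (cmod (g x))\<^sup>2 \<le> (cmod (f x))\<^sup>2" using assms(2) by eventually_elim simp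
qed

text \<open>Completeness in the form the Neumann series needs. The partial sums of |f_j| are bounded
  in norm, so by monotone convergence their squared supremum is integrable; it is finite almost
  everywhere, dominates all remainders, and dominated convergence applies.\<close>

lemma L2_series_complete:
  assumes f: "\<And>j. f j \<in> L2 S" and b: "\<And>j. L2_norm S (f j) \<le> C * \<kappa> ^ j" and \<kappa>: "0 \<le> \<kappa>" "\<kappa> < 1"
  obtains h where "h \<in> L2 S" "(\<lambda>n. L2_norm S (\<lambda>x. h x - (\<Sum>j<n. f j x))) \<longlonglongrightarrow> 0"
proof -
  let ?M = "lebesgue_on S"
  define s where "s n x = (\<Sum>j<n. cmod (f j x))" for n x
  define H where "H x = (SUP n. ennreal ((s n x)\<^sup>2))" for x
  have C0: "C \<ge> 0" using b[of 0] L2_norm_nonneg[of S "f 0"] by simp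
  have fm[measurable]: "f j \<in> borel_measurable ?M" for j using f L2D by blast
  have cf: "(\<lambda>x. complex_of_real (cmod (f j x))) \<in> L2 S" for j
    using f[of j] fm[of j] by (auto simp: L2_def)
  have cs: "(\<lambda>x. complex_of_real (s n x)) \<in> L2 S" for n
    unfolding s_def of_real_sum using cf by (rule L2_sum)
  have ns: "L2_norm S (\<lambda>x. of_real (s n x)) \<le> (\<Sum>j<n. C * \<kappa> ^ j)" for n
  proof (induction n)
    case 0 show ?case by (simp add: s_def L2_norm_def)
  next
    case (Suc n)
    have "L2_norm S (\<lambda>x. of_real (s (Suc n) x)) = L2_norm S (\<lambda>x. of_real (s n x) + of_real (cmod (f n x)))"
      by (simp add: s_def)
    also have "\<dots> \<le> L2_norm S (\<lambda>x. of_real (s n x)) + L2_norm S (\<lambda>x. of_real (cmod (f n x)))"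
      using cs cf by (rule L2_norm_triangle)
    also have "L2_norm S (\<lambda>x. of_real (cmod (f n x))) = L2_norm S (f n)" by (simp add: L2_norm_def)
    finally show ?case using Suc.IH b[of n] by simp
  qed
  define B where "B = C / (1 - \<kappa>)"
  have ns': "L2_norm S (\<lambda>x. of_real (s n x)) \<le> B" for n
  proof -
    have "(\<Sum>j<n. \<kappa> ^ j) \<le> (\<Sum>j. \<kappa> ^ j)" using \<kappa> by (intro sum_le_suminf summable_geometric) auto
    then have "(\<Sum>j<n. \<kappa> ^ j) \<le> 1 / (1 - \<kappa>)" using \<kappa> by (simp add: suminf_geometric)
    then have "C * (\<Sum>j<n. \<kappa> ^ j) \<le> C * (1 / (1 - \<kappa>))" using C0 by (intro mult_left_mono)
    then show ?thesis using ns[of n] by (simp add: B_def sum_distrib_left)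
  qed
  have B0: "B \<ge> 0" using C0 \<kappa> by (simp add: B_def)
  have sm[measurable]: "s n \<in> borel_measurable ?M" for n unfolding s_def by measurable
  have nn: "(\<integral>\<^sup>+x. ennreal ((s n x)\<^sup>2) \<partial>?M) \<le> ennreal (B\<^sup>2)" for n
  proof -
    have "(\<integral>\<^sup>+x. ennreal ((s n x)\<^sup>2) \<partial>?M) = ennreal (\<integral>x. (s n x)\<^sup>2 \<partial>?M)"
      using L2D(2)[OF cs[of n]] by (intro nn_integral_eq_integral) auto
    also have "(\<integral>x. (s n x)\<^sup>2 \<partial>?M) = (L2_norm S (\<lambda>x. of_real (s n x)))\<^sup>2" by (simp add: L2_norm_sq)
    also have "ennreal \<dots> \<le> ennreal (B\<^sup>2)" using ns' L2_norm_nonneg by (intro ennreal_leI power_mono)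
    finally show ?thesis .
  qed
  have s_mono: "s n x \<le> s m x" if "n \<le> m" for n m x
    unfolding s_def using that by (intro sum_mono2) auto
  have s_nonneg: "s n x \<ge> 0" for n x unfolding s_def by (intro sum_nonneg) auto
  have Hm[measurable]: "H \<in> borel_measurable ?M" unfolding H_def by measurable
  have "(\<integral>\<^sup>+x. H x \<partial>?M) = (SUP n. \<integral>\<^sup>+x. ennreal ((s n x)\<^sup>2) \<partial>?M)"
    unfolding H_def
    by (intro nn_integral_monotone_convergence_SUP)
      (auto simp: incseq_def le_fun_def s_nonneg intro!: ennreal_leI power_mono s_mono)
  also have "\<dots> \<le> ennreal (B\<^sup>2)" using nn by (intro SUP_least)
  finally have HB: "(\<integral>\<^sup>+x. H x \<partial>?M) \<le> ennreal (B\<^sup>2)" .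
  then have fin: "AE x in ?M. H x \<noteq> \<infinity>"
    by (intro nn_integral_noteq_infinite Hm) (auto simp: top_unique)
  \<comment> \<open>\<open>enn2real\<close> sends the value \<infinity> to 0, which alters
    \<open>H\<close> on a null set only and turns it into a real integrable majorant.\<close>
  define w where "w x = enn2real (H x)" for x
  have iw: "integrable ?M w"
  proof (rule integrableI_bounded)
    show "w \<in> borel_measurable ?M" unfolding w_def by measurable
    have "(\<integral>\<^sup>+x. ennreal (norm (w x)) \<partial>?M) \<le> (\<integral>\<^sup>+x. H x \<partial>?M)"
      using fin by (intro nn_integral_mono_AE) (auto simp: w_def ennreal_enn2real_if elim!: eventually_mono)
    then show "(\<integral>\<^sup>+x. ennreal (norm (w x)) \<partial>?M) < \<infinity>"
      using HB by (auto simp: le_less_trans ennreal_less_top intro: le_less_trans order_trans)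
  qed
  have sw: "(s n x)\<^sup>2 \<le> w x" if "H x \<noteq> \<infinity>" for n x
  proof -
    have "ennreal ((s n x)\<^sup>2) \<le> H x" unfolding H_def by (rule SUP_upper) simp
    also have "H x = ennreal (w x)" using that by (simp add: w_def less_top)
    finally show ?thesis by (simp add: w_def ennreal_le_iff)
  qed
  define h where "h x = (\<Sum>j. f j x)" for x
  have hm: "h \<in> borel_measurable ?M" unfolding h_def by measurable
  have pt: "summable (\<lambda>j. cmod (f j x)) \<and> (\<forall>n. (cmod (h x - (\<Sum>j<n. f j x)))\<^sup>2 \<le> w x) \<and>
      (\<lambda>n. (cmod (h x - (\<Sum>j<n. f j x)))\<^sup>2) \<longlonglongrightarrow> 0" if H: "H x \<noteq> \<infinity>" for x
  proof -
    have bnd: "s n x \<le> sqrt (w x)" for n using sw[OF H, of n] s_nonneg[of n x] by (simp add: real_le_rsqrt)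
    have sa: "summable (\<lambda>j. cmod (f j x))"
      by (rule summableI_nonneg_bounded[of _ "sqrt (w x)"]) (use bnd in \<open>auto simp: s_def\<close>)
    have sf: "summable (\<lambda>j. f j x)" using sa by (rule summable_norm_cancel)
    have tot: "(\<Sum>j. cmod (f j x)) \<le> sqrt (w x)"
      by (rule suminf_le_const[OF sa]) (use bnd in \<open>auto simp: s_def\<close>)
    have "cmod (h x - (\<Sum>j<n. f j x)) \<le> sqrt (w x)" for n
    proof -
      have "h x - (\<Sum>j<n. f j x) = (\<Sum>j. f (j + n) x)" unfolding h_def using suminf_split_initial_segment[OF sf, of n] by simp
      also have "cmod \<dots> \<le> (\<Sum>j. cmod (f (j + n) x))"
        by (rule summable_norm) (use summable_iff_shift[of "\<lambda>j. cmod (f j x)" n] sa in simp)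
      also have "\<dots> = (\<Sum>j. cmod (f j x)) - s n x" unfolding s_def using suminf_minus_initial_segment[OF sa, of n] by simp
      also have "\<dots> \<le> sqrt (w x)" using tot s_nonneg[of n x] by simp
      finally show ?thesis .
    qed
    moreover have "w x \<ge> 0" by (simp add: w_def)
    ultimately have "(cmod (h x - (\<Sum>j<n. f j x)))\<^sup>2 \<le> w x" for n
      by (metis norm_ge_zero power_mono real_sqrt_pow2)
    moreover have "(\<lambda>n. (cmod (h x - (\<Sum>j<n. f j x)))\<^sup>2) \<longlonglongrightarrow> (cmod (h x - h x))\<^sup>2"
      unfolding h_def by (intro tendsto_intros summable_LIMSEQ sf)
    ultimately show ?thesis using sa by simp
  qed
  have hL2: "h \<in> L2 S"
  proof (rule L2I_bound[OF hm iw])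
    show "AE x in ?M. (cmod (h x))\<^sup>2 \<le> w x"
      using fin
    proof eventually_elim
      case (elim x)
      then show ?case using pt[OF elim] spec[of "\<lambda>n. (cmod (h x - (\<Sum>j<n. f j x)))\<^sup>2 \<le> w x" 0] by simp
    qed
  qed
  have "(\<lambda>n. \<integral>x. (cmod (h x - (\<Sum>j<n. f j x)))\<^sup>2 \<partial>?M) \<longlonglongrightarrow> (\<integral>x. 0 \<partial>?M)"
  proof (rule integral_dominated_convergence[OF _ _ iw])
    show "(\<lambda>x. (cmod (h x - (\<Sum>j<n. f j x)))\<^sup>2) \<in> borel_measurable ?M" for n using hm by measurable
    show "AE x in ?M. (\<lambda>n. (cmod (h x - (\<Sum>j<n. f j x)))\<^sup>2) \<longlonglongrightarrow> 0"
      using fin by eventually_elim (use pt in blast)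
    show "AE x in ?M. norm ((cmod (h x - (\<Sum>j<n. f j x)))\<^sup>2) \<le> w x" for n
      using fin by eventually_elim (use pt in auto)
  qed simp
  then have "(\<lambda>n. L2_norm S (\<lambda>x. h x - (\<Sum>j<n. f j x))) \<longlonglongrightarrow> sqrt 0"
    unfolding L2_norm_def by (intro tendsto_real_sqrt) simp
  then show ?thesis using that hL2 by simp
qed

text \<open>Linearity holds almost everywhere only: the perturbation acts on representatives and
  returns some representative of the image.\<close>

definition L2_bounded_op :: "real set \<Rightarrow> real \<Rightarrow> ((real \<Rightarrow> complex) \<Rightarrow> real \<Rightarrow> complex) \<Rightarrow> bool" where
  "L2_bounded_op S C T \<longleftrightarrow> (\<forall>g\<in>L2 S. T g \<in> L2 S) \<and>
     (\<forall>g\<in>L2 S. \<forall>h\<in>L2 S. \<forall>c. AE x in lebesgue_on S. T (\<lambda>y. g y + c * h y) x = T g x + c * T h x) \<and>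
     (\<forall>g\<in>L2 S. L2_norm S (T g) \<le> C * L2_norm S g)"

lemma L2_bounded_opD:
  assumes "L2_bounded_op S C T"
  shows "g \<in> L2 S \<Longrightarrow> T g \<in> L2 S"
    and "g \<in> L2 S \<Longrightarrow> h \<in> L2 S \<Longrightarrow> AE x in lebesgue_on S. T (\<lambda>y. g y + c * h y) x = T g x + c * T h x"
    and "g \<in> L2 S \<Longrightarrow> L2_norm S (T g) \<le> C * L2_norm S g"
  using assms by (auto simp: L2_bounded_op_def)

lemma L2_bounded_op_diff:
  assumes T: "L2_bounded_op S C T" and g: "g \<in> L2 S" "h \<in> L2 S"
  shows "AE x in lebesgue_on S. T (\<lambda>y. g y - h y) x = T g x - T h x"
    "L2_norm S (\<lambda>x. T g x - T h x) \<le> C * L2_norm S (\<lambda>x. g x - h x)"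
proof -
  show ae: "AE x in lebesgue_on S. T (\<lambda>y. g y - h y) x = T g x - T h x"
    using L2_bounded_opD(2)[OF T g, of "-1"] by simp
  show "L2_norm S (\<lambda>x. T g x - T h x) \<le> C * L2_norm S (\<lambda>x. g x - h x)"
    using L2_norm_cong_AE[OF L2_bounded_opD(1)[OF T L2_diff[OF g]] L2_diff[OF L2_bounded_opD(1)[OF T g(1)] L2_bounded_opD(1)[OF T g(2)]] ae]
      L2_bounded_opD(3)[OF T L2_diff[OF g]] by simp
qed

text \<open>The Neumann series of the iterates of \<open>T\<close> on \<open>f\<close> converges
  geometrically; continuity of \<open>T\<close> in norm shows that its sum solves the equation up to
  a function of norm 0.\<close>

lemma L2_fixpoint_exists:
  assumes T: "L2_bounded_op S \<kappa> T" and \<kappa>: "0 \<le> \<kappa>" "\<kappa> < 1" and f: "f \<in> L2 S"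
  obtains h where "h \<in> L2 S" "AE x in lebesgue_on S. h x = f x + T h x"
proof -
  note TD = L2_bounded_opD[OF T]
  define F where "F j = (T ^^ j) f" for j
  have F: "F j \<in> L2 S" for j by (induction j) (auto simp: F_def f TD)
  have Fn: "L2_norm S (F j) \<le> L2_norm S f * \<kappa> ^ j" for j
  proof (induction j)
    case (Suc j)
    have "L2_norm S (F (Suc j)) \<le> \<kappa> * L2_norm S (F j)" using TD(3)[OF F[of j]] by (simp add: F_def)
    also have "\<dots> \<le> \<kappa> * (L2_norm S f * \<kappa> ^ j)" using Suc \<kappa> by (intro mult_left_mono)
    finally show ?case by (simp add: mult_ac)
  qed (simp add: F_def)
  obtain h where h: "h \<in> L2 S" "(\<lambda>n. L2_norm S (\<lambda>x. h x - (\<Sum>j<n. F j x))) \<longlonglongrightarrow> 0"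
    using L2_series_complete[OF F Fn \<kappa>] by blast
  define s where "s n x = (\<Sum>j<n. F j x)" for n x
  have sL: "s n \<in> L2 S" for n unfolding s_def using F by (rule L2_sum)
  \<comment> \<open>Additivity almost everywhere is chained over finitely many summands. For the
    empty sum, \<open>T\<close> of 0 vanishes almost everywhere because its norm does.\<close>
  have Ts: "AE x in lebesgue_on S. T (s n) x = (\<Sum>j<n. F (Suc j) x)" for n
  proof (induction n)
    case 0
    have "L2_norm S (T (s 0)) \<le> \<kappa> * L2_norm S (s 0)" using sL by (rule TD(3))
    moreover have "L2_norm S (s 0) = 0" by (simp add: s_def L2_norm_def)
    ultimately have "L2_norm S (T (s 0)) = 0" using L2_norm_nonneg[of S "T (s 0)"] by simp
    then show ?case using L2_norm_zero_iff[OF TD(1)[OF sL[of 0]]] by simp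
  next
    case (Suc n)
    have e: "s (Suc n) = (\<lambda>x. s n x + 1 * F n x)" by (rule ext) (simp add: s_def)
    have "AE x in lebesgue_on S. T (s (Suc n)) x = T (s n) x + 1 * T (F n) x"
      unfolding e using sL F by (rule TD(2))
    then show ?case using Suc by eventually_elim (simp add: F_def)
  qed
  have dL: "(\<lambda>x. h x - (f x + T h x)) \<in> L2 S" by (intro L2_diff L2_add h f TD)
  have bd: "L2_norm S (\<lambda>x. h x - (f x + T h x)) \<le> L2_norm S (\<lambda>x. h x - s (Suc n) x) + \<kappa> * L2_norm S (\<lambda>x. h x - s n x)" for n
  proof -
    have d1: "(\<lambda>x. h x - s (Suc n) x) \<in> L2 S" by (intro L2_diff h sL)
    have d2: "(\<lambda>x. T h x - T (s n) x) \<in> L2 S" by (intro L2_diff h sL TD)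
    have ae: "AE x in lebesgue_on S. h x - (f x + T h x) = (h x - s (Suc n) x) - (T h x - T (s n) x)"
      using Ts[of n]
    proof eventually_elim
      case (elim x)
      have "s (Suc n) x = f x + (\<Sum>j<n. F (Suc j) x)"
        unfolding s_def by (subst sum.lessThan_Suc_shift) (simp add: F_def)
      then show ?case using elim by simp
    qed
    show ?thesis
      using L2_norm_cong_AE[OF dL L2_diff[OF d1 d2] ae] L2_norm_triangle_diff[OF d1 d2]
        L2_bounded_op_diff(2)[OF T h(1) sL[of n]] by simp
  qed
  have hs: "(\<lambda>n. L2_norm S (\<lambda>x. h x - s n x)) \<longlonglongrightarrow> 0" using h(2) by (simp add: s_def)
  have "(\<lambda>n. L2_norm S (\<lambda>x. h x - s (Suc n) x) + \<kappa> * L2_norm S (\<lambda>x. h x - s n x)) \<longlonglongrightarrow> 0 + \<kappa> * 0"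
    by (intro tendsto_add tendsto_mult_left hs LIMSEQ_Suc)
  then have "L2_norm S (\<lambda>x. h x - (f x + T h x)) \<le> 0 + \<kappa> * 0"
    by (rule LIMSEQ_le_const) (use bd in auto)
  then have "L2_norm S (\<lambda>x. h x - (f x + T h x)) = 0" using L2_norm_nonneg[of S "\<lambda>x. h x - (f x + T h x)"] by simp
  then have "AE x in lebesgue_on S. h x - (f x + T h x) = 0" using L2_norm_zero_iff[OF dL] by simp
  then have "AE x in lebesgue_on S. h x = f x + T h x" by simp
  then show ?thesis using that h(1) by blast
qed

lemma L2_fixpoint_bound:
  assumes T: "L2_bounded_op S \<kappa> T" and \<kappa>: "\<kappa> < 1" and f: "f \<in> L2 S"
    and h: "h \<in> L2 S" "AE x in lebesgue_on S. h x = f x + T h x"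
  shows "L2_norm S h \<le> L2_norm S f / (1 - \<kappa>)"
proof -
  have "L2_norm S h = L2_norm S (\<lambda>x. f x + T h x)"
    using L2_norm_cong_AE[OF h(1) L2_add[OF f L2_bounded_opD(1)[OF T h(1)]] h(2)] .
  also have "\<dots> \<le> L2_norm S f + \<kappa> * L2_norm S h"
    using L2_norm_triangle[OF f L2_bounded_opD(1)[OF T h(1)]] L2_bounded_opD(3)[OF T h(1)] by simp
  finally have "(1 - \<kappa>) * L2_norm S h \<le> L2_norm S f" by (simp add: algebra_simps)
  then show ?thesis using \<kappa> by (simp add: field_simps)
qed

lemma L2_inner_bound:
  assumes "f \<in> L2 S" "g \<in> L2 S"
  shows "cmod (L2_inner S f g) \<le> L2_norm S f * L2_norm S g"
proof -
  have "cmod (L2_inner S f g) \<le> (\<integral>x. cmod (f x * cnj (g x)) \<partial>lebesgue_on S)"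
    unfolding L2_inner_def by (rule integral_norm_bound)
  also have "\<dots> = (\<integral>x. cmod (f x) * cmod (g x) \<partial>lebesgue_on S)" by (simp add: norm_mult)
  finally show ?thesis using L2_Cauchy_Schwarz[OF assms] by simp
qed

lemma L2_cnj: "g \<in> L2 S \<Longrightarrow> (\<lambda>x. cnj (g x)) \<in> L2 S"
  unfolding L2_def
  by (auto intro!: measurable_compose[of g "lebesgue_on S" borel cnj] borel_measurable_continuous_onI continuous_intros)

lemma L2_inner_linear:
  assumes "f \<in> L2 S" "g \<in> L2 S" "k \<in> L2 S"
  shows "L2_inner S (\<lambda>x. f x + c * g x) k = L2_inner S f k + c * L2_inner S g k"
  unfolding L2_inner_def
  using L2_mult_integrable[OF assms(1) L2_cnj[OF assms(3)]] L2_mult_integrable[OF assms(2) L2_cnj[OF assms(3)]]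
  by (simp add: distrib_right mult.assoc)

lemma L2_inner_cong_AE:
  assumes "f \<in> L2 S" "g \<in> L2 S" "k \<in> L2 S" "AE x in lebesgue_on S. f x = g x"
  shows "L2_inner S f k = L2_inner S g k"
  unfolding L2_inner_def
proof (rule integral_cong_AE)
  show "AE x in lebesgue_on S. f x * cnj (k x) = g x * cnj (k x)" using assms(4) by eventually_elim simp
qed (rule borel_measurable_integrable[OF L2_mult_integrable[OF assms(1) L2_cnj[OF assms(3)]]]
    borel_measurable_integrable[OF L2_mult_integrable[OF assms(2) L2_cnj[OF assms(3)]]])+

section \<open>The Hill equation\<close>

lemma locally_finite_countable:
  assumes "locally_finite_set E" shows "countable E"
proof -
  have "E = (\<Union>i::nat. E \<inter> {- real i..real i})"
  proof safe
    fix x assume "x \<in> E"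
    obtain k :: nat where "\<bar>x\<bar> \<le> real k" using real_arch_simple by blast
    then show "x \<in> (\<Union>i::nat. E \<inter> {- real i..real i})" using \<open>x \<in> E\<close> by (auto intro!: exI[of _ k])
  qed
  moreover have "countable (\<Union>i::nat. E \<inter> {- real i..real i})"
    using assms by (intro countable_UN) (auto simp: locally_finite_set_def intro: countable_finite)
  ultimately show "countable E" by simp
qed

text \<open>One-sided limits at every point bound \<open>f\<close> near that point; bisection makes
  the bound uniform on the compact interval.\<close>

lemma piecewise_continuous_bounded:
  assumes "piecewise_continuous f" and xy: "x \<le> y"
  shows "bounded (f ` {x..y})"
proof (rule Bolzano[of x y "\<lambda>s t. bounded (f ` {s..t})", OF xy])
  fix a b c :: real
  assume "bounded (f ` {a..b})" "bounded (f ` {b..c})" "a \<le> b" "b \<le> c"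
  then have "bounded (f ` ({a..b} \<union> {b..c}))" by (simp add: image_Un)
  then show "bounded (f ` {a..c})"
    by (rule bounded_subset) (intro image_mono, auto)
next
  fix z
  obtain l r where l: "(f \<longlongrightarrow> l) (at_left z)" and r: "(f \<longlongrightarrow> r) (at_right z)"
    using assms(1) unfolding piecewise_continuous_def by blast
  have "eventually (\<lambda>s. dist (f s) l < 1) (at_left z)" using tendstoD[OF l] by simp
  then obtain d1 where d1: "d1 < z" "\<And>s. d1 < s \<Longrightarrow> s < z \<Longrightarrow> dist (f s) l < 1"
    by (auto simp: eventually_at_left[of "z - 1" z])
  have "eventually (\<lambda>s. dist (f s) r < 1) (at_right z)" using tendstoD[OF r] by simp
  then obtain d2 where d2: "d2 > z" "\<And>s. z < s \<Longrightarrow> s < d2 \<Longrightarrow> dist (f s) r < 1"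
    by (auto simp: eventually_at_right[of z "z + 1"])
  show "\<exists>d>0. \<forall>a b. a \<le> z \<and> z \<le> b \<and> b - a < d \<longrightarrow> bounded (f ` {a..b})"
  proof (intro exI[of _ "min (z - d1) (d2 - z)"] conjI allI impI)
    fix a b assume ab: "a \<le> z \<and> z \<le> b \<and> b - a < min (z - d1) (d2 - z)"
    have "f ` {a..b} \<subseteq> ball l 1 \<union> ball r 1 \<union> {f z}"
    proof
      fix t assume "t \<in> f ` {a..b}"
      then obtain s where s: "a \<le> s" "s \<le> b" "t = f s" by auto
      consider "s < z" | "s = z" | "s > z" by linarith
      then show "t \<in> ball l 1 \<union> ball r 1 \<union> {f z}"
        by cases (use s ab d1(2)[of s] d2(2)[of s] in \<open>auto simp: dist_commute\<close>)
    qed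
    then show "bounded (f ` {a..b})" by (rule bounded_subset[rotated]) auto
  qed (use d1 d2 in auto)
qed

lemma piecewise_continuous_measurable:
  assumes "piecewise_continuous f"
  shows "f \<in> borel_measurable borel"
proof -
  obtain E where E: "locally_finite_set E" "\<And>x. x \<notin> E \<Longrightarrow> isCont f x"
    using assms unfolding piecewise_continuous_def by blast
  have cE: "countable E" using E(1) by (rule locally_finite_countable)
  then have "- E \<in> sets borel" using sets.countable[OF _ cE, of borel] by (auto intro: borel_comp)
  then have "(\<lambda>x. indicator (- E) x *\<^sub>R f x) \<in> borel_measurable borel"
    by (rule borel_measurable_continuous_on_indicator) (use E(2) in \<open>auto simp: continuous_at_imp_continuous_on\<close>)
  then show ?thesis
    by (rule measurable_discrete_difference[OF _ cE]) (auto simp: indicator_def)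
qed

lemma borel_imp_lebesgue_measurable: "f \<in> borel_measurable borel \<Longrightarrow> f \<in> borel_measurable lebesgue"
  by (simp add: measurable_completion)

text \<open>The function (A + K Y(x)) exp(- K (x - c)), with Y the integral of \<open>y\<close> from
  \<open>c\<close>, does not increase, since its derivative carries the factor y - (A + K
  Y).\<close>

lemma gronwall_forward:
  fixes y :: "real \<Rightarrow> real"
  assumes y: "continuous_on UNIV y" and K: "K \<ge> 0" and cd: "c \<le> d"
    and le: "\<And>x. c \<le> x \<Longrightarrow> x \<le> d \<Longrightarrow> y x \<le> A + K * integral {c..x} y"
  shows "y d \<le> A * exp (K * (d - c))"
proof -
  \<comment> \<open>Starting the integral at c - 1 makes \<open>Y\<close> differentiable from both
    sides even at \<open>c\<close>.\<close>
  define Y where "Y x = integral {c-1..x} y - integral {c-1..c} y" for x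
  have Yc: "Y x = integral {c..x} y" if "c \<le> x" for x
    using Henstock_Kurzweil_Integration.integral_combine[of "c-1" c x y] that
      integrable_continuous_real[OF continuous_on_subset[OF y], of "c-1" x]
    by (auto simp: Y_def algebra_simps)
  have Y': "(Y has_real_derivative y x) (at x)" if "c \<le> x" for x
  proof -
    have "((\<lambda>x. integral {c-1..x} y) has_real_derivative y x) (at x within {c-1..x+1})"
      by (rule integral_has_real_derivative) (use that continuous_on_subset[OF y] in auto)
    then have "((\<lambda>x. integral {c-1..x} y) has_real_derivative y x) (at x)"
      using that by (simp add: at_within_Icc_at)
    then show ?thesis unfolding Y_def by (auto intro!: derivative_eq_intros)
  qed
  define g where "g x = (A + K * Y x) * exp (- K * (x - c))" for x
  have "g d \<le> g c"
  proof (rule DERIV_nonpos_imp_nonincreasing[OF cd])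
    fix x assume x: "c \<le> x" "x \<le> d"
    have "(g has_real_derivative (K * y x) * exp (- K * (x - c)) + (A + K * Y x) * (exp (- K * (x - c)) * (- K))) (at x)"
      unfolding g_def by (rule derivative_eq_intros Y'[OF x(1)] refl)+ (simp add: algebra_simps)
    moreover have "(K * y x) * exp (- K * (x - c)) + (A + K * Y x) * (exp (- K * (x - c)) * (- K)) \<le> 0"
    proof -
      have "K * (y x - (A + K * Y x)) \<le> 0" using le[OF x] Yc[OF x(1)] K by (intro mult_nonneg_nonpos) auto
      then have "(K * (y x - (A + K * Y x))) * exp (- K * (x - c)) \<le> 0" by (rule mult_nonpos_nonneg) simp
      then show ?thesis by (simp add: algebra_simps)
    qed
    ultimately show "\<exists>y. (g has_real_derivative y) (at x) \<and> y \<le> 0" by blast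
  qed
  then have "(A + K * Y d) * exp (- K * (d - c)) \<le> A" by (simp add: g_def Y_def)
  then have "(A + K * Y d) * (exp (- K * (d - c)) * exp (K * (d - c))) \<le> A * exp (K * (d - c))"
    by (metis exp_ge_zero mult.assoc mult_right_mono)
  then have "A + K * Y d \<le> A * exp (K * (d - c))" by (simp flip: exp_add)
  then show ?thesis using le[of d] Yc[of d] cd by simp
qed

lemma gronwall_backward:
  fixes y :: "real \<Rightarrow> real"
  assumes y: "continuous_on UNIV y" and K: "K \<ge> 0" and cd: "d \<le> c"
    and le: "\<And>x. d \<le> x \<Longrightarrow> x \<le> c \<Longrightarrow> y x \<le> A + K * integral {x..c} y"
  shows "y d \<le> A * exp (K * (c - d))"
proof -
  have "(\<lambda>x. y (- x)) (- d) \<le> A * exp (K * (- d - - c))"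
  proof (rule gronwall_forward[OF _ K])
    show "continuous_on UNIV (\<lambda>x. y (- x))" by (intro continuous_on_compose2[OF y] continuous_intros) auto
    fix x assume "- c \<le> x" "x \<le> - d"
    then show "y (- x) \<le> A + K * integral {- c..x} (\<lambda>x. y (- x))"
      using le[of "- x"] Henstock_Kurzweil_Integration.integral_reflect_real[where a="- x" and b=c and f=y] by simp
  qed (use cd in auto)
  then show ?thesis by (simp add: algebra_simps)
qed

section \<open>Solutions of the inhomogeneous Hill equation\<close>

locale hill =
  fixes p q :: "real \<Rightarrow> real" and p0 :: real
  assumes p_per: "p (x + 1) = p x" and q_per: "q (x + 1) = q x"
    and p_C1: "piecewise_C1 p" and q_pc: "piecewise_continuous q"
    and p0_pos: "p0 > 0" and p_ge: "p x \<ge> p0" and p_0: "p 0 = 1"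
begin

lemma p_pos: "p x > 0" using p_ge[of x] p0_pos by linarith

lemma p_nz [simp]: "p x \<noteq> 0" using p_pos[of x] by simp

lemma p_cont: "continuous_on UNIV p" using p_C1 by (simp add: piecewise_C1_def)

lemma p_1: "p 1 = 1" using p_per[of 0] p_0 by simp

lemma per_int:
  fixes g :: "real \<Rightarrow> 'b" assumes "\<And>x. g (x + 1) = g x" shows "g (x + of_int k) = g x"
proof -
  have n: "g (x + of_nat n) = g x" for x n
  proof (induction n)
    case (Suc n) show ?case using assms[of "x + of_nat n"] Suc by (simp add: add_ac)
  qed simp
  show ?thesis
  proof (cases "k \<ge> 0")
    case True then show ?thesis using n[of x "nat k"] by simp
  next
    case False then show ?thesis using n[of "x + of_int k" "nat (- k)"] by simp
  qed
qed

lemma q_bounded: "\<exists>B\<ge>0. \<forall>x. \<bar>q x\<bar> \<le> B"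
proof -
  obtain B where B: "\<And>x. x \<in> {0..1} \<Longrightarrow> \<bar>q x\<bar> \<le> B"
    using piecewise_continuous_bounded[OF q_pc, of 0 1] unfolding bounded_iff by (metis imageI real_norm_def zero_le_one)
  have "\<bar>q x\<bar> \<le> B" for x
  proof -
    have "q x = q (frac x)" using per_int[of q "frac x" "\<lfloor>x\<rfloor>", OF q_per] by (simp add: frac_def)
    then show ?thesis using B[of "frac x"] by (simp add: frac_ge_0 frac_lt_1 less_imp_le)
  qed
  moreover from this[of 0] have "B \<ge> 0" by simp
  ultimately show ?thesis by blast
qed

definition qB :: real where "qB = (SOME B. B \<ge> 0 \<and> (\<forall>x. \<bar>q x\<bar> \<le> B))"

lemma qB: "qB \<ge> 0" "\<bar>q x\<bar> \<le> qB"
  using someI_ex[OF q_bounded[unfolded Bex_def], folded qB_def] by auto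

lemma q_measurable: "q \<in> borel_measurable lebesgue"
  using piecewise_continuous_measurable[OF q_pc] by (rule borel_imp_lebesgue_measurable)

abbreviation "P \<equiv> (\<lambda>x. complex_of_real (p x))"

text \<open>A derivative of \<open>p\<close> is needed as a total, measurable and globally bounded
  function. The one supplied by \<open>piecewise_C1\<close> has arbitrary values on the exceptional
  set, so boundedness is clear only on compact intervals.\<close>

lemma dp_exists: "\<exists>g B. g \<in> borel_measurable lebesgue \<and> (\<forall>x. \<bar>g x\<bar> \<le> B) \<and>
    has_ac_deriv P (\<lambda>x. of_real (g x)) \<and> has_ac_deriv (\<lambda>x. inverse (P x)) (\<lambda>x. - of_real (g x) * (inverse (P x))\<^sup>2)"
proof -
  obtain E f' where E: "locally_finite_set E" and f': "\<And>x. x \<notin> E \<Longrightarrow> (p has_real_derivative f' x) (at x)"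
    and pc: "piecewise_continuous f'" using p_C1 unfolding piecewise_C1_def by blast
  \<comment> \<open>Copying the values from one period yields a global bound; off the integer
    translates of the exceptional set, periodicity of \<open>p\<close> makes this copy agree with
    \<open>f'\<close>.\<close>
  define g where "g x = f' (frac x)" for x
  obtain B where B: "\<And>x. x \<in> {0..1} \<Longrightarrow> \<bar>f' x\<bar> \<le> B"
    using piecewise_continuous_bounded[OF pc, of 0 1] unfolding bounded_iff by (metis imageI real_norm_def zero_le_one)
  have gB: "\<bar>g x\<bar> \<le> B" for x unfolding g_def by (intro B) (simp add: frac_ge_0 frac_lt_1 less_imp_le)
  have f'm: "f' \<in> borel_measurable lebesgue"
    using piecewise_continuous_measurable[OF pc] by (rule borel_imp_lebesgue_measurable)
  have gm: "g \<in> borel_measurable lebesgue"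
  proof (rule borel_imp_lebesgue_measurable)
    have [measurable]: "f' \<in> borel_measurable borel" by (rule piecewise_continuous_measurable[OF pc])
    show "g \<in> borel_measurable borel" unfolding g_def frac_def by measurable
  qed
  define E' where "E' = E \<union> (\<Union>k::int. (\<lambda>x. x + of_int k) ` E)"
  have "countable E'" unfolding E'_def using locally_finite_countable[OF E] by auto
  then have negE': "negligible E'"
    by (simp add: negligible_iff_null_sets countable_imp_null_set_lborel null_sets_completionI)
  have ae: "AE x in lebesgue. f' x = g x"
    unfolding AE_lebesgue_iff_negligible
  proof (rule negligible_subset[OF negE'])
    show "{x. f' x \<noteq> g x} \<subseteq> E'"
    proof (rule subsetI, rule ccontr)
      fix x assume x: "x \<in> {x. f' x \<noteq> g x}" and nE: "x \<notin> E'"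
      have fE: "frac x \<notin> E"
      proof
        assume "frac x \<in> E"
        then have "frac x + of_int \<lfloor>x\<rfloor> \<in> (\<Union>k::int. (\<lambda>x. x + of_int k) ` E)" by blast
        then show False using nE by (simp add: E'_def frac_def)
      qed
      have "(p has_real_derivative f' (frac x)) (at (frac x))" using f' fE by blast
      then have "(p has_real_derivative f' (frac x)) (at (x + of_int (- \<lfloor>x\<rfloor>)))" by (simp add: frac_def)
      then have "((\<lambda>y. p (y + of_int (- \<lfloor>x\<rfloor>))) has_real_derivative f' (frac x)) (at x)"
        by (rule DERIV_shift[THEN iffD1])
      then have "(p has_real_derivative f' (frac x)) (at x)" unfolding per_int[of p, OF p_per] .
      moreover have "(p has_real_derivative f' x) (at x)" using f' nE by (auto simp: E'_def)
      ultimately have "f' x = f' (frac x)" by (rule DERIV_unique[rotated])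
      then show False using x by (simp add: g_def)
    qed
  qed
  have lf: "loc_abs_int (\<lambda>x. complex_of_real (f' x))"
  proof -
    have "loc_abs_int (\<lambda>x. complex_of_real (f' x) * 1)"
    proof (rule loc_abs_int_mult_bounded)
      show "(\<lambda>x. complex_of_real (f' x)) \<in> borel_measurable lebesgue" using f'm by measurable
      show "bounded ((\<lambda>x. complex_of_real (f' x)) ` {x..y})" for x y
        using piecewise_continuous_bounded[OF pc, of x y] by (cases "x \<le> y") (auto simp: bounded_iff)
    qed (simp add: loc_abs_int_continuous)
    then show ?thesis by simp
  qed
  have cP: "continuous_on UNIV P" by (intro continuous_intros p_cont)
  have ciP: "continuous_on UNIV (\<lambda>x. inverse (P x))" by (intro continuous_intros p_cont) simp
  have a1: "has_ac_deriv P (\<lambda>x. of_real (f' x))"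
  proof (rule has_ac_deriv_piecewise[OF cP E _ lf])
    fix x assume "x \<notin> E"
    then show "(P has_vector_derivative of_real (f' x)) (at x)"
      using f' by (simp add: has_vector_derivative_of_real has_real_derivative_iff_has_vector_derivative)
  qed
  have a2: "has_ac_deriv (\<lambda>x. inverse (P x)) (\<lambda>x. - of_real (f' x) * (inverse (P x))\<^sup>2)"
  proof (rule has_ac_deriv_piecewise[OF ciP E])
    fix x assume "x \<notin> E"
    then have "((\<lambda>x. inverse (p x)) has_real_derivative - (inverse (p x) * f' x * inverse (p x))) (at x)"
      using f' by (intro DERIV_inverse') auto
    then have "((\<lambda>x. complex_of_real (inverse (p x))) has_vector_derivative of_real (- (inverse (p x) * f' x * inverse (p x)))) (at x)"
      by (intro has_vector_derivative_of_real) (simp add: has_real_derivative_iff_has_vector_derivative)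
    then show "((\<lambda>x. inverse (P x)) has_vector_derivative - of_real (f' x) * (inverse (P x))\<^sup>2) (at x)"
      by (simp add: power2_eq_square mult_ac)
  next
    have "loc_abs_int (\<lambda>x. (- (inverse (P x))\<^sup>2) * of_real (f' x))"
      by (rule loc_abs_int_mult_continuous[OF _ lf]) (intro continuous_intros ciP)
    then show "loc_abs_int (\<lambda>x. - of_real (f' x) * (inverse (P x))\<^sup>2)" by (simp add: mult_ac)
  qed
  show ?thesis
  proof (intro exI conjI)
    show "has_ac_deriv P (\<lambda>x. of_real (g x))"
      by (rule has_ac_deriv_cong_AE[OF a1]) (use ae in \<open>eventually_elim, simp\<close>)
    show "has_ac_deriv (\<lambda>x. inverse (P x)) (\<lambda>x. - of_real (g x) * (inverse (P x))\<^sup>2)"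
      by (rule has_ac_deriv_cong_AE[OF a2]) (use ae in \<open>eventually_elim, simp\<close>)
  qed (use gm gB in auto)
qed

definition dp :: "real \<Rightarrow> real" where
  "dp = (SOME g. \<exists>B. g \<in> borel_measurable lebesgue \<and> (\<forall>x. \<bar>g x\<bar> \<le> B) \<and>
    has_ac_deriv P (\<lambda>x. of_real (g x)) \<and> has_ac_deriv (\<lambda>x. inverse (P x)) (\<lambda>x. - of_real (g x) * (inverse (P x))\<^sup>2))"

lemma dp: "dp \<in> borel_measurable lebesgue" "\<exists>B. \<forall>x. \<bar>dp x\<bar> \<le> B"
  "has_ac_deriv P (\<lambda>x. of_real (dp x))"
  "has_ac_deriv (\<lambda>x. inverse (P x)) (\<lambda>x. - of_real (dp x) * (inverse (P x))\<^sup>2)"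
  using someI_ex[OF dp_exists, folded dp_def] by blast+

definition dB :: real where "dB = (SOME B. \<forall>x. \<bar>dp x\<bar> \<le> B)"

lemma dB: "\<bar>dp x\<bar> \<le> dB" "dB \<ge> 0"
proof -
  have "\<forall>x. \<bar>dp x\<bar> \<le> dB" using someI_ex[OF dp(2), folded dB_def] .
  then show "\<bar>dp x\<bar> \<le> dB" "dB \<ge> 0" by (auto intro: order_trans[OF abs_ge_zero])
qed

text \<open>First-order form of - (p u')' + (q - l) u = f with v = u'. The flux
  \<open>P x * v x\<close> is what the equation differentiates, so it, and not \<open>v\<close>, is
  required to be absolutely continuous.\<close>

definition sol :: "complex \<Rightarrow> (real \<Rightarrow> complex) \<Rightarrow> (real \<Rightarrow> complex) \<Rightarrow> (real \<Rightarrow> complex) \<Rightarrow> bool" where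
  "sol l f u v \<longleftrightarrow> has_ac_deriv u v \<and> has_ac_deriv (\<lambda>x. P x * v x) (\<lambda>x. (of_real (q x) - l) * u x - f x)"

lemma sol_cont: assumes "sol l f u v" shows "continuous_on UNIV u" "continuous_on UNIV v"
proof -
  show "continuous_on UNIV u" using assms has_ac_deriv_continuous sol_def by blast
  have "continuous_on UNIV (\<lambda>x. P x * v x)" using assms has_ac_deriv_continuous sol_def by blast
  then have "continuous_on UNIV (\<lambda>x. P x * v x / P x)"
    by (rule continuous_on_divide) (auto intro!: continuous_intros p_cont)
  then show "continuous_on UNIV v" by simp
qed

lemma q_mult_loc: "loc_abs_int u \<Longrightarrow> loc_abs_int (\<lambda>x. (of_real (q x) - l) * u x)"
proof (rule loc_abs_int_mult_bounded)
  show "(\<lambda>x. complex_of_real (q x) - l) \<in> borel_measurable lebesgue" using q_measurable by measurable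
  fix x y
  have "cmod (complex_of_real (q t) - l) \<le> qB + cmod l" for t
    using norm_triangle_ineq4[of "complex_of_real (q t)" l] qB(2)[of t] by simp
  then show "bounded ((\<lambda>x. complex_of_real (q x) - l) ` {x..y})" by (auto simp: bounded_iff)
qed

lemma sol_f_loc: assumes "sol l f u v" shows "loc_abs_int f"
proof -
  have 1: "loc_abs_int (\<lambda>x. (of_real (q x) - l) * u x)"
    by (intro q_mult_loc loc_abs_int_continuous sol_cont[OF assms])
  have 2: "loc_abs_int (\<lambda>x. (of_real (q x) - l) * u x - f x)" using assms has_ac_derivD(1) sol_def by blast
  show ?thesis using loc_abs_int_diff[OF 1 2] by simp
qed

lemma sol_lincomb:
  assumes "sol l f u v" "sol l g w y"
  shows "sol l (\<lambda>x. f x + c * g x) (\<lambda>x. u x + c * w x) (\<lambda>x. v x + c * y x)"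
  unfolding sol_def
proof
  show "has_ac_deriv (\<lambda>x. u x + c * w x) (\<lambda>x. v x + c * y x)"
    using assms by (intro has_ac_deriv_add has_ac_deriv_cmult) (auto simp: sol_def)
  have "has_ac_deriv (\<lambda>x. P x * v x + c * (P x * y x)) (\<lambda>x. ((of_real (q x) - l) * u x - f x) + c * ((of_real (q x) - l) * w x - g x))"
    using assms by (intro has_ac_deriv_add has_ac_deriv_cmult) (auto simp: sol_def)
  then show "has_ac_deriv (\<lambda>x. P x * (v x + c * y x)) (\<lambda>x. (of_real (q x) - l) * (u x + c * w x) - (f x + c * g x))"
    by (rule has_ac_deriv_cong) (auto simp: algebra_simps)
qed

lemma sol_cong: "sol l f u v \<Longrightarrow> (\<And>x. f x = f' x) \<Longrightarrow> (\<And>x. u x = u' x) \<Longrightarrow> (\<And>x. v x = v' x) \<Longrightarrow> sol l f' u' v'"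
  using ext[of f f'] ext[of u u'] ext[of v v'] by simp

lemma sol_cong_AE: 
  assumes "sol l f u v" "AE x in lebesgue. f x = f' x" shows "sol l f' u v"
  unfolding sol_def
proof
  show "has_ac_deriv u v" using assms by (simp add: sol_def)
  show "has_ac_deriv (\<lambda>x. P x * v x) (\<lambda>x. (of_real (q x) - l) * u x - f' x)"
    by (rule has_ac_deriv_cong_AE[where v="\<lambda>x. (of_real (q x) - l) * u x - f x"])
       (use assms in \<open>auto simp: sol_def elim!: eventually_mono\<close>)
qed

lemma sol_change_l: "sol l f u v \<Longrightarrow> sol l' (\<lambda>x. f x + (l - l') * u x) u v"
  unfolding sol_def by (auto elim!: has_ac_deriv_cong simp: algebra_simps)

text \<open>Writing v = (p v) (1/p) as a product of absolutely continuous functions recovers u''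
  from the equation; this is how solutions are placed in \<open>W22\<close>.\<close>

lemma sol_second:
  assumes "sol l f u v"
  shows "has_ac_deriv v (\<lambda>x. ((of_real (q x) - l) * u x - f x - of_real (dp x) * v x) / P x)"
proof -
  have "has_ac_deriv (\<lambda>x. (P x * v x) * inverse (P x))
     (\<lambda>x. ((of_real (q x) - l) * u x - f x) * inverse (P x) + (P x * v x) * (- of_real (dp x) * (inverse (P x))\<^sup>2))"
    using assms by (intro has_ac_deriv_mult dp) (auto simp: sol_def)
  then show ?thesis
    by (rule has_ac_deriv_cong) (auto simp: field_simps power2_eq_square)
qed

lemma sol_wronskian:
  assumes "sol l f u v" "sol l' g w y"
  shows "has_ac_deriv (\<lambda>x. P x * (u x * y x - v x * w x)) (\<lambda>x. (l - l') * (u x * w x) - u x * g x + f x * w x)"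
proof -
  have "has_ac_deriv (\<lambda>x. u x * (P x * y x) - w x * (P x * v x))
     (\<lambda>x. (v x * (P x * y x) + u x * ((of_real (q x) - l') * w x - g x)) - (y x * (P x * v x) + w x * ((of_real (q x) - l) * u x - f x)))"
    using assms by (intro has_ac_deriv_diff has_ac_deriv_mult) (auto simp: sol_def)
  then show ?thesis by (rule has_ac_deriv_cong) (auto simp: algebra_simps)
qed

text \<open>Gronwall for |u| + |p v|: integrating u' = (p v)/p contributes the rate 1/p0, the flux
  equation contributes qB + R, and the source enters additively. The bound is uniform for |l| \<le>
  R.\<close>

lemma sol_estimate:
  assumes s: "sol l f u v" and x: "\<bar>x - c\<bar> \<le> T" and l: "cmod l \<le> R"
  shows "cmod (u x) + cmod (P x * v x) \<le>
    (cmod (u c) + cmod (P c * v c) + integral {c-T..c+T} (\<lambda>t. cmod (f t))) * exp ((1/p0 + qB + R) * T)"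
proof -
  define K where "K = 1/p0 + qB + R"
  have R0: "R \<ge> 0" using l norm_ge_zero[of l] by linarith
  have K: "K \<ge> 0" "1/p0 \<le> K" "qB + R \<le> K" using p0_pos qB(1) R0 by (auto simp: K_def)
  define y where "y t = cmod (u t) + cmod (P t * v t)" for t
  define I where "I = integral {c-T..c+T} (\<lambda>t. cmod (f t))"
  define A where "A = y c + I"
  have fl: "loc_abs_int f" using s by (rule sol_f_loc)
  have T0: "T \<ge> 0" using x by linarith
  have yc: "continuous_on UNIV y" unfolding y_def by (intro continuous_intros sol_cont[OF s] p_cont)
  have yi: "y integrable_on {r..t}" for r t using yc continuous_on_subset integrable_continuous_real by blast
  have a1: "has_ac_deriv u v" and a2: "has_ac_deriv (\<lambda>x. P x * v x) (\<lambda>x. (of_real (q x) - l) * u x - f x)"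
    using s by (auto simp: sol_def)
  have v_le: "cmod (v t) \<le> (1/p0) * cmod (P t * v t)" for t
  proof -
    have "p0 * cmod (v t) \<le> p t * cmod (v t)" by (intro mult_right_mono p_ge) simp
    then show ?thesis using p0_pos p_pos[of t] by (simp add: norm_mult field_simps)
  qed
  have g_le: "cmod ((of_real (q t) - l) * u t - f t) \<le> (qB + R) * cmod (u t) + cmod (f t)" for t
  proof -
    have "cmod ((of_real (q t) - l) * u t - f t) \<le> cmod (of_real (q t) - l) * cmod (u t) + cmod (f t)"
      using norm_triangle_ineq4[of "(of_real (q t) - l) * u t" "f t"] by (simp add: norm_mult)
    moreover have "cmod (of_real (q t) - l) \<le> qB + R"
      using norm_triangle_ineq4[of "complex_of_real (q t)" l] qB(2)[of t] l by simp
    then have "cmod (of_real (q t) - l) * cmod (u t) \<le> (qB + R) * cmod (u t)" by (rule mult_right_mono) simp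
    ultimately show ?thesis by linarith
  qed
  have step: "cmod (u t - u r) + cmod (P t * v t - P r * v r) \<le> K * integral {r..t} y + I"
    if rt: "r \<le> t" "c - T \<le> r" "t \<le> c + T" for r t
  proof -
    have i1: "v integrable_on {r..t}" "(\<lambda>x. (of_real (q x) - l) * u x - f x) integrable_on {r..t}"
      by (rule loc_abs_int_integrable[OF has_ac_derivD(1)[OF a1]], rule loc_abs_int_integrable[OF has_ac_derivD(1)[OF a2]])
    have i2: "(\<lambda>s. (1/p0) * cmod (P s * v s)) integrable_on {r..t}"
      by (rule integrable_continuous_real[OF continuous_on_subset[OF _ subset_UNIV]])
         (intro continuous_intros sol_cont[OF s] p_cont)
    have i3: "(\<lambda>s. (qB + R) * cmod (u s)) integrable_on {r..t}"
      by (rule integrable_continuous_real[OF continuous_on_subset[OF _ subset_UNIV]])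
         (intro continuous_intros sol_cont[OF s])
    have i4: "(\<lambda>s. cmod (f s)) integrable_on {r..t}" using fl by (rule loc_abs_int_norm)
    have "cmod (u t - u r) \<le> integral {r..t} (\<lambda>s. (1/p0) * cmod (P s * v s))"
      using integral_norm_bound_integral[OF i1(1) i2] v_le has_ac_derivD(3)[OF a1 rt(1)] by simp
    moreover have "cmod (P t * v t - P r * v r) \<le> integral {r..t} (\<lambda>s. (qB + R) * cmod (u s) + cmod (f s))"
      using integral_norm_bound_integral[OF i1(2) integrable_add[OF i3 i4]] g_le has_ac_derivD(3)[OF a2 rt(1)] by simp
    moreover have "integral {r..t} (\<lambda>s. (qB + R) * cmod (u s) + cmod (f s)) = integral {r..t} (\<lambda>s. (qB + R) * cmod (u s)) + integral {r..t} (\<lambda>s. cmod (f s))"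
      using i3 i4 by (rule Henstock_Kurzweil_Integration.integral_add)
    moreover have "integral {r..t} (\<lambda>s. cmod (f s)) \<le> I"
      unfolding I_def by (rule integral_subset_le) (use rt i4 loc_abs_int_norm[OF fl] in auto)
    moreover have "integral {r..t} (\<lambda>s. (1/p0) * cmod (P s * v s)) + integral {r..t} (\<lambda>s. (qB + R) * cmod (u s)) \<le> K * integral {r..t} y"
    proof -
      have "integral {r..t} (\<lambda>s. (1/p0) * cmod (P s * v s)) + integral {r..t} (\<lambda>s. (qB + R) * cmod (u s))
         = integral {r..t} (\<lambda>s. (1/p0) * cmod (P s * v s) + (qB + R) * cmod (u s))"
        using i2 i3 by (rule Henstock_Kurzweil_Integration.integral_add[symmetric])
      also have "\<dots> \<le> integral {r..t} (\<lambda>s. K * y s)"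
      proof (rule integral_le[OF integrable_add[OF i2 i3] integrable_on_mult_right[OF yi]])
        fix s
        have "(1/p0) * cmod (P s * v s) \<le> K * cmod (P s * v s)" "(qB + R) * cmod (u s) \<le> K * cmod (u s)"
          using K by (intro mult_right_mono; simp)+
        then show "(1/p0) * cmod (P s * v s) + (qB + R) * cmod (u s) \<le> K * y s" by (simp add: y_def distrib_left)
      qed
      finally show ?thesis by simp
    qed
    ultimately show ?thesis by linarith
  qed
  have tri: "y t \<le> y r + (cmod (u t - u r) + cmod (P t * v t - P r * v r))" for r t
    unfolding y_def using norm_triangle_sub[of "u t" "u r"] norm_triangle_sub[of "P t * v t" "P r * v r"] by linarith
  have A0: "A \<ge> 0" unfolding A_def I_def y_def
    by (intro add_nonneg_nonneg integral_nonneg loc_abs_int_norm[OF fl]) auto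
  have "y x \<le> A * exp (K * \<bar>x - c\<bar>)"
  proof (cases "c \<le> x")
    case True
    have "y x \<le> A * exp (K * (x - c))"
    proof (rule gronwall_forward[OF yc K(1) True])
      fix t assume t: "c \<le> t" "t \<le> x"
      have "t \<le> c + T" using t x by linarith
      then show "y t \<le> A + K * integral {c..t} y" using step[of c t] tri[of t c] t T0 by (simp add: A_def)
    qed
    then show ?thesis using True by simp
  next
    case False
    then have xc: "x \<le> c" by simp
    have "y x \<le> A * exp (K * (c - x))"
    proof (rule gronwall_backward[OF yc K(1) xc])
      fix t assume t: "x \<le> t" "t \<le> c"
      have "c - T \<le> t" using t x by linarith
      then show "y t \<le> A + K * integral {t..c} y"
        using step[of t c] tri[of t c] t T0 by (simp add: A_def norm_minus_commute)
    qed
    then show ?thesis using False by simp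
  qed
  also have "\<dots> \<le> A * exp (K * T)" using x K A0 by (intro mult_left_mono) (auto intro: mult_left_mono)
  finally show ?thesis by (simp add: y_def A_def I_def K_def)
qed

lemma sol_unique:
  assumes "sol l f u v" "sol l f' u' v'" "AE x in lebesgue. f x = f' x" "u c = u' c" "v c = v' c"
  shows "u x = u' x" "v x = v' x"
proof -
  have "sol l (\<lambda>x. f x + (-1) * f' x) (\<lambda>x. u x + (-1) * u' x) (\<lambda>x. v x + (-1) * v' x)"
    using assms(1,2) by (rule sol_lincomb)
  then have s: "sol l (\<lambda>_. 0) (\<lambda>x. u x - u' x) (\<lambda>x. v x - v' x)"
    by (rule sol_cong_AE[THEN sol_cong]) (use assms(3) in auto)
  have "cmod (u x - u' x) + cmod (P x * (v x - v' x)) \<le> 0"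
    using sol_estimate[OF s, of x c "\<bar>x - c\<bar>" "cmod l"] assms(4,5) by simp
  then have "cmod (u x - u' x) = 0" "cmod (P x * (v x - v' x)) = 0"
    using norm_ge_zero[of "u x - u' x"] norm_ge_zero[of "P x * (v x - v' x)"] by linarith+
  then show "u x = u' x" "v x = v' x" by auto
qed

end

lemma has_ac_deriv_cnj:
  assumes "has_ac_deriv u v" shows "has_ac_deriv (\<lambda>x. cnj (u x)) (\<lambda>x. cnj (v x))"
proof (rule has_ac_derivI)
  show "loc_abs_int (\<lambda>x. cnj (v x))"
    unfolding loc_abs_int_def
  proof (intro allI)
    fix x y
    show "(\<lambda>x. cnj (v x)) absolutely_integrable_on {x..y}"
      using absolutely_integrable_linear[OF loc_abs_intD[OF has_ac_derivD(1)[OF assms]] bounded_linear_cnj, of x y]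
      by (simp add: o_def)
  qed
  fix x y :: real assume "x \<le> y"
  then show "((\<lambda>x. cnj (v x)) has_integral cnj (u y) - cnj (u x)) {x..y}"
    using has_integral_linear[OF has_ac_derivD(2)[OF assms] bounded_linear_cnj] by (simp add: o_def)
qed

lemma isCont_lipschitz:
  fixes g :: "complex \<Rightarrow> complex"
  assumes "\<And>l. cmod (l - m) \<le> 1 \<Longrightarrow> cmod (g l - g m) \<le> C * cmod (l - m)"
  shows "isCont g m"
proof -
  have "((\<lambda>l. g l - g m) \<longlongrightarrow> 0) (at m)"
  proof (rule Lim_null_comparison)
    show "\<forall>\<^sub>F l in at m. norm (g l - g m) \<le> C * cmod (l - m)"
      using eventually_at[of "\<lambda>l. norm (g l - g m) \<le> C * cmod (l - m)" m UNIV] assms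
      by (auto simp: dist_norm intro!: exI[of _ 1])
    have "((\<lambda>l. C * cmod (l - m)) \<longlongrightarrow> C * cmod (m - m)) (at m)" by (intro tendsto_intros)
    then show "((\<lambda>l. C * cmod (l - m)) \<longlongrightarrow> 0) (at m)" by simp
  qed
  then show ?thesis by (simp add: isCont_def LIM_zero_iff)
qed

lemma ode_solution_UNIV_E:
  assumes "ode_solution UNIV p q l v"
  obtains v' E where "\<And>x. (v has_vector_derivative v' x) (at x)" "continuous_on UNIV v'" "locally_finite_set E"
    "\<And>x. x \<notin> E \<Longrightarrow> ((\<lambda>y. of_real (p y) * v' y) has_vector_derivative (of_real (q x) - l) * v x) (at x)"
proof -
  obtain v' E where a: "\<forall>x\<in>UNIV. (v has_vector_derivative v' x) (at x within UNIV)" "continuous_on UNIV v'" "locally_finite_set E"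
    "\<forall>x\<in>UNIV - E. ((\<lambda>y. of_real (p y) * v' y) has_vector_derivative (of_real (q x) - l) * v x) (at x within UNIV)"
    using assms unfolding ode_solution_def by blast
  show ?thesis by (rule that[of v' E]) (use a in auto)
qed

context hill begin

lemma ode_solution_sol:
  assumes "ode_solution UNIV p q l v"
  shows "sol l (\<lambda>_. 0) v (\<lambda>x. vector_derivative v (at x))"
    and "(v has_vector_derivative vector_derivative v (at x)) (at x)"
    and "\<exists>E. locally_finite_set E \<and> (\<forall>x. x \<notin> E \<longrightarrow> ((\<lambda>y. P y * vector_derivative v (at y)) has_vector_derivative (of_real (q x) - l) * v x) (at x))"
proof -
  obtain v' E where v': "\<And>x. (v has_vector_derivative v' x) (at x)" "continuous_on UNIV v'"
    and E: "locally_finite_set E"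
    and d: "\<And>x. x \<notin> E \<Longrightarrow> ((\<lambda>y. P y * v' y) has_vector_derivative (of_real (q x) - l) * v x) (at x)"
    using assms by (rule ode_solution_UNIV_E) blast
  have eq: "vector_derivative v (at x) = v' x" for x using v'(1) by (rule vector_derivative_at)
  have a1: "has_ac_deriv v v'"
    by (rule has_ac_deriv_piecewise[of _ "{}"])
       (use v' in \<open>auto simp: locally_finite_set_def loc_abs_int_continuous intro!: continuous_at_imp_continuous_on has_vector_derivative_continuous\<close>)
  have a2: "has_ac_deriv (\<lambda>x. P x * v' x) (\<lambda>x. (of_real (q x) - l) * v x)"
  proof (rule has_ac_deriv_piecewise[OF _ E d])
    show "continuous_on UNIV (\<lambda>x. P x * v' x)" by (intro continuous_intros p_cont v')
    show "loc_abs_int (\<lambda>x. (of_real (q x) - l) * v x)"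
      by (intro q_mult_loc loc_abs_int_continuous has_ac_deriv_continuous[OF a1])
  qed
  show "sol l (\<lambda>_. 0) v (\<lambda>x. vector_derivative v (at x))"
    using a1 a2 by (simp add: sol_def eq)
  show "(v has_vector_derivative vector_derivative v (at x)) (at x)" using v'(1) by (simp add: eq)
  show "\<exists>E. locally_finite_set E \<and> (\<forall>x. x \<notin> E \<longrightarrow> ((\<lambda>y. P y * vector_derivative v (at y)) has_vector_derivative (of_real (q x) - l) * v x) (at x))"
    using E d by (auto simp: eq)
qed

lemma sol_cnj:
  assumes "sol l f u v" shows "sol (cnj l) (\<lambda>x. cnj (f x)) (\<lambda>x. cnj (u x)) (\<lambda>x. cnj (v x))"
proof -
  have "has_ac_deriv (\<lambda>x. cnj (P x * v x)) (\<lambda>x. cnj ((of_real (q x) - l) * u x - f x))"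
    using assms by (intro has_ac_deriv_cnj) (simp add: sol_def)
  then show ?thesis using assms by (simp add: sol_def has_ac_deriv_cnj)
qed

lemma has_vector_derivative_shift1:
  "(v has_vector_derivative d) (at (x + 1)) \<Longrightarrow> ((\<lambda>x. v (x + 1)) has_vector_derivative d) (at (x::real))"
proof -
  assume "(v has_vector_derivative d) (at (x + 1))"
  moreover have "((\<lambda>x. x + 1) has_vector_derivative 1) (at x)"
    by (auto intro!: derivative_eq_intros)
  ultimately show ?thesis using vector_diff_chain_at[of "\<lambda>x. x + 1" 1 x v d] by (simp add: o_def)
qed

lemma ode_solution_shift:
  assumes "ode_solution UNIV p q l v"
  shows "ode_solution UNIV p q l (\<lambda>x. v (x + 1))"
    "vector_derivative (\<lambda>x. v (x + 1)) (at x) = vector_derivative v (at (x + 1))"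
proof -
  obtain v' E where v': "\<And>x. (v has_vector_derivative v' x) (at x)" "continuous_on UNIV v'"
    and E: "locally_finite_set E"
    and d: "\<And>x. x \<notin> E \<Longrightarrow> ((\<lambda>y. P y * v' y) has_vector_derivative (of_real (q x) - l) * v x) (at x)"
    using assms by (rule ode_solution_UNIV_E) blast
  show "ode_solution UNIV p q l (\<lambda>x. v (x + 1))"
    unfolding ode_solution_def
  proof (intro exI conjI ballI)
    fix x :: real
    show "((\<lambda>x. v (x + 1)) has_vector_derivative v' (x + 1)) (at x)" by (intro has_vector_derivative_shift1 v')
    show "continuous_on UNIV (\<lambda>x. v' (x + 1))"
      by (intro continuous_on_compose2[OF v'(2)] continuous_intros) auto
    show "locally_finite_set ((\<lambda>x. x - 1) ` E)"
      unfolding locally_finite_set_def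
    proof (intro allI)
      fix a b :: real
      have "(\<lambda>x. x - 1) ` E \<inter> {a..b} \<subseteq> (\<lambda>x. x - 1) ` (E \<inter> {a+1..b+1})" by auto
      then show "finite ((\<lambda>x. x - 1) ` E \<inter> {a..b})"
        using E by (meson finite_imageI finite_subset locally_finite_set_def)
    qed
    fix x assume "x \<in> UNIV - (\<lambda>x. x - 1) ` E"
    then have "x + 1 \<notin> E" by (metis DiffD2 add_diff_cancel_right' image_eqI)
    from has_vector_derivative_shift1[OF d[OF this]]
    show "((\<lambda>y. P y * v' (y + 1)) has_vector_derivative (of_real (q x) - l) * v (x + 1)) (at x)"
      by (simp add: p_per q_per)
  qed
  show "vector_derivative (\<lambda>x. v (x + 1)) (at x) = vector_derivative v (at (x + 1))"
    using vector_derivative_at[OF has_vector_derivative_shift1[OF v'(1)]] vector_derivative_at[OF v'(1)] by simp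
qed

lemma deriv_from_flux: "cmod v \<le> (1/p0) * cmod (P x * v)"
proof -
  have "p0 * cmod v \<le> p x * cmod v" by (intro mult_right_mono p_ge) simp
  then show ?thesis using p0_pos p_pos[of x] by (simp add: norm_mult field_simps)
qed

lemma sol_bound_ex:
  assumes "T \<ge> 0"
  shows "\<exists>C\<ge>0. \<forall>l f u v x. cmod l \<le> R \<longrightarrow> \<bar>x\<bar> \<le> T \<longrightarrow> sol l f u v \<longrightarrow>
    cmod (u x) \<le> C * (cmod (u 0) + cmod (v 0) + integral {-T..T} (\<lambda>t. cmod (f t))) \<and>
    cmod (v x) \<le> C * (cmod (u 0) + cmod (v 0) + integral {-T..T} (\<lambda>t. cmod (f t)))"
proof (intro exI conjI allI impI)
  define e where "e = exp ((1/p0 + qB + R) * T)"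
  let ?C = "max 1 (1/p0) * e"
  have e: "e \<ge> 0" by (simp add: e_def)
  then show "?C \<ge> 0" by simp
  fix l f u v x assume a: "cmod l \<le> R" "\<bar>x\<bar> \<le> T" "sol l f u v"
  let ?N = "cmod (u 0) + cmod (v 0) + integral {-T..T} (\<lambda>t. cmod (f t))"
  have N: "?N \<ge> 0"
    by (intro add_nonneg_nonneg integral_nonneg loc_abs_int_norm[OF sol_f_loc[OF a(3)]]) auto
  have b: "cmod (u x) + cmod (P x * v x) \<le> e * ?N"
    using sol_estimate[OF a(3), of x 0 T R] a p_0 by (simp add: e_def mult.commute)
  have m1: "e * ?N \<le> ?C * ?N" using mult_right_mono[of 1 "max 1 (1/p0)" e] e N by (intro mult_right_mono) auto
  show "cmod (u x) \<le> ?C * ?N" using b m1 norm_ge_zero[of "P x * v x"] by linarith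
  have "cmod (v x) \<le> (1/p0) * (e * ?N)"
    using deriv_from_flux[of "v x" x] b norm_ge_zero[of "u x"] p0_pos
    by (smt (verit, best) divide_nonneg_pos mult_left_mono)
  also have "\<dots> \<le> max 1 (1/p0) * (e * ?N)" using e N by (intro mult_right_mono mult_nonneg_nonneg) auto
  finally show "cmod (v x) \<le> ?C * ?N" by (simp add: mult.assoc)
qed

lemma family_bound:
  assumes w: "\<And>l. sol l (\<lambda>_. 0) (w l) (w' l)" and init: "\<And>l. w l 0 = c" "\<And>l. w' l 0 = c'" and T: "T \<ge> 0"
  shows "\<exists>C\<ge>0. \<forall>l x. cmod l \<le> R \<longrightarrow> \<bar>x\<bar> \<le> T \<longrightarrow> cmod (w l x) \<le> C \<and> cmod (w' l x) \<le> C"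
proof -
  obtain C where C: "C \<ge> 0" "\<And>l f u v x. cmod l \<le> R \<Longrightarrow> \<bar>x\<bar> \<le> T \<Longrightarrow> sol l f u v \<Longrightarrow>
    cmod (u x) \<le> C * (cmod (u 0) + cmod (v 0) + integral {-T..T} (\<lambda>t. cmod (f t))) \<and>
    cmod (v x) \<le> C * (cmod (u 0) + cmod (v 0) + integral {-T..T} (\<lambda>t. cmod (f t)))"
    using sol_bound_ex[OF T, of R] by blast
  show ?thesis
  proof (intro exI[of _ "C * (cmod c + cmod c')"] conjI allI impI)
    show "0 \<le> C * (cmod c + cmod c')" using C(1) by simp
    fix l x assume "cmod l \<le> R" "\<bar>x\<bar> \<le> T"
    from C(2)[OF this w] show "cmod (w l x) \<le> C * (cmod c + cmod c')" "cmod (w' l x) \<le> C * (cmod c + cmod c')"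
      by (simp_all add: init)
  qed
qed

text \<open>The difference of the solutions at \<open>l\<close> and \<open>l'\<close> has zero
  Cauchy data and solves the equation at \<open>l\<close> with source (l - l') w(l'), so the a
  priori bound is already a Lipschitz estimate in the spectral parameter.\<close>

lemma family_lipschitz:
  assumes w: "\<And>l. sol l (\<lambda>_. 0) (w l) (w' l)" and init: "\<And>l. w l 0 = c" "\<And>l. w' l 0 = c'" and T: "T \<ge> 0"
  shows "\<exists>C\<ge>0. \<forall>l l' x. cmod l \<le> R \<longrightarrow> cmod l' \<le> R \<longrightarrow> \<bar>x\<bar> \<le> T \<longrightarrow>
    cmod (w l x - w l' x) \<le> C * cmod (l - l') \<and> cmod (w' l x - w' l' x) \<le> C * cmod (l - l')"
proof -
  obtain C where C: "C \<ge> 0" "\<And>l f u v x. cmod l \<le> R \<Longrightarrow> \<bar>x\<bar> \<le> T \<Longrightarrow> sol l f u v \<Longrightarrow>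
    cmod (u x) \<le> C * (cmod (u 0) + cmod (v 0) + integral {-T..T} (\<lambda>t. cmod (f t))) \<and>
    cmod (v x) \<le> C * (cmod (u 0) + cmod (v 0) + integral {-T..T} (\<lambda>t. cmod (f t)))"
    using sol_bound_ex[OF T, of R] by blast
  obtain B where B: "B \<ge> 0" "\<And>l x. cmod l \<le> R \<Longrightarrow> \<bar>x\<bar> \<le> T \<Longrightarrow> cmod (w l x) \<le> B"
    using family_bound[OF w init T, of R] by blast
  show ?thesis
  proof (intro exI[of _ "C * (2 * T * B)"] conjI allI impI)
    show "0 \<le> C * (2 * T * B)" using C(1) B(1) T by simp
    fix l l' x assume a: "cmod l \<le> R" "cmod l' \<le> R" "\<bar>x\<bar> \<le> T"
    have "sol l (\<lambda>x. 0 + (-1) * (0 + (l' - l) * w l' x)) (\<lambda>x. w l x + (-1) * w l' x) (\<lambda>x. w' l x + (-1) * w' l' x)"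
      by (intro sol_lincomb w sol_change_l)
    then have s: "sol l (\<lambda>x. (l - l') * w l' x) (\<lambda>x. w l x - w l' x) (\<lambda>x. w' l x - w' l' x)"
      by (rule sol_cong) (auto simp: algebra_simps)
    have i: "integral {-T..T} (\<lambda>t. cmod ((l - l') * w l' t)) \<le> integral {-T..T} (\<lambda>t. cmod (l - l') * B)"
      by (rule integral_le[OF loc_abs_int_norm[OF sol_f_loc[OF s]]])
         (use B(2)[OF a(2)] in \<open>auto simp: norm_mult intro!: mult_left_mono\<close>)
    also have "\<dots> = 2 * T * B * cmod (l - l')" using T by simp
    finally have "C * integral {-T..T} (\<lambda>t. cmod ((l - l') * w l' t)) \<le> C * (2 * T * B * cmod (l - l'))"
      using C(1) by (rule mult_left_mono)
    then show "cmod (w l x - w l' x) \<le> C * (2 * T * B) * cmod (l - l')"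
      "cmod (w' l x - w' l' x) \<le> C * (2 * T * B) * cmod (l - l')"
      using C(2)[OF a(1,3) s] by (simp_all add: init mult.assoc)
  qed
qed

end

section \<open>Fundamental solutions, monodromy and the derivative of the discriminant\<close>

locale hill_fs = hill +
  fixes th1 th2 :: "complex \<Rightarrow> real \<Rightarrow> complex"
  assumes fs: "fundamental_solutions p q th1 th2"
begin

definition "dth1 l x = vector_derivative (th1 l) (at x)"
definition "dth2 l x = vector_derivative (th2 l) (at x)"

lemma ode_th: "ode_solution UNIV p q l (th1 l)" "ode_solution UNIV p q l (th2 l)"
  using fs by (auto simp: fundamental_solutions_def)

lemma th_init [simp]: "th1 l 0 = 1" "dth1 l 0 = 0" "th2 l 0 = 0" "dth2 l 0 = 1"
  using fs by (auto simp: fundamental_solutions_def dth1_def dth2_def)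

lemma sol_th: "sol l (\<lambda>_. 0) (th1 l) (dth1 l)" "sol l (\<lambda>_. 0) (th2 l) (dth2 l)"
  using ode_solution_sol(1)[OF ode_th(1)] ode_solution_sol(1)[OF ode_th(2)]
  by (simp_all add: dth1_def[abs_def] dth2_def[abs_def])

lemma th_cont: "continuous_on A (th1 l)" "continuous_on A (th2 l)" "continuous_on A (dth1 l)" "continuous_on A (dth2 l)"
  using sol_cont[OF sol_th(1)] sol_cont[OF sol_th(2)] continuous_on_subset by blast+

text \<open>p times the Wronskian is constant, and at 0 it equals p(0) = 1; variation of parameters
  therefore carries no extra factor.\<close>

lemma wronskian: "P x * (th1 l x * dth2 l x - dth1 l x * th2 l x) = 1"
proof -
  have "has_ac_deriv (\<lambda>x. P x * (th1 l x * dth2 l x - dth1 l x * th2 l x)) (\<lambda>x. (l - l) * (th1 l x * th2 l x) - th1 l x * 0 + 0 * th2 l x)"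
    using sol_th by (rule sol_wronskian)
  from has_ac_deriv_zero[OF this, of x 0] show ?thesis by (simp add: p_0)
qed

lemma det_1: "th1 l 1 * dth2 l 1 - dth1 l 1 * th2 l 1 = 1"
  using wronskian[of 1 l] by (simp add: p_1)

lemma sol_comb: "sol l (\<lambda>_. 0) (\<lambda>x. \<alpha> * th1 l x + \<beta> * th2 l x) (\<lambda>x. \<alpha> * dth1 l x + \<beta> * dth2 l x)"
proof -
  have "sol l (\<lambda>x. (0 + (\<alpha> - 1) * 0) + \<beta> * 0) (\<lambda>x. (th1 l x + (\<alpha> - 1) * th1 l x) + \<beta> * th2 l x) (\<lambda>x. (dth1 l x + (\<alpha> - 1) * dth1 l x) + \<beta> * dth2 l x)"
    by (intro sol_lincomb sol_th)
  then show ?thesis by (rule sol_cong) (auto simp: algebra_simps)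
qed

lemma sol_rep:
  assumes "sol l (\<lambda>_. 0) u v"
  shows "u x = u 0 * th1 l x + v 0 * th2 l x" "v x = u 0 * dth1 l x + v 0 * dth2 l x"
  using sol_unique[OF assms sol_comb[of l "u 0" "v 0"], of 0 x] by auto

lemma th_shift:
  "th1 l (x + 1) = th1 l 1 * th1 l x + dth1 l 1 * th2 l x"
  "dth1 l (x + 1) = th1 l 1 * dth1 l x + dth1 l 1 * dth2 l x"
  "th2 l (x + 1) = th2 l 1 * th1 l x + dth2 l 1 * th2 l x"
  "dth2 l (x + 1) = th2 l 1 * dth1 l x + dth2 l 1 * dth2 l x"
proof -
  have s1: "sol l (\<lambda>_. 0) (\<lambda>x. th1 l (x + 1)) (\<lambda>x. dth1 l (x + 1))"
    using ode_solution_sol(1)[OF ode_solution_shift(1)[OF ode_th(1)]] by (simp add: ode_solution_shift(2)[OF ode_th(1)] dth1_def)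
  have s2: "sol l (\<lambda>_. 0) (\<lambda>x. th2 l (x + 1)) (\<lambda>x. dth2 l (x + 1))"
    using ode_solution_sol(1)[OF ode_solution_shift(1)[OF ode_th(2)]] by (simp add: ode_solution_shift(2)[OF ode_th(2)] dth2_def)
  show "th1 l (x + 1) = th1 l 1 * th1 l x + dth1 l 1 * th2 l x"
    "dth1 l (x + 1) = th1 l 1 * dth1 l x + dth1 l 1 * dth2 l x"
    "th2 l (x + 1) = th2 l 1 * th1 l x + dth2 l 1 * th2 l x"
    "dth2 l (x + 1) = th2 l 1 * dth1 l x + dth2 l 1 * dth2 l x"
    using sol_rep[OF s1, of x] sol_rep[OF s2, of x] by auto
qed

lemma th_bound:
  assumes "T \<ge> 0"
  obtains C where "C \<ge> 0" "\<And>l x. cmod l \<le> R \<Longrightarrow> \<bar>x\<bar> \<le> T \<Longrightarrow>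
    cmod (th1 l x) \<le> C \<and> cmod (th2 l x) \<le> C \<and> cmod (dth1 l x) \<le> C \<and> cmod (dth2 l x) \<le> C"
proof -
  obtain C1 where C1: "C1 \<ge> 0" "\<And>l x. cmod l \<le> R \<Longrightarrow> \<bar>x\<bar> \<le> T \<Longrightarrow> cmod (th1 l x) \<le> C1 \<and> cmod (dth1 l x) \<le> C1"
    using family_bound[OF sol_th(1) th_init(1,2) assms, of R] by blast
  obtain C2 where C2: "C2 \<ge> 0" "\<And>l x. cmod l \<le> R \<Longrightarrow> \<bar>x\<bar> \<le> T \<Longrightarrow> cmod (th2 l x) \<le> C2 \<and> cmod (dth2 l x) \<le> C2"
    using family_bound[OF sol_th(2) th_init(3,4) assms, of R] by blast
  show ?thesis
    by (rule that[of "max C1 C2"]) (use C1 C2 in \<open>auto simp: le_max_iff_disj\<close>)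
qed

lemma th_lipschitz:
  assumes "T \<ge> 0"
  obtains C where "C \<ge> 0" "\<And>l l' x. cmod l \<le> R \<Longrightarrow> cmod l' \<le> R \<Longrightarrow> \<bar>x\<bar> \<le> T \<Longrightarrow>
    cmod (th1 l x - th1 l' x) \<le> C * cmod (l - l') \<and> cmod (th2 l x - th2 l' x) \<le> C * cmod (l - l') \<and>
    cmod (dth1 l x - dth1 l' x) \<le> C * cmod (l - l') \<and> cmod (dth2 l x - dth2 l' x) \<le> C * cmod (l - l')"
proof -
  obtain C1 where C1: "C1 \<ge> 0" "\<And>l l' x. cmod l \<le> R \<Longrightarrow> cmod l' \<le> R \<Longrightarrow> \<bar>x\<bar> \<le> T \<Longrightarrow>
    cmod (th1 l x - th1 l' x) \<le> C1 * cmod (l - l') \<and> cmod (dth1 l x - dth1 l' x) \<le> C1 * cmod (l - l')"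
    using family_lipschitz[OF sol_th(1) th_init(1,2) assms, of R] by blast
  obtain C2 where C2: "C2 \<ge> 0" "\<And>l l' x. cmod l \<le> R \<Longrightarrow> cmod l' \<le> R \<Longrightarrow> \<bar>x\<bar> \<le> T \<Longrightarrow>
    cmod (th2 l x - th2 l' x) \<le> C2 * cmod (l - l') \<and> cmod (dth2 l x - dth2 l' x) \<le> C2 * cmod (l - l')"
    using family_lipschitz[OF sol_th(2) th_init(3,4) assms, of R] by blast
  have m: "C1 * cmod z \<le> max C1 C2 * cmod z" "C2 * cmod z \<le> max C1 C2 * cmod z" for z
    by (intro mult_right_mono; simp)+
  show ?thesis
  proof (rule that[of "max C1 C2"])
    fix l l' x assume a: "cmod l \<le> R" "cmod l' \<le> R" "\<bar>x\<bar> \<le> T"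
    show "cmod (th1 l x - th1 l' x) \<le> max C1 C2 * cmod (l - l') \<and> cmod (th2 l x - th2 l' x) \<le> max C1 C2 * cmod (l - l') \<and>
      cmod (dth1 l x - dth1 l' x) \<le> max C1 C2 * cmod (l - l') \<and> cmod (dth2 l x - dth2 l' x) \<le> max C1 C2 * cmod (l - l')"
      using C1(2)[OF a] C2(2)[OF a] m[of "l - l'"] by linarith
  qed (use C1(1) in auto)
qed

lemma th_real:
  "cnj (th1 (of_real r) x) = th1 (of_real r) x" "cnj (th2 (of_real r) x) = th2 (of_real r) x"
  "cnj (dth1 (of_real r) x) = dth1 (of_real r) x" "cnj (dth2 (of_real r) x) = dth2 (of_real r) x"
proof -
  have s1: "sol (of_real r) (\<lambda>_. 0) (\<lambda>x. cnj (th1 (of_real r) x)) (\<lambda>x. cnj (dth1 (of_real r) x))"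
    using sol_cnj[OF sol_th(1)[of "of_real r"]] by simp
  have s2: "sol (of_real r) (\<lambda>_. 0) (\<lambda>x. cnj (th2 (of_real r) x)) (\<lambda>x. cnj (dth2 (of_real r) x))"
    using sol_cnj[OF sol_th(2)[of "of_real r"]] by simp
  show "cnj (th1 (of_real r) x) = th1 (of_real r) x" "cnj (th2 (of_real r) x) = th2 (of_real r) x"
    "cnj (dth1 (of_real r) x) = dth1 (of_real r) x" "cnj (dth2 (of_real r) x) = dth2 (of_real r) x"
    using sol_rep[OF s1, of x] sol_rep[OF s2, of x] by auto
qed

abbreviation "D \<equiv> discriminant th1 th2"

lemma D_eq: "D l = th1 l 1 + dth2 l 1"
  by (simp add: discriminant_def dth2_def)

text \<open>The symmetric bilinear form attached to the trace-free part of the monodromy matrix. Its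
  diagonal integrates to - D', and as an integral kernel it is the part of the resolvent that is
  multiplied by 1/z.\<close>

definition "bform l x t = th2 l 1 * (th1 l x * th1 l t)
   + ((dth2 l 1 - th1 l 1) / 2) * (th1 l x * th2 l t + th2 l x * th1 l t) - dth1 l 1 * (th2 l x * th2 l t)"

text \<open>Lagrange's identity over one period for two different spectral parameters; p(0) = p(1) =
  1 removes the weight at both ends.\<close>

lemma green_identities:
  fixes l m :: complex
  defines "w i j \<equiv> integral {0..1} (\<lambda>x. (if i then th1 l x else th2 l x) * (if j then th1 m x else th2 m x))"
  shows "th1 l 1 * dth1 m 1 - dth1 l 1 * th1 m 1 = (l - m) * w True True"
    "th1 l 1 * dth2 m 1 - dth1 l 1 * th2 m 1 = 1 + (l - m) * w True False"
    "th2 l 1 * dth1 m 1 - dth2 l 1 * th1 m 1 = - 1 + (l - m) * w False True"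
    "th2 l 1 * dth2 m 1 - dth2 l 1 * th2 m 1 = (l - m) * w False False"
proof -
  have g: "(u 1 * y 1 - v 1 * g 1) - (u 0 * y 0 - v 0 * g 0) = (l - m) * integral {0..1} (\<lambda>x. u x * g x)"
    if "sol l (\<lambda>_. 0) u v" "sol m (\<lambda>_. 0) g y" for u v g y
  proof -
    have "has_ac_deriv (\<lambda>x. P x * (u x * y x - v x * g x)) (\<lambda>x. (l - m) * (u x * g x) - u x * 0 + 0 * g x)"
      using that by (rule sol_wronskian)
    from has_ac_derivD(3)[OF this, of 0 1] show ?thesis by (simp add: p_0 p_1)
  qed
  show "th1 l 1 * dth1 m 1 - dth1 l 1 * th1 m 1 = (l - m) * w True True"
    using g[OF sol_th(1) sol_th(1)] by (simp add: w_def)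
  show "th1 l 1 * dth2 m 1 - dth1 l 1 * th2 m 1 = 1 + (l - m) * w True False"
    using g[OF sol_th(1) sol_th(2)] by (simp add: w_def algebra_simps)
  show "th2 l 1 * dth1 m 1 - dth2 l 1 * th1 m 1 = - 1 + (l - m) * w False True"
    using g[OF sol_th(2) sol_th(1)] by (simp add: w_def algebra_simps)
  show "th2 l 1 * dth2 m 1 - dth2 l 1 * th2 m 1 = (l - m) * w False False"
    using g[OF sol_th(2) sol_th(2)] by (simp add: w_def)
qed

text \<open>Solving the Green identities for the entries at \<open>l\<close>, by means of
  determinant 1 at \<open>m\<close>, gives the exact formula D(l) - D(m) = \<Phi>(l) (l - m) with
  continuous \<Phi>. Caratheodory's criterion then yields the complex derivative without
  differentiating solutions in the parameter.\<close>

lemma D_has_derivative: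
  "(D has_field_derivative - integral {0..1} (\<lambda>t. bform m t t)) (at m)"
proof -
  define w where "w l i j = integral {0..1} (\<lambda>x. (if i then th1 l x else th2 l x) * (if j then th1 m x else th2 m x))" for l i j
  note G = green_identities[of _ m, folded w_def]
  define \<Phi> where "\<Phi> l = th1 m 1 * w l True False - th2 m 1 * w l True True - dth2 m 1 * w l False True + dth1 m 1 * w l False False" for l
  have dD: "D l - D m = \<Phi> l * (l - m)" for l
  proof -
    let ?A = "th1 m 1" and ?B = "dth1 m 1" and ?E = "th2 m 1" and ?F = "dth2 m 1"
    have det: "?A * ?F - ?B * ?E = 1" by (rule det_1)
    have "th1 l 1 * (?A * ?F - ?B * ?E) = ?A * (th1 l 1 * ?F - dth1 l 1 * ?E) - ?E * (th1 l 1 * ?B - dth1 l 1 * ?A)"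
      by (simp add: algebra_simps)
    then have a: "th1 l 1 = ?A * (1 + (l - m) * w l True False) - ?E * ((l - m) * w l True True)"
      unfolding det G by simp
    have "dth2 l 1 * (?A * ?F - ?B * ?E) = ?B * (th2 l 1 * ?F - dth2 l 1 * ?E) - ?F * (th2 l 1 * ?B - dth2 l 1 * ?A)"
      by (simp add: algebra_simps)
    then have b: "dth2 l 1 = ?B * ((l - m) * w l False False) - ?F * (- 1 + (l - m) * w l False True)"
      unfolding det G by simp
    show ?thesis unfolding D_eq a b by (simp add: \<Phi>_def algebra_simps)
  qed
  have ci: "(\<lambda>x. f x * g x) integrable_on {0..1}" if "continuous_on {0..1} f" "continuous_on {0..1} g" for f g :: "real \<Rightarrow> complex"
    using that by (intro integrable_continuous_real continuous_intros)
  have wcont: "isCont (\<lambda>l. w l i j) m" for i j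
  proof -
    define R where "R = cmod m + 1"
    obtain B where B: "B \<ge> 0" "\<And>l x. cmod l \<le> R \<Longrightarrow> \<bar>x\<bar> \<le> 1 \<Longrightarrow>
        cmod (th1 l x) \<le> B \<and> cmod (th2 l x) \<le> B \<and> cmod (dth1 l x) \<le> B \<and> cmod (dth2 l x) \<le> B"
      using th_bound[of 1 R] by (metis zero_le_one)
    obtain C where C: "C \<ge> 0" "\<And>l l' x. cmod l \<le> R \<Longrightarrow> cmod l' \<le> R \<Longrightarrow> \<bar>x\<bar> \<le> 1 \<Longrightarrow>
        cmod (th1 l x - th1 l' x) \<le> C * cmod (l - l') \<and> cmod (th2 l x - th2 l' x) \<le> C * cmod (l - l') \<and>
        cmod (dth1 l x - dth1 l' x) \<le> C * cmod (l - l') \<and> cmod (dth2 l x - dth2 l' x) \<le> C * cmod (l - l')"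
      using th_lipschitz[of 1 R] by (metis zero_le_one)
    show ?thesis
    proof (rule isCont_lipschitz)
      fix l assume l: "cmod (l - m) \<le> 1"
      have lR: "cmod l \<le> R" "cmod m \<le> R" using norm_triangle_sub[of l m] l by (auto simp: R_def)
      define a b c where "a x = (if i then th1 l x else th2 l x)" and "b x = (if j then th1 m x else th2 m x)"
        and "c x = (if i then th1 m x else th2 m x)" for x
      have cc: "continuous_on {0..1} a" "continuous_on {0..1} b" "continuous_on {0..1} c"
        by (cases i; cases j; simp add: a_def[abs_def] b_def[abs_def] c_def[abs_def] th_cont)+
      have "w l i j - w m i j = integral {0..1} (\<lambda>x. a x * b x - c x * b x)"
        unfolding w_def a_def[symmetric] b_def[symmetric] c_def[symmetric]
        using Henstock_Kurzweil_Integration.integral_diff[OF ci[OF cc(1,2)] ci[OF cc(3,2)]] by simp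
      also have "cmod \<dots> \<le> integral {0..1} (\<lambda>x::real. C * cmod (l - m) * B)"
      proof (rule integral_norm_bound_integral)
        show "(\<lambda>x. a x * b x - c x * b x) integrable_on {0..1}" by (intro integrable_diff ci cc)
        fix x :: real assume x: "x \<in> {0..1}"
        have "cmod (a x - c x) \<le> C * cmod (l - m)" using C(2)[OF lR, of x] x by (auto simp: a_def c_def)
        moreover have "cmod (b x) \<le> B" using B(2)[OF lR(2), of x] x by (auto simp: b_def)
        ultimately have "cmod (a x - c x) * cmod (b x) \<le> C * cmod (l - m) * B"
          using C(1) by (intro mult_mono) auto
        then show "cmod (a x * b x - c x * b x) \<le> C * cmod (l - m) * B"
          by (simp add: norm_mult flip: left_diff_distrib)
      qed auto
      finally show "cmod (w l i j - w m i j) \<le> (C * B) * cmod (l - m)" by (simp add: mult_ac)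
    qed
  qed
  have "isCont \<Phi> m" unfolding \<Phi>_def by (intro continuous_intros wcont)
  moreover have "\<Phi> m = - integral {0..1} (\<lambda>t. bform m t t)"
  proof -
    have i: "(\<lambda>x. th1 m x * th1 m x) integrable_on {0..1}" "(\<lambda>x. th1 m x * th2 m x) integrable_on {0..1}" "(\<lambda>x. th2 m x * th2 m x) integrable_on {0..1}"
      "(\<lambda>x. th2 m x * th1 m x) integrable_on {0..1}"
      by (intro ci th_cont)+
    have "((\<lambda>t. bform m t t) has_integral (th2 m 1 * w m True True + ((dth2 m 1 - th1 m 1) / 2) * (w m True False + w m False True) - dth1 m 1 * w m False False)) {0..1}"
      unfolding bform_def w_def
      using i by (intro has_integral_diff has_integral_add has_integral_mult_right) (simp_all add: integrable_integral)
    then have "integral {0..1} (\<lambda>t. bform m t t) = th2 m 1 * w m True True + ((dth2 m 1 - th1 m 1) / 2) * (w m True False + w m False True) - dth1 m 1 * w m False False"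
      by (rule integral_unique)
    moreover have "w m True False = w m False True" by (simp add: w_def mult.commute)
    moreover have "(z / 2) * (y + y) = z * y" for z y :: complex by simp
    ultimately have "integral {0..1} (\<lambda>t. bform m t t) = th2 m 1 * w m True True + (dth2 m 1 - th1 m 1) * w m False True - dth1 m 1 * w m False False"
      by metis
    then show ?thesis using \<open>w m True False = w m False True\<close> by (simp add: \<Phi>_def algebra_simps)
  qed
  ultimately show ?thesis using dD by (auto simp: CARAT_DERIV)
qed

lemma D_holomorphic: "D holomorphic_on A"
  using D_has_derivative by (meson field_differentiable_def field_differentiable_at_within holomorphic_on_def)

end

section \<open>Band edges\<close>

context hill_fs begin

text \<open>Eigenvector equation of the monodromy matrix, which acts on the Cauchy data (value,
  derivative) at 0.\<close>

definition "mon_eig l \<sigma> c1 c2 \<longleftrightarrow> th1 l 1 * c1 + th2 l 1 * c2 = \<sigma> * c1 \<and> dth1 l 1 * c1 + dth2 l 1 * c2 = \<sigma> * c2"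

definition "restr l c1 c2 = (\<lambda>x::real. if x \<in> {0..1} then c1 * th1 l x + c2 * th2 l x else 0)"

lemma comb_vderiv: "((\<lambda>x. c1 * th1 l x + c2 * th2 l x) has_vector_derivative c1 * dth1 l x + c2 * dth2 l x) (at x within S)"
proof -
  have "((\<lambda>x. c1 * th1 l x + c2 * th2 l x) has_vector_derivative c1 * dth1 l x + c2 * dth2 l x) (at x)"
    by (rule has_ac_deriv_vderiv) (use sol_comb[of l c1 c2] sol_cont[OF sol_comb[of l c1 c2]] in \<open>auto simp: sol_def\<close>)
  then show ?thesis by (rule has_vector_derivative_at_within)
qed

lemma restr_vderiv:
  assumes "x \<in> {0..1}"
  shows "(restr l c1 c2 has_vector_derivative c1 * dth1 l x + c2 * dth2 l x) (at x within {0..1})"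
proof (rule has_vector_derivative_transform[OF assms _ comb_vderiv])
  show "restr l c1 c2 y = c1 * th1 l y + c2 * th2 l y" if "y \<in> {0..1}" for y using that by (simp add: restr_def)
qed

lemma restr_vector_derivative:
  "x \<in> {0..1} \<Longrightarrow> vector_derivative (restr l c1 c2) (at x within {0..1}) = c1 * dth1 l x + c2 * dth2 l x"
  using vector_derivative_within_closed_interval[OF _ _ restr_vderiv, of x] by simp

lemma restr_bvp:
  assumes "mon_eig l ((-1) ^ n) c1 c2"
  shows "restr l c1 c2 \<in> bvp_eigenspace p q n l"
proof -
  obtain E1 where E1: "locally_finite_set E1" "\<And>x. x \<notin> E1 \<Longrightarrow> ((\<lambda>y. P y * dth1 l y) has_vector_derivative (of_real (q x) - l) * th1 l x) (at x)"
    using ode_solution_sol(3)[OF ode_th(1)[of l]] by (auto simp: dth1_def)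
  obtain E2 where E2: "locally_finite_set E2" "\<And>x. x \<notin> E2 \<Longrightarrow> ((\<lambda>y. P y * dth2 l y) has_vector_derivative (of_real (q x) - l) * th2 l x) (at x)"
    using ode_solution_sol(3)[OF ode_th(2)[of l]] by (auto simp: dth2_def)
  have o: "ode_solution {0..1} p q l (restr l c1 c2)"
    unfolding ode_solution_def
  proof (intro exI conjI ballI)
    show "(restr l c1 c2 has_vector_derivative c1 * dth1 l x + c2 * dth2 l x) (at x within {0..1})" if "x \<in> {0..1}" for x
      using that by (rule restr_vderiv)
    show "continuous_on {0..1} (\<lambda>x. c1 * dth1 l x + c2 * dth2 l x)" by (intro continuous_intros th_cont)
    show "locally_finite_set (E1 \<union> E2)" using E1(1) E2(1) by (rule locally_finite_union)
    fix x assume x: "x \<in> {0..1} - (E1 \<union> E2)"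
    have "((\<lambda>y. c1 * (P y * dth1 l y) + c2 * (P y * dth2 l y)) has_vector_derivative c1 * ((of_real (q x) - l) * th1 l x) + c2 * ((of_real (q x) - l) * th2 l x)) (at x)"
      using x by (intro has_vector_derivative_add has_vector_derivative_mult_right E1 E2) auto
    then have "((\<lambda>y. P y * (c1 * dth1 l y + c2 * dth2 l y)) has_vector_derivative (of_real (q x) - l) * restr l c1 c2 x) (at x)"
      using x by (simp add: restr_def algebra_simps)
    then show "((\<lambda>y. P y * (c1 * dth1 l y + c2 * dth2 l y)) has_vector_derivative (of_real (q x) - l) * restr l c1 c2 x) (at x within {0..1})"
      by (rule has_vector_derivative_at_within)
  qed
  show ?thesis
    unfolding bvp_eigenspace_def
    using o assms restr_vector_derivative[of 0 l c1 c2] restr_vector_derivative[of 1 l c1 c2]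
    by (auto simp: mon_eig_def restr_def mult.commute algebra_simps simp flip: power_add mult_2)
qed

text \<open>Here \<phi> solves the equation on [0,1] only, with one-sided derivatives at the ends.
  Its weighted Wronskians with both fundamental solutions are constant off finitely many points, and
  the two constants determine \<phi> and its derivative.\<close>

lemma bvp_rep:
  assumes "\<phi> \<in> bvp_eigenspace p q n l"
  defines "c1 \<equiv> \<phi> 0" and "c2 \<equiv> vector_derivative \<phi> (at 0 within {0..1})"
  shows "\<phi> = restr l c1 c2" "mon_eig l ((-1) ^ n) c1 c2"
proof -
  have A: "ode_solution {0..1} p q l \<phi>" "\<And>x. x \<notin> {0..1} \<Longrightarrow> \<phi> x = 0" "\<phi> 0 + (-1) ^ (n + 1) * \<phi> 1 = 0"
    "vector_derivative \<phi> (at 0 within {0..1}) + (-1) ^ (n + 1) * vector_derivative \<phi> (at 1 within {0..1}) = 0"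
    using assms(1) unfolding bvp_eigenspace_def by blast+
  obtain v' E where v': "\<And>x. x \<in> {0..1} \<Longrightarrow> (\<phi> has_vector_derivative v' x) (at x within {0..1})" "continuous_on {0..1} v'"
    and E: "locally_finite_set E"
    and d: "\<And>x. x \<in> {0..1} - E \<Longrightarrow> ((\<lambda>y. P y * v' y) has_vector_derivative (of_real (q x) - l) * \<phi> x) (at x within {0..1})"
    using A(1) unfolding ode_solution_def by blast
  have \<phi>c: "continuous_on {0..1} \<phi>" using v'(1) has_vector_derivative_continuous by (metis continuous_on_eq_continuous_within)
  have vd: "vector_derivative \<phi> (at x within {0..1}) = v' x" if "x \<in> {0..1}" for x
    using vector_derivative_within_closed_interval[OF _ _ v'(1)[OF that]] that by simp
  have c2: "c2 = v' 0" using vd[of 0] by (simp add: c2_def)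
  have W: "P x * (\<phi> x * y x - v' x * w x) = \<phi> 0 * y 0 - v' 0 * w 0"
    if s: "ode_solution UNIV p q l w" and y: "\<And>x. y x = vector_derivative w (at x)" and x: "x \<in> {0..1}" for w y x
  proof -
    obtain E1 where E1: "locally_finite_set E1" "\<And>x. x \<notin> E1 \<Longrightarrow> ((\<lambda>z. P z * y z) has_vector_derivative (of_real (q x) - l) * w x) (at x)"
      using ode_solution_sol(3)[OF s] by (auto simp: y)
    have wd: "(w has_vector_derivative y x) (at x within S)" for x S
      by (simp add: y has_vector_derivative_at_within[OF ode_solution_sol(2)[OF s]])
    have wc: "continuous_on {0..1} w" "continuous_on {0..1} y"
      using sol_cont[OF ode_solution_sol(1)[OF s]] continuous_on_subset y by (auto simp: y[abs_def])
    have "\<phi> x * (P x * y x) - (P x * v' x) * w x = \<phi> 0 * y 0 - v' 0 * w 0"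
    proof (rule has_derivative_zero_unique_strong_interval[of "(E \<union> E1) \<inter> {0..1}" 0 1])
      show "finite ((E \<union> E1) \<inter> {0..1})" using locally_finite_union[OF E E1(1)] by (simp add: locally_finite_set_def)
      show "continuous_on {0..1} (\<lambda>x. \<phi> x * (P x * y x) - (P x * v' x) * w x)"
        by (intro continuous_intros \<phi>c wc v' continuous_on_subset[OF p_cont]) auto
      show "\<phi> 0 * (P 0 * y 0) - (P 0 * v' 0) * w 0 = \<phi> 0 * y 0 - v' 0 * w 0" by (simp add: p_0)
      fix t :: real assume t: "t \<in> {0..1} - (E \<union> E1) \<inter> {0..1}"
      have "((\<lambda>x. \<phi> x * (P x * y x) - (P x * v' x) * w x) has_vector_derivative
         (\<phi> t * ((of_real (q t) - l) * w t) + v' t * (P t * y t)) - ((P t * v' t) * y t + ((of_real (q t) - l) * \<phi> t) * w t)) (at t within {0..1})"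
        using t by (intro has_vector_derivative_diff has_vector_derivative_mult v' d wd has_vector_derivative_at_within[OF E1(2)]) auto
      then show "((\<lambda>x. \<phi> x * (P x * y x) - (P x * v' x) * w x) has_derivative (\<lambda>h. 0)) (at t within {0..1})"
        by (simp add: has_vector_derivative_def algebra_simps)
    qed (use x in auto)
    then show ?thesis by (simp add: algebra_simps)
  qed
  have eq: "\<phi> x = c1 * th1 l x + c2 * th2 l x \<and> v' x = c1 * dth1 l x + c2 * dth2 l x" if x: "x \<in> {0..1}" for x
  proof -
    let ?X = "P x"
    have w1: "?X * (\<phi> x * dth1 l x - v' x * th1 l x) = - c2"
      using W[OF ode_th(1)[of l] dth1_def x] by (simp add: c2)
    have w2: "?X * (\<phi> x * dth2 l x - v' x * th2 l x) = c1"
      using W[OF ode_th(2)[of l] dth2_def x] by (simp add: c1_def)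
    have "\<phi> x = \<phi> x * (?X * (th1 l x * dth2 l x - dth1 l x * th2 l x))" by (simp add: wronskian)
    also have "\<dots> = th1 l x * (?X * (\<phi> x * dth2 l x - v' x * th2 l x)) - th2 l x * (?X * (\<phi> x * dth1 l x - v' x * th1 l x))"
      by (simp add: algebra_simps)
    finally have 1: "\<phi> x = c1 * th1 l x + c2 * th2 l x" unfolding w1 w2 by simp
    have "v' x = v' x * (?X * (th1 l x * dth2 l x - dth1 l x * th2 l x))" by (simp add: wronskian)
    also have "\<dots> = dth1 l x * (?X * (\<phi> x * dth2 l x - v' x * th2 l x)) - dth2 l x * (?X * (\<phi> x * dth1 l x - v' x * th1 l x))"
      by (simp add: algebra_simps)
    finally show ?thesis using 1 unfolding w1 w2 by simp
  qed
  show "\<phi> = restr l c1 c2" using eq A(2) by (auto simp: restr_def)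
  have sq: "(-1) ^ n * ((-1) ^ n * z) = (z :: complex)" for z
    by (simp add: mult.assoc[symmetric] flip: power_mult_distrib)
  have "\<phi> 0 = (-1) ^ n * \<phi> 1" "v' 0 = (-1) ^ n * v' 1" using A(3,4) vd[of 0] vd[of 1] by auto
  then have "\<phi> 1 = (-1) ^ n * c1" "v' 1 = (-1) ^ n * c2" using sq[of "\<phi> 1"] sq[of "v' 1"] by (auto simp: c1_def c2)
  then show "mon_eig l ((-1) ^ n) c1 c2" using eq[of 1] by (simp add: mon_eig_def mult.commute)
qed

lemma restr_zero: assumes "\<And>x. restr l c1 c2 x = 0" shows "c1 = 0" "c2 = 0"
proof -
  have z: "restr l c1 c2 = (\<lambda>_. 0)" using assms by auto
  show "c1 = 0" using assms[of 0] by (simp add: restr_def)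
  have "vector_derivative (restr l c1 c2) (at 0 within {0..1}) = 0"
    unfolding z using vector_derivative_within_closed_interval[of 0 1 0 "\<lambda>_. 0" 0] by simp
  then show "c2 = 0" using restr_vector_derivative[of 0 l c1 c2] by simp
qed

text \<open>For determinant 1 and \<sigma>^2 = 1 the characteristic polynomial at \<sigma> equals 2
  - \<sigma> D. In the converse direction an eigenvector is written down from whichever off-diagonal
  entry is non-zero; if both vanish the matrix is \<sigma> times the identity.\<close>

lemma mon_eig_exists_iff:
  assumes \<sigma>: "\<sigma> * \<sigma> = 1"
  shows "(\<exists>c1 c2. (c1 \<noteq> 0 \<or> c2 \<noteq> 0) \<and> mon_eig l \<sigma> c1 c2) \<longleftrightarrow> D l = 2 * \<sigma>"
proof -
  define A B E F where "A = th1 l 1" and "B = th2 l 1" and "E = dth1 l 1" and "F = dth2 l 1"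
  have det: "A * F - E * B = 1" using det_1[of l] by (simp add: A_def B_def E_def F_def)
  have DAF: "D l = A + F" by (simp add: D_eq A_def F_def)
  have m: "mon_eig l \<sigma> c1 c2 \<longleftrightarrow> A * c1 + B * c2 = \<sigma> * c1 \<and> E * c1 + F * c2 = \<sigma> * c2" for c1 c2
    by (simp add: mon_eig_def A_def B_def E_def F_def)
  show ?thesis
  proof
    assume "\<exists>c1 c2. (c1 \<noteq> 0 \<or> c2 \<noteq> 0) \<and> mon_eig l \<sigma> c1 c2"
    then obtain c1 c2 where c: "c1 \<noteq> 0 \<or> c2 \<noteq> 0" "A * c1 + B * c2 = \<sigma> * c1" "E * c1 + F * c2 = \<sigma> * c2" using m by blast
    have "((A - \<sigma>) * (F - \<sigma>) - E * B) * c1 = 0" "((A - \<sigma>) * (F - \<sigma>) - E * B) * c2 = 0"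
      using c(2,3) by algebra+
    then have "(A - \<sigma>) * (F - \<sigma>) - E * B = 0" using c(1) by auto
    then have "\<sigma> * (A + F) = 2" using det \<sigma> by algebra
    then have "(\<sigma> * \<sigma>) * (A + F) = \<sigma> * 2" by (simp add: mult.assoc)
    then have "A + F = 2 * \<sigma>" using \<sigma> by simp
    then show "D l = 2 * \<sigma>" using DAF by simp
  next
    assume "D l = 2 * \<sigma>"
    then have AF: "A + F = 2 * \<sigma>" using DAF by simp
    consider "B \<noteq> 0" | "E \<noteq> 0" | "B = 0" "E = 0" by blast
    then show "\<exists>c1 c2. (c1 \<noteq> 0 \<or> c2 \<noteq> 0) \<and> mon_eig l \<sigma> c1 c2"
    proof cases
      case 1
      have "A * B + B * (\<sigma> - A) = \<sigma> * B" by (simp add: algebra_simps)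
      moreover have "E * B + F * (\<sigma> - A) = \<sigma> * (\<sigma> - A)" using AF det \<sigma> by algebra
      ultimately show ?thesis using 1 m by blast
    next
      case 2
      have "E * (\<sigma> - F) + F * E = \<sigma> * E" by (simp add: algebra_simps)
      moreover have "A * (\<sigma> - F) + B * E = \<sigma> * (\<sigma> - F)" using AF det \<sigma> by algebra
      ultimately show ?thesis using 2 m by blast
    next
      case 3
      have "(A - \<sigma>) * (A - \<sigma>) = 0" using AF det \<sigma> 3 by algebra
      then have "A = \<sigma>" by simp
      then show ?thesis using 3 m by (intro exI[of _ 1] exI[of _ 0]) simp
    qed
  qed
qed

abbreviation "vscale \<equiv> (\<lambda>(c::complex) (f::real \<Rightarrow> complex) x. c * f x)"

lemma vscale_vector_space: "vector_space vscale"
  by standard (auto simp: fun_eq_iff algebra_simps)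

text \<open>The eigenspace consists of restrictions of combinations of the two fundamental
  solutions, so it is trivial exactly when \<sigma> is no multiplier. If both off-diagonal entries
  vanished, the monodromy matrix would be plus or minus the identity and both restrictions would be
  independent eigenfunctions.\<close>

lemma bvp_dim:
  shows "vector_space.dim vscale (bvp_eigenspace p q n l) = 0 \<longleftrightarrow> D l \<noteq> 2 * (-1) ^ n"
    and "vector_space.dim vscale (bvp_eigenspace p q n l) = 1 \<Longrightarrow> \<not> (th2 l 1 = 0 \<and> dth1 l 1 = 0)"
proof -
  interpret vs: vector_space vscale by (rule vscale_vector_space)
  let ?V = "bvp_eigenspace p q n l"
  have \<sigma>: "(-1) ^ n * (-1) ^ n = (1::complex)" by (simp flip: power_mult_distrib)
  have dec: "restr l c1 c2 = vscale c1 (restr l 1 0) + vscale c2 (restr l 0 1)" for c1 c2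
    by (auto simp: restr_def fun_eq_iff)
  have Vspan: "?V \<subseteq> vs.span {restr l 1 0, restr l 0 1}"
  proof
    fix \<phi> assume "\<phi> \<in> ?V"
    then obtain c1 c2 where "\<phi> = restr l c1 c2" using bvp_rep(1) by blast
    moreover have "vscale c1 (restr l 1 0) + vscale c2 (restr l 0 1) \<in> vs.span {restr l 1 0, restr l 0 1}"
      by (intro vs.span_add vs.span_scale vs.span_base) auto
    ultimately show "\<phi> \<in> vs.span {restr l 1 0, restr l 0 1}" using dec by metis
  qed
  obtain B where B: "B \<subseteq> ?V" "vs.independent B" "?V \<subseteq> vs.span B" "card B = vs.dim ?V"
    using vs.basis_exists[of ?V] by blast
  have finB: "finite B"
    using vs.independent_span_bound[OF _ B(2), of "{restr l 1 0, restr l 0 1}"] B(1) Vspan by blast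
  show "vs.dim ?V = 0 \<longleftrightarrow> D l \<noteq> 2 * (-1) ^ n"
  proof
    assume "vs.dim ?V = 0"
    then have "B = {}" using B(4) finB by simp
    then have V0: "?V \<subseteq> {0}" using B(3) by simp
    show "D l \<noteq> 2 * (-1) ^ n"
    proof
      assume "D l = 2 * (-1) ^ n"
      then obtain c1 c2 where c: "c1 \<noteq> 0 \<or> c2 \<noteq> 0" "mon_eig l ((-1) ^ n) c1 c2"
        using mon_eig_exists_iff[OF \<sigma>] by blast
      then have "restr l c1 c2 \<in> {0}" using restr_bvp V0 by blast
      then have "restr l c1 c2 x = 0" for x by simp
      then show False using restr_zero c(1) by blast
    qed
  next
    assume "D l \<noteq> 2 * (-1) ^ n"
    then have no: "\<not> (\<exists>c1 c2. (c1 \<noteq> 0 \<or> c2 \<noteq> 0) \<and> mon_eig l ((-1) ^ n) c1 c2)"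
      using mon_eig_exists_iff[OF \<sigma>] by blast
    have "?V \<subseteq> {0}"
    proof
      fix \<phi> assume "\<phi> \<in> ?V"
      from bvp_rep[OF this] no have "\<phi> = restr l 0 0" by metis
      then show "\<phi> \<in> {0}" by (auto simp: restr_def fun_eq_iff)
    qed
    then have "B \<subseteq> {0}" using B(1) by blast
    moreover have "0 \<notin> B" using B(2) vs.dependent_zero by blast
    ultimately have "B = {}" by blast
    then show "vs.dim ?V = 0" using B(4) by simp
  qed
  show "\<not> (th2 l 1 = 0 \<and> dth1 l 1 = 0)" if d1: "vs.dim ?V = 1"
  proof
    assume z: "th2 l 1 = 0 \<and> dth1 l 1 = 0"
    have "card B = 1" using B(4) d1 by simp
    then obtain b where b: "B = {b}" using card_1_singletonE by blast
    have "b \<in> ?V" "b \<noteq> 0" using B(1,2) b vs.dependent_zero by auto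
    from bvp_rep[OF this(1)] obtain c1 c2 where c: "b = restr l c1 c2" "mon_eig l ((-1) ^ n) c1 c2" by blast
    have "restr l 0 0 = 0" by (simp add: restr_def fun_eq_iff)
    then have "c1 \<noteq> 0 \<or> c2 \<noteq> 0" using c(1) \<open>b \<noteq> 0\<close> by metis
    then have "D l = 2 * (-1) ^ n" using c(2) mon_eig_exists_iff[OF \<sigma>] by blast
    then have "th1 l 1 + dth2 l 1 = 2 * (-1) ^ n" "th1 l 1 * dth2 l 1 = 1" using det_1[of l] z by (simp_all add: D_eq)
    moreover have "(A - t) * (A - t) = 0" if "A + F = 2 * t" "A * F = 1" "t * t = 1" for A F t :: complex
      using that by algebra
    ultimately have "(th1 l 1 - (-1) ^ n) * (th1 l 1 - (-1) ^ n) = 0" using \<sigma> by blast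
    then have A: "th1 l 1 = (-1) ^ n" by simp
    then have F: "dth2 l 1 = (-1) ^ n" using \<open>th1 l 1 + dth2 l 1 = 2 * (-1) ^ n\<close> by simp
    have "mon_eig l ((-1) ^ n) 1 0" "mon_eig l ((-1) ^ n) 0 1" using A F z by (auto simp: mon_eig_def)
    then have "restr l 1 0 \<in> vs.span {b}" "restr l 0 1 \<in> vs.span {b}" using restr_bvp B(3) b by blast+
    then obtain k1 k2 where k: "restr l 1 0 = vscale k1 b" "restr l 0 1 = vscale k2 b"
      unfolding vs.span_singleton by auto
    have "restr l k2 (- k1) x = 0" for x
    proof -
      have "restr l k2 (- k1) x = k2 * restr l 1 0 x - k1 * restr l 0 1 x" by (simp add: restr_def)
      then show ?thesis by (simp add: k)
    qed
    then have "k1 = 0" using restr_zero by (metis neg_equal_0_iff_equal)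
    then have "restr l 1 0 x = 0" for x by (simp add: k)
    then show False using restr_zero by (metis zero_neq_one)
  qed
qed

definition "Dr r = Re (D (of_real r))"

lemma D_of_real: "D (of_real r) = of_real (Dr r)"
proof -
  have "cnj (D (of_real r)) = D (of_real r)" by (simp add: D_eq th_real)
  then show ?thesis by (simp add: Dr_def complex_eq_iff)
qed

lemma Dr_DERIV:
  assumes "(D has_field_derivative d) (at (of_real r))"
  shows "(Dr has_real_derivative Re d) (at r)"
proof -
  have "((D \<circ> complex_of_real) has_vector_derivative 1 * d) (at r)"
  proof (rule field_vector_diff_chain_at)
    show "(complex_of_real has_vector_derivative 1) (at r)"
      using has_vector_derivative_of_real[OF DERIV_ident[of "at r"]] by simp
  qed (rule assms)
  then have "((\<lambda>x. Re ((D \<circ> complex_of_real) x)) has_vector_derivative Re (1 * d)) (at r)"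
    by (rule bounded_linear.has_vector_derivative[OF bounded_linear_Re])
  then show ?thesis by (simp add: has_real_derivative_iff_has_vector_derivative Dr_def[abs_def] o_def)
qed

lemma Dr_cont: "continuous_on A Dr"
  using Dr_DERIV[OF D_has_derivative] by (meson DERIV_isCont continuous_at_imp_continuous_on)

end

lemma card_pos_iff_ne: "finite A \<Longrightarrow> x \<in> A \<Longrightarrow> card A \<noteq> 0" by auto

section \<open>Position of the band edges and sign of the discriminant's derivative\<close>

lemma edge_order:
  assumes "\<And>n. \<mu> Upper n < \<mu> Lower (Suc n)" "\<And>n. n \<ge> 1 \<Longrightarrow> \<mu> Lower n \<le> (\<mu> Upper n :: real)" "j < k"
  shows "\<mu> Upper j < \<mu> Lower k"
  using assms(3)
proof (induction k)
  case (Suc k)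
  show ?case
  proof (cases "j = k")
    case False
    then have "\<mu> Upper j < \<mu> Lower k" using Suc by simp
    also have "\<dots> \<le> \<mu> Upper k" using assms(2)[of k] Suc.prems False by simp
    also have "\<dots> < \<mu> Lower (Suc k)" by (rule assms(1))
    finally show ?thesis .
  qed (simp add: assms(1))
qed simp

locale edge_setup = hill_fs +
  fixes \<mu> :: "edge \<Rightarrow> nat \<Rightarrow> real" and s :: edge and n :: nat and \<phi> :: "real \<Rightarrow> real"
  assumes be: "band_edges p q \<mu>" and nd: "nondegenerate_edge \<mu> s n"
    and ef: "edge_eigenfunction p q th1 th2 n (\<mu> s n) \<phi>"
begin

definition "m = \<mu> s n"
definition "sg = ((-1) ^ n :: real)"

lemma sg2: "sg * sg = 1" "sg = 1 \<or> sg = -1"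
  by (simp add: sg_def flip: power_mult_distrib) (cases "even n"; simp add: sg_def)

lemma sgc: "complex_of_real sg * complex_of_real sg = 1" "complex_of_real sg = (-1) ^ n"
  using sg2(1) by (simp_all add: sg_def flip: of_real_mult)

text \<open>The labels that \<open>band_edges\<close> counts at the value \<open>l\<close> for the
  boundary condition of the parity of \<open>k\<close>.\<close>

definition "eset k l = {(s, m). (even m \<longleftrightarrow> even k) \<and> (m = 0 \<longrightarrow> s = Upper) \<and> complex_of_real (\<mu> s m) = l}" for k :: nat and l

lemma mu1: "\<mu> Upper k < \<mu> Lower (Suc k)" and mu2: "k \<ge> 1 \<Longrightarrow> \<mu> Lower k \<le> \<mu> Upper k"
  and card_dim: "card (eset k l) = vector_space.dim vscale (bvp_eigenspace p q k l)"
  using be unfolding band_edges_def eset_def by blast+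

lemma mu_le: assumes "k = 0 \<longrightarrow> t = Upper" shows "\<mu> t k \<le> \<mu> Upper k" "k \<ge> 1 \<Longrightarrow> \<mu> Lower k \<le> \<mu> t k"
  using assms mu2[of k] by (cases t; cases "k = 0"; simp)+

lemma mu_less:
  assumes "j < k" "j = 0 \<longrightarrow> t = Upper" shows "\<mu> t j < \<mu> t' k"
proof -
  have "\<mu> t j \<le> \<mu> Upper j" using assms(2) by (rule mu_le(1))
  also have "\<dots> < \<mu> Lower k" by (rule edge_order[of \<mu>]) (use mu1 mu2 assms(1) in auto)
  also have "\<dots> \<le> \<mu> t' k" by (rule mu_le(2)) (use assms(1) in auto)
  finally show ?thesis .
qed

lemma eset_level: assumes "(t, k) \<in> eset j l" "(t', k') \<in> eset j' l" shows "k = k'"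
proof -
  have "\<mu> t k = \<mu> t' k'" "k = 0 \<longrightarrow> t = Upper" "k' = 0 \<longrightarrow> t' = Upper" using assms unfolding eset_def by auto
  then show ?thesis using mu_less[of k k' t t'] mu_less[of k' k t' t] by (metis less_irrefl linorder_neqE_nat)
qed

lemma D_edge: assumes "k = 0 \<longrightarrow> t = Upper" shows "Dr (\<mu> t k) = 2 * (-1) ^ k"
proof -
  have i: "(t, k) \<in> eset k (of_real (\<mu> t k))" using assms by (simp add: eset_def)
  \<comment> \<open>An infinite set has \<open>card\<close> 0, so finiteness must be secured before
    a member of the set yields a positive dimension.\<close>
  have "eset k (of_real (\<mu> t k)) \<subseteq> {Lower, Upper} \<times> {k}"
    using eset_level[OF i] by (auto intro: edge.exhaust)
  then have "finite (eset k (of_real (\<mu> t k)))" by (rule finite_subset) auto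
  then have "card (eset k (of_real (\<mu> t k))) \<noteq> 0" using i by (rule card_pos_iff_ne)
  then have "D (of_real (\<mu> t k)) = 2 * (-1) ^ k" using card_dim bvp_dim(1) by metis
  then show ?thesis by (simp add: Dr_def)
qed

text \<open>A point where D = 2 or D = -2 is an eigenvalue for one of the two boundary conditions,
  hence carries a label; the ordering of the labels leaves none in the interior of a band.\<close>

lemma D_band: assumes "\<mu> Upper k < r" "r < \<mu> Lower (Suc k)" shows "Dr r \<noteq> 2 * (-1) ^ j"
proof
  assume "Dr r = 2 * (-1) ^ j"
  then have "D (of_real r) = 2 * (-1) ^ j" by (simp add: D_of_real)
  then have "card (eset j (of_real r)) \<noteq> 0" using card_dim bvp_dim(1) by metis
  then have "eset j (of_real r) \<noteq> {}" by (metis card.empty)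
  then obtain t i where "(t, i) \<in> eset j (of_real r)" by (metis ex_in_conv surj_pair)
  then have ti: "\<mu> t i = r" "i = 0 \<longrightarrow> t = Upper" unfolding eset_def by auto
  show False
  proof (cases "i \<le> k")
    case True
    then have "\<mu> t i \<le> \<mu> Upper k"
      using mu_le(1)[OF ti(2)] mu_less[of i k t Upper] ti(2) by (cases "i = k") auto
    then show False using ti assms by simp
  next
    case False
    then have "\<mu> Lower (Suc k) \<le> \<mu> t i"
      using mu_le(2)[OF ti(2)] mu_less[of "Suc k" i Lower t] by (cases "i = Suc k") auto
    then show False using ti assms by simp
  qed
qed

lemma n_valid: "n = 0 \<longrightarrow> s = Upper" using nd by (auto simp: nondegenerate_edge_def)

lemma D_m: "Dr m = 2 * sg" "D (of_real m) = 2 * of_real sg"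
  using D_edge[OF n_valid] by (simp_all add: m_def sg_def D_of_real)

text \<open>Non-degeneracy leaves a single label at this value, so the eigenspace has dimension one
  and the monodromy matrix is not plus or minus the identity.\<close>

lemma edge_simple: "\<not> (th2 (of_real m) 1 = 0 \<and> dth1 (of_real m) 1 = 0)"
proof -
  have i: "(s, n) \<in> eset n (of_real m)" using n_valid by (simp add: eset_def m_def)
  have "eset n (of_real m) \<subseteq> {(s, n)}"
  proof (rule subsetI)
    fix z assume z: "z \<in> eset n (of_real m)"
    obtain t k where tk: "z = (t, k)" by fastforce
    have k: "k = n" using eset_level[OF i] z tk by blast
    then have "\<mu> t n = \<mu> s n" "n = 0 \<longrightarrow> t = Upper" using z tk unfolding eset_def m_def by auto
    then have "t = s" using nd n_valid by (cases s; cases t) (auto simp: nondegenerate_edge_def)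
    then show "z \<in> {(s, n)}" using tk k by simp
  qed
  then have "eset n (of_real m) = {(s, n)}" using i by blast
  then have "card (eset n (of_real m)) = 1" by simp
  then show ?thesis using card_dim bvp_dim(2) by metis
qed

text \<open>Within the adjacent band \<open>\<bar>D\<bar> \<le> 2\<close>, which fixes the sign of \<open>D'\<close> at the edge.\<close>

lemma Dr_sign:
  assumes "(Dr has_real_derivative d) (at m)"
  shows "pm s * (sg * d) \<le> 0"
proof (cases s)
  case Upper
  define m' where "m' = \<mu> Lower (Suc n)"
  have mU: "m = \<mu> Upper n" unfolding m_def unfolding Upper ..
  have mm': "m < m'" using mu1[of n] by (simp add: mU m'_def)
  have Dm': "Dr m' = - 2 * sg" using D_edge[of "Suc n" Lower] by (simp add: m'_def sg_def)
  \<comment> \<open>At the far end of the band \<open>sg * Dr\<close> equals -2, so a value above 2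
    would force another crossing of the level 2 inside the band.\<close>
  have le: "sg * Dr r \<le> 2" if r: "m < r" "r < m'" for r
  proof (rule ccontr)
    assume "\<not> sg * Dr r \<le> 2"
    then have "\<exists>x\<ge>r. x \<le> m' \<and> sg * Dr x = 2"
      using Dm' sg2 r by (intro IVT2') (auto intro!: continuous_intros Dr_cont)
    then obtain x where x: "x \<ge> r" "x \<le> m'" "sg * Dr x = 2" by blast
    have "x \<noteq> m'" using x(3) Dm' sg2 by auto
    moreover have "Dr x = 2 * (-1) ^ n" using x(3) sg2(2) by (auto simp: sg_def[symmetric])
    ultimately show False using D_band[of n x n] x r by (auto simp: mU m'_def)
  qed
  have "\<not> sg * d > 0"
  proof
    assume pos: "sg * d > 0"
    have "((\<lambda>x. sg * Dr x) has_real_derivative sg * d) (at m)" using assms by (rule DERIV_cmult)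
    from DERIV_pos_inc_right[OF this pos] obtain e where e: "e > 0" "\<And>h. h > 0 \<Longrightarrow> h < e \<Longrightarrow> sg * Dr m < sg * Dr (m + h)" by blast
    have "sg * Dr m = 2" using D_m sg2 by auto
    moreover obtain h where "h > 0" "h < min e (m' - m)" using dense[of 0 "min e (m' - m)"] e(1) mm' by auto
    ultimately show False using e(2)[of h] le[of "m + h"] by auto
  qed
  then show ?thesis using Upper by simp
next
  case Lower
  then obtain k where k: "n = Suc k" using n_valid by (cases n) auto
  define m' where "m' = \<mu> Upper k"
  have mU: "m = \<mu> Lower (Suc k)" unfolding m_def unfolding Lower k ..
  have mm': "m' < m" using mu1[of k] by (simp add: mU m'_def)
  have Dm': "Dr m' = - 2 * sg" 
  proof -
    have "sg = - ((-1) ^ k)" unfolding sg_def unfolding k by simp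
    then show ?thesis using D_edge[of k Upper] by (simp add: m'_def)
  qed
  have le: "sg * Dr r \<le> 2" if r: "m' < r" "r < m" for r
  proof (rule ccontr)
    assume "\<not> sg * Dr r \<le> 2"
    then have "\<exists>x\<ge>m'. x \<le> r \<and> sg * Dr x = 2"
      using Dm' sg2 r by (intro IVT') (auto intro!: continuous_intros Dr_cont)
    then obtain x where x: "x \<ge> m'" "x \<le> r" "sg * Dr x = 2" by blast
    have "x \<noteq> m'" using x(3) Dm' sg2 by auto
    moreover have "Dr x = 2 * (-1) ^ n" using x(3) sg2(2) by (auto simp: sg_def[symmetric])
    ultimately show False using D_band[of k x n] x r by (auto simp: mU m'_def)
  qed
  have "\<not> sg * d < 0"
  proof
    assume neg: "sg * d < 0"
    have "((\<lambda>x. sg * Dr x) has_real_derivative sg * d) (at m)" using assms by (rule DERIV_cmult)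
    from DERIV_neg_dec_left[OF this neg] obtain e where e: "e > 0" "\<And>h. h > 0 \<Longrightarrow> h < e \<Longrightarrow> sg * Dr m < sg * Dr (m - h)" by blast
    have "sg * Dr m = 2" using D_m sg2 by auto
    moreover obtain h where "h > 0" "h < min e (m - m')" using dense[of 0 "min e (m - m')"] e(1) mm' by auto
    ultimately show False using e(2)[of h] le[of "m - h"] by auto
  qed
  then show ?thesis using Lower by simp
qed

end

text \<open>The matrix with rows (a, b) and (c, -a) is nilpotent and (x, y) spans or represents its
  kernel. The associated form b X^2 - 2 a X Y - c Y^2 is then plus or minus the square of x X + y Y,
  and x^2 + y^2 = |b| + |c| fixes the scale to 1. This is where the normalisation of the
  eigenfunction is used.\<close>

lemma rank_one_form:
  fixes a b c x y :: real
  assumes "a\<^sup>2 + b * c = 0" "a * x + b * y = 0" "c * x - a * y = 0" "x\<^sup>2 + y\<^sup>2 = \<bar>b\<bar> + \<bar>c\<bar>"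
  obtains \<tau> where "\<tau> = 1 \<or> \<tau> = -1" "b = \<tau> * x\<^sup>2" "- a = \<tau> * (x * y)" "- c = \<tau> * y\<^sup>2"
proof (cases "b = 0")
  case False
  have y: "y = - a * x / b" using assms(2) False by (simp add: field_simps eq_neg_iff_add_eq_0)
  have "b * b * y\<^sup>2 = a\<^sup>2 * x\<^sup>2" using False by (simp add: y field_simps power2_eq_square)
  also have "a\<^sup>2 = - b * c" using assms(1) by simp
  finally have "b * (b * y\<^sup>2) = b * (- c * x\<^sup>2)" by (simp add: mult_ac)
  then have y2: "b * y\<^sup>2 = - c * x\<^sup>2" using False by (metis mult_left_cancel)
  have bc: "b * c \<le> 0" using assms(1) zero_le_power2[of a] by linarith
  have "b * x\<^sup>2 + b * y\<^sup>2 = b * (\<bar>b\<bar> + \<bar>c\<bar>)" using assms(4) by (metis distrib_left)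
  then have "(b - c) * x\<^sup>2 = b * (\<bar>b\<bar> + \<bar>c\<bar>)" using y2 by (simp add: algebra_simps)
  moreover have "b * (\<bar>b\<bar> + \<bar>c\<bar>) = \<bar>b\<bar> * (b - c)"
  proof (cases "b > 0")
    case True
    then have "c \<le> 0" using bc by (simp add: mult_le_0_iff)
    then show ?thesis using True by simp
  next
    case False
    then have "b < 0" using \<open>b \<noteq> 0\<close> by simp
    then have "c \<ge> 0" using bc by (simp add: mult_le_0_iff)
    then show ?thesis using \<open>b < 0\<close> by (simp add: algebra_simps)
  qed
  moreover have "b - c \<noteq> 0" using bc False by (auto simp: mult_le_0_iff)
  ultimately have x2: "x\<^sup>2 = \<bar>b\<bar>" by (simp add: mult.commute)
  show ?thesis
  proof (rule that[of "sgn b"])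
    show "sgn b = 1 \<or> sgn b = -1" using False by (simp add: sgn_if)
    show "b = sgn b * x\<^sup>2" using x2 by (simp add: sgn_if abs_if)
    have "x * y = - a * x\<^sup>2 / b" by (simp add: y power2_eq_square)
    then show "- a = sgn b * (x * y)" using x2 False by (simp add: sgn_if abs_if)
    have "y\<^sup>2 = - c * x\<^sup>2 / b" using y2 False by (simp add: field_simps)
    then show "- c = sgn b * y\<^sup>2" using x2 False by (simp add: sgn_if abs_if)
  qed
next
  case True
  then have a: "a = 0" using assms(1) by simp
  show ?thesis
  proof (cases "c = 0")
    case True
    then have "x = 0" "y = 0" using assms(4) \<open>b = 0\<close> by (auto simp: sum_power2_eq_zero_iff)
    then show ?thesis using that[of 1] True \<open>b = 0\<close> a by simp
  next
    case False
    then have x: "x = 0" using assms(3) a by simp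
    then have "y\<^sup>2 = \<bar>c\<bar>" using assms(4) True by simp
    then show ?thesis using that[of "- sgn c"] False True a x by (auto simp: sgn_if abs_if)
  qed
qed

section \<open>Rank-one degeneration at the edge\<close>

context edge_setup begin

abbreviation "mc \<equiv> complex_of_real m"
abbreviation "phic \<equiv> (\<lambda>x. complex_of_real (\<phi> x))"
definition "dD = deriv D mc"

text \<open>On [0,1] the boundary value problem gives the representation. Both sides pick up the
  same sign under translation by 1, so the modulus of their difference is periodic and vanishes
  everywhere.\<close>

lemma phi_facts:
  shows phi_rep: "of_real (\<phi> x) = of_real (\<phi> 0) * th1 mc x + of_real (deriv \<phi> 0) * th2 mc x"
    and phi_eig: "mon_eig mc (of_real sg) (of_real (\<phi> 0)) (of_real (deriv \<phi> 0))"
proof -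
  let ?r = "\<lambda>x. if x \<in> {0..1} then complex_of_real (\<phi> x) else 0"
  have e: "?r \<in> bvp_eigenspace p q n mc" "\<And>x. \<phi> (x + 1) = (-1) ^ n * \<phi> x"
    using ef by (auto simp: edge_eigenfunction_def m_def)
  define c1 c2 where "c1 = ?r 0" and "c2 = vector_derivative ?r (at 0 within {0..1})"
  have r: "?r = restr mc c1 c2" and me: "mon_eig mc ((-1) ^ n) c1 c2"
    using bvp_rep[OF e(1)] by (simp_all add: c1_def c2_def)
  have c1: "c1 = of_real (\<phi> 0)" by (simp add: c1_def)
  define g where "g x = complex_of_real (\<phi> x) - (c1 * th1 mc x + c2 * th2 mc x)" for x
  have g01: "g x = 0" if "x \<in> {0..1}" for x
    using fun_cong[OF r, of x] that by (simp add: g_def restr_def)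
  have gs: "g (x + 1) = (-1) ^ n * g x" for x
  proof -
    have "c1 * th1 mc (x + 1) + c2 * th2 mc (x + 1) = (th1 mc 1 * c1 + th2 mc 1 * c2) * th1 mc x + (dth1 mc 1 * c1 + dth2 mc 1 * c2) * th2 mc x"
      unfolding th_shift by (simp add: algebra_simps)
    also have "\<dots> = (-1) ^ n * (c1 * th1 mc x + c2 * th2 mc x)"
      using me by (simp add: mon_eig_def algebra_simps)
    finally show ?thesis unfolding g_def e(2) by (simp add: algebra_simps)
  qed
  have "cmod (g (x + 1)) = cmod (g x)" for x by (simp add: gs norm_mult norm_power)
  then have "cmod (g (frac x + of_int \<lfloor>x\<rfloor>)) = cmod (g (frac x))" for x by (rule per_int)
  then have gf: "cmod (g x) = cmod (g (frac x))" for x by (simp add: frac_def)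
  have g0: "g x = 0" for x using gf[of x] g01[of "frac x"] by (simp add: frac_ge_0 frac_lt_1 less_imp_le)
  have rep: "of_real (\<phi> x) = c1 * th1 mc x + c2 * th2 mc x" for x using g0[of x] by (simp add: g_def)
  have vd: "(phic has_vector_derivative c1 * dth1 mc 0 + c2 * dth2 mc 0) (at 0)"
    unfolding rep by (rule comb_vderiv)
  then have vd: "(phic has_vector_derivative c2) (at 0)" by simp
  have "((\<lambda>x. Re (complex_of_real (\<phi> x))) has_vector_derivative Re c2) (at 0)"
    using vd by (rule bounded_linear.has_vector_derivative[OF bounded_linear_Re])
  then have d: "(\<phi> has_real_derivative Re c2) (at 0)" by (simp add: has_real_derivative_iff_has_vector_derivative)
  then have "(phic has_vector_derivative of_real (Re c2)) (at 0)" by (rule has_vector_derivative_of_real)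
  then have "c2 = of_real (Re c2)" using vd vector_derivative_unique_at by blast
  moreover have "deriv \<phi> 0 = Re c2" using d by (rule DERIV_imp_deriv)
  ultimately have c2: "c2 = of_real (deriv \<phi> 0)" by simp
  show "of_real (\<phi> x) = of_real (\<phi> 0) * th1 mc x + of_real (deriv \<phi> 0) * th2 mc x" using rep[of x] by (simp add: c1 c2)
  show "mon_eig mc (of_real sg) (of_real (\<phi> 0)) (of_real (deriv \<phi> 0))" using me by (simp add: c1 c2 sgc)
qed

lemma sol_phi: "sol mc (\<lambda>_. 0) phic (\<lambda>x. of_real (\<phi> 0) * dth1 mc x + of_real (deriv \<phi> 0) * dth2 mc x)"
  using sol_comb[of mc "of_real (\<phi> 0)" "of_real (deriv \<phi> 0)"] by (simp add: phi_rep[symmetric])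

lemma phi_cont: "continuous_on A \<phi>"
proof -
  have "continuous_on UNIV (\<lambda>x. Re (phic x))" by (intro continuous_intros sol_cont(1)[OF sol_phi])
  then show ?thesis using continuous_on_subset by auto
qed

text \<open>At the edge the monodromy matrix is \<open>sg\<close> times the identity plus a
  nilpotent matrix that annihilates the Cauchy data of \<phi>. The form is therefore \<tau>
  \<phi>(x) \<phi>(t); integrating its diagonal gives D' = - \<tau> times the integral of \<phi>^2,
  and the sign of D' determines \<tau>.\<close>

lemma edge_data:
  shows bform_edge: "bform mc x t = of_real (pm s * sg * \<phi> x * \<phi> t)"
    and dD_real: "dD = of_real (Re dD)" and dD_sign: "sg * Re dD = - pm s * cmod dD" and dD_nz: "dD \<noteq> 0"
proof -
  define A B E F where "A = Re (th1 mc 1)" and "B = Re (th2 mc 1)" and "E = Re (dth1 mc 1)" and "F = Re (dth2 mc 1)"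
  have re: "z = of_real (Re z)" if "cnj z = z" for z using that by (simp add: complex_eq_iff)
  have ABEF: "th1 mc 1 = of_real A" "th2 mc 1 = of_real B" "dth1 mc 1 = of_real E" "dth2 mc 1 = of_real F"
    unfolding A_def B_def E_def F_def by (rule re, rule th_real)+
  have det: "A * F - E * B = 1" using det_1[of mc] unfolding ABEF by (metis of_real_1 of_real_diff of_real_eq_iff of_real_mult)
  have tr: "A + F = 2 * sg" using D_m(2) unfolding D_eq ABEF by (metis of_real_add of_real_eq_iff of_real_mult of_real_numeral)
  define x0 y0 where "x0 = \<phi> 0" and "y0 = deriv \<phi> 0"
  have eig: "A * x0 + B * y0 = sg * x0" "E * x0 + F * y0 = sg * y0"
    using phi_eig unfolding mon_eig_def ABEF x0_def[symmetric] y0_def[symmetric]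
    by (metis of_real_add of_real_eq_iff of_real_mult)+
  have nrm: "x0\<^sup>2 + y0\<^sup>2 = \<bar>B\<bar> + \<bar>E\<bar>"
  proof -
    have "\<bar>\<phi> 0\<bar>\<^sup>2 + \<bar>deriv \<phi> 0\<bar>\<^sup>2 = cmod (vector_derivative (th1 mc) (at 1)) + cmod (th2 mc 1)"
      using ef by (simp add: edge_eigenfunction_def m_def)
    then show ?thesis by (simp add: x0_def y0_def ABEF flip: dth1_def)
  qed
  \<comment> \<open>The diagonal entries are \<open>sg + a\<close> and \<open>sg - a\<close>, since
    the trace is \<open>2 * sg\<close>; determinant 1 then makes the trace-free part
    nilpotent.\<close>
  define a where "a = (A - F) / 2"
  have a1: "a = A - sg" "- a = F - sg" using tr by (auto simp: a_def field_simps)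
  have h1: "a\<^sup>2 + B * E = 0"
  proof -
    have "(A - sg) * (F - sg) = a * (- a)" unfolding a1(1)[symmetric] a1(2)[symmetric] ..
    then have "a\<^sup>2 = - ((A - sg) * (F - sg))" by (simp add: power2_eq_square)
    also have "\<dots> = - (A * F) + sg * (A + F) - sg * sg" by (simp add: algebra_simps)
    also have "\<dots> = - (B * E)" using det tr sg2(1) by (simp add: algebra_simps)
    finally show ?thesis by simp
  qed
  have h2: "a * x0 + B * y0 = 0" "E * x0 - a * y0 = 0"
    using eig a1(1) by (auto simp: algebra_simps) (use a1(2) eig(2) in \<open>simp add: algebra_simps\<close>)
  obtain \<tau> where \<tau>: "\<tau> = 1 \<or> \<tau> = -1" "B = \<tau> * x0\<^sup>2" "- a = \<tau> * (x0 * y0)" "- E = \<tau> * y0\<^sup>2"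
    using rank_one_form[OF h1 h2 nrm] by blast
  have bf: "bform mc x t = of_real (\<tau> * \<phi> x * \<phi> t)" for x t
  proof -
    have h: "(of_real F - of_real A) / 2 = complex_of_real (- a)" by (simp add: a_def field_simps)
    have "bform mc x t = of_real (\<tau> * x0\<^sup>2) * (th1 mc x * th1 mc t) + of_real (\<tau> * (x0 * y0)) * (th1 mc x * th2 mc t + th2 mc x * th1 mc t)
       + of_real (\<tau> * y0\<^sup>2) * (th2 mc x * th2 mc t)"
      unfolding bform_def ABEF h \<tau>(2)[symmetric] \<tau>(3)[symmetric] \<tau>(4)[symmetric] by simp
    also have "\<dots> = of_real \<tau> * (of_real x0 * th1 mc x + of_real y0 * th2 mc x) * (of_real x0 * th1 mc t + of_real y0 * th2 mc t)"
      by (simp add: algebra_simps power2_eq_square)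
    also have "\<dots> = of_real (\<tau> * \<phi> x * \<phi> t)" using phi_rep[of x] phi_rep[of t] by (simp add: x0_def y0_def)
    finally show ?thesis .
  qed
  define J where "J = integral {0..1} (\<lambda>t. (\<phi> t)\<^sup>2)"
  have ci: "(\<lambda>t. (\<phi> t)\<^sup>2) integrable_on {0..1}" by (intro integrable_continuous_real continuous_intros phi_cont)
  have J0: "J \<ge> 0" unfolding J_def using ci by (rule integral_nonneg) auto
  \<comment> \<open>If \<phi> vanished on the period its Cauchy data would be 0, and by the
    normalisation both off-diagonal entries of the monodromy matrix as well, against simplicity of
    the edge.\<close>
  have Jnz: "J \<noteq> 0"
  proof
    assume "J = 0"
    then have i0: "((\<lambda>t. (\<phi> t)\<^sup>2) has_integral 0) (cbox 0 1)" using integrable_integral[OF ci] by (simp add: J_def)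
    have z: "\<phi> t = 0" if "t \<in> {0..1}" for t
    proof -
      have "(\<phi> t)\<^sup>2 = 0"
        by (rule has_integral_0_cbox_imp_0[OF _ _ i0]) (use that in \<open>auto intro!: continuous_intros phi_cont\<close>)
      then show ?thesis by simp
    qed
    have "restr mc (of_real x0) (of_real y0) t = 0" for t
      using z[of t] phi_rep[of t] by (auto simp: restr_def x0_def y0_def)
    from restr_zero[OF this] have "x0 = 0" "y0 = 0" by auto
    then have "B = 0" "E = 0" using \<tau> by auto
    then show False using edge_simple by (simp add: ABEF)
  qed
  have "integral {0..1} (\<lambda>t. bform mc t t) = of_real (\<tau> * J)"
  proof -
    have "((\<lambda>t. complex_of_real (\<tau> * (\<phi> t)\<^sup>2)) has_integral of_real (\<tau> * J)) {0..1}"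
      using has_integral_of_real[OF has_integral_mult_right[OF integrable_integral[OF ci], of \<tau>]] by (simp add: J_def)
    moreover have "bform mc t t = complex_of_real (\<tau> * (\<phi> t)\<^sup>2)" for t by (simp add: bf power2_eq_square)
    ultimately show ?thesis by (simp only: integral_unique)
  qed
  then have dd: "(D has_field_derivative of_real (- \<tau> * J)) (at mc)" using D_has_derivative[of mc] by simp
  have dDe: "dD = of_real (- \<tau> * J)" unfolding dD_def using dd by (rule DERIV_imp_deriv)
  show "dD = of_real (Re dD)" "dD \<noteq> 0" using dDe Jnz \<tau>(1) by auto
  have sgn: "pm s * (sg * (- \<tau> * J)) \<le> 0" using Dr_sign[OF Dr_DERIV[OF dd]] by simp
  have pms: "pm s = 1 \<or> pm s = -1" by (cases s) auto
  have ts: "\<tau> = pm s * sg"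
    using sgn J0 Jnz \<tau>(1) pms sg2(2) by (auto simp: mult_le_0_iff zero_le_mult_iff)
  show "bform mc x t = of_real (pm s * sg * \<phi> x * \<phi> t)" using bf[of x t] by (simp add: ts)
  have "cmod dD = J" using J0 \<tau>(1) by (auto simp: dDe norm_mult)
  then show "sg * Re dD = - pm s * cmod dD"
    using pms sg2(2) by (auto simp: dDe ts)
qed

end

lemma open_interval_const_L2: "(\<lambda>_. c) \<in> L2 {a<..<b::real}"
proof -
  have "integrable lebesgue (indicat_real {a<..<b})"
    using lmeasurable_iff_integrable[of "{a<..<b}"] by (simp add: bounded_set_imp_lmeasurable)
  then have "integrable (lebesgue_on {a<..<b}) (\<lambda>_. (cmod c)\<^sup>2)"
    by (simp add: integrable_restrict_space)
  then show ?thesis by (simp add: L2_def)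
qed

lemma L2_norm_const: assumes "a \<le> b" shows "L2_norm {a<..<b} (\<lambda>_. c) = cmod c * sqrt (b - a)"
proof -
  have i: "integrable (lebesgue_on {a<..<b}) (\<lambda>_. (cmod c)\<^sup>2)" using L2D(2)[OF open_interval_const_L2[of c a b]] by simp
  have "(\<integral>x. (cmod c)\<^sup>2 \<partial>lebesgue_on {a<..<b}) = integral {a<..<b} (\<lambda>_. (cmod c)\<^sup>2)"
    by (rule lebesgue_integral_eq_integral[OF i]) simp
  also have "\<dots> = integral {a..b} (\<lambda>_. (cmod c)\<^sup>2)"
    using integral_open_interval_real[of a b "\<lambda>_. (cmod c)\<^sup>2"] by simp
  also have "\<dots> = (b - a) * (cmod c)\<^sup>2" using assms by simp
  finally show ?thesis using assms by (simp add: L2_norm_def real_sqrt_mult mult.commute)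
qed

lemma L2_bounded_continuous:
  assumes "continuous_on UNIV u" "a \<le> b" "\<And>x. x \<in> {a<..<b} \<Longrightarrow> cmod (u x) \<le> A"
  shows "u \<in> L2 {a<..<b}" "A \<ge> 0 \<Longrightarrow> L2_norm {a<..<b} u \<le> A * sqrt (b - a)"
proof -
  have um: "u \<in> borel_measurable (lebesgue_on {a<..<b})"
    using continuous_measurable_lebesgue[OF assms(1)] by (simp add: measurable_restrict_space1)
  have ae: "AE x in lebesgue_on {a<..<b}. cmod (u x) \<le> A" using assms(3) by (intro AE_I2) simp
  show uL: "u \<in> L2 {a<..<b}"
    using ae by (intro L2I_bound[OF um L2D(2)[OF open_interval_const_L2[of "of_real A" a b]]])
       (auto elim!: eventually_mono intro!: power_mono simp del: power2_abs simp: abs_le_square_iff[symmetric])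
  assume A: "A \<ge> 0"
  have "L2_norm {a<..<b} u \<le> L2_norm {a<..<b} (\<lambda>_. of_real A)"
    by (rule L2_norm_le_AE[OF uL open_interval_const_L2]) (use ae A in simp)
  then show "L2_norm {a<..<b} u \<le> A * sqrt (b - a)" using A by (simp add: L2_norm_const[OF assms(2)])
qed

lemma L2_integrable: "g \<in> L2 {a<..<b} \<Longrightarrow> integrable (lebesgue_on {a<..<b}) g"
  using L2_mult_integrable[OF open_interval_const_L2[of 1], of g] by simp

lemma L2_ext_loc:
  assumes "g \<in> L2 {a<..<b}" shows "loc_abs_int (extend_by_zero {a<..<b} g)"
  unfolding loc_abs_int_def
proof (intro allI)
  fix x y :: real
  have "integrable lebesgue (\<lambda>t. indicator {a<..<b} t *\<^sub>R g t)"
    using L2_integrable[OF assms] by (simp add: integrable_restrict_space)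
  then have "integrable lebesgue (\<lambda>t. indicator {x..y} t *\<^sub>R (indicator {a<..<b} t *\<^sub>R g t))"
    by (rule integrable_mult_indicator[rotated]) simp
  moreover have "indicator {a<..<b} t *\<^sub>R g t = extend_by_zero {a<..<b} g t" for t by (simp add: extend_by_zero_def)
  ultimately show "extend_by_zero {a<..<b} g absolutely_integrable_on {x..y}" by (simp add: set_integrable_def)
qed

lemma ext_integral:
  fixes h :: "real \<Rightarrow> 'c::euclidean_space"
  assumes "integrable (lebesgue_on {a<..<b}) h"
  shows "(\<integral>t. h t \<partial>lebesgue_on {a<..<b}) = integral {a..b} (\<lambda>t. if t \<in> {a<..<b} then h t else 0)"
proof -
  have "(\<integral>t. h t \<partial>lebesgue_on {a<..<b}) = integral {a<..<b} h" by (rule lebesgue_integral_eq_integral[OF assms]) simp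
  also have "\<dots> = integral {a..b} (\<lambda>t. if t \<in> {a<..<b} then h t else 0)"
    using integral_restrict_Int[of "{a..b}" "{a<..<b}" h] by (simp add: Int_absorb2 greaterThanLessThan_subseteq_atLeastAtMost_iff)
  finally show ?thesis .
qed

definition prim :: "real \<Rightarrow> (real \<Rightarrow> complex) \<Rightarrow> real \<Rightarrow> complex" where
  "prim c v = (SOME u. has_ac_deriv u v \<and> u c = 0)"

lemma prim: assumes "loc_abs_int v" shows "has_ac_deriv (prim c v) v" "prim c v c = 0"
  using someI_ex[of "\<lambda>u. has_ac_deriv u v \<and> u c = 0"] has_ac_deriv_indefinite[OF assms, of c] unfolding prim_def by metis+

lemma prim_integral: assumes "loc_abs_int v" "c \<le> x" shows "prim c v x = integral {c..x} v"
  using has_ac_derivD(3)[OF prim(1)[OF assms(1), of c] assms(2)] prim(2)[OF assms(1), of c] by simp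

lemma prim_linear:
  assumes "loc_abs_int v" "loc_abs_int w" shows "prim c (\<lambda>x. v x + k * w x) x = prim c v x + k * prim c w x"
proof -
  have "loc_abs_int (\<lambda>x. v x + k * w x)" using assms by (intro loc_abs_int_add loc_abs_int_cmult)
  then have d: "has_ac_deriv (\<lambda>x. prim c (\<lambda>x. v x + k * w x) x - (prim c v x + k * prim c w x)) (\<lambda>x. (v x + k * w x) - (v x + k * w x))"
    using assms by (intro has_ac_deriv_diff has_ac_deriv_add has_ac_deriv_cmult prim)
  have "prim c (\<lambda>x. v x + k * w x) x - (prim c v x + k * prim c w x) = prim c (\<lambda>x. v x + k * w x) c - (prim c v c + k * prim c w c)"
    using has_ac_deriv_zero[OF d, of x c] by simp
  also have "\<dots> = 0" using assms \<open>loc_abs_int (\<lambda>x. v x + k * w x)\<close> by (simp add: prim(2))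
  finally show ?thesis by simp
qed

section \<open>Green operators\<close>

lemma L2_bounded_measurable:
  assumes u: "u \<in> borel_measurable (lebesgue_on {a<..<b})" and ab: "a \<le> b"
    and A: "\<And>x. x \<in> {a<..<b} \<Longrightarrow> cmod (u x) \<le> A" "A \<ge> 0"
  shows "u \<in> L2 {a<..<b}" "L2_norm {a<..<b} u \<le> A * sqrt (b - a)"
proof -
  have ae: "AE x in lebesgue_on {a<..<b}. cmod (u x) \<le> A" using A(1) by (intro AE_I2) simp
  show uL: "u \<in> L2 {a<..<b}"
    using ae A(2) by (intro L2I_bound[OF u L2D(2)[OF open_interval_const_L2[of "of_real A" a b]]])
      (auto elim!: eventually_mono intro!: power_mono)
  have "L2_norm {a<..<b} u \<le> L2_norm {a<..<b} (\<lambda>_. of_real A)"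
    by (rule L2_norm_le_AE[OF uL open_interval_const_L2]) (use ae A in simp)
  then show "L2_norm {a<..<b} u \<le> A * sqrt (b - a)" using A by (simp add: L2_norm_const[OF ab])
qed

lemma sqrt_sum_squares3_le:
  assumes "x \<ge> 0" "y \<ge> 0" "z \<ge> 0" shows "sqrt (x\<^sup>2 + y\<^sup>2 + z\<^sup>2) \<le> x + y + z"
proof (rule real_le_lsqrt)
  have "0 \<le> x * y + x * z + y * z" using assms by simp
  then show "x\<^sup>2 + y\<^sup>2 + z\<^sup>2 \<le> (x + y + z)\<^sup>2" by (simp add: power2_eq_square algebra_simps)
qed (use assms in auto)

lemma W22_normI:
  assumes uv: "has_weak_deriv S u v" and vw: "has_weak_deriv S v w" and S: "open S"
    and L: "u \<in> L2 S" "v \<in> L2 S" "w \<in> L2 S"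
  shows "u \<in> W22 S" "W22_norm S u \<le> L2_norm S u + L2_norm S v + L2_norm S w"
proof -
  have Sm: "S \<in> sets lebesgue" using S by simp
  show "u \<in> W22 S" unfolding W22_def using assms by blast
  have a1: "AE x in lebesgue_on S. weak_deriv S u x = v x" using weak_deriv_AE(2)[OF uv S] .
  have a1': "AE x in lebesgue_on S. v x = weak_deriv S u x" using a1 by eventually_elim simp
  have vL: "weak_deriv S u \<in> L2 S" using L2_cong_AE[OF L(2) a1' Sm] .
  have n1: "L2_norm S (weak_deriv S u) = L2_norm S v" using L2_norm_cong_AE[OF vL L(2) a1] .
  have "has_weak_deriv S (weak_deriv S u) w"
    by (rule has_weak_deriv_cong_AE[OF vw S a1']) simp
  then have a2: "AE x in lebesgue_on S. weak_deriv S (weak_deriv S u) x = w x" using weak_deriv_AE(2) S by blast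
  have a2': "AE x in lebesgue_on S. w x = weak_deriv S (weak_deriv S u) x" using a2 by eventually_elim simp
  have wL: "weak_deriv S (weak_deriv S u) \<in> L2 S" using L2_cong_AE[OF L(3) a2' Sm] .
  have n2: "L2_norm S (weak_deriv S (weak_deriv S u)) = L2_norm S w" using L2_norm_cong_AE[OF wL L(3) a2] .
  show "W22_norm S u \<le> L2_norm S u + L2_norm S v + L2_norm S w"
    unfolding W22_norm_def n1 n2 by (intro sqrt_sum_squares3_le L2_norm_nonneg)
qed

lemma L2_scaled_bound:
  assumes f: "f \<in> L2 S" and u: "u \<in> borel_measurable (lebesgue_on S)"
    and b: "\<And>x. cmod (u x) \<le> K * cmod (f x)" and K: "K \<ge> 0"
  shows "u \<in> L2 S" "L2_norm S u \<le> K * L2_norm S f"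
proof -
  have Kf: "(\<lambda>x. of_real K * f x) \<in> L2 S" using f by (rule L2_cmult)
  show uL: "u \<in> L2 S"
  proof (rule L2I_bound[OF u L2D(2)[OF Kf]])
    show "AE x in lebesgue_on S. (cmod (u x))\<^sup>2 \<le> (cmod (of_real K * f x))\<^sup>2"
      using b K by (intro AE_I2 power_mono) (auto simp: norm_mult)
  qed
  have "L2_norm S u \<le> L2_norm S (\<lambda>x. of_real K * f x)"
    by (rule L2_norm_le_AE[OF uL Kf]) (use b K in \<open>auto simp: norm_mult\<close>)
  then show "L2_norm S u \<le> K * L2_norm S f" using K by (simp add: L2_norm_cmult)
qed

context hill begin

definition "sol2 l f u v = (\<lambda>x. ((of_real (q x) - l) * u x - f x - of_real (dp x) * v x) / P x)"

lemma inv_P_le: "cmod (z / P x) \<le> (1 / p0) * cmod z"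
proof -
  have "cmod z / p x \<le> cmod z / p0" using p_ge[of x] p0_pos by (intro divide_left_mono) (auto intro: mult_pos_pos p_pos)
  then show ?thesis using p_pos[of x] by (simp add: norm_divide)
qed

lemma sol2_parts:
  assumes "cmod l \<le> R"
  shows "cmod (((of_real (q x) - l) * u - of_real (dp x) * v) / P x) \<le> (1 / p0) * ((qB + R) * cmod u + dB * cmod v)"
proof -
  have "cmod (of_real (q x) - l) \<le> qB + R"
    using norm_triangle_ineq4[of "complex_of_real (q x)" l] qB(2)[of x] assms by simp
  then have "cmod ((of_real (q x) - l) * u) \<le> (qB + R) * cmod u" by (simp add: norm_mult mult_right_mono)
  moreover have "cmod (of_real (dp x) * v) \<le> dB * cmod v" using dB(1)[of x] by (simp add: norm_mult mult_right_mono)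
  ultimately have "cmod ((of_real (q x) - l) * u - of_real (dp x) * v) \<le> (qB + R) * cmod u + dB * cmod v"
    using norm_triangle_ineq4[of "(of_real (q x) - l) * u" "of_real (dp x) * v"] by linarith
  then have "(1 / p0) * cmod ((of_real (q x) - l) * u - of_real (dp x) * v) \<le> (1 / p0) * ((qB + R) * cmod u + dB * cmod v)"
    using p0_pos by (intro mult_left_mono) auto
  then show ?thesis using inv_P_le[of "(of_real (q x) - l) * u - of_real (dp x) * v" x] by linarith
qed

text \<open>Only u and u' need pointwise bounds: the equation expresses u'' through u, u' and the
  source, with coefficients bounded by means of p0, qB, dB and R.\<close>

lemma sol_W22:
  assumes ab: "a < b" and R: "R \<ge> 0"
  obtains C where "C \<ge> 0" "\<And>l f u v A. cmod l \<le> R \<Longrightarrow> sol l f u v \<Longrightarrow> f \<in> L2 {a<..<b} \<Longrightarrow> A \<ge> 0 \<Longrightarrow>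
     (\<And>x. x \<in> {a<..<b} \<Longrightarrow> cmod (u x) \<le> A \<and> cmod (v x) \<le> A) \<Longrightarrow>
     u \<in> W22 {a<..<b} \<and> W22_norm {a<..<b} u \<le> C * (A + L2_norm {a<..<b} f)"
proof
  define S where "S = sqrt (b - a)"
  define K where "K = (1 / p0) * (qB + R + dB)"
  let ?C = "2 * S + K * S + 1 / p0"
  have S0: "S \<ge> 0" using ab by (simp add: S_def)
  have K0: "K \<ge> 0" using p0_pos qB(1) dB(2) R by (simp add: K_def)
  show "?C \<ge> 0" using S0 K0 p0_pos by simp
  fix l f u v A
  assume l: "cmod l \<le> R" and s: "sol l f u v" and f: "f \<in> L2 {a<..<b}" and A: "A \<ge> 0"
    and uv: "\<And>x. x \<in> {a<..<b} \<Longrightarrow> cmod (u x) \<le> A \<and> cmod (v x) \<le> A"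
  let ?Q = "{a<..<b}"
  have um: "u \<in> borel_measurable (lebesgue_on ?Q)" "v \<in> borel_measurable (lebesgue_on ?Q)"
    using sol_cont[OF s] by (auto intro!: measurable_restrict_space1 continuous_measurable_lebesgue)
  have qm: "q \<in> borel_measurable (lebesgue_on ?Q)" "dp \<in> borel_measurable (lebesgue_on ?Q)" "p \<in> borel_measurable (lebesgue_on ?Q)"
    using q_measurable dp(1) continuous_measurable_lebesgue[OF p_cont] by (auto intro!: measurable_restrict_space1)
  define w1 where "w1 x = ((of_real (q x) - l) * u x - of_real (dp x) * v x) / P x" for x
  define w2 where "w2 x = f x / P x" for x
  have w1m: "w1 \<in> borel_measurable (lebesgue_on ?Q)" unfolding w1_def using um qm by measurable
  have w2m: "w2 \<in> borel_measurable (lebesgue_on ?Q)" unfolding w2_def using L2D(1)[OF f] qm by measurable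
  have w1b: "cmod (w1 x) \<le> K * A" if "x \<in> ?Q" for x
  proof -
    have "cmod (w1 x) \<le> (1 / p0) * ((qB + R) * cmod (u x) + dB * cmod (v x))" unfolding w1_def by (rule sol2_parts[OF l])
    also have "\<dots> \<le> (1 / p0) * ((qB + R) * A + dB * A)"
      using uv[OF that] p0_pos qB(1) R dB(2) by (intro mult_left_mono add_mono) auto
    finally show ?thesis by (simp add: K_def algebra_simps)
  qed
  have L1: "u \<in> L2 ?Q" "L2_norm ?Q u \<le> A * S" using L2_bounded_measurable[OF um(1), of A] uv A ab by (auto simp: S_def)
  have L2': "v \<in> L2 ?Q" "L2_norm ?Q v \<le> A * S" using L2_bounded_measurable[OF um(2), of A] uv A ab by (auto simp: S_def)
  have L3: "w1 \<in> L2 ?Q" "L2_norm ?Q w1 \<le> (K * A) * S" using L2_bounded_measurable[OF w1m, of "K * A"] w1b A K0 ab by (auto simp: S_def)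
  have L4: "w2 \<in> L2 ?Q" "L2_norm ?Q w2 \<le> (1 / p0) * L2_norm ?Q f"
    using L2_scaled_bound[OF f w2m, of "1 / p0"] inv_P_le p0_pos by (auto simp: w2_def)
  have weq: "sol2 l f u v = (\<lambda>x. w1 x - w2 x)"
    by (rule ext) (simp add: sol2_def w1_def w2_def diff_divide_distrib)
  have wL: "sol2 l f u v \<in> L2 ?Q" unfolding weq using L3(1) L4(1) by (rule L2_diff)
  have wn: "L2_norm ?Q (sol2 l f u v) \<le> (K * A) * S + (1 / p0) * L2_norm ?Q f"
    unfolding weq using L2_norm_triangle_diff[OF L3(1) L4(1)] L3(2) L4(2) by linarith
  have d1: "has_weak_deriv ?Q u v" using s by (intro has_ac_deriv_imp_weak) (auto simp: sol_def)
  have d2: "has_weak_deriv ?Q v (sol2 l f u v)" unfolding sol2_def by (intro has_ac_deriv_imp_weak sol_second[OF s]) auto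
  note W = W22_normI[OF d1 d2 _ L1(1) L2'(1) wL]
  have "W22_norm ?Q u \<le> A * S + A * S + ((K * A) * S + (1 / p0) * L2_norm ?Q f)"
    using W(2) L1(2) L2'(2) wn by simp
  also have "\<dots> \<le> ?C * (A + L2_norm ?Q f)"
  proof -
    have "0 \<le> (2 * S + K * S) * L2_norm ?Q f" "0 \<le> (1 / p0) * A" using S0 K0 A L2_norm_nonneg p0_pos by auto
    then show ?thesis by (simp add: algebra_simps)
  qed
  finally show "u \<in> W22 ?Q \<and> W22_norm ?Q u \<le> ?C * (A + L2_norm ?Q f)" using W(1) by simp
qed

end

section \<open>Variation of parameters with sources supported in Q\<close>

locale edge_Q = edge_setup +
  fixes a b :: real assumes ab: "a < b"
begin

abbreviation "Q \<equiv> {a<..<b}"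
abbreviation "xt \<equiv> extend_by_zero Q"

definition "p1 l g = prim a (\<lambda>t. th1 l t * xt g t)"
definition "p2 l g = prim a (\<lambda>t. th2 l t * xt g t)"
text \<open>The bracket \<open>2 * p2 l g x - p2 l g b\<close> is the integral from a to x minus the
  integral from x to b. The kernel thus carries the factor sgn(x - t)/2, and neither end of the line
  is favoured.\<close>

definition "G0 l g x = 1/2 * (th1 l x * (2 * p2 l g x - p2 l g b) - th2 l x * (2 * p1 l g x - p1 l g b))"
definition "dG0 l g x = 1/2 * (dth1 l x * (2 * p2 l g x - p2 l g b) - dth2 l x * (2 * p1 l g x - p1 l g b))"
definition "hh l = (dth2 l 1 - th1 l 1) / 2"
definition "cA l g = th2 l 1 * p1 l g b + hh l * p2 l g b"
definition "cB l g = hh l * p1 l g b - dth1 l 1 * p2 l g b"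
text \<open>Integral operator with kernel \<open>bform\<close>; being a homogeneous solution, it can
  correct the tails of \<open>G0\<close> without changing the source.\<close>

definition "Bop l g x = cA l g * th1 l x + cB l g * th2 l x"
definition "dBop l g x = cA l g * dth1 l x + cB l g * dth2 l x"

lemma ext_loc: "g \<in> L2 Q \<Longrightarrow> loc_abs_int (xt g)"
  by (rule L2_ext_loc)

lemma ext_lincomb: "xt (\<lambda>y. g y + c * h y) t = xt g t + c * xt h t"
  by (simp add: extend_by_zero_def)

lemma th_ext_loc: "g \<in> L2 Q \<Longrightarrow> loc_abs_int (\<lambda>t. th1 l t * xt g t)" "g \<in> L2 Q \<Longrightarrow> loc_abs_int (\<lambda>t. th2 l t * xt g t)"
  by (intro loc_abs_int_mult_continuous ext_loc th_cont; assumption)+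

lemma p_facts:
  assumes "g \<in> L2 Q"
  shows "has_ac_deriv (p1 l g) (\<lambda>t. th1 l t * xt g t)" "p1 l g a = 0" "has_ac_deriv (p2 l g) (\<lambda>t. th2 l t * xt g t)" "p2 l g a = 0"
  unfolding p1_def p2_def using prim th_ext_loc[OF assms] by auto

lemma p_linear:
  assumes "g \<in> L2 Q" "h \<in> L2 Q"
  shows "p1 l (\<lambda>y. g y + c * h y) x = p1 l g x + c * p1 l h x" "p2 l (\<lambda>y. g y + c * h y) x = p2 l g x + c * p2 l h x"
  unfolding p1_def p2_def ext_lincomb
  using prim_linear[OF th_ext_loc(1)[OF assms(1), of l] th_ext_loc(1)[OF assms(2), of l], of a c x]
    prim_linear[OF th_ext_loc(2)[OF assms(1), of l] th_ext_loc(2)[OF assms(2), of l], of a c x]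
  by (simp_all add: algebra_simps)

lemma G0_linear: "g \<in> L2 Q \<Longrightarrow> h \<in> L2 Q \<Longrightarrow> G0 l (\<lambda>y. g y + c * h y) x = G0 l g x + c * G0 l h x"
  by (simp add: G0_def p_linear algebra_simps)

lemma Bop_linear: "g \<in> L2 Q \<Longrightarrow> h \<in> L2 Q \<Longrightarrow> Bop l (\<lambda>y. g y + c * h y) x = Bop l g x + c * Bop l h x"
  by (simp add: Bop_def cA_def cB_def p_linear algebra_simps)

lemma sol_Bop: "sol l (\<lambda>_. 0) (Bop l g) (dBop l g)"
  using sol_comb[of l "cA l g" "cB l g"] by (simp add: Bop_def[abs_def] dBop_def[abs_def])

text \<open>Differentiating the two primitives cancels in the first derivative, and in the flux
  equation it leaves the source times p times the Wronskian, which is 1.\<close>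

lemma sol_G0:
  assumes g: "g \<in> L2 Q" shows "sol l (xt g) (G0 l g) (dG0 l g)"
  unfolding sol_def
proof
  let ?I1 = "\<lambda>x. 2 * p1 l g x - p1 l g b" and ?I2 = "\<lambda>x. 2 * p2 l g x - p2 l g b"
  have I1: "has_ac_deriv ?I1 (\<lambda>t. 2 * (th1 l t * xt g t) - 0)" and I2: "has_ac_deriv ?I2 (\<lambda>t. 2 * (th2 l t * xt g t) - 0)"
    by (intro has_ac_deriv_diff has_ac_deriv_cmult p_facts[OF g] has_ac_deriv_const)+
  have t: "has_ac_deriv (th1 l) (dth1 l)" "has_ac_deriv (th2 l) (dth2 l)"
    "has_ac_deriv (\<lambda>x. P x * dth1 l x) (\<lambda>x. (of_real (q x) - l) * th1 l x - 0)" "has_ac_deriv (\<lambda>x. P x * dth2 l x) (\<lambda>x. (of_real (q x) - l) * th2 l x - 0)"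
    using sol_th[of l] by (auto simp: sol_def)
  have "has_ac_deriv (\<lambda>x. 1/2 * (th1 l x * ?I2 x - th2 l x * ?I1 x))
     (\<lambda>x. 1/2 * ((dth1 l x * ?I2 x + th1 l x * (2 * (th2 l x * xt g x) - 0)) - (dth2 l x * ?I1 x + th2 l x * (2 * (th1 l x * xt g x) - 0))))"
    by (intro has_ac_deriv_diff has_ac_deriv_cmult has_ac_deriv_mult t I1 I2)
  then show "has_ac_deriv (G0 l g) (dG0 l g)"
    by (rule has_ac_deriv_cong) (auto simp: G0_def dG0_def algebra_simps)
  have "has_ac_deriv (\<lambda>x. 1/2 * ((P x * dth1 l x) * ?I2 x - (P x * dth2 l x) * ?I1 x))
     (\<lambda>x. 1/2 * ((((of_real (q x) - l) * th1 l x - 0) * ?I2 x + (P x * dth1 l x) * (2 * (th2 l x * xt g x) - 0))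
        - (((of_real (q x) - l) * th2 l x - 0) * ?I1 x + (P x * dth2 l x) * (2 * (th1 l x * xt g x) - 0))))"
    by (intro has_ac_deriv_diff has_ac_deriv_cmult has_ac_deriv_mult t I1 I2)
  then show "has_ac_deriv (\<lambda>x. P x * dG0 l g x) (\<lambda>x. (of_real (q x) - l) * G0 l g x - xt g x)"
  proof (rule has_ac_deriv_cong)
    fix x
    show "1/2 * ((P x * dth1 l x) * ?I2 x - (P x * dth2 l x) * ?I1 x) = P x * dG0 l g x" by (simp add: dG0_def algebra_simps)
    have "1/2 * ((((of_real (q x) - l) * th1 l x - 0) * ?I2 x + (P x * dth1 l x) * (2 * (th2 l x * xt g x) - 0))
        - (((of_real (q x) - l) * th2 l x - 0) * ?I1 x + (P x * dth2 l x) * (2 * (th1 l x * xt g x) - 0)))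
      = (of_real (q x) - l) * G0 l g x - (P x * (th1 l x * dth2 l x - dth1 l x * th2 l x)) * xt g x"
    proof -
      have "1/2 * (((k * x - 0) * i2 + (r * y) * (2 * (w * e) - 0)) - ((k * w - 0) * i1 + (r * z) * (2 * (x * e) - 0)))
        = k * (1/2 * (x * i2 - w * i1)) - (r * (x * z - y * w)) * e" for k x i2 r y w e i1 z :: complex
        by (simp add: field_simps)
      then show ?thesis unfolding G0_def .
    qed
    then show "1/2 * ((((of_real (q x) - l) * th1 l x - 0) * ?I2 x + (P x * dth1 l x) * (2 * (th2 l x * xt g x) - 0))
        - (((of_real (q x) - l) * th2 l x - 0) * ?I1 x + (P x * dth2 l x) * (2 * (th1 l x * xt g x) - 0)))
      = (of_real (q x) - l) * G0 l g x - xt g x" by (simp add: wronskian)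
  qed
qed

lemma p_const:
  assumes "g \<in> L2 Q" shows "x \<le> a \<Longrightarrow> p1 l g x = 0" "x \<le> a \<Longrightarrow> p2 l g x = 0"
    "b \<le> x \<Longrightarrow> p1 l g x = p1 l g b" "b \<le> x \<Longrightarrow> p2 l g x = p2 l g b"
proof -
  have z: "u y = u x" if d: "has_ac_deriv u (\<lambda>t. f t * xt g t)" and xy: "x \<le> y" "y \<le> a \<or> b \<le> x" for u f x y
  proof -
    have "integral {x..y} (\<lambda>t. f t * xt g t) = integral {x..y} (\<lambda>_. 0)"
      by (rule integral_cong) (use xy in \<open>auto simp: extend_by_zero_def\<close>)
    then show ?thesis using has_ac_derivD(3)[OF d xy(1)] by simp
  qed
  show "x \<le> a \<Longrightarrow> p1 l g x = 0" using z[OF p_facts(1)[OF assms], of x a l] p_facts(2)[OF assms] by simp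
  show "x \<le> a \<Longrightarrow> p2 l g x = 0" using z[OF p_facts(3)[OF assms], of x a l] p_facts(4)[OF assms] by simp
  show "b \<le> x \<Longrightarrow> p1 l g x = p1 l g b" using z[OF p_facts(1)[OF assms], of b x l] by simp
  show "b \<le> x \<Longrightarrow> p2 l g x = p2 l g b" using z[OF p_facts(3)[OF assms], of b x l] by simp
qed

lemma p_integral:
  assumes "g \<in> L2 Q"
  shows "p1 l g b = (\<integral>t. th1 l t * g t \<partial>lebesgue_on Q)" "p2 l g b = (\<integral>t. th2 l t * g t \<partial>lebesgue_on Q)"
    "integrable (lebesgue_on Q) (\<lambda>t. th1 l t * g t)" "integrable (lebesgue_on Q) (\<lambda>t. th2 l t * g t)"
proof -
  have thL: "f \<in> L2 Q" if "continuous_on UNIV f" for f :: "real \<Rightarrow> complex"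
  proof -
    have "compact (f ` {a..b})" by (intro compact_continuous_image continuous_on_subset[OF that]) auto
    then have "bounded (f ` {a..b})" by (rule compact_imp_bounded)
    then obtain A where "\<And>x. x \<in> {a..b} \<Longrightarrow> cmod (f x) \<le> A" unfolding bounded_iff by blast
    then show ?thesis using L2_bounded_continuous(1)[OF that, of a b A] ab by simp
  qed
  show i: "integrable (lebesgue_on Q) (\<lambda>t. th1 l t * g t)" "integrable (lebesgue_on Q) (\<lambda>t. th2 l t * g t)"
    by (intro L2_mult_integrable thL th_cont assms)+
  have eq: "(if t \<in> Q then f t * g t else 0) = f t * xt g t" for f t by (simp add: extend_by_zero_def)
  show "p1 l g b = (\<integral>t. th1 l t * g t \<partial>lebesgue_on Q)" "p2 l g b = (\<integral>t. th2 l t * g t \<partial>lebesgue_on Q)"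
    using ext_integral[OF i(1)] ext_integral[OF i(2)] prim_integral[OF th_ext_loc(1)[OF assms, of l], of a b] prim_integral[OF th_ext_loc(2)[OF assms, of l], of a b] ab
    unfolding p1_def p2_def eq by simp_all
qed

lemma Bop_edge:
  assumes "g \<in> L2 Q"
  shows "Bop mc g x = of_real (pm s * sg) * L2_inner Q g phic * phic x"
proof -
  have "L2_inner Q g phic = (\<integral>t. of_real (\<phi> 0) * (th1 mc t * g t) + of_real (deriv \<phi> 0) * (th2 mc t * g t) \<partial>lebesgue_on Q)"
    unfolding L2_inner_def
  proof (rule Bochner_Integration.integral_cong)
    fix t show "g t * cnj (phic t) = of_real (\<phi> 0) * (th1 mc t * g t) + of_real (deriv \<phi> 0) * (th2 mc t * g t)"
    proof -
      have "g t * cnj (phic t) = g t * phic t" by simp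
      also have "\<dots> = g t * (of_real (\<phi> 0) * th1 mc t + of_real (deriv \<phi> 0) * th2 mc t)" by (simp only: phi_rep[of t, symmetric])
      finally show ?thesis by (simp add: algebra_simps)
    qed
  qed simp
  also have "\<dots> = of_real (\<phi> 0) * p1 mc g b + of_real (deriv \<phi> 0) * p2 mc g b"
    using p_integral[OF assms, of mc] by simp
  finally have ip: "L2_inner Q g phic = of_real (\<phi> 0) * p1 mc g b + of_real (deriv \<phi> 0) * p2 mc g b" .
  let ?k = "of_real (pm s * sg) :: complex"
  have bf: "th2 mc 1 * (th1 mc x * th1 mc t) + hh mc * (th1 mc x * th2 mc t + th2 mc x * th1 mc t) - dth1 mc 1 * (th2 mc x * th2 mc t) = ?k * phic x * phic t" for x t
    using bform_edge[of x t] by (simp add: bform_def hh_def)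
  text \<open>Comparing Cauchy data at \<open>0\<close> in the second variable extracts the coefficients.\<close>
  define F where "F x t = (th2 mc 1 * th1 mc x + hh mc * th2 mc x) * th1 mc t + (hh mc * th1 mc x - dth1 mc 1 * th2 mc x) * th2 mc t" for x t
  have F: "F x t = (?k * phic x * of_real (\<phi> 0)) * th1 mc t + (?k * phic x * of_real (deriv \<phi> 0)) * th2 mc t" for x t
    using bf[of x t] phi_rep[of t] by (simp add: F_def algebra_simps)
  have e1: "th2 mc 1 * th1 mc x + hh mc * th2 mc x = ?k * phic x * of_real (\<phi> 0)" using F[of x 0] by (simp add: F_def)
  have vd: "(F x has_vector_derivative (hh mc * th1 mc x - dth1 mc 1 * th2 mc x)) (at 0)"
    unfolding F_def using comb_vderiv[of "th2 mc 1 * th1 mc x + hh mc * th2 mc x" mc "hh mc * th1 mc x - dth1 mc 1 * th2 mc x" 0 UNIV] by simp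
  have "(F x has_vector_derivative (?k * phic x * of_real (deriv \<phi> 0))) (at 0)"
    unfolding F using comb_vderiv[of "?k * phic x * of_real (\<phi> 0)" mc "?k * phic x * of_real (deriv \<phi> 0)" 0 UNIV] by simp
  then have e2: "hh mc * th1 mc x - dth1 mc 1 * th2 mc x = ?k * phic x * of_real (deriv \<phi> 0)"
    using vd vector_derivative_unique_at by blast
  have "Bop mc g x = (th2 mc 1 * th1 mc x + hh mc * th2 mc x) * p1 mc g b + (hh mc * th1 mc x - dth1 mc 1 * th2 mc x) * p2 mc g b"
    by (simp add: Bop_def cA_def cB_def algebra_simps)
  also have "\<dots> = ?k * L2_inner Q g phic * phic x" unfolding e1 e2 ip by (simp add: algebra_simps)
  finally show ?thesis .
qed

text \<open>The operator in the statement is defined by a kernel with a case split, whereas the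
  estimates use primitives; this identifies the two at the edge.\<close>

lemma green_operator_eq:
  assumes g: "g \<in> L2 Q"
  shows "green_operator Q th1 th2 m g x = G0 mc g x"
proof -
  \<comment> \<open>The kernel is \<sigma>(t)/2 times one and the same antisymmetric combination in
    both cases.\<close>
  define \<sigma> where "\<sigma> t = (if t > x then -1 else 1 :: complex)" for t
  have \<sigma>m: "\<sigma> \<in> borel_measurable lebesgue" unfolding \<sigma>_def by (intro borel_imp_lebesgue_measurable) measurable
  have sint: "integrable (lebesgue_on Q) (\<lambda>t. \<sigma> t * (f t * g t)) \<and> (\<integral>t. \<sigma> t * (f t * g t) \<partial>lebesgue_on Q) = 2 * u x - u b"
    if i: "integrable (lebesgue_on Q) (\<lambda>t. f t * g t)" and u: "has_ac_deriv u (\<lambda>t. f t * xt g t)" "u a = 0"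
      and lo: "x \<le> a \<Longrightarrow> u x = 0" and hi: "b \<le> x \<Longrightarrow> u x = u b" for f u
  proof
    let ?v = "\<lambda>t. f t * xt g t"
    show isg: "integrable (lebesgue_on Q) (\<lambda>t. \<sigma> t * (f t * g t))"
    proof (rule Bochner_Integration.integrable_bound[OF i])
      have "\<sigma> \<in> borel_measurable (lebesgue_on Q)" using \<sigma>m by (rule measurable_restrict_space1)
      then show "(\<lambda>t. \<sigma> t * (f t * g t)) \<in> borel_measurable (lebesgue_on Q)"
        using borel_measurable_integrable[OF i] by measurable
    qed (auto simp: \<sigma>_def norm_mult)
    have "(\<integral>t. \<sigma> t * (f t * g t) \<partial>lebesgue_on Q) = integral {a..b} (\<lambda>t. \<sigma> t * ?v t)"
      unfolding ext_integral[OF isg] by (rule integral_cong) (simp add: extend_by_zero_def)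
    also have "\<dots> = 2 * u x - u b"
    proof -
      have vi: "?v integrable_on {c..d}" for c d using loc_abs_int_integrable[OF has_ac_derivD(1)[OF u(1)]] .
      consider "x \<le> a" | "b \<le> x" | "a < x" "x < b" by linarith
      then show ?thesis
      proof cases
        case 1
        have "integral {a..b} (\<lambda>t. \<sigma> t * ?v t) = integral {a..b} (\<lambda>t. - ?v t)"
          by (rule integral_cong) (use 1 in \<open>auto simp: \<sigma>_def extend_by_zero_def\<close>)
        then show ?thesis using has_ac_derivD(3)[OF u(1), of a b] ab u(2) lo[OF 1] by simp
      next
        case 2
        have "integral {a..b} (\<lambda>t. \<sigma> t * ?v t) = integral {a..b} ?v"
          by (rule integral_cong) (use 2 in \<open>auto simp: \<sigma>_def extend_by_zero_def\<close>)
        then show ?thesis using has_ac_derivD(3)[OF u(1), of a b] ab u(2) hi[OF 2] by simp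
      next
        case 3
        have e1: "integral {a..x} (\<lambda>t. \<sigma> t * ?v t) = u x" "(\<lambda>t. \<sigma> t * ?v t) integrable_on {a..x}"
          using has_ac_derivD(3)[OF u(1), of a x] 3 u(2) integral_cong[of "{a..x}" "\<lambda>t. \<sigma> t * ?v t" ?v]
            integrable_cong[of "{a..x}" "\<lambda>t. \<sigma> t * ?v t" ?v] vi[of a x] by (auto simp: \<sigma>_def)
        have sp: "?v t * (-1) = \<sigma> t * ?v t" if "t \<in> {x..b} - {x}" for t using that by (auto simp: \<sigma>_def)
        have hi': "((\<lambda>t. ?v t * (-1)) has_integral (u b - u x) * (-1)) {x..b}"
          using has_ac_derivD(2)[OF u(1), of x b] 3 by (intro has_integral_mult_left) auto
        have e2: "((\<lambda>t. \<sigma> t * ?v t) has_integral (u b - u x) * (-1)) {x..b}"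
          by (rule has_integral_spike[OF _ _ hi', of "{x}"]) (use sp in auto)
        have "(\<lambda>t. \<sigma> t * ?v t) integrable_on {a..b}"
          by (rule Henstock_Kurzweil_Integration.integrable_combine[of a x b]) (use 3 e1(2) e2 in auto)
        then have "integral {a..b} (\<lambda>t. \<sigma> t * ?v t) = u x + (u b - u x) * (-1)"
          using Henstock_Kurzweil_Integration.integral_combine[of a x b "\<lambda>t. \<sigma> t * ?v t"] 3 e1(1) integral_unique[OF e2] by simp
        then show ?thesis by simp
      qed
    qed
    finally show "(\<integral>t. \<sigma> t * (f t * g t) \<partial>lebesgue_on Q) = 2 * u x - u b" .
  qed
  note S1 = sint[OF p_integral(3)[OF g, of mc] p_facts(1,2)[OF g] p_const(1)[OF g] p_const(3)[OF g]]
  note S2 = sint[OF p_integral(4)[OF g, of mc] p_facts(3,4)[OF g] p_const(2)[OF g] p_const(4)[OF g]]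
  have "green_operator Q th1 th2 m g x = (\<integral>t. (1/2 * th1 mc x) * (\<sigma> t * (th2 mc t * g t)) - (1/2 * th2 mc x) * (\<sigma> t * (th1 mc t * g t)) \<partial>lebesgue_on Q)"
    unfolding green_operator_def
    by (rule Bochner_Integration.integral_cong) (auto simp: green_kernel_def Let_def \<sigma>_def algebra_simps)
  also have "\<dots> = (1/2 * th1 mc x) * (2 * p2 mc g x - p2 mc g b) - (1/2 * th2 mc x) * (2 * p1 mc g x - p1 mc g b)"
    using S1 S2 by simp
  finally show ?thesis by (simp add: G0_def algebra_simps)
qed

end

lemma bounded_operator_mono:
  assumes "bounded_operator_W22_L2 S M T" "M \<le> M'" shows "bounded_operator_W22_L2 S M' T"
proof -
  have "M * W22_norm S u \<le> M' * W22_norm S u" for u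
    using assms(2) by (intro mult_right_mono) (auto simp: W22_norm_def)
  then show ?thesis using assms(1) unfolding bounded_operator_W22_L2_def by (meson order_trans)
qed

lemma bounded_operatorD:
  assumes "bounded_operator_W22_L2 S M T"
  shows "u \<in> W22 S \<Longrightarrow> T u \<in> L2 S"
    and "u \<in> W22 S \<Longrightarrow> v \<in> W22 S \<Longrightarrow> AE x in lebesgue_on S. T (\<lambda>y. u y + c * v y) x = T u x + c * T v x"
    and "u \<in> W22 S \<Longrightarrow> L2_norm S (T u) \<le> M * W22_norm S u"
proof -
  have lin: "\<forall>u\<in>W22 S. \<forall>v\<in>W22 S. \<forall>a b. AE x in lebesgue_on S. T (\<lambda>y. a * u y + b * v y) x = a * T u x + b * T v x"
    using assms by (simp add: bounded_operator_W22_L2_def)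
  show "AE x in lebesgue_on S. T (\<lambda>y. u y + c * v y) x = T u x + c * T v x" if "u \<in> W22 S" "v \<in> W22 S"
    using lin[rule_format, OF that, of 1 c] by simp
qed (use assms in \<open>auto simp: bounded_operator_W22_L2_def\<close>)

lemma bounded_operator_diff:
  assumes T: "bounded_operator_W22_L2 S M T" and u: "u \<in> W22 S" "v \<in> W22 S" and d: "(\<lambda>x. u x - v x) \<in> W22 S"
  shows "L2_norm S (\<lambda>x. T u x - T v x) \<le> M * W22_norm S (\<lambda>x. u x - v x)"
proof -
  have ae: "AE x in lebesgue_on S. T u x - T v x = T (\<lambda>x. u x - v x) x"
    using bounded_operatorD(2)[OF T u, of "-1"] by eventually_elim simp
  have "L2_norm S (\<lambda>x. T u x - T v x) = L2_norm S (T (\<lambda>x. u x - v x))"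
    by (rule L2_norm_cong_AE[OF L2_diff[OF bounded_operatorD(1)[OF T u(1)] bounded_operatorD(1)[OF T u(2)]] bounded_operatorD(1)[OF T d] ae])
  then show ?thesis using bounded_operatorD(3)[OF T d] by simp
qed

section \<open>Uniform bounds and Lipschitz dependence on the spectral parameter\<close>

context edge_Q begin

text \<open>One constant serves both the bound and the Lipschitz estimate in \<open>l\<close>. The
  weight \<omega> is 1 for coefficient functions and the norm of \<open>g\<close> for operators, so
  that estimates for composite expressions follow from closure rules.\<close>

definition lb :: "real \<Rightarrow> ((real \<Rightarrow> complex) \<Rightarrow> real) \<Rightarrow> (complex \<Rightarrow> (real \<Rightarrow> complex) \<Rightarrow> real \<Rightarrow> complex) \<Rightarrow> real \<Rightarrow> bool" where
  "lb R \<omega> F C \<longleftrightarrow> 0 \<le> C \<and> (\<forall>l l' g x. cmod l \<le> R \<longrightarrow> cmod l' \<le> R \<longrightarrow> g \<in> L2 Q \<longrightarrow> x \<in> {a..b} \<longrightarrow>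
     cmod (F l g x) \<le> C * \<omega> g \<and> cmod (F l g x - F l' g x) \<le> C * \<omega> g * cmod (l - l'))"

definition "LB R \<omega> F \<longleftrightarrow> (\<exists>C. lb R \<omega> F C)"

lemma LBI:
  assumes "C \<ge> 0" "\<And>l l' g x. cmod l \<le> R \<Longrightarrow> cmod l' \<le> R \<Longrightarrow> g \<in> L2 Q \<Longrightarrow> x \<in> {a..b} \<Longrightarrow>
     cmod (F l g x) \<le> C * \<omega> g \<and> cmod (F l g x - F l' g x) \<le> C * \<omega> g * cmod (l - l')"
  shows "LB R \<omega> F"
  unfolding LB_def lb_def using assms by blast

lemma lbD:
  assumes "lb R \<omega> F C"
  shows "0 \<le> C" "cmod l \<le> R \<Longrightarrow> g \<in> L2 Q \<Longrightarrow> x \<in> {a..b} \<Longrightarrow> cmod (F l g x) \<le> C * \<omega> g"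
    "cmod l \<le> R \<Longrightarrow> cmod l' \<le> R \<Longrightarrow> g \<in> L2 Q \<Longrightarrow> x \<in> {a..b} \<Longrightarrow> cmod (F l g x - F l' g x) \<le> C * \<omega> g * cmod (l - l')"
  using assms unfolding lb_def by blast+

lemma LB_add:
  assumes "LB R \<omega> F" "LB R \<omega> G" shows "LB R \<omega> (\<lambda>l g x. F l g x + G l g x)"
proof -
  obtain C where lbC: "lb R \<omega> F C" using assms(1) unfolding LB_def by blast
  note C = lbD[OF lbC]
  obtain C' where lbC': "lb R \<omega> G C'" using assms(2) unfolding LB_def by blast
  note C' = lbD[OF lbC']
  show ?thesis
  proof (rule LBI[of "C + C'"])
    fix l l' g x assume a: "cmod l \<le> R" "cmod l' \<le> R" "g \<in> L2 Q" "x \<in> {a..b}"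
    have "cmod (F l g x + G l g x) \<le> C * \<omega> g + C' * \<omega> g"
      by (rule order_trans[OF norm_triangle_ineq add_mono[OF C(2) C'(2)]]) (use a in auto)
    moreover have "cmod ((F l g x - F l' g x) + (G l g x - G l' g x)) \<le> C * \<omega> g * cmod (l - l') + C' * \<omega> g * cmod (l - l')"
      by (rule order_trans[OF norm_triangle_ineq add_mono[OF C(3)[OF a] C'(3)[OF a]]])
    ultimately show "cmod (F l g x + G l g x) \<le> (C + C') * \<omega> g \<and> cmod (F l g x + G l g x - (F l' g x + G l' g x)) \<le> (C + C') * \<omega> g * cmod (l - l')"
      by (simp add: algebra_simps)
  qed (use C(1) C'(1) in simp)
qed

lemma LB_cmult:
  assumes "LB R \<omega> F" shows "LB R \<omega> (\<lambda>l g x. c * F l g x)"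
proof -
  obtain C where lbC: "lb R \<omega> F C" using assms(1) unfolding LB_def by blast
  note C = lbD[OF lbC]
  show ?thesis
  proof (rule LBI[of "cmod c * C"])
    fix l l' g x assume a: "cmod l \<le> R" "cmod l' \<le> R" "g \<in> L2 Q" "x \<in> {a..b}"
    have "cmod (c * F l g x) \<le> cmod c * (C * \<omega> g)" unfolding norm_mult by (intro mult_left_mono C(2)) (use a in auto)
    moreover have "cmod (c * (F l g x - F l' g x)) \<le> cmod c * (C * \<omega> g * cmod (l - l'))"
      unfolding norm_mult by (intro mult_left_mono C(3)[OF a]) auto
    ultimately show "cmod (c * F l g x) \<le> cmod c * C * \<omega> g \<and> cmod (c * F l g x - c * F l' g x) \<le> cmod c * C * \<omega> g * cmod (l - l')"
      by (simp add: mult.assoc right_diff_distrib)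
  qed (use C(1) in simp)
qed

lemma LB_diff:
  assumes "LB R \<omega> F" "LB R \<omega> G" shows "LB R \<omega> (\<lambda>l g x. F l g x - G l g x)"
  using LB_add[OF assms(1) LB_cmult[OF assms(2), of "-1"]] by simp

text \<open>The increment of the product is (F - F') G + F' (G - G'). Only the second factor carries
  the weight, which keeps the result linear in the norm of \<open>g\<close>.\<close>

lemma LB_mult:
  assumes "LB R (\<lambda>_. 1) F" "LB R \<omega> G" and \<omega>: "\<And>g. \<omega> g \<ge> 0" shows "LB R \<omega> (\<lambda>l g x. F l g x * G l g x)"
proof -
  obtain C where lbC: "lb R (\<lambda>_. 1) F C" using assms(1) unfolding LB_def by blast
  note C = lbD[OF lbC]
  obtain C' where lbC': "lb R \<omega> G C'" using assms(2) unfolding LB_def by blast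
  note C' = lbD[OF lbC']
  show ?thesis
  proof (rule LBI[of "2 * C * C'"])
    fix l l' g x assume a: "cmod l \<le> R" "cmod l' \<le> R" "g \<in> L2 Q" "x \<in> {a..b}"
    have "cmod (F l g x * G l g x) \<le> (C * 1) * (C' * \<omega> g)" unfolding norm_mult
      by (intro mult_mono C(2) C'(2)) (use a C(1) in auto)
    moreover have "0 \<le> C * C' * \<omega> g" using C(1) C'(1) \<omega> by simp
    ultimately have 1: "cmod (F l g x * G l g x) \<le> 2 * C * C' * \<omega> g" by (simp add: algebra_simps)
    have "cmod ((F l g x - F l' g x) * G l g x) \<le> (C * 1 * cmod (l - l')) * (C' * \<omega> g)" unfolding norm_mult
      by (intro mult_mono C(3)[OF a] C'(2)) (use a C(1) in auto)
    moreover have "cmod (F l' g x * (G l g x - G l' g x)) \<le> (C * 1) * (C' * \<omega> g * cmod (l - l'))" unfolding norm_mult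
      by (intro mult_mono C(2) C'(3)[OF a]) (use a C(1) in auto)
    moreover have "F l g x * G l g x - F l' g x * G l' g x = (F l g x - F l' g x) * G l g x + F l' g x * (G l g x - G l' g x)"
      by (simp add: algebra_simps)
    ultimately have "cmod (F l g x * G l g x - F l' g x * G l' g x) \<le> (C * 1 * cmod (l - l')) * (C' * \<omega> g) + (C * 1) * (C' * \<omega> g * cmod (l - l'))"
      by (metis add_mono norm_triangle_mono)
    then show "cmod (F l g x * G l g x) \<le> 2 * C * C' * \<omega> g \<and> cmod (F l g x * G l g x - F l' g x * G l' g x) \<le> 2 * C * C' * \<omega> g * cmod (l - l')"
      using 1 by (simp add: algebra_simps)
  qed (use C(1) C'(1) in simp)
qed

lemma LB_at_b: "LB R \<omega> F \<Longrightarrow> LB R \<omega> (\<lambda>l g x. F l g b)"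
  unfolding LB_def lb_def using ab by fastforce

lemma LB_th:
  "LB R (\<lambda>_. 1) (\<lambda>l g x. th1 l x)" "LB R (\<lambda>_. 1) (\<lambda>l g x. th2 l x)"
  "LB R (\<lambda>_. 1) (\<lambda>l g x. dth1 l x)" "LB R (\<lambda>_. 1) (\<lambda>l g x. dth2 l x)"
  "LB R (\<lambda>_. 1) (\<lambda>l g x. th1 l 1)" "LB R (\<lambda>_. 1) (\<lambda>l g x. th2 l 1)"
  "LB R (\<lambda>_. 1) (\<lambda>l g x. dth1 l 1)" "LB R (\<lambda>_. 1) (\<lambda>l g x. dth2 l 1)"
proof -
  define T where "T = \<bar>a\<bar> + \<bar>b\<bar> + 1"
  have T: "T \<ge> 0" "\<bar>1\<bar> \<le> T" "\<And>x. x \<in> {a..b} \<Longrightarrow> \<bar>x\<bar> \<le> T" by (auto simp: T_def)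
  obtain C where C: "C \<ge> 0" "\<And>l x. cmod l \<le> R \<Longrightarrow> \<bar>x\<bar> \<le> T \<Longrightarrow>
    cmod (th1 l x) \<le> C \<and> cmod (th2 l x) \<le> C \<and> cmod (dth1 l x) \<le> C \<and> cmod (dth2 l x) \<le> C"
    using th_bound[OF T(1), of R] by blast
  obtain C' where C': "C' \<ge> 0" "\<And>l l' x. cmod l \<le> R \<Longrightarrow> cmod l' \<le> R \<Longrightarrow> \<bar>x\<bar> \<le> T \<Longrightarrow>
    cmod (th1 l x - th1 l' x) \<le> C' * cmod (l - l') \<and> cmod (th2 l x - th2 l' x) \<le> C' * cmod (l - l') \<and>
    cmod (dth1 l x - dth1 l' x) \<le> C' * cmod (l - l') \<and> cmod (dth2 l x - dth2 l' x) \<le> C' * cmod (l - l')"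
    using th_lipschitz[OF T(1), of R] by blast
  have key: "LB R (\<lambda>_. 1) F" if b: "\<And>l g x. cmod l \<le> R \<Longrightarrow> x \<in> {a..b} \<Longrightarrow> cmod (F l g x) \<le> C"
    and d: "\<And>l l' g x. cmod l \<le> R \<Longrightarrow> cmod l' \<le> R \<Longrightarrow> x \<in> {a..b} \<Longrightarrow> cmod (F l g x - F l' g x) \<le> C' * cmod (l - l')" for F
  proof (rule LBI[of "C + C'"])
    fix l l' g x assume A: "cmod l \<le> R" "cmod l' \<le> R" "g \<in> L2 Q" "x \<in> {a..b}"
    have "0 \<le> C * cmod (l - l')" using C(1) by simp
    then show "cmod (F l g x) \<le> (C + C') * 1 \<and> cmod (F l g x - F l' g x) \<le> (C + C') * 1 * cmod (l - l')"
      using b[OF A(1,4), of g] d[OF A(1,2,4), of g] C'(1) by (simp add: distrib_right)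
  qed (use C(1) C'(1) in simp)
  show "LB R (\<lambda>_. 1) (\<lambda>l g x. th1 l x)" "LB R (\<lambda>_. 1) (\<lambda>l g x. th2 l x)"
    "LB R (\<lambda>_. 1) (\<lambda>l g x. dth1 l x)" "LB R (\<lambda>_. 1) (\<lambda>l g x. dth2 l x)"
    "LB R (\<lambda>_. 1) (\<lambda>l g x. th1 l 1)" "LB R (\<lambda>_. 1) (\<lambda>l g x. th2 l 1)"
    "LB R (\<lambda>_. 1) (\<lambda>l g x. dth1 l 1)" "LB R (\<lambda>_. 1) (\<lambda>l g x. dth2 l 1)"
    by (rule key; use C(2) C'(2) T(2,3) in blast)+
qed

lemma N1_bound: assumes "g \<in> L2 Q" shows "integral {a..b} (\<lambda>t. cmod (xt g t)) \<le> sqrt (b - a) * L2_norm Q g"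
proof -
  have i: "integrable (lebesgue_on Q) (\<lambda>t. cmod (g t))" using L2_integrable[OF assms] by simp
  have "integral {a..b} (\<lambda>t. cmod (xt g t)) = (\<integral>t. cmod (g t) \<partial>lebesgue_on Q)"
    unfolding ext_integral[OF i] by (rule integral_cong) (simp add: extend_by_zero_def)
  also have "\<dots> \<le> L2_norm Q (\<lambda>_. 1) * L2_norm Q g" using L2_Cauchy_Schwarz[OF open_interval_const_L2[of 1] assms] by simp
  finally show ?thesis using L2_norm_const[of a b 1] ab by simp
qed

lemma weighted_integral_bound:
  assumes g: "g \<in> L2 Q" and f: "continuous_on UNIV f" "\<And>t. t \<in> {a..b} \<Longrightarrow> cmod (f t) \<le> C" and x: "x \<in> {a..b}" and C: "C \<ge> 0"
  shows "cmod (integral {a..x} (\<lambda>t. f t * xt g t)) \<le> C * (sqrt (b - a) * L2_norm Q g)"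
proof -
  have "cmod (integral {a..x} (\<lambda>t. f t * xt g t)) \<le> integral {a..x} (\<lambda>t. C * cmod (xt g t))"
  proof (rule integral_norm_bound_integral)
    show "(\<lambda>t. f t * xt g t) integrable_on {a..x}" by (intro loc_abs_int_integrable loc_abs_int_mult_continuous ext_loc f g)
    show "(\<lambda>t. C * cmod (xt g t)) integrable_on {a..x}" by (intro integrable_on_mult_right loc_abs_int_norm ext_loc g)
    show "cmod (f t * xt g t) \<le> C * cmod (xt g t)" if "t \<in> {a..x}" for t
      unfolding norm_mult by (intro mult_right_mono f(2)) (use that x in auto)
  qed
  also have "\<dots> = C * integral {a..x} (\<lambda>t. cmod (xt g t))" by simp
  also have "\<dots> \<le> C * integral {a..b} (\<lambda>t. cmod (xt g t))"
    using x C by (intro mult_left_mono integral_subset_le loc_abs_int_norm ext_loc g) auto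
  also have "\<dots> \<le> C * (sqrt (b - a) * L2_norm Q g)" using C N1_bound[OF g] by (rule mult_left_mono[rotated])
  finally show ?thesis .
qed

lemma LB_prim:
  assumes F: "LB R (\<lambda>_. 1) (\<lambda>l g x. f l x)" and fc: "\<And>l. continuous_on UNIV (f l)"
  shows "LB R (L2_norm Q) (\<lambda>l g x. prim a (\<lambda>t. f l t * xt g t) x)"
proof -
  obtain C where lbC: "lb R (\<lambda>_. 1) (\<lambda>l g x. f l x) C" using F unfolding LB_def by blast
  note C = lbD[OF lbC]
  have C2: "cmod l \<le> R \<Longrightarrow> x \<in> {a..b} \<Longrightarrow> cmod (f l x) \<le> C" for l x using C(2)[OF _ L2_zero] by simp
  have C3: "cmod l \<le> R \<Longrightarrow> cmod l' \<le> R \<Longrightarrow> x \<in> {a..b} \<Longrightarrow> cmod (f l x - f l' x) \<le> C * cmod (l - l')" for l l' x using C(3)[OF _ _ L2_zero] by simp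
  have li: "loc_abs_int (\<lambda>t. f l t * xt g t)" if "g \<in> L2 Q" for l g
    using that by (intro loc_abs_int_mult_continuous ext_loc fc)
  show ?thesis
  proof (rule LBI[of "C * sqrt (b - a)"])
    fix l l' g x assume A: "cmod l \<le> R" "cmod l' \<le> R" "g \<in> L2 Q" "x \<in> {a..b}"
    have ax: "a \<le> x" using A(4) by simp
    have 1: "cmod (prim a (\<lambda>t. f l t * xt g t) x) \<le> C * sqrt (b - a) * L2_norm Q g"
      using weighted_integral_bound[OF A(3) fc C2[OF A(1)] A(4) C(1)] prim_integral[OF li[OF A(3)] ax, of l] by (simp add: mult.assoc)
    have "prim a (\<lambda>t. f l t * xt g t) x - prim a (\<lambda>t. f l' t * xt g t) x = integral {a..x} (\<lambda>t. f l t * xt g t - f l' t * xt g t)"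
      unfolding prim_integral[OF li[OF A(3)] ax]
      by (rule Henstock_Kurzweil_Integration.integral_diff[symmetric]) (intro loc_abs_int_integrable li A)+
    also have "\<dots> = integral {a..x} (\<lambda>t. (f l t - f l' t) * xt g t)" by (simp add: left_diff_distrib)
    also have "cmod \<dots> \<le> (C * cmod (l - l')) * (sqrt (b - a) * L2_norm Q g)"
      by (rule weighted_integral_bound[OF A(3) _ C3[OF A(1,2)] A(4)]) (use C(1) in \<open>auto intro!: continuous_intros fc\<close>)
    finally show "cmod (prim a (\<lambda>t. f l t * xt g t) x) \<le> C * sqrt (b - a) * L2_norm Q g \<and>
      cmod (prim a (\<lambda>t. f l t * xt g t) x - prim a (\<lambda>t. f l' t * xt g t) x) \<le> C * sqrt (b - a) * L2_norm Q g * cmod (l - l')"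
      using 1 by (simp add: mult_ac)
  qed (use C(1) ab in simp)
qed

lemma LB_p: "LB R (L2_norm Q) (\<lambda>l g x. p1 l g x)" "LB R (L2_norm Q) (\<lambda>l g x. p2 l g x)"
  unfolding p1_def p2_def by (rule LB_prim[OF LB_th(1) th_cont(1)], rule LB_prim[OF LB_th(2) th_cont(2)])

lemma LB_pb: "LB R (L2_norm Q) (\<lambda>l g x. p1 l g b)" "LB R (L2_norm Q) (\<lambda>l g x. p2 l g b)"
  using LB_at_b[OF LB_p(1)] LB_at_b[OF LB_p(2)] .

lemmas LB_multN = LB_mult[OF _ _ L2_norm_nonneg]

lemma LB_G0: "LB R (L2_norm Q) G0" "LB R (L2_norm Q) dG0"
proof -
  have "LB R (L2_norm Q) (\<lambda>l g x. 1/2 * (th1 l x * (2 * p2 l g x - p2 l g b) - th2 l x * (2 * p1 l g x - p1 l g b)))"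
    by (intro LB_cmult LB_diff LB_multN LB_th LB_p LB_pb)
  then show "LB R (L2_norm Q) G0" by (simp add: G0_def[abs_def])
  have "LB R (L2_norm Q) (\<lambda>l g x. 1/2 * (dth1 l x * (2 * p2 l g x - p2 l g b) - dth2 l x * (2 * p1 l g x - p1 l g b)))"
    by (intro LB_cmult LB_diff LB_multN LB_th LB_p LB_pb)
  then show "LB R (L2_norm Q) dG0" by (simp add: dG0_def[abs_def])
qed

lemma LB_Bop: "LB R (L2_norm Q) Bop" "LB R (L2_norm Q) dBop"
proof -
  have "LB R (\<lambda>_. 1) (\<lambda>l g x. (1/2) * (dth2 l 1 - th1 l 1))" by (intro LB_cmult LB_diff LB_th)
  then have h: "LB R (\<lambda>_. 1) (\<lambda>l g x. hh l)" by (simp add: hh_def)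
  have A: "LB R (L2_norm Q) (\<lambda>l g x. cA l g)" unfolding cA_def by (intro LB_add LB_multN LB_th LB_pb h)
  have B: "LB R (L2_norm Q) (\<lambda>l g x. cB l g)" unfolding cB_def by (intro LB_diff LB_multN LB_th LB_pb h)
  have "LB R (L2_norm Q) (\<lambda>l g x. th1 l x * cA l g + th2 l x * cB l g)" by (intro LB_add LB_multN LB_th A B)
  then show "LB R (L2_norm Q) Bop" by (simp add: Bop_def[abs_def] mult.commute)
  have "LB R (L2_norm Q) (\<lambda>l g x. dth1 l x * cA l g + dth2 l x * cB l g)" by (intro LB_add LB_multN LB_th A B)
  then show "LB R (L2_norm Q) dBop" by (simp add: dBop_def[abs_def] mult.commute)
qed

text \<open>The constant \<open>C\<close> refers to the unperturbed family alone; the perturbation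
  enters through its norm bound \<open>M\<close>. Estimates are therefore uniform over all operators
  with the same bound.\<close>

definition "op_est R F C \<longleftrightarrow> 0 \<le> C \<and> (\<forall>l g. cmod l \<le> R \<longrightarrow> g \<in> L2 Q \<longrightarrow> F l g \<in> W22 Q) \<and>
  (\<forall>M Le l g. 0 \<le> M \<longrightarrow> bounded_operator_W22_L2 Q M Le \<longrightarrow> cmod l \<le> R \<longrightarrow> g \<in> L2 Q \<longrightarrow> L2_norm Q (Le (F l g)) \<le> M * C * L2_norm Q g) \<and>
  (\<forall>M Le l l' g. 0 \<le> M \<longrightarrow> bounded_operator_W22_L2 Q M Le \<longrightarrow> cmod l \<le> R \<longrightarrow> cmod l' \<le> R \<longrightarrow> g \<in> L2 Q \<longrightarrow>
    L2_norm Q (\<lambda>x. Le (F l g) x - Le (F l' g) x) \<le> M * C * cmod (l - l') * L2_norm Q g)"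

lemma op_estD:
  assumes "op_est R F C"
  shows "0 \<le> C" "cmod l \<le> R \<Longrightarrow> g \<in> L2 Q \<Longrightarrow> F l g \<in> W22 Q"
    "0 \<le> M \<Longrightarrow> bounded_operator_W22_L2 Q M Le \<Longrightarrow> cmod l \<le> R \<Longrightarrow> g \<in> L2 Q \<Longrightarrow> L2_norm Q (Le (F l g)) \<le> M * C * L2_norm Q g"
    "0 \<le> M \<Longrightarrow> bounded_operator_W22_L2 Q M Le \<Longrightarrow> cmod l \<le> R \<Longrightarrow> cmod l' \<le> R \<Longrightarrow> g \<in> L2 Q \<Longrightarrow>
      L2_norm Q (\<lambda>x. Le (F l g) x - Le (F l' g) x) \<le> M * C * cmod (l - l') * L2_norm Q g"
  using assms unfolding op_est_def by blast+

lemma op_est_mono: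
  assumes "op_est R F C" "C \<le> C'" shows "op_est R F C'"
proof -
  note E = op_estD[OF assms(1)]
  have m: "M * C * z \<le> M * C' * z" "M * C * y * z \<le> M * C' * y * z" if "0 \<le> M" "0 \<le> z" "0 \<le> y" for M y z
    using that assms(2) by (auto intro!: mult_right_mono mult_left_mono)
  show ?thesis
    unfolding op_est_def using E(1) assms(2)
    by (auto intro: E(2) order_trans[OF E(3) m(1)] order_trans[OF E(4) m(2)] simp: L2_norm_nonneg)
qed

text \<open>Pointwise Lipschitz bounds on F and F' are not enough, because the perturbation sees
  second derivatives. The increment F(l) - F(l') solves the equation with source (l - l') F(l'), so
  its full Sobolev norm is of order |l - l'|.\<close>

lemma op_bound:
  assumes F: "LB R (L2_norm Q) F" and F': "LB R (L2_norm Q) F'" and R: "R \<ge> 0"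
    and s: "\<And>l g. g \<in> L2 Q \<Longrightarrow> sol l (f g) (F l g) (F' l g)" and f: "\<And>g. g \<in> L2 Q \<Longrightarrow> f g \<in> L2 Q \<and> L2_norm Q (f g) \<le> L2_norm Q g"
  obtains C where "op_est R F C"
proof -
  obtain W where W: "W \<ge> 0" "\<And>l f u v A. cmod l \<le> R \<Longrightarrow> sol l f u v \<Longrightarrow> f \<in> L2 Q \<Longrightarrow> A \<ge> 0 \<Longrightarrow>
     (\<And>x. x \<in> Q \<Longrightarrow> cmod (u x) \<le> A \<and> cmod (v x) \<le> A) \<Longrightarrow> u \<in> W22 Q \<and> W22_norm Q u \<le> W * (A + L2_norm Q f)"
    using sol_W22[OF ab R] by blast
  obtain C1 where lbC1: "lb R (L2_norm Q) F C1" using F unfolding LB_def by blast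
  note C1 = lbD[OF lbC1]
  obtain C2 where lbC2: "lb R (L2_norm Q) F' C2" using F' unfolding LB_def by blast
  note C2 = lbD[OF lbC2]
  define K where "K = C1 + C2"
  define S where "S = sqrt (b - a)"
  have S0: "S \<ge> 0" using ab by (simp add: S_def)
  have K: "K \<ge> 0" "C1 \<le> K" "C2 \<le> K" using C1(1) C2(1) by (auto simp: K_def)
  have Km: "C1 * z \<le> K * z" "C2 * z \<le> K * z" if "z \<ge> 0" for z using K that by (auto intro: mult_right_mono)
  have w1: "F l g \<in> W22 Q \<and> W22_norm Q (F l g) \<le> W * (K * L2_norm Q g + L2_norm Q g)" if l: "cmod l \<le> R" and g: "g \<in> L2 Q" for l g
  proof -
    have "F l g \<in> W22 Q \<and> W22_norm Q (F l g) \<le> W * (K * L2_norm Q g + L2_norm Q (f g))"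
    proof (rule W(2)[OF l s[OF g]])
      show "cmod (F l g x) \<le> K * L2_norm Q g \<and> cmod (F' l g x) \<le> K * L2_norm Q g" if "x \<in> Q" for x
        using C1(2)[OF l g, of x] C2(2)[OF l g, of x] Km[OF L2_norm_nonneg[of Q g]] that by auto
    qed (use f[OF g] K(1) L2_norm_nonneg in auto)
    moreover have "W * (K * L2_norm Q g + L2_norm Q (f g)) \<le> W * (K * L2_norm Q g + L2_norm Q g)"
      using f[OF g] W(1) by (intro mult_left_mono) auto
    ultimately show ?thesis by linarith
  qed
  have w2: "(\<lambda>x. F l g x - F l' g x) \<in> W22 Q \<and> W22_norm Q (\<lambda>x. F l g x - F l' g x) \<le> W * (K * L2_norm Q g * cmod (l - l') + K * L2_norm Q g * cmod (l - l') * S)"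
    if l: "cmod l \<le> R" "cmod l' \<le> R" and g: "g \<in> L2 Q" for l l' g
  proof -
    let ?d = "\<lambda>x. (l - l') * F l' g x"
    have "sol l (\<lambda>x. f g x + (-1) * (f g x + (l' - l) * F l' g x)) (\<lambda>x. F l g x + (-1) * F l' g x) (\<lambda>x. F' l g x + (-1) * F' l' g x)"
      by (intro sol_lincomb s[OF g] sol_change_l)
    then have sd: "sol l ?d (\<lambda>x. F l g x - F l' g x) (\<lambda>x. F' l g x - F' l' g x)"
      by (rule sol_cong) (auto simp: algebra_simps)
    have dc: "continuous_on UNIV ?d" by (intro continuous_intros sol_cont(1)[OF s[OF g]])
    have db: "cmod (?d x) \<le> K * L2_norm Q g * cmod (l - l')" if "x \<in> Q" for x
    proof -
      have "cmod (F l' g x) \<le> K * L2_norm Q g" using C1(2)[OF l(2) g, of x] Km[OF L2_norm_nonneg[of Q g]] that by auto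
      then show ?thesis by (simp add: norm_mult mult.commute mult_left_mono)
    qed
    have n0: "0 \<le> K * L2_norm Q g * cmod (l - l')" using K(1) L2_norm_nonneg by simp
    have dL: "?d \<in> L2 Q" "L2_norm Q ?d \<le> K * L2_norm Q g * cmod (l - l') * S"
      using L2_bounded_continuous[OF dc _ db] ab n0 by (auto simp: S_def)
    have "(\<lambda>x. F l g x - F l' g x) \<in> W22 Q \<and> W22_norm Q (\<lambda>x. F l g x - F l' g x) \<le> W * (K * L2_norm Q g * cmod (l - l') + L2_norm Q ?d)"
    proof (rule W(2)[OF l(1) sd dL(1) n0])
      fix x assume x: "x \<in> Q"
      have z: "0 \<le> L2_norm Q g * cmod (l - l')" using L2_norm_nonneg by simp
      show "cmod (F l g x - F l' g x) \<le> K * L2_norm Q g * cmod (l - l') \<and> cmod (F' l g x - F' l' g x) \<le> K * L2_norm Q g * cmod (l - l')"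
        using C1(3)[OF l g, of x] C2(3)[OF l g, of x] Km[OF z] x by (auto simp: mult.assoc)
    qed
    moreover have "W * (K * L2_norm Q g * cmod (l - l') + L2_norm Q ?d) \<le> W * (K * L2_norm Q g * cmod (l - l') + K * L2_norm Q g * cmod (l - l') * S)"
      using dL(2) W(1) by (intro mult_left_mono) auto
    ultimately show ?thesis by linarith
  qed
  show ?thesis
  proof (rule that[of "W * (K + 1) + W * (K + K * S)"], unfold op_est_def, intro conjI allI impI)
    show "0 \<le> W * (K + 1) + W * (K + K * S)" using W(1) K(1) S0 by simp
    show "F l g \<in> W22 Q" if "cmod l \<le> R" "g \<in> L2 Q" for l g using w1[OF that] by simp
    have p: "0 \<le> W * (K + K * S)" "0 \<le> W * (K + 1)" using W(1) K(1) S0 by auto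
    fix M Le l g assume M: "M \<ge> (0::real)" and Le: "bounded_operator_W22_L2 Q M Le" and l: "cmod l \<le> R" and g: "g \<in> L2 Q"
    have "L2_norm Q (Le (F l g)) \<le> M * W22_norm Q (F l g)" using w1[OF l g] bounded_operatorD(3)[OF Le] by blast
    also have "\<dots> \<le> M * (W * (K * L2_norm Q g + L2_norm Q g))" using w1[OF l g] M by (intro mult_left_mono) auto
    also have "\<dots> = M * ((W * (K + 1)) * L2_norm Q g)" by (simp add: algebra_simps)
    also have "\<dots> \<le> M * ((W * (K + 1) + W * (K + K * S)) * L2_norm Q g)"
      using M p L2_norm_nonneg by (intro mult_left_mono mult_right_mono) auto
    finally show "L2_norm Q (Le (F l g)) \<le> M * (W * (K + 1) + W * (K + K * S)) * L2_norm Q g" by (simp add: mult.assoc)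
    fix l' assume l': "cmod l' \<le> R"
    have "L2_norm Q (\<lambda>x. Le (F l g) x - Le (F l' g) x) \<le> M * W22_norm Q (\<lambda>x. F l g x - F l' g x)"
      using bounded_operator_diff[OF Le] w1[OF l g] w1[OF l' g] w2[OF l l' g] by blast
    also have "\<dots> \<le> M * (W * (K * L2_norm Q g * cmod (l - l') + K * L2_norm Q g * cmod (l - l') * S))"
      using w2[OF l l' g] M by (intro mult_left_mono) auto
    also have "\<dots> = M * ((W * (K + K * S)) * (cmod (l - l') * L2_norm Q g))" by (simp add: algebra_simps)
    also have "\<dots> \<le> M * ((W * (K + 1) + W * (K + K * S)) * (cmod (l - l') * L2_norm Q g))"
      using M p L2_norm_nonneg by (intro mult_left_mono mult_right_mono) auto
    finally show "L2_norm Q (\<lambda>x. Le (F l g) x - Le (F l' g) x) \<le> M * (W * (K + 1) + W * (K + K * S)) * cmod (l - l') * L2_norm Q g"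
      by (simp add: mult.assoc)
  qed
qed

lemma xt_L2: assumes "g \<in> L2 Q" shows "xt g \<in> L2 Q" "L2_norm Q (xt g) = L2_norm Q g"
proof -
  have ae: "AE x in lebesgue_on Q. g x = xt g x" by (intro AE_I2) (simp add: extend_by_zero_def)
  show 1: "xt g \<in> L2 Q" using L2_cong_AE[OF assms ae] by simp
  show "L2_norm Q (xt g) = L2_norm Q g" using L2_norm_cong_AE[OF assms 1 ae] by simp
qed

lemma operator_constants:
  obtains C where "op_est R G0 C" "op_est R Bop C"
proof (cases "R \<ge> 0")
  case True
  obtain C1 where C1: "op_est R G0 C1" by (rule op_bound[OF LB_G0 True, of xt]) (use sol_G0 xt_L2 in auto)
  obtain C2 where C2: "op_est R Bop C2"
    by (rule op_bound[OF LB_Bop True, of "\<lambda>_ _. 0"]) (use sol_Bop L2_zero L2_norm_nonneg in \<open>auto simp: L2_norm_def\<close>)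
  show ?thesis
    using that[of "C1 + C2"] op_est_mono[OF C1, of "C1 + C2"] op_est_mono[OF C2, of "C1 + C2"] op_estD(1)[OF C1] op_estD(1)[OF C2] by simp
next
  case False
  then have "\<not> cmod l \<le> R" for l using norm_ge_zero[of l] by linarith
  then show ?thesis using that[of 0] by (simp add: op_est_def)
qed

end

section \<open>The regularised operator family\<close>

lemma L2_bounded_op_scale:
  assumes "L2_bounded_op S C T" shows "L2_bounded_op S (cmod c * C) (\<lambda>g x. c * T g x)"
  unfolding L2_bounded_op_def
proof (intro conjI ballI allI)
  note D = L2_bounded_opD[OF assms]
  fix g assume g: "g \<in> L2 S"
  show "(\<lambda>x. c * T g x) \<in> L2 S" by (intro L2_cmult D g)
  have "cmod c * L2_norm S (T g) \<le> cmod c * (C * L2_norm S g)" by (intro mult_left_mono D g) auto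
  then show "L2_norm S (\<lambda>x. c * T g x) \<le> cmod c * C * L2_norm S g" by (simp add: L2_norm_cmult mult.assoc)
  fix h k assume "h \<in> L2 S"
  from D(2)[OF g this, of k] show "AE x in lebesgue_on S. c * T (\<lambda>y. g y + k * h y) x = c * T g x + k * (c * T h x)"
    by eventually_elim (simp add: algebra_simps)
qed

text \<open>h - h' = T (h - h') + (T - T') h', and \<kappa> \<le> 1/2 lets the first term be
  absorbed at the price of a factor 2.\<close>

lemma L2_fixpoint_perturb:
  assumes T: "L2_bounded_op S \<kappa> T" "\<kappa> \<le> 1/2" and T': "L2_bounded_op S \<kappa> T'" and f: "f \<in> L2 S"
    and h: "h \<in> L2 S" "AE x in lebesgue_on S. h x = f x + T h x"
    and h': "h' \<in> L2 S" "AE x in lebesgue_on S. h' x = f x + T' h' x"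
    and d: "L2_norm S (\<lambda>x. T h' x - T' h' x) \<le> \<delta>"
  shows "L2_norm S (\<lambda>x. h x - h' x) \<le> 2 * \<delta>"
proof -
  note D = L2_bounded_opD[OF T(1)] and D' = L2_bounded_opD[OF T']
  have L1: "(\<lambda>x. T h x - T h' x) \<in> L2 S" and L2': "(\<lambda>x. T h' x - T' h' x) \<in> L2 S"
    by (intro L2_diff D D' h h')+
  have ae: "AE x in lebesgue_on S. h x - h' x = (T h x - T h' x) + (T h' x - T' h' x)"
    using h(2) h'(2) by eventually_elim simp
  have "L2_norm S (\<lambda>x. h x - h' x) = L2_norm S (\<lambda>x. (T h x - T h' x) + (T h' x - T' h' x))"
    by (rule L2_norm_cong_AE[OF L2_diff[OF h(1) h'(1)] L2_add[OF L1 L2'] ae])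
  also have "\<dots> \<le> \<kappa> * L2_norm S (\<lambda>x. h x - h' x) + \<delta>"
    using L2_norm_triangle[OF L1 L2'] L2_bounded_op_diff(2)[OF T(1) h(1) h'(1)] d by linarith
  also have "\<dots> \<le> 1/2 * L2_norm S (\<lambda>x. h x - h' x) + \<delta>"
    using T(2) L2_norm_nonneg by (intro add_right_mono mult_right_mono) auto
  finally show ?thesis by simp
qed

lemma L2_fixpoint_unique:
  assumes T: "L2_bounded_op S \<kappa> T" "\<kappa> \<le> 1/2" and f: "f \<in> L2 S"
    and h: "h \<in> L2 S" "AE x in lebesgue_on S. h x = f x + T h x"
    and h': "h' \<in> L2 S" "AE x in lebesgue_on S. h' x = f x + T h' x"
  shows "AE x in lebesgue_on S. h x = h' x"
proof -
  have "L2_norm S (\<lambda>x. h x - h' x) \<le> 2 * 0"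
    by (rule L2_fixpoint_perturb[OF T T(1) f h h']) (simp add: L2_norm_def)
  then have "L2_norm S (\<lambda>x. h x - h' x) = 0" using L2_norm_nonneg[of S "\<lambda>x. h x - h' x"] by simp
  then have "AE x in lebesgue_on S. h x - h' x = 0" using L2_norm_zero_iff[OF L2_diff[OF h(1) h'(1)]] by simp
  then show ?thesis by simp
qed

text \<open>The increment of 1/z is |z - z'| / (|z| |z'|), at most |z - z'| / |z'|^2 when z' is the
  smaller point; the quadratic bound on \<open>d\<close> cancels the denominator. For z' = 0 that
  bound forces d = 0.\<close>

lemma inverse_diff_bound:
  fixes z z' d :: complex
  assumes "cmod z' \<le> cmod z" "cmod d \<le> \<kappa> * (cmod z')\<^sup>2" "\<kappa> \<ge> 0"
  shows "cmod (1 / z - 1 / z') * cmod d \<le> \<kappa> * cmod (z - z')"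
proof (cases "z' = 0")
  case True
  then show ?thesis using assms by simp
next
  case False
  then have z: "z \<noteq> 0" "cmod z' > 0" "cmod z > 0" using assms(1) by auto
  have "1 / z - 1 / z' = (z' - z) / (z * z')" using z False by (simp add: field_simps)
  then have "cmod (1 / z - 1 / z') = cmod (z - z') / (cmod z * cmod z')" by (simp add: norm_divide norm_mult norm_minus_commute)
  also have "\<dots> \<le> cmod (z - z') / (cmod z' * cmod z')"
    using z assms(1) by (intro divide_left_mono mult_right_mono mult_pos_pos) auto
  finally have "cmod (1 / z - 1 / z') * cmod d \<le> (cmod (z - z') / (cmod z' * cmod z')) * (\<kappa> * (cmod z')\<^sup>2)"
    using assms(2) by (intro mult_mono) auto
  also have "\<dots> = \<kappa> * cmod (z - z')" using z by (simp add: power2_eq_square)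
  finally show ?thesis .
qed

context edge_Q begin

text \<open>For l - mu = O(z^2) the quotient is O(z). At z = 0 totalised division makes the quotient
  vanish, which is its limiting value, so the family includes the edge itself.\<close>

definition "T Le l z g x = Le (G0 l g) x + (of_real sg / (2 * z)) * (Le (Bop l g) x - Le (Bop mc g) x)"

lemma cmod_sg [simp]: "cmod (of_real sg) = 1" "\<bar>sg\<bar> = 1" using sg2(2) by auto

text \<open>The hypotheses on \<open>l\<close> and \<open>l'\<close> are those satisfied by an
  analytic function of z^2. The constant is proportional to \<open>M\<close> and does not depend on
  the perturbation otherwise.\<close>

lemma T_props:
  assumes \<kappa>: "\<kappa> \<ge> 0"
  obtains C where "C \<ge> 0"
    "\<And>l g. cmod (l - mc) \<le> \<kappa> \<Longrightarrow> g \<in> L2 Q \<Longrightarrow> G0 l g \<in> W22 Q \<and> Bop l g \<in> W22 Q"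
    "\<And>M Le l z. M \<ge> 0 \<Longrightarrow> bounded_operator_W22_L2 Q M Le \<Longrightarrow> cmod z \<le> 1 \<Longrightarrow> cmod (l - mc) \<le> \<kappa> * (cmod z)\<^sup>2 \<Longrightarrow>
      L2_bounded_op Q (M * C) (T Le l z)"
    "\<And>M Le l z l' z' g. M \<ge> 0 \<Longrightarrow> bounded_operator_W22_L2 Q M Le \<Longrightarrow> cmod z \<le> 1 \<Longrightarrow> cmod z' \<le> 1 \<Longrightarrow>
      cmod (l - mc) \<le> \<kappa> * (cmod z)\<^sup>2 \<Longrightarrow> cmod (l' - mc) \<le> \<kappa> * (cmod z')\<^sup>2 \<Longrightarrow>
      cmod (l - l') \<le> \<kappa> * cmod (z - z') * (cmod z + cmod z') \<Longrightarrow> g \<in> L2 Q \<Longrightarrow>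
      L2_norm Q (\<lambda>x. T Le l z g x - T Le l' z' g x) \<le> M * C * cmod (z - z') * L2_norm Q g"
    "\<And>M Le l g. M \<ge> 0 \<Longrightarrow> bounded_operator_W22_L2 Q M Le \<Longrightarrow> cmod (l - mc) \<le> \<kappa> \<Longrightarrow> g \<in> L2 Q \<Longrightarrow>
      L2_norm Q (Le (G0 l g)) \<le> M * C * L2_norm Q g"
proof -
  define R where "R = cmod mc + \<kappa>"
  obtain C where CG: "op_est R G0 C" and CB: "op_est R Bop C" by (rule operator_constants)
  note G = op_estD[OF CG] and B' = op_estD[OF CB]
  note C = G(1)
  have lR: "cmod l \<le> R" if "cmod (l - mc) \<le> \<kappa>" for l
    using norm_triangle_sub[of l mc] that by (simp add: R_def)
  have mR: "cmod mc \<le> R" using \<kappa> by (simp add: R_def)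
  have lk: "cmod (l - mc) \<le> \<kappa>" if "cmod (l - mc) \<le> \<kappa> * (cmod z)\<^sup>2" "cmod z \<le> 1" for l z
  proof -
    have "\<kappa> * (cmod z)\<^sup>2 \<le> \<kappa> * 1" using that(2) \<kappa> by (intro mult_left_mono) (auto simp: power_le_one)
    then show ?thesis using that(1) by simp
  qed
  \<comment> \<open>The Lipschitz estimate costs 2 \<kappa> C for \<open>G0\<close>, \<kappa> C for
    the increment of \<open>Bop\<close> and \<kappa> C for the increment of 1/z; the summand C
    covers the plain bound on \<open>G0\<close>.\<close>
  define C' where "C' = C + 2 * \<kappa> * C + 2 * \<kappa> * C"
  have C': "C' \<ge> 0" using C \<kappa> by (simp add: C'_def)
  show ?thesis
  proof (rule that[of C'])
    show "G0 l g \<in> W22 Q \<and> Bop l g \<in> W22 Q" if "cmod (l - mc) \<le> \<kappa>" "g \<in> L2 Q" for l g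
      using G(2) B'(2) lR[OF that(1)] that(2) by blast
  next
    fix M Le l z assume A: "M \<ge> (0::real)" "bounded_operator_W22_L2 Q M Le" "cmod z \<le> 1" "cmod (l - mc) \<le> \<kappa> * (cmod z)\<^sup>2"
    have l: "cmod l \<le> R" using lR lk A by blast
    note B = bounded_operatorD[OF A(2)]
    show "L2_bounded_op Q (M * C') (T Le l z)"
      unfolding L2_bounded_op_def
    proof (intro conjI ballI allI)
      fix g assume g: "g \<in> L2 Q"
      have W: "G0 l g \<in> W22 Q" "Bop l g \<in> W22 Q" "Bop mc g \<in> W22 Q" using G(2)[OF l g] B'(2)[OF l g] G(2)[OF mR g] B'(2)[OF mR g] by auto
      have dL: "(\<lambda>x. Le (Bop l g) x - Le (Bop mc g) x) \<in> L2 Q" by (intro L2_diff B W)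
      show "T Le l z g \<in> L2 Q" unfolding T_def by (intro L2_lincomb dL B W)
      have "L2_norm Q (T Le l z g) \<le> L2_norm Q (Le (G0 l g)) + L2_norm Q (\<lambda>x. (of_real sg / (2 * z)) * (Le (Bop l g) x - Le (Bop mc g) x))"
        unfolding T_def by (rule L2_norm_triangle[OF B(1)[OF W(1)] L2_cmult[OF dL]])
      also have "L2_norm Q (\<lambda>x. (of_real sg / (2 * z)) * (Le (Bop l g) x - Le (Bop mc g) x))
          = (1 / (2 * cmod z)) * L2_norm Q (\<lambda>x. Le (Bop l g) x - Le (Bop mc g) x)"
        unfolding L2_norm_cmult by (simp add: norm_divide norm_mult)
      also have "\<dots> \<le> (1 / (2 * cmod z)) * (M * C * cmod (l - mc) * L2_norm Q g)"
        using B'(4)[OF A(1,2) l mR g] by (intro mult_left_mono) auto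
      also have "\<dots> = ((1 / (2 * cmod z)) * cmod (l - mc)) * (M * C * L2_norm Q g)" by (simp add: mult_ac)
      also have "\<dots> \<le> \<kappa> * (M * C * L2_norm Q g)"
      proof (rule mult_right_mono)
        show "(1 / (2 * cmod z)) * cmod (l - mc) \<le> \<kappa>"
        proof (cases "z = 0")
          case False
          have "(1 / (2 * cmod z)) * cmod (l - mc) \<le> (1 / (2 * cmod z)) * (\<kappa> * (cmod z)\<^sup>2)" using A(4) by (intro mult_left_mono) auto
          also have "\<dots> = \<kappa> * (cmod z / 2)" using False by (simp add: power2_eq_square)
          also have "\<dots> \<le> \<kappa> * 1" using \<kappa> A(3) by (intro mult_left_mono) auto
          finally show ?thesis by simp
        qed (use \<kappa> in simp)
      qed (use A(1) C L2_norm_nonneg in simp)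
      also have "L2_norm Q (Le (G0 l g)) + \<kappa> * (M * C * L2_norm Q g) \<le> M * C' * L2_norm Q g"
      proof -
        have "0 \<le> 3 * (\<kappa> * (M * C * L2_norm Q g))" using \<kappa> A(1) C L2_norm_nonneg by simp
        then show ?thesis using G(3)[OF A(1,2) l g] by (simp add: C'_def algebra_simps)
      qed
      finally show "L2_norm Q (T Le l z g) \<le> M * C' * L2_norm Q g" by simp
      fix h k assume h: "h \<in> L2 Q"
      have W': "G0 l h \<in> W22 Q" "Bop l h \<in> W22 Q" "Bop mc h \<in> W22 Q" using G(2)[OF l h] B'(2)[OF l h] G(2)[OF mR h] B'(2)[OF mR h] by auto
      show "AE x in lebesgue_on Q. T Le l z (\<lambda>y. g y + k * h y) x = T Le l z g x + k * T Le l z h x"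
        using B(2)[OF W(1) W'(1), of k] B(2)[OF W(2) W'(2), of k] B(2)[OF W(3) W'(3), of k]
        unfolding T_def G0_linear[OF g h, abs_def] Bop_linear[OF g h, abs_def]
        by eventually_elim (simp add: algebra_simps)
    qed
  next
    fix M Le l z l' z' g
    assume A: "M \<ge> (0::real)" "bounded_operator_W22_L2 Q M Le" "cmod z \<le> 1" "cmod z' \<le> 1"
      "cmod (l - mc) \<le> \<kappa> * (cmod z)\<^sup>2" "cmod (l' - mc) \<le> \<kappa> * (cmod z')\<^sup>2"
      "cmod (l - l') \<le> \<kappa> * cmod (z - z') * (cmod z + cmod z')" and g: "g \<in> L2 Q"
    note B = bounded_operatorD[OF A(2)]
    \<comment> \<open>The point of smaller modulus is called \<open>z'\<close>: the factor 1/z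
      multiplies the increment of \<open>Bop\<close>, and the increment of 1/z is paired with the
      quadratic bound at \<open>z'\<close>. The symmetric case follows by exchange.\<close>
    have main: "L2_norm Q (\<lambda>x. T Le l z g x - T Le l' z' g x) \<le> M * C' * cmod (z - z') * L2_norm Q g"
      if A': "cmod z \<le> 1" "cmod z' \<le> 1" "cmod (l - mc) \<le> \<kappa> * (cmod z)\<^sup>2" "cmod (l' - mc) \<le> \<kappa> * (cmod z')\<^sup>2"
      "cmod (l - l') \<le> \<kappa> * cmod (z - z') * (cmod z + cmod z')" and zz: "cmod z' \<le> cmod z" for l z l' z'
    proof -
      have l: "cmod l \<le> R" "cmod l' \<le> R" using lR lk A' by blast+
      have W: "G0 l g \<in> W22 Q" "Bop l g \<in> W22 Q" "Bop mc g \<in> W22 Q" "G0 l' g \<in> W22 Q" "Bop l' g \<in> W22 Q"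
        using G(2)[OF l(1) g] B'(2)[OF l(1) g] G(2)[OF l(2) g] B'(2)[OF l(2) g] G(2)[OF mR g] B'(2)[OF mR g] by auto
      let ?n = "L2_norm Q g" and ?d = "cmod (z - z')"
      let ?X = "\<lambda>x. Le (G0 l g) x - Le (G0 l' g) x"
      let ?Y = "\<lambda>x. Le (Bop l g) x - Le (Bop l' g) x"
      let ?Z = "\<lambda>x. Le (Bop l' g) x - Le (Bop mc g) x"
      have L: "?X \<in> L2 Q" "?Y \<in> L2 Q" "?Z \<in> L2 Q" by (intro L2_diff B W)+
      have MC: "0 \<le> M * C * ?n" using A(1) C L2_norm_nonneg by simp
      have eq: "T Le l z g x - T Le l' z' g x = (?X x + (of_real sg / (2 * z)) * ?Y x) + (of_real sg / 2 * (1 / z - 1 / z')) * ?Z x" for x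
        by (simp add: T_def algebra_simps diff_divide_distrib add_divide_distrib)
      have n1: "L2_norm Q ?X \<le> (2 * \<kappa> * ?d) * (M * C * ?n)"
      proof -
        have "\<kappa> * ?d * (cmod z + cmod z') \<le> \<kappa> * ?d * 2" using A' \<kappa> by (intro mult_left_mono) auto
        then have "cmod (l - l') \<le> 2 * \<kappa> * ?d" using A'(5) by (simp add: mult_ac)
        from mult_right_mono[OF this MC] show ?thesis using G(4)[OF A(1,2) l g] by (simp add: mult_ac)
      qed
      have n2: "L2_norm Q (\<lambda>x. (of_real sg / (2 * z)) * ?Y x) \<le> (\<kappa> * ?d) * (M * C * ?n)"
      proof -
        have "(1 / (2 * cmod z)) * cmod (l - l') \<le> \<kappa> * ?d"
        proof (cases "z = 0")
          case False
          have "(1 / (2 * cmod z)) * cmod (l - l') \<le> (1 / (2 * cmod z)) * (\<kappa> * ?d * (cmod z + cmod z'))" using A'(5) by (intro mult_left_mono) auto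
          also have "\<dots> \<le> (1 / (2 * cmod z)) * (\<kappa> * ?d * (2 * cmod z))" using zz \<kappa> by (intro mult_left_mono) auto
          also have "\<dots> = \<kappa> * ?d" using False by simp
          finally show ?thesis .
        qed (use \<kappa> in simp)
        from mult_right_mono[OF this MC] have "(1 / (2 * cmod z)) * (M * C * cmod (l - l') * ?n) \<le> (\<kappa> * ?d) * (M * C * ?n)"
          by (simp add: mult_ac)
        moreover have "(1 / (2 * cmod z)) * L2_norm Q ?Y \<le> (1 / (2 * cmod z)) * (M * C * cmod (l - l') * ?n)"
          using B'(4)[OF A(1,2) l g] by (intro mult_left_mono) auto
        moreover have "L2_norm Q (\<lambda>x. (of_real sg / (2 * z)) * ?Y x) = (1 / (2 * cmod z)) * L2_norm Q ?Y"
          unfolding L2_norm_cmult by (simp add: norm_divide norm_mult)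
        ultimately show ?thesis by linarith
      qed
      have n3: "L2_norm Q (\<lambda>x. (of_real sg / 2 * (1 / z - 1 / z')) * ?Z x) \<le> (\<kappa> * ?d) * (M * C * ?n)"
      proof -
        have "L2_norm Q (\<lambda>x. (of_real sg / 2 * (1 / z - 1 / z')) * ?Z x) = (1/2 * cmod (1 / z - 1 / z')) * L2_norm Q ?Z"
          unfolding L2_norm_cmult by (simp add: norm_divide norm_mult)
        also have "\<dots> \<le> (1/2 * cmod (1 / z - 1 / z')) * (M * C * cmod (l' - mc) * ?n)"
          using B'(4)[OF A(1,2) l(2) mR g] by (intro mult_left_mono) auto
        also have "\<dots> = (1/2 * (cmod (1 / z - 1 / z') * cmod (l' - mc))) * (M * C * ?n)" by (simp add: mult_ac)
        also have "\<dots> \<le> (\<kappa> * ?d) * (M * C * ?n)"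
          using inverse_diff_bound[OF zz A'(4) \<kappa>] mult_nonneg_nonneg[OF norm_ge_zero[of "1 / z - 1 / z'"] norm_ge_zero[of "l' - mc"]]
          by (intro mult_right_mono MC) linarith
        finally show ?thesis .
      qed
      have "L2_norm Q (\<lambda>x. T Le l z g x - T Le l' z' g x) \<le> L2_norm Q ?X + L2_norm Q (\<lambda>x. (of_real sg / (2 * z)) * ?Y x)
          + L2_norm Q (\<lambda>x. (of_real sg / 2 * (1 / z - 1 / z')) * ?Z x)"
        unfolding eq
        using L2_norm_triangle[OF L2_lincomb[OF L(1,2)] L2_cmult[OF L(3)], of "of_real sg / (2 * z)" "of_real sg / 2 * (1 / z - 1 / z')"]
          L2_norm_triangle[OF L(1) L2_cmult[OF L(2)], of "of_real sg / (2 * z)"] by linarith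
      also have "\<dots> \<le> (2 * \<kappa> * ?d) * (M * C * ?n) + (\<kappa> * ?d) * (M * C * ?n) + (\<kappa> * ?d) * (M * C * ?n)"
        using n1 n2 n3 by linarith
      also have "\<dots> \<le> M * C' * ?d * ?n"
      proof -
        have "0 \<le> ?d * (M * C * ?n)" using MC by simp
        then show ?thesis by (simp add: C'_def algebra_simps)
      qed
      finally show ?thesis .
    qed
    show "L2_norm Q (\<lambda>x. T Le l z g x - T Le l' z' g x) \<le> M * C' * cmod (z - z') * L2_norm Q g"
    proof (cases "cmod z' \<le> cmod z")
      case True then show ?thesis using main A by blast
    next
      case False
      have "L2_norm Q (\<lambda>x. T Le l z g x - T Le l' z' g x) = L2_norm Q (\<lambda>x. T Le l' z' g x - T Le l z g x)"
        by (simp add: L2_norm_def norm_minus_commute)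
      also have "\<dots> \<le> M * C' * cmod (z' - z) * L2_norm Q g"
        by (rule main) (use A False in \<open>auto simp: norm_minus_commute add.commute\<close>)
      finally show ?thesis by (simp add: norm_minus_commute)
    qed
  next
    fix M Le l g assume A: "M \<ge> (0::real)" "bounded_operator_W22_L2 Q M Le" "cmod (l - mc) \<le> \<kappa>" "g \<in> L2 Q"
    have "C \<le> C'" using C \<kappa> by (simp add: C'_def)
    then have "M * C * L2_norm Q g \<le> M * C' * L2_norm Q g" using A(1) by (intro mult_right_mono mult_left_mono L2_norm_nonneg)
    then show "L2_norm Q (Le (G0 l g)) \<le> M * C' * L2_norm Q g" using G(3)[OF A(1,2) lR[OF A(3)] A(4)] by linarith
  qed (rule C')
qed

end

section \<open>Eigenfunctions on the line\<close>

lemma integral_shift_real: "integral {x..y} (\<lambda>t. f (t + c)) = integral {x+c..y+c} f" for c :: real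
  using integral_shift_real_ivl[of "x + c" c "y + c" f] by simp

lemma cont_sq_integrable: "continuous_on UNIV f \<Longrightarrow> (\<lambda>t::real. (cmod (f t))\<^sup>2) integrable_on {x..y}"
  by (intro integrable_continuous_real continuous_intros) (auto intro: continuous_on_subset)

text \<open>If the modulus does not decrease under unit shifts, the integral of its square over k
  consecutive unit intervals is at least k times the first one; boundedness forces the first to be
  0.\<close>

lemma tail_growth:
  fixes v :: "real \<Rightarrow> complex"
  assumes v: "continuous_on UNIV v" and mono: "\<And>x. cmod (v x) \<le> cmod (v (x + 1))"
    and B: "\<And>x y. b \<le> x \<Longrightarrow> x \<le> y \<Longrightarrow> integral {x..y} (\<lambda>t. (cmod (v t))\<^sup>2) \<le> B" and x: "b \<le> x"
  shows "v x = 0"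
proof -
  let ?F = "\<lambda>t. (cmod (v t))\<^sup>2"
  note ci = cont_sq_integrable[OF v]
  define I where "I = integral {x..x+1} ?F"
  have mono_n: "cmod (v t) \<le> cmod (v (t + real k))" for t k
  proof (induction k)
    case (Suc k) show ?case using Suc mono[of "t + real k"] by (simp add: add_ac)
  qed simp
  have step: "I \<le> integral {x+real k..x+real k+1} ?F" for k
  proof -
    have "I \<le> integral {x..x+1} (\<lambda>t. ?F (t + real k))"
      unfolding I_def
    proof (rule integral_le[OF ci])
      show "(\<lambda>t. ?F (t + real k)) integrable_on {x..x+1}"
        by (rule cont_sq_integrable) (intro continuous_on_compose2[OF v] continuous_intros, auto)
    qed (intro power_mono mono_n, auto)
    then show ?thesis using integral_shift_real[of x "x+1" ?F "real k"] by (simp add: algebra_simps)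
  qed
  have "real k * I \<le> integral {x..x+real k} ?F" for k
  proof (induction k)
    case (Suc k)
    have "integral {x..x+real (Suc k)} ?F = integral {x..x+real k} ?F + integral {x+real k..x+real k+1} ?F"
      using Henstock_Kurzweil_Integration.integral_combine[of x "x+real k" "x + real (Suc k)" ?F] ci by (simp add: algebra_simps)
    then show ?case using Suc step[of k] by (simp add: algebra_simps)
  qed simp
  then have le: "real k * I \<le> B" for k using B[OF x, of "x + real k"] by (meson le_add_same_cancel1 of_nat_0_le_iff order_trans)
  have "I \<le> 0"
  proof (rule ccontr)
    assume "\<not> I \<le> 0"
    then obtain k where "B < real k * I" using reals_Archimedean3[of I] by auto
    then show False using le[of k] by simp
  qed
  moreover have "I \<ge> 0" unfolding I_def by (rule integral_nonneg[OF ci]) auto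
  ultimately have "(?F has_integral 0) (cbox x (x+1))" using integrable_integral[OF ci, of x "x+1"] by (simp add: I_def)
  then have "?F x = 0"
    by (rule has_integral_0_cbox_imp_0[rotated 2]) (auto intro!: continuous_intros continuous_on_subset[OF v])
  then show ?thesis by simp
qed

lemma tail_growth_left:
  fixes v :: "real \<Rightarrow> complex"
  assumes v: "continuous_on UNIV v" and mono: "\<And>x. cmod (v x) \<le> cmod (v (x - 1))"
    and B: "\<And>x y. y \<le> a \<Longrightarrow> x \<le> y \<Longrightarrow> integral {x..y} (\<lambda>t. (cmod (v t))\<^sup>2) \<le> B" and x: "x \<le> a"
  shows "v x = 0"
proof -
  have "v (- (- x)) = 0"
  proof (rule tail_growth[where v="\<lambda>t. v (- t)" and x="- x" and b="- a" and B=B])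
    show "continuous_on UNIV (\<lambda>t. v (- t))" by (intro continuous_on_compose2[OF v] continuous_intros) auto
    show "cmod (v (- t)) \<le> cmod (v (- (t + 1)))" for t using mono[of "- t"] by (simp add: minus_add_distrib)
    fix s t assume st: "- a \<le> s" "s \<le> (t :: real)"
    have "integral {s..t} (\<lambda>r. (cmod (v (- r)))\<^sup>2) = integral {- t..- s} (\<lambda>r. (cmod (v r))\<^sup>2)"
      using Henstock_Kurzweil_Integration.integral_reflect_real[of "- s" "- t" "\<lambda>r. (cmod (v r))\<^sup>2"] by simp
    then show "integral {s..t} (\<lambda>r. (cmod (v (- r)))\<^sup>2) \<le> B" using B[of "- s" "- t"] st by simp
  qed (use x in auto)
  then show ?thesis by simp
qed

text \<open>The integrals over successive unit intervals form a geometric series of ratio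
  r^2.\<close>

lemma tail_decay:
  fixes f :: "real \<Rightarrow> complex"
  assumes f: "continuous_on UNIV f" and r: "0 \<le> r" "r < 1" and d: "\<And>x. b \<le> x \<Longrightarrow> cmod (f (x + 1)) = r * cmod (f x)"
  shows "\<exists>B. \<forall>y\<ge>b. integral {b..y} (\<lambda>t. (cmod (f t))\<^sup>2) \<le> B"
proof -
  let ?F = "\<lambda>t. (cmod (f t))\<^sup>2"
  note ci = cont_sq_integrable[OF f]
  define I where "I = integral {b..b+1} ?F"
  have I0: "I \<ge> 0" unfolding I_def by (rule integral_nonneg[OF ci]) auto
  have r2: "0 \<le> r\<^sup>2" "r\<^sup>2 < 1" using r by (auto simp: power_less_one_iff)
  have K: "integral {b..b+real k} ?F \<le> I / (1 - r\<^sup>2)" for k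
  proof (induction k)
    case 0 show ?case using I0 r2 by simp
  next
    case (Suc k)
    have "integral {b..b+real (Suc k)} ?F = I + integral {b+1..b+real k+1} ?F"
      using Henstock_Kurzweil_Integration.integral_combine[of b "b+1" "b + real (Suc k)" ?F] ci by (simp add: I_def algebra_simps)
    also have "integral {b+1..b+real k+1} ?F = integral {b..b+real k} (\<lambda>t. ?F (t + 1))" using integral_shift_real[of b "b + real k" ?F 1] by simp
    also have "\<dots> = integral {b..b+real k} (\<lambda>t. r\<^sup>2 * ?F t)" by (rule integral_cong) (simp add: d power_mult_distrib)
    also have "\<dots> = r\<^sup>2 * integral {b..b+real k} ?F" by simp
    also have "I + \<dots> \<le> I + r\<^sup>2 * (I / (1 - r\<^sup>2))" using Suc r2 by (intro add_left_mono mult_left_mono) auto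
    also have "\<dots> = I / (1 - r\<^sup>2)" using r2 by (simp add: field_simps)
    finally show ?case by simp
  qed
  have "integral {b..y} ?F \<le> I / (1 - r\<^sup>2)" if "y \<ge> b" for y
  proof -
    obtain k :: nat where "y - b \<le> real k" using real_arch_simple by blast
    then have "integral {b..y} ?F \<le> integral {b..b+real k} ?F" by (intro integral_subset_le ci) auto
    then show ?thesis using K[of k] by linarith
  qed
  then show ?thesis by blast
qed

lemma tail_decay_left:
  fixes f :: "real \<Rightarrow> complex"
  assumes f: "continuous_on UNIV f" and r: "0 \<le> r" "r < 1" and d: "\<And>x. x \<le> a \<Longrightarrow> cmod (f (x - 1)) = r * cmod (f x)"
  shows "\<exists>B. \<forall>y\<le>a. integral {y..a} (\<lambda>t. (cmod (f t))\<^sup>2) \<le> B"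
proof -
  have "\<exists>B. \<forall>y\<ge>-a. integral {-a..y} (\<lambda>t. (cmod (f (- t)))\<^sup>2) \<le> B"
  proof (rule tail_decay[OF _ r])
    show "continuous_on UNIV (\<lambda>t. f (- t))" by (intro continuous_on_compose2[OF f] continuous_intros) auto
    show "cmod (f (- (x + 1))) = r * cmod (f (- x))" if "- a \<le> x" for x using d[of "- x"] that by (simp add: minus_add_distrib)
  qed
  then obtain B where B: "\<And>y. y \<ge> - a \<Longrightarrow> integral {-a..y} (\<lambda>t. (cmod (f (- t)))\<^sup>2) \<le> B" by blast
  have "integral {y..a} (\<lambda>t. (cmod (f t))\<^sup>2) \<le> B" if "y \<le> a" for y
    using B[of "- y"] that Henstock_Kurzweil_Integration.integral_reflect_real[of a y "\<lambda>r. (cmod (f r))\<^sup>2"] by simp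
  then show ?thesis by blast
qed

lemma L2_UNIV_integral_le:
  assumes "f \<in> L2 UNIV" shows "integral {x..y} (\<lambda>t. (cmod (f t))\<^sup>2) \<le> (L2_norm UNIV f)\<^sup>2"
proof -
  have i: "integrable lebesgue (\<lambda>t. (cmod (f t))\<^sup>2)" using L2D(2)[OF assms] by (simp add: lebesgue_on_UNIV_eq)
  have hi: "((\<lambda>t. (cmod (f t))\<^sup>2) has_integral (L2_norm UNIV f)\<^sup>2) UNIV"
    unfolding L2_norm_sq using has_integral_integral_lebesgue[OF i] by (simp add: lebesgue_on_UNIV_eq)
  then have iu: "(\<lambda>t. (cmod (f t))\<^sup>2) integrable_on UNIV" by blast
  have "integral {x..y} (\<lambda>t. (cmod (f t))\<^sup>2) \<le> integral UNIV (\<lambda>t. (cmod (f t))\<^sup>2)"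
    by (intro integral_subset_le iu integrable_on_subinterval[OF iu]) auto
  then show ?thesis using hi by (simp add: integral_unique)
qed

lemma L2_UNIV_I:
  fixes f :: "real \<Rightarrow> complex"
  assumes f: "continuous_on UNIV f" and B: "\<And>x y. x \<le> y \<Longrightarrow> integral {x..y} (\<lambda>t. (cmod (f t))\<^sup>2) \<le> B"
  shows "f \<in> L2 UNIV"
proof -
  let ?F = "\<lambda>t. (cmod (f t))\<^sup>2"
  note ci = cont_sq_integrable[OF f]
  define g where "g k t = (if t \<in> {- real k..real k} then ?F t else 0)" for k t
  have gi: "g k integrable_on UNIV" "integral UNIV (g k) = integral {- real k..real k} ?F" for k
    unfolding g_def using integrable_restrict_UNIV[of "{- real k..real k}" ?F] integral_restrict_UNIV[of "{- real k..real k}" ?F] ci by auto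
  have "?F integrable_on UNIV \<and> (\<lambda>k. integral UNIV (g k)) \<longlonglongrightarrow> integral UNIV ?F"
  proof (rule monotone_convergence_increasing)
    show "g k integrable_on UNIV" for k by (rule gi)
    show "g k t \<le> g (Suc k) t" for k t by (auto simp: g_def)
    show "(\<lambda>k. g k t) \<longlonglongrightarrow> ?F t" for t
    proof (rule tendsto_eventually)
      obtain k0 :: nat where k0: "\<bar>t\<bar> \<le> real k0" using real_arch_simple by blast
      show "\<forall>\<^sub>F k in sequentially. g k t = ?F t"
        using eventually_ge_at_top[of k0] by eventually_elim (use k0 in \<open>auto simp: g_def\<close>)
    qed
    show "bounded (range (\<lambda>k. integral UNIV (g k)))"
      unfolding bounded_iff
    proof (intro exI[of _ B] ballI)
      fix z assume "z \<in> range (\<lambda>k. integral UNIV (g k))"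
      then obtain k where "z = integral {- real k..real k} ?F" using gi(2) by auto
      moreover have "integral {- real k..real k} ?F \<ge> 0" by (rule integral_nonneg[OF ci]) auto
      ultimately show "norm z \<le> B" using B[of "- real k" "real k"] by simp
    qed
  qed
  then have "?F absolutely_integrable_on UNIV" by (intro nonnegative_absolutely_integrable_1) auto
  then have "integrable lebesgue ?F" by (simp add: set_integrable_def)
  then show ?thesis using continuous_measurable_lebesgue[OF f] by (simp add: L2_def lebesgue_on_UNIV_eq)
qed

lemma L2_UNIV_restrict: assumes "f \<in> L2 UNIV" "S \<in> sets lebesgue" shows "f \<in> L2 S"
proof -
  have i: "f \<in> borel_measurable lebesgue" "integrable lebesgue (\<lambda>t. (cmod (f t))\<^sup>2)" using assms(1) by (auto simp: L2_def lebesgue_on_UNIV_eq)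
  then have "integrable (lebesgue_on S) (\<lambda>t. (cmod (f t))\<^sup>2)"
    using integrable_mult_indicator[OF assms(2) i(2)] assms(2) by (simp add: integrable_restrict_space)
  then show ?thesis using i(1) by (simp add: L2_def measurable_restrict_space1)
qed

lemma W22_zero: assumes z: "AE x in lebesgue_on S. u x = 0" and S: "open S" shows "u \<in> W22 S" "W22_norm S u = 0"
proof -
  have z': "AE x in lebesgue_on S. 0 = u x" using z by eventually_elim simp
  have d0: "has_weak_deriv S (\<lambda>_. 0) (\<lambda>_. 0)" using has_ac_deriv_imp_weak[OF has_ac_deriv_const S] .
  have d: "has_weak_deriv S u (\<lambda>_. 0)" by (rule has_weak_deriv_cong_AE[OF d0 S z']) simp
  have Sm: "S \<in> sets lebesgue" using S by simp
  have uL: "u \<in> L2 S" using L2_cong_AE[OF L2_zero z' Sm] .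
  have "L2_norm S u = 0" using L2_norm_zero_iff[OF uL] z by simp
  moreover have "L2_norm S (\<lambda>_. 0) = 0" by (simp add: L2_norm_def)
  moreover have "W22_norm S u \<ge> 0" by (simp add: W22_norm_def)
  ultimately show "u \<in> W22 S" "W22_norm S u = 0"
    using W22_normI[OF d d0 S uL L2_zero L2_zero] by auto
qed

text \<open>Independence of the representative: the difference of the arguments has Sobolev norm 0,
  so linearity and the norm bound make the images agree almost everywhere.\<close>

lemma bounded_operator_cong_AE:
  assumes T: "bounded_operator_W22_L2 S M T" and u: "u \<in> W22 S" and v: "v \<in> W22 S" and S: "open S"
    and eq: "AE x in lebesgue_on S. u x = v x"
  shows "AE x in lebesgue_on S. T u x = T v x"
proof -
  have "AE x in lebesgue_on S. u x - v x = 0" using eq by eventually_elim simp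
  from W22_zero[OF this S] have d: "(\<lambda>x. u x - v x) \<in> W22 S" "W22_norm S (\<lambda>x. u x - v x) = 0" by auto
  have L: "(\<lambda>x. T u x - T v x) \<in> L2 S" by (intro L2_diff bounded_operatorD[OF T] u v)
  have "L2_norm S (\<lambda>x. T u x - T v x) = 0"
    using bounded_operator_diff[OF T u v d(1)] d(2) L2_norm_nonneg[of S "\<lambda>x. T u x - T v x"] by simp
  then have "AE x in lebesgue_on S. T u x - T v x = 0" using L2_norm_zero_iff[OF L] by simp
  then show ?thesis by eventually_elim simp
qed

section \<open>Square integrable tails of homogeneous solutions\<close>

context hill_fs begin

text \<open>Vanishing on an interval makes value and derivative 0 at a common point, and the
  non-zero Wronskian there recovers both coefficients.\<close>

lemma comb_zero:
  assumes "\<And>x. x \<in> {x0<..<x1} \<Longrightarrow> c1 * th1 l x + c2 * th2 l x = 0" "x0 < x1"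
  shows "c1 = 0" "c2 = 0"
proof -
  define t where "t = (x0 + x1) / 2"
  have t: "t \<in> {x0<..<x1}" using assms(2) by (simp add: t_def)
  let ?u = "\<lambda>x. c1 * th1 l x + c2 * th2 l x"
  have "(?u has_vector_derivative c1 * dth1 l t + c2 * dth2 l t) (at t)" by (rule comb_vderiv)
  moreover have "(?u has_vector_derivative 0) (at t)"
    by (rule has_vector_derivative_transform_within_open[OF has_vector_derivative_const[of 0] open_greaterThanLessThan t]) (use assms(1) in simp)
  ultimately have d: "c1 * dth1 l t + c2 * dth2 l t = 0" using vector_derivative_unique_at by blast
  have u: "c1 * th1 l t + c2 * th2 l t = 0" using assms(1)[OF t] .
  have "c1 * (P t * (th1 l t * dth2 l t - dth1 l t * th2 l t)) = P t * (dth2 l t * (c1 * th1 l t + c2 * th2 l t) - th2 l t * (c1 * dth1 l t + c2 * dth2 l t))"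
    by (simp add: algebra_simps)
  then show "c1 = 0" using u d by (simp add: wronskian)
  have "c2 * (P t * (th1 l t * dth2 l t - dth1 l t * th2 l t)) = P t * (th1 l t * (c1 * dth1 l t + c2 * dth2 l t) - dth1 l t * (c1 * th1 l t + c2 * th2 l t))"
    by (simp add: algebra_simps)
  then show "c2 = 0" using u d by (simp add: wronskian)
qed

lemma comb_shift:
  "c1 * th1 l (x + 1) + c2 * th2 l (x + 1) = (th1 l 1 * c1 + th2 l 1 * c2) * th1 l x + (dth1 l 1 * c1 + dth2 l 1 * c2) * th2 l x"
  "c1 * dth1 l (x + 1) + c2 * dth2 l (x + 1) = (th1 l 1 * c1 + th2 l 1 * c2) * dth1 l x + (dth1 l 1 * c1 + dth2 l 1 * c2) * dth2 l x"
  by (simp_all only: th_shift) (simp_all add: algebra_simps)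

lemma eig_shift:
  assumes "mon_eig l \<rho> c1 c2"
  shows "c1 * th1 l (x + 1) + c2 * th2 l (x + 1) = \<rho> * (c1 * th1 l x + c2 * th2 l x)"
    "c1 * dth1 l (x + 1) + c2 * dth2 l (x + 1) = \<rho> * (c1 * dth1 l x + c2 * dth2 l x)"
  using assms unfolding comb_shift mon_eig_def by (simp_all add: algebra_simps)

lemma comb_cont: "continuous_on A (\<lambda>x. c1 * th1 l x + c2 * th2 l x)" "continuous_on A (\<lambda>x. c1 * dth1 l x + c2 * dth2 l x)"
  by (intro continuous_intros th_cont)+

text \<open>Cayley--Hamilton: \<open>(M - \<rho>) c\<close> is an eigenvector for the other multiplier \<open>\<rho>'\<close>.\<close>

lemma mon_residual:
  assumes "\<rho> + \<rho>' = D l" "\<rho> * \<rho>' = 1"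
  shows "mon_eig l \<rho>' (th1 l 1 * c1 + th2 l 1 * c2 - \<rho> * c1) (dth1 l 1 * c1 + dth2 l 1 * c2 - \<rho> * c2)"
    "(th1 l 1 * c1 + th2 l 1 * c2 - \<rho> * c1) * th1 l x + (dth1 l 1 * c1 + dth2 l 1 * c2 - \<rho> * c2) * th2 l x
      = (c1 * th1 l (x + 1) + c2 * th2 l (x + 1)) - \<rho> * (c1 * th1 l x + c2 * th2 l x)"
proof -
  define A B E F where "A = th1 l 1" and "B = th2 l 1" and "E = dth1 l 1" and "F = dth2 l 1"
  have det: "A * F - E * B = 1" using det_1[of l] by (simp add: A_def B_def E_def F_def)
  have tr: "\<rho> + \<rho>' = A + F" using assms(1) by (simp add: D_eq A_def F_def)
  have "A * (A * c1 + B * c2 - \<rho> * c1) + B * (E * c1 + F * c2 - \<rho> * c2) = \<rho>' * (A * c1 + B * c2 - \<rho> * c1)"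
    using det tr assms(2) by algebra
  moreover have "E * (A * c1 + B * c2 - \<rho> * c1) + F * (E * c1 + F * c2 - \<rho> * c2) = \<rho>' * (E * c1 + F * c2 - \<rho> * c2)"
    using det tr assms(2) by algebra
  ultimately show "mon_eig l \<rho>' (th1 l 1 * c1 + th2 l 1 * c2 - \<rho> * c1) (dth1 l 1 * c1 + dth2 l 1 * c2 - \<rho> * c2)"
    by (simp add: mon_eig_def A_def B_def E_def F_def)
  show "(th1 l 1 * c1 + th2 l 1 * c2 - \<rho> * c1) * th1 l x + (dth1 l 1 * c1 + dth2 l 1 * c2 - \<rho> * c2) * th2 l x
      = (c1 * th1 l (x + 1) + c2 * th2 l (x + 1)) - \<rho> * (c1 * th1 l x + c2 * th2 l x)"
    unfolding comb_shift by (simp add: algebra_simps)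
qed

lemma sq_diff_bound: "(cmod (u - \<rho> * v))\<^sup>2 \<le> 2 * (cmod u)\<^sup>2 + 2 * (cmod \<rho>)\<^sup>2 * (cmod v)\<^sup>2"
proof -
  have "(cmod (u - \<rho> * v))\<^sup>2 \<le> (cmod u + cmod \<rho> * cmod v)\<^sup>2"
    using norm_triangle_ineq4[of u "\<rho> * v"] by (intro power_mono) (auto simp: norm_mult)
  also have "\<dots> \<le> 2 * (cmod u)\<^sup>2 + 2 * (cmod \<rho> * cmod v)\<^sup>2" by (rule sum_sq_le)
  finally show ?thesis by (simp add: power_mult_distrib mult.assoc)
qed

lemma shifted_tail:
  fixes u v :: "real \<Rightarrow> complex"
  assumes u: "continuous_on UNIV u" and v: "\<And>x. v x = u (x + 1) - \<rho> * u x" and vc: "continuous_on UNIV v"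
    and B: "integral {x+1..y+1} (\<lambda>t. (cmod (u t))\<^sup>2) \<le> B" "integral {x..y} (\<lambda>t. (cmod (u t))\<^sup>2) \<le> B"
  shows "integral {x..y} (\<lambda>t. (cmod (v t))\<^sup>2) \<le> 2 * B + 2 * (cmod \<rho>)\<^sup>2 * B"
proof -
  have i1: "(\<lambda>t. (cmod (u (t + 1)))\<^sup>2) integrable_on {x..y}"
    by (rule cont_sq_integrable) (intro continuous_on_compose2[OF u] continuous_intros, auto)
  note i2 = cont_sq_integrable[OF u, of x y]
  have "integral {x..y} (\<lambda>t. (cmod (v t))\<^sup>2) \<le> integral {x..y} (\<lambda>t. 2 * (cmod (u (t + 1)))\<^sup>2 + 2 * (cmod \<rho>)\<^sup>2 * (cmod (u t))\<^sup>2)"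
    by (intro integral_le cont_sq_integrable vc integrable_add integrable_on_mult_right i1 i2) (simp add: v sq_diff_bound)
  also have "\<dots> = 2 * integral {x..y} (\<lambda>t. (cmod (u (t + 1)))\<^sup>2) + 2 * (cmod \<rho>)\<^sup>2 * integral {x..y} (\<lambda>t. (cmod (u t))\<^sup>2)"
    using i1 i2 by (subst Henstock_Kurzweil_Integration.integral_add) (auto intro: integrable_on_mult_right)
  also have "integral {x..y} (\<lambda>t. (cmod (u (t + 1)))\<^sup>2) = integral {x+1..y+1} (\<lambda>t. (cmod (u t))\<^sup>2)"
    using integral_shift_real[of x y "\<lambda>t. (cmod (u t))\<^sup>2" 1] by simp
  finally show ?thesis using B(1) mult_left_mono[OF B(2), of "2 * (cmod \<rho>)\<^sup>2"] by simp
qed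

text \<open>The solution with data (M - \<rho>) c is u(x + 1) - \<rho> u(x), hence square integrable
  on the right, but it is multiplied by \<rho>' of modulus at least 1 in each period. It vanishes,
  so c belongs to \<rho>; if \<rho> is no contraction either, u vanishes for the same
  reason.\<close>

lemma tail_right:
  assumes \<rho>: "\<rho> + \<rho>' = D l" "\<rho> * \<rho>' = 1" "cmod \<rho>' \<ge> 1"
    and B: "\<And>x y. b \<le> x \<Longrightarrow> x \<le> y \<Longrightarrow> integral {x..y} (\<lambda>t. (cmod (c1 * th1 l t + c2 * th2 l t))\<^sup>2) \<le> B"
  shows "mon_eig l \<rho> c1 c2" "cmod \<rho> \<ge> 1 \<Longrightarrow> c1 = 0 \<and> c2 = 0"
proof -
  define y1 y2 where "y1 = th1 l 1 * c1 + th2 l 1 * c2 - \<rho> * c1" and "y2 = dth1 l 1 * c1 + dth2 l 1 * c2 - \<rho> * c2"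
  note R = mon_residual[OF \<rho>(1,2), of c1 c2, folded y1_def y2_def]
  have z: "y1 * th1 l x + y2 * th2 l x = 0" if "b \<le> x" for x
  proof (rule tail_growth[OF comb_cont(1) _ _ that])
    show "cmod (y1 * th1 l x + y2 * th2 l x) \<le> cmod (y1 * th1 l (x + 1) + y2 * th2 l (x + 1))" for x
      unfolding eig_shift(1)[OF R(1)] norm_mult using mult_right_mono[OF \<rho>(3), of "cmod (y1 * th1 l x + y2 * th2 l x)"] by simp
    show "integral {x..y} (\<lambda>t. (cmod (y1 * th1 l t + y2 * th2 l t))\<^sup>2) \<le> 2 * B + 2 * (cmod \<rho>)\<^sup>2 * B" if "b \<le> x" "x \<le> y" for x y
      by (rule shifted_tail[OF comb_cont(1) R(2) comb_cont(1)]) (use that in \<open>auto intro!: B\<close>)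
  qed
  have "y1 = 0" "y2 = 0" using comb_zero[of b "b + 1" y1 l y2] z by auto
  then show e: "mon_eig l \<rho> c1 c2" by (simp add: mon_eig_def y1_def y2_def)
  assume r: "cmod \<rho> \<ge> 1"
  have "c1 * th1 l x + c2 * th2 l x = 0" if "b \<le> x" for x
  proof (rule tail_growth[OF comb_cont(1) _ B that])
    show "cmod (c1 * th1 l x + c2 * th2 l x) \<le> cmod (c1 * th1 l (x + 1) + c2 * th2 l (x + 1))" for x
      unfolding eig_shift(1)[OF e] norm_mult using mult_right_mono[OF r, of "cmod (c1 * th1 l x + c2 * th2 l x)"] by simp
  qed
  then show "c1 = 0 \<and> c2 = 0" using comb_zero[of b "b + 1" c1 l c2] by auto
qed

text \<open>The mirror image, with multipliers inverted by the shift x - 1; this exchanges the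
  inequalities on the moduli.\<close>

lemma tail_left:
  assumes \<rho>: "\<rho> + \<rho>' = D l" "\<rho> * \<rho>' = 1" "cmod \<rho>' \<le> 1"
    and B: "\<And>x y. y \<le> a \<Longrightarrow> x \<le> y \<Longrightarrow> integral {x..y} (\<lambda>t. (cmod (c1 * th1 l t + c2 * th2 l t))\<^sup>2) \<le> B"
  shows "mon_eig l \<rho> c1 c2" "cmod \<rho> \<le> 1 \<Longrightarrow> c1 = 0 \<and> c2 = 0"
proof -
  define y1 y2 where "y1 = th1 l 1 * c1 + th2 l 1 * c2 - \<rho> * c1" and "y2 = dth1 l 1 * c1 + dth2 l 1 * c2 - \<rho> * c2"
  note R = mon_residual[OF \<rho>(1,2), of c1 c2, folded y1_def y2_def]
  have backw: "cmod (e1 * th1 l x + e2 * th2 l x) \<le> cmod (e1 * th1 l (x - 1) + e2 * th2 l (x - 1))"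
    if e: "mon_eig l r e1 e2" "cmod r \<le> 1" for r e1 e2 x
    using eig_shift(1)[OF e(1), of "x - 1"] mult_right_mono[OF e(2), of "cmod (e1 * th1 l (x - 1) + e2 * th2 l (x - 1))"]
    by (simp add: norm_mult)
  \<comment> \<open>The residual at x involves u(x + 1), which must still lie to the left of
    \<open>a\<close>.\<close>
  have z: "y1 * th1 l x + y2 * th2 l x = 0" if "x \<le> a - 1" for x
  proof (rule tail_growth_left[OF comb_cont(1) backw[OF R(1) \<rho>(3)] _ that])
    show "integral {x..y} (\<lambda>t. (cmod (y1 * th1 l t + y2 * th2 l t))\<^sup>2) \<le> 2 * B + 2 * (cmod \<rho>)\<^sup>2 * B" if "y \<le> a - 1" "x \<le> y" for x y
      by (rule shifted_tail[OF comb_cont(1) R(2) comb_cont(1)]) (use that in \<open>auto intro!: B\<close>)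
  qed
  have "y1 = 0" "y2 = 0" using comb_zero[of "a - 2" "a - 1" y1 l y2] z by auto
  then show e: "mon_eig l \<rho> c1 c2" by (simp add: mon_eig_def y1_def y2_def)
  assume r: "cmod \<rho> \<le> 1"
  have "c1 * th1 l x + c2 * th2 l x = 0" if "x \<le> a" for x
    by (rule tail_growth_left[OF comb_cont(1) backw[OF e r] B that])
  then show "c1 = 0 \<and> c2 = 0" using comb_zero[of "a - 1" a c1 l c2] by auto
qed

end

lemma bounded_operator_lin2:
  assumes "bounded_operator_W22_L2 S M T" "u \<in> W22 S" "v \<in> W22 S"
  shows "AE x in lebesgue_on S. T (\<lambda>y. c * u y + d * v y) x = c * T u x + d * T v x"
  using assms unfolding bounded_operator_W22_L2_def by blast

lemma AE_lebesgue_on_UNIV: "(AE x in lebesgue_on UNIV. R x) \<longleftrightarrow> (AE x in lebesgue. R (x::real))"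
  by (subst AE_lebesgue_on_iff) auto

lemma AE_restrict: "S \<in> sets lebesgue \<Longrightarrow> AE x in lebesgue. R x \<Longrightarrow> AE x in lebesgue_on S. R (x::real)"
  by (auto simp: AE_lebesgue_on_iff elim: eventually_mono)

context edge_Q begin

text \<open>In terms of \<open>z\<close> with \<open>z\<^sup>2 = D\<^sup>2/4 - 1\<close> the multipliers are \<open>(-1)\<^sup>n (w \<plusminus> z)\<close>.\<close>

definition "zw l z w \<longleftrightarrow> D l = 2 * of_real sg * w \<and> w * w = 1 + z * z"

lemma sg_c: "of_real sg * of_real sg = (1 :: complex)" using sgc(1) .

lemma zw_rho:
  assumes "zw l z w"
  shows "of_real sg * (w - z) + of_real sg * (w + z) = D l" "of_real sg * (w - z) * (of_real sg * (w + z)) = 1"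
  using assms sg_c unfolding zw_def by (algebra+)

text \<open>With s = \<open>of_real sg\<close> the monodromy matrix is s w I + N with N trace-free
  and N^2 = z^2 I. For v = (P2/2, - P1/2) the two vectors are v - 2 k N v and - v - 2 k N v; since 2
  k = s/z they lie in the eigenspaces of s (w - z) and s (w + z).\<close>

lemma boundary_algebra_forward:
  assumes "zw l z w" and k: "2 * k * z = of_real sg"
  shows "mon_eig l (of_real sg * (w - z)) (1/2 * P2 + k * (th2 l 1 * P1 + hh l * P2)) (- 1/2 * P1 + k * (hh l * P1 - dth1 l 1 * P2))"
    "mon_eig l (of_real sg * (w + z)) (- 1/2 * P2 + k * (th2 l 1 * P1 + hh l * P2)) (1/2 * P1 + k * (hh l * P1 - dth1 l 1 * P2))"
proof -
  define s :: complex where "s = of_real sg"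
  define B E h where "B = th2 l 1" and "E = dth1 l 1" and "h = hh l"
  define X Y where "X = 1/2 * P2" and "Y = - 1/2 * P1"
  have ss: "s * s = 1" using sg_c by (simp add: s_def)
  have A: "th1 l 1 = s * w - h" and F: "dth2 l 1 = s * w + h"
    using assms(1) by (simp_all add: zw_def D_eq hh_def h_def s_def field_simps)
  have "(s * w - h) * (s * w + h) - E * B = 1" using det_1[of l] unfolding A F by (simp add: B_def E_def)
  then have hz: "h * h + B * E = z * z" using assms(1) ss unfolding zw_def by algebra
  have k': "2 * k * z = s" using k by (simp add: s_def)
  have cs: "1/2 * P2 = X" "- 1/2 * P1 = Y" "- 1/2 * P2 = - X" "1/2 * P1 = - Y" "P1 = - 2 * Y" "P2 = 2 * X" by (auto simp: X_def Y_def)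
  have c1: "(s * w - h) * (X + k * (B * (- 2 * Y) + h * (2 * X))) + B * (Y + k * (h * (- 2 * Y) - E * (2 * X))) = s * (w - z) * (X + k * (B * (- 2 * Y) + h * (2 * X)))"
    using hz k' ss by algebra
  have c2: "E * (X + k * (B * (- 2 * Y) + h * (2 * X))) + (s * w + h) * (Y + k * (h * (- 2 * Y) - E * (2 * X))) = s * (w - z) * (Y + k * (h * (- 2 * Y) - E * (2 * X)))"
    using hz k' ss by algebra
  have c3: "(s * w - h) * (- X + k * (B * (- 2 * Y) + h * (2 * X))) + B * (- Y + k * (h * (- 2 * Y) - E * (2 * X))) = s * (w + z) * (- X + k * (B * (- 2 * Y) + h * (2 * X)))"
    using hz k' ss by algebra
  have c4: "E * (- X + k * (B * (- 2 * Y) + h * (2 * X))) + (s * w + h) * (- Y + k * (h * (- 2 * Y) - E * (2 * X))) = s * (w + z) * (- Y + k * (h * (- 2 * Y) - E * (2 * X)))"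
    using hz k' ss by algebra
  show "mon_eig l (of_real sg * (w - z)) (1/2 * P2 + k * (th2 l 1 * P1 + hh l * P2)) (- 1/2 * P1 + k * (hh l * P1 - dth1 l 1 * P2))"
    unfolding mon_eig_def A F B_def[symmetric] E_def[symmetric] h_def[symmetric] s_def[symmetric]
    using c1 c2 unfolding X_def Y_def by simp
  show "mon_eig l (of_real sg * (w + z)) (- 1/2 * P2 + k * (th2 l 1 * P1 + hh l * P2)) (1/2 * P1 + k * (hh l * P1 - dth1 l 1 * P2))"
    unfolding mon_eig_def A F B_def[symmetric] E_def[symmetric] h_def[symmetric] s_def[symmetric]
    using c3 c4 unfolding X_def Y_def by simp
qed

text \<open>Conversely, with v = (X, Y), combining the eigenvector equations of the two tails gives
  s z (\<alpha>, \<beta>) = - N v. Dividing by z determines the homogeneous part uniquely, and here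
  the pole 1/z arises.\<close>

lemma boundary_algebra_backward:
  assumes "zw l z w" and k: "2 * k * z = of_real sg" "z \<noteq> 0"
    and e: "mon_eig l (of_real sg * (w - z)) (\<alpha> + X) (\<beta> + Y)" "mon_eig l (of_real sg * (w + z)) (\<alpha> - X) (\<beta> - Y)"
  shows "\<alpha> = k * (2 * hh l * X - 2 * th2 l 1 * Y)" "\<beta> = k * (- 2 * hh l * Y - 2 * dth1 l 1 * X)"
proof -
  define s :: complex where "s = of_real sg"
  define B E h where "B = th2 l 1" and "E = dth1 l 1" and "h = hh l"
  have ss: "s * s = 1" using sg_c by (simp add: s_def)
  have A: "th1 l 1 = s * w - h" and F: "dth2 l 1 = s * w + h"
    using assms(1) by (simp_all add: zw_def D_eq hh_def h_def s_def field_simps)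
  have k': "2 * k * z = s" using k by (simp add: s_def)
  have e': "(s * w - h) * (\<alpha> + X) + B * (\<beta> + Y) = s * (w - z) * (\<alpha> + X)" "E * (\<alpha> + X) + (s * w + h) * (\<beta> + Y) = s * (w - z) * (\<beta> + Y)"
    "(s * w - h) * (\<alpha> - X) + B * (\<beta> - Y) = s * (w + z) * (\<alpha> - X)" "E * (\<alpha> - X) + (s * w + h) * (\<beta> - Y) = s * (w + z) * (\<beta> - Y)"
    using e unfolding mon_eig_def A F B_def[symmetric] E_def[symmetric] s_def[symmetric] by auto
  have "s * z * \<alpha> = h * X - B * Y" using e'(1,3) by algebra
  then have "\<alpha> * z = s * (h * X - B * Y)" using ss by algebra
  then have "(\<alpha> - k * (2 * h * X - 2 * B * Y)) * z = 0" using k' by algebra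
  then show "\<alpha> = k * (2 * hh l * X - 2 * th2 l 1 * Y)" using k(2) by (simp add: h_def B_def)
  have "s * z * \<beta> = - h * Y - E * X" using e'(2,4) by algebra
  then have "\<beta> * z = s * (- h * Y - E * X)" using ss by algebra
  then have "(\<beta> - k * (- 2 * h * Y - 2 * E * X)) * z = 0" using k' by algebra
  then show "\<beta> = k * (- 2 * hh l * Y - 2 * dth1 l 1 * X)" using k(2) by (simp add: h_def E_def)
qed

lemma G0_outside:
  assumes "g \<in> L2 Q"
  shows "b \<le> x \<Longrightarrow> G0 l g x = 1/2 * p2 l g b * th1 l x + (- 1/2 * p1 l g b) * th2 l x"
    "b \<le> x \<Longrightarrow> dG0 l g x = 1/2 * p2 l g b * dth1 l x + (- 1/2 * p1 l g b) * dth2 l x"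
    "x \<le> a \<Longrightarrow> G0 l g x = - 1/2 * p2 l g b * th1 l x + 1/2 * p1 l g b * th2 l x"
    "x \<le> a \<Longrightarrow> dG0 l g x = - 1/2 * p2 l g b * dth1 l x + 1/2 * p1 l g b * dth2 l x"
  using p_const[OF assms, of x l] by (simp_all add: G0_def dG0_def algebra_simps)

text \<open>The operator is written with chosen weak derivatives. Continuous representatives U and V
  of u and u' make p V absolutely continuous; uniqueness of weak derivatives then identifies its
  derivative with the one prescribed by the equation.\<close>

lemma H_pert_eigenfunction_sol:
  assumes u: "u \<in> W22 UNIV" and g: "loc_abs_int g"
    and eq: "AE x in lebesgue. - weak_deriv UNIV (\<lambda>y. P y * weak_deriv UNIV u y) x + of_real (q x) * u x - g x = l * u x"
  obtains U V where "sol l g U V" "AE x in lebesgue. u x = U x" "U \<in> L2 UNIV" "U \<in> W22 Q"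
proof -
  obtain v1 w1 where vw: "v1 \<in> L2 UNIV" "w1 \<in> L2 UNIV" "has_weak_deriv UNIV u v1" "has_weak_deriv UNIV v1 w1" and uL: "u \<in> L2 UNIV"
    using u by (auto simp: W22_def)
  obtain U where U: "has_ac_deriv U v1" "AE x in lebesgue. u x = U x" using weak_deriv_UNIV_imp_ac[OF vw(3)] by blast
  obtain V where V: "has_ac_deriv V w1" "AE x in lebesgue. v1 x = V x" using weak_deriv_UNIV_imp_ac[OF vw(4)] by blast
  have UV: "has_ac_deriv U V" using has_ac_deriv_cong_AE[OF U(1) V(2)] .
  have PV: "has_ac_deriv (\<lambda>x. P x * V x) (\<lambda>x. of_real (dp x) * V x + P x * w1 x)" using has_ac_deriv_mult[OF dp(3) V(1)] .
  have d1: "AE x in lebesgue. weak_deriv UNIV u x = v1 x" using weak_deriv_AE(2)[OF vw(3) open_UNIV] by (simp only: AE_lebesgue_on_UNIV)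
  have "AE x in lebesgue. P x * V x = P x * weak_deriv UNIV u x" using d1 V(2) by eventually_elim simp
  then have "AE x in lebesgue_on UNIV. P x * V x = P x * weak_deriv UNIV u x" by (simp only: AE_lebesgue_on_UNIV)
  then have "has_weak_deriv UNIV (\<lambda>x. P x * weak_deriv UNIV u x) (\<lambda>x. of_real (dp x) * V x + P x * w1 x)"
    by (rule has_weak_deriv_cong_AE[OF has_ac_deriv_imp_weak[OF PV open_UNIV] open_UNIV]) simp
  from weak_deriv_AE(2)[OF this open_UNIV]
  have d2: "AE x in lebesgue. weak_deriv UNIV (\<lambda>x. P x * weak_deriv UNIV u x) x = of_real (dp x) * V x + P x * w1 x"
    by (simp only: AE_lebesgue_on_UNIV)
  have "AE x in lebesgue. of_real (dp x) * V x + P x * w1 x = (of_real (q x) - l) * U x - g x"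
    using d2 eq U(2) by eventually_elim (simp add: algebra_simps)
  then have "has_ac_deriv (\<lambda>x. P x * V x) (\<lambda>x. (of_real (q x) - l) * U x - g x)" by (rule has_ac_deriv_cong_AE[OF PV])
  then have s: "sol l g U V" unfolding sol_def using UV by simp
  have UL: "U \<in> L2 UNIV" by (rule L2_cong_AE[OF uL]) (use U(2) in \<open>simp_all only: AE_lebesgue_on_UNIV, simp\<close>)
  have "AE x in lebesgue_on UNIV. v1 x = V x" using V(2) by (simp only: AE_lebesgue_on_UNIV)
  then have VL: "V \<in> L2 UNIV" by (rule L2_cong_AE[OF vw(1)]) simp
  have "U \<in> W22 Q"
    by (rule W22_normI(1)[OF has_ac_deriv_imp_weak[OF UV] has_ac_deriv_imp_weak[OF V(1)]])
       (use UL VL vw(2) in \<open>auto intro: L2_UNIV_restrict\<close>)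
  then show ?thesis using that s U(2) UL by blast
qed

text \<open>For g = L u the function u - \<epsilon> G0 g is a homogeneous solution on the whole
  line, with two unknown coefficients. Square integrability of both tails fixes them: for |w - z| <
  1 they are those of \<open>Bop\<close>, and on the unit circle both tails must vanish, so only
  \<open>G0\<close> remains.\<close>

lemma spectral_necessary:
  assumes Le: "bounded_operator_W22_L2 Q M Le" and zw: "zw l z w" and wz: "cmod (w - z) \<le> 1"
    and W: "\<And>g. g \<in> L2 Q \<Longrightarrow> G0 l g \<in> W22 Q \<and> Bop l g \<in> W22 Q"
    and u: "u \<in> W22 UNIV" "\<not> (AE x in lebesgue. u x = 0)"
    and eq: "AE x in lebesgue. - weak_deriv UNIV (\<lambda>y. P y * weak_deriv UNIV u y) x + of_real (q x) * u x - of_real eps * xt (Le u) x = l * u x"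
  obtains g where "g \<in> L2 Q" "\<not> (AE x in lebesgue_on Q. g x = 0)"
    "cmod (w - z) < 1 \<Longrightarrow> AE x in lebesgue_on Q. g x = of_real eps * (Le (G0 l g) x + (of_real sg / (2 * z)) * Le (Bop l g) x)"
    "cmod (w - z) = 1 \<Longrightarrow> AE x in lebesgue_on Q. g x = of_real eps * Le (G0 l g) x"
proof -
  let ?e = "complex_of_real eps"
  have rW: "r \<in> W22 Q" if r: "r \<in> W22 UNIV" for r
  proof -
    obtain v w where vw: "v \<in> L2 UNIV" "w \<in> L2 UNIV" "has_weak_deriv UNIV r v" "has_weak_deriv UNIV v w" "r \<in> L2 UNIV" using r unfolding W22_def by blast
    obtain U where U: "has_ac_deriv U v" "AE x in lebesgue. r x = U x" using weak_deriv_UNIV_imp_ac[OF vw(3)] by blast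
    obtain V where V: "has_ac_deriv V w" "AE x in lebesgue. v x = V x" using weak_deriv_UNIV_imp_ac[OF vw(4)] by blast
    have r1: "AE x in lebesgue_on Q. U x = r x" by (rule AE_restrict) (use U(2) in \<open>auto elim: eventually_mono\<close>)
    have v1: "AE x in lebesgue_on Q. V x = v x" by (rule AE_restrict) (use V(2) in \<open>auto elim: eventually_mono\<close>)
    have "has_weak_deriv Q r v" by (rule has_weak_deriv_cong_AE[OF has_ac_deriv_imp_weak[OF U(1)]]) (use r1 in auto)
    moreover have "has_weak_deriv Q v w" by (rule has_weak_deriv_cong_AE[OF has_ac_deriv_imp_weak[OF V(1)]]) (use v1 in auto)
    ultimately show ?thesis using vw L2_UNIV_restrict[of _ Q] by (auto simp: W22_def)
  qed
  define g where "g = Le u"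
  have uQ: "u \<in> W22 Q" using rW u(1) .
  have g: "g \<in> L2 Q" unfolding g_def using bounded_operatorD(1)[OF Le uQ] .
  have gl: "loc_abs_int (\<lambda>x. ?e * xt g x)" by (intro loc_abs_int_cmult ext_loc g)
  obtain U V where UV: "sol l (\<lambda>x. ?e * xt g x) U V" "AE x in lebesgue. u x = U x" "U \<in> L2 UNIV" "U \<in> W22 Q"
    using H_pert_eigenfunction_sol[OF u(1) gl] eq unfolding g_def by blast
  have "sol l (\<lambda>x. ?e * xt g x + (- ?e) * xt g x) (\<lambda>x. U x + (- ?e) * G0 l g x) (\<lambda>x. V x + (- ?e) * dG0 l g x)"
    using UV(1) sol_G0[OF g] by (rule sol_lincomb)
  then have s0: "sol l (\<lambda>_. 0) (\<lambda>x. U x - ?e * G0 l g x) (\<lambda>x. V x - ?e * dG0 l g x)" by (rule sol_cong) auto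
  obtain \<alpha> \<beta> where ab0: "\<And>x. U x - ?e * G0 l g x = \<alpha> * th1 l x + \<beta> * th2 l x" using sol_rep(1)[OF s0] by blast
  have Ux: "U x = ?e * G0 l g x + \<alpha> * th1 l x + \<beta> * th2 l x" for x using ab0[of x] by (simp add: algebra_simps)
  \<comment> \<open>Beyond the two ends of Q, \<open>G0\<close> contributes opposite coefficient
    pairs, so the tails have coefficients (\<alpha> + X, \<beta> + Y) and (\<alpha> - X, \<beta> -
    Y).\<close>
  define X Y where "X = ?e * (1/2 * p2 l g b)" and "Y = ?e * (- 1/2 * p1 l g b)"
  have Ur: "U x = (\<alpha> + X) * th1 l x + (\<beta> + Y) * th2 l x" if "b \<le> x" for x
    unfolding Ux G0_outside(1)[OF g that] X_def Y_def by (simp add: algebra_simps)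
  have Ul: "U x = (\<alpha> - X) * th1 l x + (\<beta> - Y) * th2 l x" if "x \<le> a" for x
    unfolding Ux G0_outside(3)[OF g that] X_def Y_def by (simp add: algebra_simps)
  define B where "B = (L2_norm UNIV U)\<^sup>2"
  have Br: "integral {x..y} (\<lambda>t. (cmod ((\<alpha> + X) * th1 l t + (\<beta> + Y) * th2 l t))\<^sup>2) \<le> B" if "b \<le> x" "x \<le> y" for x y
  proof -
    have "integral {x..y} (\<lambda>t. (cmod (U t))\<^sup>2) = integral {x..y} (\<lambda>t. (cmod ((\<alpha> + X) * th1 l t + (\<beta> + Y) * th2 l t))\<^sup>2)"
      by (rule integral_cong) (use Ur that in auto)
    then show ?thesis using L2_UNIV_integral_le[OF UV(3), of x y] by (simp add: B_def)
  qed
  have Bl: "integral {x..y} (\<lambda>t. (cmod ((\<alpha> - X) * th1 l t + (\<beta> - Y) * th2 l t))\<^sup>2) \<le> B" if "y \<le> a" "x \<le> y" for x y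
  proof -
    have "integral {x..y} (\<lambda>t. (cmod (U t))\<^sup>2) = integral {x..y} (\<lambda>t. (cmod ((\<alpha> - X) * th1 l t + (\<beta> - Y) * th2 l t))\<^sup>2)"
      by (rule integral_cong) (use Ul that in auto)
    then show ?thesis using L2_UNIV_integral_le[OF UV(3), of x y] by (simp add: B_def)
  qed
  define \<rho> \<rho>' where "\<rho> = of_real sg * (w - z)" and "\<rho>' = of_real sg * (w + z)"
  have rr: "\<rho> + \<rho>' = D l" "\<rho> * \<rho>' = 1" "\<rho>' + \<rho> = D l" "\<rho>' * \<rho> = 1" using zw_rho[OF zw] by (auto simp: \<rho>_def \<rho>'_def mult_ac add.commute)
  have r1: "cmod \<rho> \<le> 1" "cmod \<rho> = cmod (w - z)" using wz by (auto simp: \<rho>_def norm_mult)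
  have pr: "cmod \<rho> * cmod \<rho>' = 1" using rr(2) by (metis norm_mult norm_one)
  have r2: "cmod \<rho>' \<ge> 1"
  proof (rule ccontr)
    assume "\<not> cmod \<rho>' \<ge> 1"
    then have "cmod \<rho> * cmod \<rho>' \<le> 1 * cmod \<rho>'" using r1 by (intro mult_right_mono) auto
    then show False using pr \<open>\<not> cmod \<rho>' \<ge> 1\<close> by simp
  qed
  note R = tail_right[OF rr(1,2) r2 Br]
  note Lf = tail_left[OF rr(3,4) r1(1) Bl]
  have eqL: "AE x in lebesgue_on Q. g x = Le U x"
    unfolding g_def by (rule bounded_operator_cong_AE[OF Le uQ UV(4)]) (use AE_restrict[OF _ UV(2)] in auto)
  show ?thesis
  proof (rule that[OF g])
    show nz: "\<not> (AE x in lebesgue_on Q. g x = 0)"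
    proof
      assume "AE x in lebesgue_on Q. g x = 0"
      then have z0: "AE x in lebesgue. xt g x = 0" by (auto simp: AE_lebesgue_on_iff extend_by_zero_def elim!: eventually_mono)
      have "p1 l g b = p1 l g a" by (rule has_ac_deriv_zero[OF p_facts(1)[OF g]]) (use z0 in \<open>auto elim!: eventually_mono\<close>)
      moreover have "p2 l g b = p2 l g a" by (rule has_ac_deriv_zero[OF p_facts(3)[OF g]]) (use z0 in \<open>auto elim!: eventually_mono\<close>)
      ultimately have XY: "X = 0" "Y = 0" using p_facts[OF g] by (auto simp: X_def Y_def)
      have "sol l (\<lambda>_. 0) U V" by (rule sol_cong_AE[OF UV(1)]) (use z0 in \<open>auto elim!: eventually_mono\<close>)
      moreover have U0: "U x = \<alpha> * th1 l x + \<beta> * th2 l x" if "b \<le> x" for x using Ur[OF that] XY by simp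
      have e1: "mon_eig l \<rho> \<alpha> \<beta>" and e2: "mon_eig l \<rho>' \<alpha> \<beta>" using R(1) Lf(1) XY by auto
      \<comment> \<open>Without a source the same data serve both tails and belong to both
        multipliers. Distinct multipliers force them to be 0; equal ones have modulus 1, where a
        square integrable tail vanishes.\<close>
      have "\<alpha> = 0 \<and> \<beta> = 0"
      proof (cases "\<rho> = \<rho>'")
        case True
        then have "cmod \<rho> = 1" using r1(1) r2 by simp
        then show ?thesis using R(2) XY by simp
      next
        case False
        have "\<rho> * \<alpha> = \<rho>' * \<alpha>" "\<rho> * \<beta> = \<rho>' * \<beta>" using e1 e2 by (auto simp: mon_eig_def)
        then show ?thesis using False by simp
      qed
      moreover have "sol l (\<lambda>_. 0) (\<lambda>_. 0) (\<lambda>_. 0)" using sol_comb[of l 0 0] by simp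
      ultimately have "U x = 0" for x
      proof -
        have U1: "U t = 0" if "b \<le> t" for t using U0[OF that] \<open>\<alpha> = 0 \<and> \<beta> = 0\<close> by simp
        have rep: "U t = U 0 * th1 l t + V 0 * th2 l t" for t using sol_rep(1)[OF \<open>sol l (\<lambda>_. 0) U V\<close>] .
        have zz: "U 0 * th1 l t + V 0 * th2 l t = 0" if "t \<in> {b<..<b + 1}" for t
          using U1[of t] rep[of t] that by auto
        have "U 0 = 0" "V 0 = 0" using comb_zero[OF zz] by auto
        then show ?thesis using rep[of x] by simp
      qed
      then show False using UV(2) u(2) by simp
    qed
    show "AE x in lebesgue_on Q. g x = ?e * (Le (G0 l g) x + (of_real sg / (2 * z)) * Le (Bop l g) x)" if lt: "cmod (w - z) < 1"
    proof -
      have znz: "z \<noteq> 0"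
      proof
        assume "z = 0"
        then have "w * w = 1" using zw by (simp add: zw_def)
        then have "cmod w * cmod w = 1" by (metis norm_mult norm_one)
        then have "cmod w = 1" by (metis abs_norm_cancel abs_square_eq_1 power2_eq_square)
        then show False using lt \<open>z = 0\<close> by simp
      qed
      define k where "k = of_real sg / (2 * z)"
      have k: "2 * k * z = of_real sg" using znz by (simp add: k_def)
      have e: "mon_eig l (of_real sg * (w - z)) (\<alpha> + X) (\<beta> + Y)" "mon_eig l (of_real sg * (w + z)) (\<alpha> - X) (\<beta> - Y)"
        using R(1) Lf(1) by (auto simp: \<rho>_def \<rho>'_def)
      have ac: "\<alpha> = ?e * k * cA l g" "\<beta> = ?e * k * cB l g"
        using boundary_algebra_backward[OF zw k znz e] by (simp_all add: X_def Y_def cA_def cB_def algebra_simps)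
      have Ueq: "U = (\<lambda>x. ?e * G0 l g x + (?e * k) * Bop l g x)"
        by (rule ext) (simp add: Ux ac Bop_def algebra_simps)
      have "AE x in lebesgue_on Q. Le U x = ?e * Le (G0 l g) x + (?e * k) * Le (Bop l g) x"
        unfolding Ueq by (rule bounded_operator_lin2[OF Le conjunct1[OF W[OF g]] conjunct2[OF W[OF g]]])
      then show ?thesis using eqL by eventually_elim (simp add: k_def algebra_simps)
    qed
    show "AE x in lebesgue_on Q. g x = ?e * Le (G0 l g) x" if eq1: "cmod (w - z) = 1"
    proof -
      have "cmod \<rho> = 1" "cmod \<rho>' = 1" using r1 pr eq1 by auto
      then have "\<alpha> + X = 0" "\<beta> + Y = 0" "\<alpha> - X = 0" "\<beta> - Y = 0" using R(2) Lf(2) by auto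
      then have "\<alpha> = 0" "\<beta> = 0" by (auto simp: add_eq_0_iff)
      then have Ueq: "U = (\<lambda>x. ?e * G0 l g x + 0 * G0 l g x)" by (intro ext) (simp add: Ux)
      have "AE x in lebesgue_on Q. Le U x = ?e * Le (G0 l g) x + 0 * Le (G0 l g) x"
        unfolding Ueq by (rule bounded_operator_lin2[OF Le conjunct1[OF W[OF g]] conjunct1[OF W[OF g]]])
      then show ?thesis using eqL by eventually_elim simp
    qed
  qed
qed

lemma xt_L2_UNIV: assumes "g \<in> L2 Q" shows "xt g \<in> L2 UNIV"
proof -
  have "integrable lebesgue (\<lambda>x. indicator Q x *\<^sub>R (cmod (g x))\<^sup>2)"
    using L2D(2)[OF assms] by (simp add: integrable_restrict_space)
  moreover have "indicator Q x *\<^sub>R (cmod (g x))\<^sup>2 = (cmod (xt g x))\<^sup>2" for x by (simp add: extend_by_zero_def)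
  ultimately show ?thesis using loc_abs_int_measurable[OF ext_loc[OF assms]] by (simp add: L2_def lebesgue_on_UNIV_eq)
qed

lemma two_sided_decay_L2:
  assumes f: "continuous_on UNIV f" and r: "0 \<le> r" "r < 1"
    and d: "\<And>x. b \<le> x \<Longrightarrow> cmod (f (x + 1)) = r * cmod (f x)" "\<And>x. x \<le> a \<Longrightarrow> cmod (f (x - 1)) = r * cmod (f x)"
  shows "f \<in> L2 UNIV"
proof -
  let ?F = "\<lambda>t. (cmod (f t))\<^sup>2"
  note ci = cont_sq_integrable[OF f]
  obtain B1 where B1: "\<And>y. y \<ge> b \<Longrightarrow> integral {b..y} ?F \<le> B1" using tail_decay[OF f r d(1)] by blast
  obtain B2 where B2: "\<And>y. y \<le> a \<Longrightarrow> integral {y..a} ?F \<le> B2" using tail_decay_left[OF f r d(2)] by blast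
  show ?thesis
  proof (rule L2_UNIV_I[OF f])
    fix x y :: real assume "x \<le> y"
    define x' y' where "x' = min x a" and "y' = max y b"
    have xy: "x' \<le> a" "b \<le> y'" "{x..y} \<subseteq> {x'..y'}" by (auto simp: x'_def y'_def)
    have "integral {x..y} ?F \<le> integral {x'..y'} ?F" using xy(3) by (intro integral_subset_le ci) auto
    also have "\<dots> = integral {x'..a} ?F + integral {a..y'} ?F"
      using Henstock_Kurzweil_Integration.integral_combine[of x' a y' ?F] xy ab ci by simp
    also have "integral {a..y'} ?F = integral {a..b} ?F + integral {b..y'} ?F"
      using Henstock_Kurzweil_Integration.integral_combine[of a b y' ?F] xy ab ci by simp
    finally show "integral {x..y} ?F \<le> B2 + integral {a..b} ?F + B1" using B1[OF xy(2)] B2[OF xy(1)] by linarith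
  qed
qed

text \<open>U = G0 g + Bop g times sg/(2z) decays geometrically at both ends. Its source is g, and
  the equation for g says g = \<epsilon> L U, so U is an eigenfunction; it is non-zero because U = 0
  would give g = 0.\<close>

lemma spectral_sufficient:
  assumes Le: "bounded_operator_W22_L2 Q M Le" and zw: "zw l z w" and wz: "cmod (w - z) < 1" and znz: "z \<noteq> 0"
    and W: "G0 l g \<in> W22 Q" "Bop l g \<in> W22 Q"
    and g: "g \<in> L2 Q" "\<not> (AE x in lebesgue_on Q. g x = 0)"
    and geq: "AE x in lebesgue_on Q. g x = of_real eps * (Le (G0 l g) x + (of_real sg / (2 * z)) * Le (Bop l g) x)"
  shows "\<exists>u\<in>W22 UNIV. \<not> (AE x in lebesgue. u x = 0) \<and>
    (AE x in lebesgue. - weak_deriv UNIV (\<lambda>y. P y * weak_deriv UNIV u y) x + of_real (q x) * u x - of_real eps * xt (Le u) x = l * u x)"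
proof -
  define k where "k = of_real sg / (2 * z)"
  have k: "2 * k * z = of_real sg" using znz by (simp add: k_def)
  define U V where "U x = G0 l g x + k * Bop l g x" and "V x = dG0 l g x + k * dBop l g x" for x
  have "sol l (\<lambda>x. xt g x + k * 0) (\<lambda>x. G0 l g x + k * Bop l g x) (\<lambda>x. dG0 l g x + k * dBop l g x)"
    using sol_G0[OF g(1)] sol_Bop by (rule sol_lincomb)
  then have s: "sol l (xt g) U V" by (rule sol_cong) (auto simp: U_def V_def)
  define \<rho> \<rho>' where "\<rho> = of_real sg * (w - z)" and "\<rho>' = of_real sg * (w + z)"
  have rr: "\<rho> * \<rho>' = 1" using zw_rho[OF zw] by (simp add: \<rho>_def \<rho>'_def)
  define c1 c2 d1 d2 where "c1 = 1/2 * p2 l g b + k * (th2 l 1 * p1 l g b + hh l * p2 l g b)" and "c2 = - 1/2 * p1 l g b + k * (hh l * p1 l g b - dth1 l 1 * p2 l g b)"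
    and "d1 = - 1/2 * p2 l g b + k * (th2 l 1 * p1 l g b + hh l * p2 l g b)" and "d2 = 1/2 * p1 l g b + k * (hh l * p1 l g b - dth1 l 1 * p2 l g b)"
  have e: "mon_eig l \<rho> c1 c2" "mon_eig l \<rho>' d1 d2"
    using boundary_algebra_forward[OF zw k] by (auto simp: \<rho>_def \<rho>'_def c1_def c2_def d1_def d2_def)
  have right: "U x = c1 * th1 l x + c2 * th2 l x" "V x = c1 * dth1 l x + c2 * dth2 l x" if "b \<le> x" for x
    unfolding U_def V_def G0_outside(1,2)[OF g(1) that] Bop_def dBop_def cA_def cB_def c1_def c2_def by (simp_all add: algebra_simps)
  have left: "U x = d1 * th1 l x + d2 * th2 l x" "V x = d1 * dth1 l x + d2 * dth2 l x" if "x \<le> a" for x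
    unfolding U_def V_def G0_outside(3,4)[OF g(1) that] Bop_def dBop_def cA_def cB_def d1_def d2_def by (simp_all add: algebra_simps)
  have dr: "U (x + 1) = \<rho> * U x" "V (x + 1) = \<rho> * V x" if "b \<le> x" for x
    using that eig_shift[OF e(1), of x] by (simp_all add: right)
  have dl: "U (x - 1) = \<rho> * U x" "V (x - 1) = \<rho> * V x" if "x \<le> a" for x
  proof -
    have "U x = \<rho>' * U (x - 1)" "V x = \<rho>' * V (x - 1)" using that eig_shift[OF e(2), of "x - 1"] by (simp_all add: left)
    then have "\<rho> * U x = (\<rho> * \<rho>') * U (x - 1)" "\<rho> * V x = (\<rho> * \<rho>') * V (x - 1)" by (simp_all add: mult.assoc)
    then show "U (x - 1) = \<rho> * U x" "V (x - 1) = \<rho> * V x" using rr by simp_all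
  qed
  have r: "0 \<le> cmod \<rho>" "cmod \<rho> < 1" using wz by (auto simp: \<rho>_def norm_mult)
  have UL: "U \<in> L2 UNIV" and VL: "V \<in> L2 UNIV"
    by (rule two_sided_decay_L2[OF _ r]; simp add: sol_cont[OF s] dr dl norm_mult)+
  have UV: "has_ac_deriv U V" and PV: "has_ac_deriv (\<lambda>x. P x * V x) (\<lambda>x. (of_real (q x) - l) * U x - xt g x)" using s by (auto simp: sol_def)
  \<comment> \<open>Membership in \<open>W22\<close> requires u'' on the whole line; each of its
    three terms is a bounded multiple of U, V or the extended g.\<close>
  have sm: "sol2 l (xt g) U V \<in> L2 UNIV"
  proof -
    have qm: "q \<in> borel_measurable (lebesgue_on UNIV)" "dp \<in> borel_measurable (lebesgue_on UNIV)" "p \<in> borel_measurable (lebesgue_on UNIV)"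
      unfolding lebesgue_on_UNIV_eq by (rule q_measurable, rule dp(1), rule continuous_measurable_lebesgue[OF p_cont])
    note um = L2D(1)[OF UL] L2D(1)[OF VL]
    have w1: "(\<lambda>x. (of_real (q x) - l) * U x / P x) \<in> L2 UNIV"
    proof (rule L2_scaled_bound(1)[OF UL])
      show "(\<lambda>x. (of_real (q x) - l) * U x / P x) \<in> borel_measurable (lebesgue_on UNIV)" using um qm by measurable
      show "cmod ((of_real (q x) - l) * U x / P x) \<le> ((1 / p0) * (qB + cmod l)) * cmod (U x)" for x
        using sol2_parts[of l "cmod l" x "U x" 0] by simp
      show "0 \<le> (1 / p0) * (qB + cmod l)" using p0_pos qB(1) by simp
    qed
    have w2: "(\<lambda>x. - (of_real (dp x) * V x) / P x) \<in> L2 UNIV"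
    proof (rule L2_scaled_bound(1)[OF VL])
      show "(\<lambda>x. - (of_real (dp x) * V x) / P x) \<in> borel_measurable (lebesgue_on UNIV)" using um qm by measurable
      show "cmod (- (of_real (dp x) * V x) / P x) \<le> ((1 / p0) * dB) * cmod (V x)" for x
        using sol2_parts[of l "cmod l" x 0 "V x"] by simp
      show "0 \<le> (1 / p0) * dB" using p0_pos dB(2) by simp
    qed
    have w3: "(\<lambda>x. xt g x / P x) \<in> L2 UNIV"
    proof (rule L2_scaled_bound(1)[OF xt_L2_UNIV[OF g(1)]])
      show "(\<lambda>x. xt g x / P x) \<in> borel_measurable (lebesgue_on UNIV)" using L2D(1)[OF xt_L2_UNIV[OF g(1)]] qm by measurable
      show "cmod (xt g x / P x) \<le> (1 / p0) * cmod (xt g x)" for x by (rule inv_P_le)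
    qed (use p0_pos in simp)
    have "sol2 l (xt g) U V = (\<lambda>x. ((of_real (q x) - l) * U x / P x + - (of_real (dp x) * V x) / P x) - xt g x / P x)"
      by (rule ext) (simp add: sol2_def diff_divide_distrib)
    then show ?thesis using L2_diff[OF L2_add[OF w1 w2] w3] by simp
  qed
  have VW: "has_weak_deriv UNIV V (sol2 l (xt g) U V)" unfolding sol2_def by (intro has_ac_deriv_imp_weak sol_second[OF s]) auto
  have UVw: "has_weak_deriv UNIV U V" using has_ac_deriv_imp_weak[OF UV open_UNIV] .
  have UW: "U \<in> W22 UNIV" by (rule W22_normI(1)[OF UVw VW open_UNIV UL VL sm])
  have U_def': "U = (\<lambda>x. 1 * G0 l g x + k * Bop l g x)" by (rule ext) (simp add: U_def)
  have LU: "AE x in lebesgue_on Q. Le U x = 1 * Le (G0 l g) x + k * Le (Bop l g) x"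
    unfolding U_def' by (rule bounded_operator_lin2[OF Le W])
  have gU: "AE x in lebesgue_on Q. g x = of_real eps * Le U x" using LU geq by eventually_elim (simp add: k_def)
  show ?thesis
  proof (intro bexI[OF _ UW] conjI)
    show "\<not> (AE x in lebesgue. U x = 0)"
    proof
      assume "AE x in lebesgue. U x = 0"
      then have "AE x in lebesgue_on Q. U x = 0" by (intro AE_restrict) auto
      then have U0: "U \<in> W22 Q" "W22_norm Q U = 0" using W22_zero by auto
      have "L2_norm Q (Le U) \<le> 0" using bounded_operatorD(3)[OF Le U0(1)] U0(2) by simp
      then have "L2_norm Q (Le U) = 0" using L2_norm_nonneg[of Q "Le U"] by simp
      then have "AE x in lebesgue_on Q. Le U x = 0" using L2_norm_zero_iff[OF bounded_operatorD(1)[OF Le U0(1)]] by simp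
      then have "AE x in lebesgue_on Q. g x = 0" using gU by eventually_elim simp
      then show False using g(2) by simp
    qed
    have d1: "AE x in lebesgue. weak_deriv UNIV U x = V x" using weak_deriv_AE(2)[OF UVw open_UNIV] by (simp only: AE_lebesgue_on_UNIV)
    then have "AE x in lebesgue_on UNIV. P x * V x = P x * weak_deriv UNIV U x" unfolding AE_lebesgue_on_UNIV by eventually_elim simp
    then have "has_weak_deriv UNIV (\<lambda>x. P x * weak_deriv UNIV U x) (\<lambda>x. (of_real (q x) - l) * U x - xt g x)"
      by (rule has_weak_deriv_cong_AE[OF has_ac_deriv_imp_weak[OF PV open_UNIV] open_UNIV]) simp
    from weak_deriv_AE(2)[OF this open_UNIV]
    have d2: "AE x in lebesgue. weak_deriv UNIV (\<lambda>x. P x * weak_deriv UNIV U x) x = (of_real (q x) - l) * U x - xt g x"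
      by (simp only: AE_lebesgue_on_UNIV)
    have gx: "AE x in lebesgue. xt g x = of_real eps * xt (Le U) x"
      using gU by (auto simp: AE_lebesgue_on_iff extend_by_zero_def elim!: eventually_mono)
    show "AE x in lebesgue. - weak_deriv UNIV (\<lambda>y. P y * weak_deriv UNIV U y) x + of_real (q x) * U x - of_real eps * xt (Le U) x = l * U x"
      using d2 gx by eventually_elim (simp add: algebra_simps)
  qed
qed

end

section \<open>Reduction to a scalar equation\<close>

text \<open>A simple zero makes \<open>f\<close> injective on a small ball. The inverse is
  holomorphic on the open image, so its derivatives are bounded on a closed disc, which gives the
  Lipschitz bound and, by Taylor, the quadratic remainder. Continuity of \<open>f\<close> at
  \<open>c\<close> gives the radius \<open>r\<close> for the converse.\<close>

lemma holomorphic_local_inverse: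
  fixes f :: "complex \<Rightarrow> complex"
  assumes f: "f holomorphic_on UNIV" and z0: "f c = 0" and d: "deriv f c \<noteq> 0" and e: "e > 0"
  obtains \<Lambda> r \<delta> \<kappa> where "r > 0" "0 < \<delta>" "\<delta> \<le> 1" "\<kappa> \<ge> 0" "\<Lambda> 0 = c"
    "\<And>w. cmod w \<le> \<delta> \<Longrightarrow> f (\<Lambda> w) = w"
    "\<And>w. cmod w \<le> \<delta> \<Longrightarrow> cmod (\<Lambda> w - c) < e"
    "\<And>w w'. cmod w \<le> \<delta> \<Longrightarrow> cmod w' \<le> \<delta> \<Longrightarrow> cmod (\<Lambda> w - \<Lambda> w') \<le> \<kappa> * cmod (w - w')"
    "\<And>w. cmod w \<le> \<delta> \<Longrightarrow> cmod (\<Lambda> w - c - w / deriv f c) \<le> \<kappa> * (cmod w)\<^sup>2"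
    "\<And>l. cmod (l - c) < r \<Longrightarrow> cmod (f l) \<le> \<delta> \<and> \<Lambda> (f l) = l"
proof -
  obtain ri where ri: "ri > 0" "inj_on f (ball c ri)"
    using has_complex_derivative_locally_injective[OF f UNIV_I open_UNIV d] by blast
  define r0 where "r0 = min ri e"
  have r0: "r0 > 0" "inj_on f (ball c r0)" using ri e by (auto simp: r0_def inj_on_def)
  have fh: "f holomorphic_on ball c r0" using f holomorphic_on_subset by blast
  obtain g where g: "g holomorphic_on (f ` ball c r0)" "\<And>z. z \<in> ball c r0 \<Longrightarrow> deriv f z * deriv g (f z) = 1"
    "\<And>z. z \<in> ball c r0 \<Longrightarrow> g (f z) = z"
    using holomorphic_has_inverse[OF fh open_ball r0(2)] by metis
  have op: "open (f ` ball c r0)" using open_mapping_thm3[OF fh open_ball r0(2)] .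
  have "0 \<in> f ` ball c r0" using r0(1) z0 by (metis centre_in_ball image_eqI)
  then obtain \<delta>0 where d0: "\<delta>0 > 0" "cball 0 \<delta>0 \<subseteq> f ` ball c r0" using op open_contains_cball by meson
  define \<delta> where "\<delta> = min \<delta>0 1"
  have \<delta>: "\<delta> > 0" "\<delta> \<le> 1" "cball 0 \<delta> \<subseteq> f ` ball c r0" using d0 by (auto simp: \<delta>_def)
  have g1: "deriv g holomorphic_on (f ` ball c r0)" using holomorphic_deriv[OF g(1) op] .
  have g2: "deriv (deriv g) holomorphic_on (f ` ball c r0)" using holomorphic_deriv[OF g1 op] .
  have bdd: "\<exists>B\<ge>0. \<forall>x\<in>cball 0 \<delta>. cmod (h x) \<le> B" if "h holomorphic_on (f ` ball c r0)" for h
  proof -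
    have "compact (h ` cball 0 \<delta>)"
      by (intro compact_continuous_image compact_cball continuous_on_subset[OF holomorphic_on_imp_continuous_on[OF that] \<delta>(3)])
    then obtain B where "\<And>x. x \<in> cball 0 \<delta> \<Longrightarrow> cmod (h x) \<le> B" using compact_imp_bounded bounded_iff by (metis image_eqI)
    then show ?thesis by (intro exI[of _ "max B 0"]) force
  qed
  obtain B1 where B1: "B1 \<ge> 0" "\<And>x. x \<in> cball 0 \<delta> \<Longrightarrow> cmod (deriv g x) \<le> B1" using bdd[OF g1] by blast
  obtain B2 where B2: "B2 \<ge> 0" "\<And>x. x \<in> cball 0 \<delta> \<Longrightarrow> cmod (deriv (deriv g) x) \<le> B2" using bdd[OF g2] by blast
  have der: "(h has_field_derivative deriv h x) (at x within cball 0 \<delta>)" if "h holomorphic_on (f ` ball c r0)" "x \<in> cball 0 \<delta>" for h x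
    using holomorphic_derivI[OF that(1) op, of x] that(2) \<delta>(3) by (meson has_field_derivative_at_within subsetD)
  have T1: "cmod (g z - g w) \<le> B1 * cmod (z - w)" if "z \<in> cball 0 \<delta>" "w \<in> cball 0 \<delta>" for z w
    by (rule field_differentiable_bound[OF convex_cball der[OF g(1)]]) (use B1 that in auto)
  have T2: "cmod (g z - (g 0 + deriv g 0 * z)) \<le> B2 * (cmod z)\<^sup>2" if z: "z \<in> cball 0 \<delta>" for z
  proof -
    define ff where "ff i = (if i = 0 then g else if i = 1 then deriv g else deriv (deriv g))" for i :: nat
    have "cmod (ff 0 z - (\<Sum>i\<le>1. ff i 0 * (z - 0) ^ i / fact i)) \<le> B2 * cmod (z - 0) ^ (Suc 1) / fact 1"
    proof (rule complex_Taylor[OF convex_cball])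
      show "(ff i has_field_derivative ff (Suc i) x) (at x within cball 0 \<delta>)" if "x \<in> cball 0 \<delta>" "i \<le> 1" for i x
        using that der[OF g(1)] der[OF g1] by (cases "i = 0") (auto simp: ff_def)
    qed (use B2 \<delta> z in \<open>auto simp: ff_def\<close>)
    then show ?thesis by (simp add: ff_def power2_eq_square)
  qed
  have g0: "g 0 = c" using g(3)[of c] z0 r0(1) by simp
  have gd: "deriv g 0 = 1 / deriv f c" using g(2)[of c] z0 r0(1) d by (simp add: field_simps)
  have fg: "f (g w) = w" "cmod (g w - c) < e" if "cmod w \<le> \<delta>" for w
  proof -
    have "w \<in> f ` ball c r0" using that \<delta>(3) by auto
    then obtain z where "z \<in> ball c r0" "w = f z" by blast
    then show "f (g w) = w" "cmod (g w - c) < e" using g(3)[of z] by (auto simp: r0_def dist_norm norm_minus_commute)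
  qed
  have "isCont f c" using f by (metis UNIV_I continuous_on_eq_continuous_at holomorphic_on_imp_continuous_on open_UNIV)
  then obtain r1 where r1: "r1 > 0" "\<And>l. cmod (l - c) < r1 \<Longrightarrow> cmod (f l) < \<delta>"
    unfolding continuous_at_eps_delta using \<delta>(1) z0 by (auto simp: dist_norm)
  show ?thesis
  proof (rule that[of "min r0 r1" \<delta> "max B1 B2" g])
    fix w w' assume *: "cmod w \<le> \<delta>" "cmod w' \<le> \<delta>"
    have "cmod (g w - g w') \<le> B1 * cmod (w - w')" using T1 * by simp
    also have "\<dots> \<le> max B1 B2 * cmod (w - w')" by (intro mult_right_mono) auto
    finally show "cmod (g w - g w') \<le> max B1 B2 * cmod (w - w')" .
  next
    fix w assume *: "cmod w \<le> \<delta>"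
    have "cmod (g w - c - w / deriv f c) \<le> B2 * (cmod w)\<^sup>2" using T2[of w] * by (simp add: g0 gd algebra_simps)
    also have "\<dots> \<le> max B1 B2 * (cmod w)\<^sup>2" by (intro mult_right_mono) auto
    finally show "cmod (g w - c - w / deriv f c) \<le> max B1 B2 * (cmod w)\<^sup>2" .
  next
    fix l assume "cmod (l - c) < min r0 r1"
    then show "cmod (f l) \<le> \<delta> \<and> g (f l) = l" using r1(2)[of l] g(3)[of l] by (auto simp: dist_norm norm_minus_commute)
  qed (use r0 r1 \<delta> B1 g0 fg in auto)
qed

text \<open>The imaginary part of w^2 = 1 + z^2 gives Re w (Re w Re z + Im w Im z) = ((Re w)^2 + (Im
  z)^2) Re z. Hence |w + z|^2 - |w - z|^2 has the sign of Re z, while |w - z| |w + z| = 1.\<close>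

lemma multiplier_modulus:
  assumes wz: "w * w = 1 + z * z" and w: "Re w > 0"
  shows "Re z > 0 \<Longrightarrow> cmod (w - z) < 1" "Re z = 0 \<Longrightarrow> cmod (w - z) = 1"
proof -
  have "(w - z) * (w + z) = 1" using wz by (simp add: algebra_simps)
  then have pr: "cmod (w - z) * cmod (w + z) = 1" by (metis norm_mult norm_one)
  have id: "(cmod (w + z))\<^sup>2 - (cmod (w - z))\<^sup>2 = 4 * (Re w * Re z + Im w * Im z)"
    unfolding cmod_power2 by (simp add: power2_eq_square algebra_simps)
  have im: "Re w * Im w = Re z * Im z" using arg_cong[OF wz, of Im] by (simp add: mult.commute)
  show "cmod (w - z) < 1" if "Re z > 0"
  proof -
    have "Re w * (Re w * Re z + Im w * Im z) = (Re w * Re w + Im z * Im z) * Re z" using im by algebra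
    moreover have "(Re w * Re w + Im z * Im z) * Re z > 0" using w that by (simp add: add_pos_nonneg)
    ultimately have "Re w * Re z + Im w * Im z > 0" using w by (metis zero_less_mult_pos)
    then have "(cmod (w - z))\<^sup>2 < (cmod (w + z))\<^sup>2" using id by simp
    then have lt: "cmod (w - z) < cmod (w + z)" by (rule power2_less_imp_less) simp
    show ?thesis
    proof (rule ccontr)
      assume "\<not> ?thesis"
      then have "1 \<le> cmod (w - z)" "1 < cmod (w + z)" using lt by auto
      then have "1 * 1 < cmod (w - z) * cmod (w + z)" by (intro mult_le_less_imp_less) auto
      then show False using pr by simp
    qed
  qed
  show "cmod (w - z) = 1" if "Re z = 0"
  proof -
    have "Im w = 0" using im w that by simp
    then have "(cmod (w - z))\<^sup>2 = (cmod (w + z))\<^sup>2" using id that by simp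
    then have "cmod (w - z) = cmod (w + z)" by simp
    then show ?thesis using pr by (metis abs_norm_cancel abs_square_eq_1 power2_eq_square)
  qed
qed

section \<open>Eigenvalues as roots of a scalar equation\<close>

context edge_Q begin

definition "S l = D l * D l / 4 - 1"

lemma D_mc: "D mc = 2 * of_real sg" using D_m by simp

lemma S_holo: "S holomorphic_on A"
  unfolding S_def[abs_def] by (intro holomorphic_intros D_holomorphic) auto

lemma S_mc: "S mc = 0" using sg_c by (simp add: S_def D_mc)

lemma dD_pm: "of_real sg * dD = - of_real (pm s * cmod dD)"
proof -
  have "of_real sg * dD = of_real (sg * Re dD)" using dD_real by simp
  then show ?thesis using dD_sign by simp
qed

text \<open>At the edge D/2 = \<open>sg\<close>, so S' is \<open>sg\<close> times D', whose sign is
  known; in particular the zero of S is simple.\<close>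

lemma deriv_S: "deriv S mc = - of_real (pm s * cmod dD)"
proof -
  have "(D has_field_derivative dD) (at mc)" using holomorphic_derivI[OF D_holomorphic open_UNIV, of mc UNIV] by (simp add: dD_def)
  then have "(S has_field_derivative (dD * D mc + D mc * dD) / 4) (at mc)"
    unfolding S_def[abs_def] by (auto intro!: derivative_eq_intros)
  then have "deriv S mc = (dD * D mc + D mc * dD) / 4" by (rule DERIV_imp_deriv)
  also have "\<dots> = of_real sg * dD" by (simp add: D_mc)
  finally show ?thesis using dD_pm by simp
qed

lemma pm_sq: "pm s * pm s = 1" "\<bar>pm s\<bar> = 1" by (cases s; simp)+

lemma S_zw:
  assumes "S l = z * z" shows "zw l z (of_real sg * D l / 2)"
proof -
  have "of_real sg * D l / 2 * (of_real sg * D l / 2) = (of_real sg * of_real sg) * (D l * D l) / 4" by simp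
  also have "\<dots> = 1 + z * z" using assms by (simp only: sg_c) (simp add: S_def algebra_simps)
  finally have "of_real sg * D l / 2 * (of_real sg * D l / 2) = 1 + z * z" .
  moreover have "2 * of_real sg * (of_real sg * D l / 2) = D l" using sg_c by (simp add: mult.assoc[symmetric])
  ultimately show ?thesis by (simp add: zw_def)
qed

definition "eig Le eps l \<longleftrightarrow> (\<exists>u\<in>W22 UNIV. \<not> (AE x in lebesgue. u x = 0) \<and>
    (AE x in lebesgue. - weak_deriv UNIV (\<lambda>y. P y * weak_deriv UNIV u y) x + of_real (q x) * u x - of_real eps * xt (Le u) x = l * u x))"

lemma phic_W22: "phic \<in> W22 Q"
proof -
  let ?v = "\<lambda>x. phic 0 * dth1 mc x + of_real (deriv \<phi> 0) * dth2 mc x"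
  have bdd: "\<exists>B. \<forall>x\<in>{a..b}. cmod (u x) \<le> B" if "continuous_on UNIV u" for u :: "real \<Rightarrow> complex"
    using compact_imp_bounded[OF compact_continuous_image[OF continuous_on_subset[OF that subset_UNIV] compact_Icc]]
    by (auto simp: bounded_iff)
  obtain B1 B2 where B: "\<forall>x\<in>{a..b}. cmod (phic x) \<le> B1" "\<forall>x\<in>{a..b}. cmod (?v x) \<le> B2"
    using bdd[OF sol_cont(1)[OF sol_phi]] bdd[OF sol_cont(2)[OF sol_phi]] by blast
  show ?thesis
  proof (rule sol_W22[OF ab norm_ge_zero[of mc]])
    fix C :: real
    assume C: "\<And>l f u v A. cmod l \<le> cmod mc \<Longrightarrow> sol l f u v \<Longrightarrow> f \<in> L2 Q \<Longrightarrow> A \<ge> 0 \<Longrightarrow>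
      (\<And>x. x \<in> Q \<Longrightarrow> cmod (u x) \<le> A \<and> cmod (v x) \<le> A) \<Longrightarrow> u \<in> W22 Q \<and> W22_norm Q u \<le> C * (A + L2_norm Q f)"
    have "cmod (phic x) \<le> max 0 (max B1 B2) \<and> cmod (?v x) \<le> max 0 (max B1 B2)" if "x \<in> Q" for x
    proof -
      have "x \<in> {a..b}" using that by auto
      then show ?thesis using bspec[OF B(1)] bspec[OF B(2)] by (metis max.coboundedI1 max.coboundedI2)
    qed
    then show ?thesis using C[OF order_refl sol_phi L2_zero, of "max 0 (max B1 B2)"] by auto
  qed
qed

lemma phic_L2: "phic \<in> L2 Q" using phic_W22 by (simp add: W22_def)

text \<open>At the edge \<open>Bop\<close> is a multiple of the inner product with \<phi>, so adding
  and subtracting its edge value moves the whole pole into a multiple of L \<phi>.\<close>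

lemma key_equation:
  assumes Le: "bounded_operator_W22_L2 Q M Le" and g: "g \<in> L2 Q"
  shows "AE x in lebesgue_on Q. of_real eps * (Le (G0 l g) x + (of_real sg / (2 * z)) * Le (Bop l g) x)
    = (of_real (eps * pm s) / (2 * z) * L2_inner Q g phic) * Le phic x + of_real eps * T Le l z g x"
proof -
  let ?c = "of_real (pm s * sg) * L2_inner Q g phic"
  have eq: "Bop mc g = (\<lambda>x. ?c * phic x + 0 * phic x)" by (rule ext) (simp add: Bop_edge[OF g])
  have "AE x in lebesgue_on Q. Le (Bop mc g) x = ?c * Le phic x + 0 * Le phic x"
    unfolding eq by (rule bounded_operator_lin2[OF Le phic_W22 phic_W22])
  then show ?thesis
  proof eventually_elim
    case (elim x)
    have "of_real sg / (2 * z) * (?c * Le phic x) = (of_real sg * of_real sg) * (of_real (pm s) / (2 * z) * L2_inner Q g phic * Le phic x)"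
      by simp
    then have e: "of_real sg / (2 * z) * (?c * Le phic x) = of_real (pm s) / (2 * z) * L2_inner Q g phic * Le phic x"
      by (simp only: sg_c mult_1)
    have "T Le l z g x = Le (G0 l g) x + (of_real sg / (2 * z)) * Le (Bop l g) x - of_real sg / (2 * z) * (?c * Le phic x)"
      unfolding T_def elim by (simp only: right_diff_distrib mult_zero_left add_0_right add_diff_eq)
    then have Teq: "T Le l z g x = Le (G0 l g) x + (of_real sg / (2 * z)) * Le (Bop l g) x - of_real (pm s) / (2 * z) * L2_inner Q g phic * Le phic x"
      unfolding e .
    show ?case unfolding Teq by (simp add: algebra_simps)
  qed
qed

text \<open>The equation for g reads g = c L \<phi> + \<epsilon> T g with c proportional to the
  inner product of g with \<phi>. Uniqueness gives g = c h, non-triviality gives c \<noteq> 0, and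
  pairing with \<phi> leaves the condition on z. Conversely that condition makes h itself
  admissible, with c = 1.\<close>

lemma eig_iff:
  assumes Le: "bounded_operator_W22_L2 Q M Le" and zS: "S l = z * z" and w: "Re (of_real sg * D l / 2) > 0" and z: "Re z > 0"
    and W: "\<And>g. g \<in> L2 Q \<Longrightarrow> G0 l g \<in> W22 Q \<and> Bop l g \<in> W22 Q"
    and op: "L2_bounded_op Q \<kappa> (\<lambda>g x. of_real eps * T Le l z g x)" "\<kappa> \<le> 1/2"
    and h: "h \<in> L2 Q" "AE x in lebesgue_on Q. h x = Le phic x + of_real eps * T Le l z h x"
  shows "eig Le eps l \<longleftrightarrow> z = of_real (eps * pm s / 2) * L2_inner Q h phic"
proof -
  let ?w = "of_real sg * D l / 2"
  let ?f = "Le phic"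
  have fL: "?f \<in> L2 Q" using bounded_operatorD(1)[OF Le phic_W22] .
  have zw: "zw l z ?w" using S_zw[OF zS] .
  have wz: "cmod (?w - z) < 1" using multiplier_modulus(1)[OF _ w z] zw by (simp add: zw_def)
  have znz: "z \<noteq> 0" using z by auto
  show ?thesis
  proof
    assume "eig Le eps l"
    then obtain u where u: "u \<in> W22 UNIV" "\<not> (AE x in lebesgue. u x = 0)"
      "AE x in lebesgue. - weak_deriv UNIV (\<lambda>y. P y * weak_deriv UNIV u y) x + of_real (q x) * u x - of_real eps * xt (Le u) x = l * u x"
      unfolding eig_def by blast
    obtain g where g: "g \<in> L2 Q" "\<not> (AE x in lebesgue_on Q. g x = 0)"
      and g1: "cmod (?w - z) < 1 \<Longrightarrow> AE x in lebesgue_on Q. g x = of_real eps * (Le (G0 l g) x + (of_real sg / (2 * z)) * Le (Bop l g) x)"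
      using spectral_necessary[OF Le zw less_imp_le[OF wz] W u] by blast
    note g3 = g1[OF wz]
    define c where "c = of_real (eps * pm s) / (2 * z) * L2_inner Q g phic"
    have gf: "AE x in lebesgue_on Q. g x = c * ?f x + of_real eps * T Le l z g x"
      using g3 key_equation[OF Le g(1), of eps l z] by eventually_elim (simp add: c_def)
    have "AE x in lebesgue_on Q. of_real eps * T Le l z (\<lambda>y. 0 + c * h y) x = of_real eps * T Le l z (\<lambda>_. 0) x + c * (of_real eps * T Le l z h x)"
      using L2_bounded_opD(2)[OF op(1) L2_zero h(1)] .
    moreover have "AE x in lebesgue_on Q. of_real eps * T Le l z (\<lambda>_. 0) x = 0"
      using L2_bounded_opD(2)[OF op(1) L2_zero L2_zero, of 1] by eventually_elim simp
    ultimately have chf: "AE x in lebesgue_on Q. c * h x = c * ?f x + of_real eps * T Le l z (\<lambda>y. c * h y) x"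
      using h(2)
    proof eventually_elim
      case (elim x)
      then have "c * h x = c * Le phic x + c * (of_real eps * T Le l z h x)" by (metis distrib_left)
      then show ?case using elim(1,2) by auto
    qed
    have gh: "AE x in lebesgue_on Q. g x = c * h x"
      by (rule L2_fixpoint_unique[OF op L2_cmult[OF fL] g(1) gf L2_cmult[OF h(1)] chf])
    have "c \<noteq> 0"
    proof
      assume "c = 0"
      then have "AE x in lebesgue_on Q. g x = 0" using gh by simp
      then show False using g(2) by simp
    qed
    have "L2_inner Q g phic = L2_inner Q (\<lambda>x. c * h x) phic" using L2_inner_cong_AE[OF g(1) L2_cmult[OF h(1)] phic_L2 gh] .
    also have "\<dots> = c * L2_inner Q h phic" by (simp add: L2_inner_def mult.assoc)
    finally have "c = of_real (eps * pm s) / (2 * z) * (c * L2_inner Q h phic)" by (simp add: c_def)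
    then have "c * (2 * z) = c * (of_real (eps * pm s) * L2_inner Q h phic)" using znz by (simp add: field_simps)
    then have "2 * z = of_real (eps * pm s) * L2_inner Q h phic" using mult_left_cancel[OF \<open>c \<noteq> 0\<close>] by blast
    then show "z = of_real (eps * pm s / 2) * L2_inner Q h phic" by (simp add: field_simps)
  next
    assume ze: "z = of_real (eps * pm s / 2) * L2_inner Q h phic"
    have c1: "of_real (eps * pm s) / (2 * z) * L2_inner Q h phic = 1"
    proof -
      have "of_real (eps * pm s) * L2_inner Q h phic = 2 * z" using ze by (simp add: mult.commute)
      then show ?thesis using znz by (simp add: field_simps)
    qed
    have heq: "AE x in lebesgue_on Q. h x = of_real eps * (Le (G0 l h) x + (of_real sg / (2 * z)) * Le (Bop l h) x)"
      using h(2) key_equation[OF Le h(1), of eps l z] unfolding c1 by eventually_elim simp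
    have "\<not> (AE x in lebesgue_on Q. h x = 0)"
    proof
      assume "AE x in lebesgue_on Q. h x = 0"
      then have "L2_inner Q h phic = L2_inner Q (\<lambda>_. 0) phic" by (intro L2_inner_cong_AE h(1) L2_zero phic_L2)
      then have "L2_inner Q h phic = 0" by (simp add: L2_inner_def)
      then show False using ze znz by simp
    qed
    then show "eig Le eps l" unfolding eig_def
      using spectral_sufficient[OF Le zw wz znz conjunct1[OF W[OF h(1)]] conjunct2[OF W[OF h(1)]] h(1) _ heq] by blast
  qed
qed

text \<open>For Re z = 0 the multipliers have modulus 1, so an eigenfunction would satisfy g =
  \<epsilon> L G0 g, which a contraction by 1/2 excludes.\<close>

lemma not_eig:
  assumes Le: "bounded_operator_W22_L2 Q M Le" and zS: "S l = z * z" and w: "Re (of_real sg * D l / 2) > 0" and z: "Re z = 0"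
    and W: "\<And>g. g \<in> L2 Q \<Longrightarrow> G0 l g \<in> W22 Q \<and> Bop l g \<in> W22 Q"
    and op: "\<And>g. g \<in> L2 Q \<Longrightarrow> L2_norm Q (Le (G0 l g)) \<le> K * L2_norm Q g" and eps: "eps \<ge> 0" "eps * K \<le> 1/2"
  shows "\<not> eig Le eps l"
proof
  let ?w = "of_real sg * D l / 2"
  assume "eig Le eps l"
  then obtain u where u: "u \<in> W22 UNIV" "\<not> (AE x in lebesgue. u x = 0)"
    "AE x in lebesgue. - weak_deriv UNIV (\<lambda>y. P y * weak_deriv UNIV u y) x + of_real (q x) * u x - of_real eps * xt (Le u) x = l * u x"
    unfolding eig_def by blast
  have zw: "zw l z ?w" using S_zw[OF zS] .
  have wz: "cmod (?w - z) = 1" using multiplier_modulus(2)[OF _ w z] zw by (simp add: zw_def)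
  obtain g where g: "g \<in> L2 Q" "\<not> (AE x in lebesgue_on Q. g x = 0)"
    and g1: "cmod (?w - z) = 1 \<Longrightarrow> AE x in lebesgue_on Q. g x = of_real eps * Le (G0 l g) x"
    using spectral_necessary[OF Le zw eq_refl[OF wz] W u] by blast
  note g3 = g1[OF wz]
  have LL: "Le (G0 l g) \<in> L2 Q" using bounded_operatorD(1)[OF Le] W[OF g(1)] by blast
  have "L2_norm Q g = eps * L2_norm Q (Le (G0 l g))"
    using L2_norm_cong_AE[OF g(1) L2_cmult[OF LL] g3] eps(1) by (simp add: L2_norm_cmult)
  also have "\<dots> \<le> eps * (K * L2_norm Q g)" using op[OF g(1)] eps(1) by (rule mult_left_mono)
  also have "\<dots> = (eps * K) * L2_norm Q g" by simp
  also have "\<dots> \<le> 1/2 * L2_norm Q g" using eps(2) L2_norm_nonneg by (rule mult_right_mono)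
  finally have "L2_norm Q g = 0" using L2_norm_nonneg[of Q g] by linarith
  then show False using L2_norm_zero_iff[OF g(1)] g(2) by simp
qed

end

text \<open>h = f + T f + (T h - T f), and the norm of h - f = T h is at most 2 \<kappa> times that
  of f, so the remainder is of second order in \<kappa>. This produces k1 and k2 as the first two
  terms.\<close>

lemma L2_fixpoint_second_order:
  assumes T: "L2_bounded_op S \<kappa> T" "0 \<le> \<kappa>" "\<kappa> \<le> 1/2" and f: "f \<in> L2 S" and k: "k \<in> L2 S"
    and h: "h \<in> L2 S" "AE x in lebesgue_on S. h x = f x + T h x"
  shows "cmod (L2_inner S h k - (L2_inner S f k + L2_inner S (T f) k)) \<le> 2 * \<kappa>\<^sup>2 * L2_norm S f * L2_norm S k"
proof -
  note D = L2_bounded_opD[OF T(1)]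
  have n: "L2_norm S h \<le> 2 * L2_norm S f"
  proof -
    have "L2_norm S h \<le> L2_norm S f / (1 - \<kappa>)" by (rule L2_fixpoint_bound[OF T(1) _ f h]) (use T(3) in simp)
    also have "\<dots> \<le> L2_norm S f / (1/2)" by (intro divide_left_mono L2_norm_nonneg) (use T(3) in auto)
    finally show ?thesis by simp
  qed
  have L: "(\<lambda>x. h x - f x) \<in> L2 S" "(\<lambda>x. T h x - T f x) \<in> L2 S" by (intro L2_diff f h D)+
  have "AE x in lebesgue_on S. h x - f x = T h x" using h(2) by eventually_elim simp
  then have "L2_norm S (\<lambda>x. h x - f x) = L2_norm S (T h)" by (rule L2_norm_cong_AE[OF L(1) D(1)[OF h(1)]])
  also have "\<dots> \<le> \<kappa> * (2 * L2_norm S f)" using D(3)[OF h(1)] mult_left_mono[OF n T(2)] by linarith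
  finally have hf: "L2_norm S (\<lambda>x. h x - f x) \<le> \<kappa> * (2 * L2_norm S f)" .
  have t: "L2_norm S (\<lambda>x. T h x - T f x) \<le> 2 * \<kappa>\<^sup>2 * L2_norm S f"
    using L2_bounded_op_diff(2)[OF T(1) h(1) f] mult_left_mono[OF hf T(2)] by (simp add: power2_eq_square)
  have "L2_inner S h k = L2_inner S (\<lambda>x. (f x + 1 * T f x) + 1 * (T h x - T f x)) k"
    by (rule L2_inner_cong_AE[OF h(1) _ k]) (use h(2) in \<open>auto intro!: L2_add L2_diff f h D\<close>)
  also have "\<dots> = L2_inner S f k + L2_inner S (T f) k + L2_inner S (\<lambda>x. T h x - T f x) k"
    by (simp add: L2_inner_linear[OF L2_lincomb[OF f D(1)[OF f]] L(2) k, of 1 1, simplified] L2_inner_linear[OF f D(1)[OF f] k, of 1, simplified])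
  finally have "cmod (L2_inner S h k - (L2_inner S f k + L2_inner S (T f) k)) = cmod (L2_inner S (\<lambda>x. T h x - T f x) k)" by simp
  also have "\<dots> \<le> L2_norm S (\<lambda>x. T h x - T f x) * L2_norm S k" by (rule L2_inner_bound[OF L(2) k])
  also have "\<dots> \<le> 2 * \<kappa>\<^sup>2 * L2_norm S f * L2_norm S k" by (intro mult_right_mono t L2_norm_nonneg)
  finally show ?thesis .
qed

section \<open>Uniform reduction near the edge\<close>

context edge_Q begin

abbreviation "Gm \<equiv> green_operator Q th1 th2 m"

lemma T_at_edge: "T Le mc 0 g = Le (G0 mc g)" by (simp add: T_def fun_eq_iff)

text \<open>\<open>L2_inverse\<close> only chooses some preimage. It solves the same fixed point
  equation as h at z = 0, whose solution is unique up to null sets, so the inner product does not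
  depend on the choice.\<close>

lemma L2_inverse_fixpoint:
  assumes op: "L2_bounded_op Q \<kappa> (\<lambda>g x. of_real eps * T Le mc 0 g x)" "\<kappa> \<le> 1/2" and f: "f \<in> L2 Q"
    and h: "h \<in> L2 Q" "AE x in lebesgue_on Q. h x = f x + of_real eps * T Le mc 0 h x"
  shows "L2_inner Q (L2_inverse Q (\<lambda>g x. g x - of_real eps * Le (Gm g) x) f) phic = L2_inner Q h phic"
proof -
  let ?g = "L2_inverse Q (\<lambda>g x. g x - of_real eps * Le (Gm g) x) f"
  have G: "Gm g = G0 mc g" if "g \<in> L2 Q" for g using green_operator_eq[OF that] by (rule ext)
  have "\<exists>g. g \<in> L2 Q \<and> (AE x in lebesgue_on Q. g x - of_real eps * Le (Gm g) x = f x)"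
    using h by (intro exI[of _ h]) (auto simp: G T_at_edge elim!: eventually_mono)
  from someI_ex[OF this] have g: "?g \<in> L2 Q" "AE x in lebesgue_on Q. ?g x - of_real eps * Le (Gm ?g) x = f x"
    unfolding L2_inverse_def by blast+
  have g2: "AE x in lebesgue_on Q. ?g x = f x + of_real eps * T Le mc 0 ?g x"
    using g(2) unfolding G[OF g(1)] T_at_edge by eventually_elim (simp add: algebra_simps)
  have "AE x in lebesgue_on Q. ?g x = h x" by (rule L2_fixpoint_unique[OF op f g(1) g2 h])
  then show ?thesis by (rule L2_inner_cong_AE[OF g(1) h(1) phic_L2])
qed

text \<open>The local inverse of S, evaluated at z^2. The factorisation z^2 - z'^2 = (z - z')(z +
  z') yields precisely the Lipschitz hypothesis required of the regularised family.\<close>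

lemma spectral_parameter:
  obtains \<Lambda> r \<rho> \<kappa> where "r > 0" "0 < \<rho>" "\<rho> \<le> 1" "\<kappa> \<ge> 0" "\<Lambda> 0 = mc"
    "\<And>z. cmod z \<le> \<rho> \<Longrightarrow> S (\<Lambda> (z * z)) = z * z"
    "\<And>z. cmod z \<le> \<rho> \<Longrightarrow> Re (of_real sg * D (\<Lambda> (z * z)) / 2) > 0"
    "\<And>z. cmod z \<le> \<rho> \<Longrightarrow> cmod (\<Lambda> (z * z) - mc) \<le> \<kappa> * (cmod z)\<^sup>2"
    "\<And>z z'. cmod z \<le> \<rho> \<Longrightarrow> cmod z' \<le> \<rho> \<Longrightarrow> cmod (\<Lambda> (z * z) - \<Lambda> (z' * z')) \<le> \<kappa> * cmod (z - z') * (cmod z + cmod z')"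
    "\<And>z. cmod z \<le> \<rho> \<Longrightarrow> cmod (\<Lambda> (z * z) - mc + of_real (pm s / cmod dD) * (z * z)) \<le> \<kappa> * cmod z ^ 4"
    "\<And>l. cmod (l - mc) < r \<Longrightarrow> \<exists>z. cmod z \<le> \<rho> \<and> Re z \<ge> 0 \<and> l = \<Lambda> (z * z)"
proof -
  have "isCont D mc" using D_holomorphic[of UNIV] by (metis UNIV_I continuous_on_eq_continuous_at holomorphic_on_imp_continuous_on open_UNIV)
  then have "isCont (\<lambda>l. Re (of_real sg * D l / 2)) mc" unfolding isCont_def by (intro tendsto_intros) auto
  moreover have "Re (of_real sg * D mc / 2) = 1" using sg2(1) by (simp add: D_mc)
  ultimately obtain e where e: "e > 0" "\<And>l. dist l mc < e \<Longrightarrow> dist (Re (of_real sg * D l / 2)) 1 < 1"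
    unfolding continuous_at_eps_delta by (metis zero_less_one)
  have ePos: "Re (of_real sg * D l / 2) > 0" if "cmod (l - mc) < e" for l
    using e(2)[of l] that by (simp add: dist_norm)
  have dnz: "deriv S mc \<noteq> 0" unfolding deriv_S using dD_nz pm_sq(2) by auto
  obtain \<Lambda> r \<delta> \<kappa> where L: "r > 0" "0 < \<delta>" "\<delta> \<le> 1" "\<kappa> \<ge> 0" "\<Lambda> 0 = mc"
    "\<And>w. cmod w \<le> \<delta> \<Longrightarrow> S (\<Lambda> w) = w"
    "\<And>w. cmod w \<le> \<delta> \<Longrightarrow> cmod (\<Lambda> w - mc) < e"
    "\<And>w w'. cmod w \<le> \<delta> \<Longrightarrow> cmod w' \<le> \<delta> \<Longrightarrow> cmod (\<Lambda> w - \<Lambda> w') \<le> \<kappa> * cmod (w - w')"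
    "\<And>w. cmod w \<le> \<delta> \<Longrightarrow> cmod (\<Lambda> w - mc - w / deriv S mc) \<le> \<kappa> * (cmod w)\<^sup>2"
    "\<And>l. cmod (l - mc) < r \<Longrightarrow> cmod (S l) \<le> \<delta> \<and> \<Lambda> (S l) = l"
    by (rule holomorphic_local_inverse[OF S_holo[of UNIV] S_mc dnz e(1)]) blast
  define \<rho> where "\<rho> = sqrt \<delta>"
  have zz: "cmod (z * z) \<le> \<delta>" if "cmod z \<le> \<rho>" for z
  proof -
    have "(cmod z)\<^sup>2 \<le> \<rho>\<^sup>2" using that by (intro power_mono) auto
    then show ?thesis using L(2) by (simp add: \<rho>_def norm_mult power2_eq_square)
  qed
  show ?thesis
  proof (rule that[of r \<rho> \<kappa> \<Lambda>])
    show "0 < \<rho>" "\<rho> \<le> 1" using L(2,3) by (auto simp: \<rho>_def)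
  next
    fix z assume z: "cmod z \<le> \<rho>"
    show "S (\<Lambda> (z * z)) = z * z" "Re (of_real sg * D (\<Lambda> (z * z)) / 2) > 0"
      using L(6)[OF zz[OF z]] ePos[OF L(7)[OF zz[OF z]]] by auto
    show "cmod (\<Lambda> (z * z) - mc) \<le> \<kappa> * (cmod z)\<^sup>2"
      using L(8)[OF zz[OF z], of 0] L(2,5) by (simp add: norm_mult power2_eq_square)
    have "z * z / deriv S mc = - (of_real (pm s / cmod dD) * (z * z))"
      unfolding deriv_S by (cases s) auto
    then show "cmod (\<Lambda> (z * z) - mc + of_real (pm s / cmod dD) * (z * z)) \<le> \<kappa> * cmod z ^ 4"
      using L(9)[OF zz[OF z]] by (simp add: norm_mult power2_eq_square power4_eq_xxxx mult.assoc)
  next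
    fix z z' assume z: "cmod z \<le> \<rho>" "cmod z' \<le> \<rho>"
    have "cmod (\<Lambda> (z * z) - \<Lambda> (z' * z')) \<le> \<kappa> * cmod (z * z - z' * z')" by (rule L(8)[OF zz[OF z(1)] zz[OF z(2)]])
    also have "z * z - z' * z' = (z - z') * (z + z')" by (simp add: algebra_simps)
    also have "\<kappa> * cmod \<dots> \<le> \<kappa> * (cmod (z - z') * (cmod z + cmod z'))"
      unfolding norm_mult by (intro mult_left_mono norm_triangle_ineq L(4)) auto
    finally show "cmod (\<Lambda> (z * z) - \<Lambda> (z' * z')) \<le> \<kappa> * cmod (z - z') * (cmod z + cmod z')" by (simp add: mult.assoc)
  next
    fix l assume l: "cmod (l - mc) < r"
    \<comment> \<open>The principal root selects the representative with Re z \<ge> 0, so every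
      spectral parameter near the edge is covered by the decaying or the borderline case.\<close>
    let ?z = "csqrt (S l)"
    have "?z * ?z = S l" using power2_csqrt[of "S l"] by (simp add: power2_eq_square)
    moreover have "cmod ?z \<le> \<rho>"
    proof (rule power2_le_imp_le)
      have "(cmod ?z)\<^sup>2 = cmod (S l)" by (metis norm_power power2_csqrt)
      then show "(cmod ?z)\<^sup>2 \<le> \<rho>\<^sup>2" using L(10)[OF l] L(2) by (simp add: \<rho>_def)
    qed (use L(2) in \<open>simp add: \<rho>_def\<close>)
    ultimately show "\<exists>z. cmod z \<le> \<rho> \<and> Re z \<ge> 0 \<and> l = \<Lambda> (z * z)"
      using L(10)[OF l] csqrt_principal[of "S l"] by (intro exI[of _ ?z]) auto
  qed (use L in auto)
qed

text \<open>The Lipschitz constant carries the factor \<open>eps\<close> because F depends on z only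
  through \<open>eps\<close> times the operator family. The half-plane Re z < 0 is left out: it
  describes the same spectral parameters with the multipliers exchanged.\<close>

definition "scalar_reduction Le eps \<Lambda> \<rho> C F \<longleftrightarrow> (\<forall>z. cmod z \<le> \<rho> \<longrightarrow> cmod (F z) \<le> C) \<and>
  (\<forall>z z'. cmod z \<le> \<rho> \<longrightarrow> cmod z' \<le> \<rho> \<longrightarrow> cmod (F z - F z') \<le> eps * C * cmod (z - z')) \<and>
  (\<forall>z. cmod z \<le> \<rho> \<longrightarrow> Re z > 0 \<longrightarrow> (eig Le eps (\<Lambda> (z * z)) \<longleftrightarrow> z = of_real eps * F z)) \<and>
  (\<forall>z. cmod z \<le> \<rho> \<longrightarrow> Re z = 0 \<longrightarrow> \<not> eig Le eps (\<Lambda> (z * z)))"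

definition "reduction_at Le eps \<Lambda> \<rho> C \<longleftrightarrow> (\<exists>F. scalar_reduction Le eps \<Lambda> \<rho> C F \<and>
  F 0 = of_real (pm s / 2) * L2_inner Q (L2_inverse Q (\<lambda>g x. g x - of_real eps * Le (Gm g) x) (Le phic)) phic \<and>
  cmod (F 0 - of_real (pm s / 2) * (L2_inner Q (Le phic) phic + of_real eps * L2_inner Q (Le (Gm (Le phic))) phic)) \<le> eps\<^sup>2 * C \<and>
  cmod (L2_inner Q (Le (Gm (Le phic))) phic) \<le> C)"

text \<open>All constants are fixed by \<open>M\<close> and the unperturbed equation, before the
  operator and the coupling are chosen. Uniformity in the coupling rests on this order of
  quantifiers.\<close>

lemma spectral_reduction:
  assumes M: "M \<ge> 0"
  obtains \<Lambda> r \<rho> \<kappa> C where "r > 0" "0 < \<rho>" "\<rho> \<le> 1" "\<kappa> \<ge> 0" "C \<ge> 0"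
    "\<And>z. cmod z \<le> \<rho> \<Longrightarrow> cmod (\<Lambda> (z * z) - mc + of_real (pm s / cmod dD) * (z * z)) \<le> \<kappa> * cmod z ^ 4"
    "\<And>l. cmod (l - mc) < r \<Longrightarrow> \<exists>z. cmod z \<le> \<rho> \<and> Re z \<ge> 0 \<and> l = \<Lambda> (z * z)"
    "\<And>Le eps. bounded_operator_W22_L2 Q M Le \<Longrightarrow> 0 < eps \<Longrightarrow> eps * C \<le> 1/2 \<Longrightarrow> reduction_at Le eps \<Lambda> \<rho> C"
proof -
  obtain \<Lambda> r \<rho> \<kappa> where L: "r > 0" "0 < \<rho>" "\<rho> \<le> 1" "\<kappa> \<ge> 0" "\<Lambda> 0 = mc"
    "\<And>z. cmod z \<le> \<rho> \<Longrightarrow> S (\<Lambda> (z * z)) = z * z"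
    "\<And>z. cmod z \<le> \<rho> \<Longrightarrow> Re (of_real sg * D (\<Lambda> (z * z)) / 2) > 0"
    "\<And>z. cmod z \<le> \<rho> \<Longrightarrow> cmod (\<Lambda> (z * z) - mc) \<le> \<kappa> * (cmod z)\<^sup>2"
    "\<And>z z'. cmod z \<le> \<rho> \<Longrightarrow> cmod z' \<le> \<rho> \<Longrightarrow> cmod (\<Lambda> (z * z) - \<Lambda> (z' * z')) \<le> \<kappa> * cmod (z - z') * (cmod z + cmod z')"
    "\<And>z. cmod z \<le> \<rho> \<Longrightarrow> cmod (\<Lambda> (z * z) - mc + of_real (pm s / cmod dD) * (z * z)) \<le> \<kappa> * cmod z ^ 4"
    "\<And>l. cmod (l - mc) < r \<Longrightarrow> \<exists>z. cmod z \<le> \<rho> \<and> Re z \<ge> 0 \<and> l = \<Lambda> (z * z)"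
    by (rule spectral_parameter) blast
  obtain C0 where C0: "C0 \<ge> 0"
    "\<And>l g. cmod (l - mc) \<le> \<kappa> \<Longrightarrow> g \<in> L2 Q \<Longrightarrow> G0 l g \<in> W22 Q \<and> Bop l g \<in> W22 Q"
    "\<And>M Le l z. M \<ge> 0 \<Longrightarrow> bounded_operator_W22_L2 Q M Le \<Longrightarrow> cmod z \<le> 1 \<Longrightarrow> cmod (l - mc) \<le> \<kappa> * (cmod z)\<^sup>2 \<Longrightarrow>
      L2_bounded_op Q (M * C0) (T Le l z)"
    "\<And>M Le l z l' z' g. M \<ge> 0 \<Longrightarrow> bounded_operator_W22_L2 Q M Le \<Longrightarrow> cmod z \<le> 1 \<Longrightarrow> cmod z' \<le> 1 \<Longrightarrow>
      cmod (l - mc) \<le> \<kappa> * (cmod z)\<^sup>2 \<Longrightarrow> cmod (l' - mc) \<le> \<kappa> * (cmod z')\<^sup>2 \<Longrightarrow>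
      cmod (l - l') \<le> \<kappa> * cmod (z - z') * (cmod z + cmod z') \<Longrightarrow> g \<in> L2 Q \<Longrightarrow>
      L2_norm Q (\<lambda>x. T Le l z g x - T Le l' z' g x) \<le> M * C0 * cmod (z - z') * L2_norm Q g"
    "\<And>M Le l g. M \<ge> 0 \<Longrightarrow> bounded_operator_W22_L2 Q M Le \<Longrightarrow> cmod (l - mc) \<le> \<kappa> \<Longrightarrow> g \<in> L2 Q \<Longrightarrow>
      L2_norm Q (Le (G0 l g)) \<le> M * C0 * L2_norm Q g"
    by (rule T_props[OF L(4)]) blast
  define n N where "n = L2_norm Q phic" and "N = M * W22_norm Q phic"
  have n: "n \<ge> 0" and N: "N \<ge> 0" using M by (auto simp: n_def N_def L2_norm_nonneg W22_norm_def)
  define K where "K = M * C0"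
  have K: "K \<ge> 0" using M C0(1) by (simp add: K_def)
  \<comment> \<open>One summand per estimate: K for the contraction, N n for the size of F, 2 K N n
    for its Lipschitz constant, K^2 N n for the second-order remainder and K N n for the pairing in
    k2.\<close>
  define C where "C = K + N * n + 2 * K * N * n + K\<^sup>2 * N * n + K * N * n"
  have nn: "N * n \<ge> 0" "K * N * n \<ge> 0" "K\<^sup>2 * N * n \<ge> 0" using n N K by simp_all
  have C: "C \<ge> 0" "K \<le> C" "N * n \<le> C" "2 * K * N * n \<le> C" "K\<^sup>2 * N * n \<le> C" "K * N * n \<le> C"
    using K nn unfolding C_def by linarith+
  show ?thesis
  proof (rule that[OF L(1-4) C(1) L(10,11)])
    fix Le eps assume Le: "bounded_operator_W22_L2 Q M Le" and e: "0 < (eps::real)" "eps * C \<le> 1/2"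
    let ?f = "Le phic"
    define \<eta> where "\<eta> = eps * K"
    have \<eta>: "0 \<le> \<eta>" "\<eta> \<le> 1/2" using e K mult_left_mono[OF C(2) less_imp_le[OF e(1)]] unfolding \<eta>_def by (simp, linarith)
    have fL: "?f \<in> L2 Q" using bounded_operatorD(1)[OF Le phic_W22] .
    have fN: "L2_norm Q ?f \<le> N" using bounded_operatorD(3)[OF Le phic_W22] by (simp add: N_def)
    have lk: "cmod (\<Lambda> (z * z) - mc) \<le> \<kappa>" if "cmod z \<le> \<rho>" for z
    proof -
      have "\<kappa> * (cmod z)\<^sup>2 \<le> \<kappa> * 1" using that L(3,4) by (intro mult_left_mono power_le_one) auto
      then show ?thesis using L(8)[OF that] by simp
    qed
    have op: "L2_bounded_op Q \<eta> (\<lambda>g x. of_real eps * T Le (\<Lambda> (z * z)) z g x)" if "cmod z \<le> \<rho>" for z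
    proof -
      have "L2_bounded_op Q K (T Le (\<Lambda> (z * z)) z)" unfolding K_def by (rule C0(3)[OF M Le _ L(8)]) (use that L(3) in auto)
      from L2_bounded_op_scale[OF this, of "of_real eps"] show ?thesis using e(1) by (simp add: \<eta>_def)
    qed
    \<comment> \<open>For each z of the disc the Neumann series gives a solution; choosing one turns
      it into a function of z.\<close>
    have "\<exists>h. cmod z \<le> \<rho> \<longrightarrow> h \<in> L2 Q \<and> (AE x in lebesgue_on Q. h x = ?f x + of_real eps * T Le (\<Lambda> (z * z)) z h x)" for z
    proof (cases "cmod z \<le> \<rho>")
      case True
      obtain h where "h \<in> L2 Q" "AE x in lebesgue_on Q. h x = ?f x + of_real eps * T Le (\<Lambda> (z * z)) z h x"
        by (rule L2_fixpoint_exists[OF op[OF True] \<eta>(1) _ fL]) (use \<eta>(2) in simp)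
      then show ?thesis by blast
    qed simp
    then obtain h where h: "\<And>z. cmod z \<le> \<rho> \<Longrightarrow> h z \<in> L2 Q"
      "\<And>z. cmod z \<le> \<rho> \<Longrightarrow> AE x in lebesgue_on Q. h z x = ?f x + of_real eps * T Le (\<Lambda> (z * z)) z (h z) x" by metis
    have hN: "L2_norm Q (h z) \<le> 2 * N" if "cmod z \<le> \<rho>" for z
    proof -
      have "L2_norm Q (h z) \<le> L2_norm Q ?f / (1 - \<eta>)" by (rule L2_fixpoint_bound[OF op[OF that] _ fL h(1)[OF that] h(2)[OF that]]) (use \<eta> in simp)
      also have "\<dots> \<le> L2_norm Q ?f / (1/2)" by (intro divide_left_mono L2_norm_nonneg) (use \<eta> in auto)
      finally show ?thesis using fN by simp
    qed
    define F where "F z = of_real (pm s / 2) * L2_inner Q (h z) phic" for z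
    have pmn: "cmod (of_real (pm s / 2) * w) = cmod w / 2" for w using pm_sq(2) by (simp add: norm_mult)
    have 1: "cmod (F z) \<le> C" if z: "cmod z \<le> \<rho>" for z
    proof -
      have "cmod (L2_inner Q (h z) phic) \<le> L2_norm Q (h z) * n" unfolding n_def by (rule L2_inner_bound[OF h(1)[OF z] phic_L2])
      also have "\<dots> \<le> (2 * N) * n" using hN[OF z] n by (rule mult_right_mono)
      finally show ?thesis using C(3) unfolding F_def pmn by simp
    qed
    have 2: "cmod (F z - F z') \<le> eps * C * cmod (z - z')" if z: "cmod z \<le> \<rho>" and z': "cmod z' \<le> \<rho>" for z z'
    proof -
      have Lh: "(\<lambda>x. h z x - h z' x) \<in> L2 Q" by (rule L2_diff[OF h(1)[OF z] h(1)[OF z']])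
      have "L2_norm Q (\<lambda>x. of_real eps * T Le (\<Lambda> (z * z)) z (h z') x - of_real eps * T Le (\<Lambda> (z' * z')) z' (h z') x)
          = eps * L2_norm Q (\<lambda>x. T Le (\<Lambda> (z * z)) z (h z') x - T Le (\<Lambda> (z' * z')) z' (h z') x)"
        using e(1) by (simp add: L2_norm_cmult flip: right_diff_distrib)
      also have "\<dots> \<le> eps * (K * cmod (z - z') * L2_norm Q (h z'))"
        unfolding K_def by (intro mult_left_mono C0(4)[OF M Le _ _ L(8)[OF z] L(8)[OF z'] L(9)[OF z z'] h(1)[OF z']]) (use z z' L(3) e in auto)
      also have "\<dots> \<le> eps * (K * cmod (z - z') * (2 * N))"
        using hN[OF z'] K e(1) by (intro mult_left_mono) auto
      finally have "L2_norm Q (\<lambda>x. h z x - h z' x) \<le> 2 * (eps * (K * cmod (z - z') * (2 * N)))"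
        by (rule L2_fixpoint_perturb[OF op[OF z] \<eta>(2) op[OF z'] fL h(1)[OF z] h(2)[OF z] h(1)[OF z'] h(2)[OF z']])
      then have b: "L2_norm Q (\<lambda>x. h z x - h z' x) * n \<le> 2 * (eps * (K * cmod (z - z') * (2 * N))) * n" using n by (rule mult_right_mono)
      have "F z - F z' = of_real (pm s / 2) * L2_inner Q (\<lambda>x. h z x - h z' x) phic"
      proof -
        have "L2_inner Q (\<lambda>x. h z x - h z' x) phic = L2_inner Q (h z) phic - L2_inner Q (h z') phic"
          using L2_inner_linear[OF h(1)[OF z] h(1)[OF z'] phic_L2, of "-1"] by simp
        then show ?thesis unfolding F_def by (simp only: right_diff_distrib)
      qed
      then have "cmod (F z - F z') = cmod (L2_inner Q (\<lambda>x. h z x - h z' x) phic) / 2" by (simp only: pmn)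
      also have "\<dots> \<le> (2 * (eps * (K * cmod (z - z') * (2 * N))) * n) / 2"
        by (rule divide_right_mono[OF order_trans[OF L2_inner_bound[OF Lh phic_L2, folded n_def] b]]) simp
      also have "\<dots> = (2 * K * N * n) * (eps * cmod (z - z'))" by simp
      also have "\<dots> \<le> C * (eps * cmod (z - z'))" using C(4) e(1) by (intro mult_right_mono) auto
      finally show ?thesis by (simp add: mult_ac)
    qed
    have 3: "eig Le eps (\<Lambda> (z * z)) \<longleftrightarrow> z = of_real eps * F z" if z: "cmod z \<le> \<rho>" "Re z > 0" for z
      unfolding F_def
      using eig_iff[OF Le L(6)[OF z(1)] L(7)[OF z(1)] z(2) C0(2)[OF lk[OF z(1)]] op[OF z(1)] \<eta>(2) h(1)[OF z(1)] h(2)[OF z(1)]]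
      by (simp add: mult.assoc)
    have 4: "\<not> eig Le eps (\<Lambda> (z * z))" if z: "cmod z \<le> \<rho>" "Re z = 0" for z
      by (rule not_eig[OF Le L(6)[OF z(1)] L(7)[OF z(1)] z(2) C0(2)[OF lk[OF z(1)]] C0(5)[OF M Le lk[OF z(1)]]])
         (use e(1) \<eta>(2) in \<open>simp_all add: \<eta>_def K_def\<close>)
    have z0: "cmod 0 \<le> \<rho>" using L(2) by simp
    note op0 = op[OF z0, unfolded mult_zero_left L(5)] and h0 = h(1)[OF z0] h(2)[OF z0, unfolded mult_zero_left L(5)]
    have G: "Gm ?f = G0 mc ?f" using green_operator_eq[OF fL] by (rule ext)
    have 5: "F 0 = of_real (pm s / 2) * L2_inner Q (L2_inverse Q (\<lambda>g x. g x - of_real eps * Le (Gm g) x) ?f) phic"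
      unfolding F_def L2_inverse_fixpoint[OF op0 \<eta>(2) fL h0] ..
    have 6: "cmod (F 0 - of_real (pm s / 2) * (L2_inner Q ?f phic + of_real eps * L2_inner Q (Le (Gm ?f)) phic)) \<le> eps\<^sup>2 * C"
    proof -
      have ie: "L2_inner Q (\<lambda>x. of_real eps * T Le mc 0 ?f x) phic = of_real eps * L2_inner Q (Le (G0 mc ?f)) phic"
        by (simp add: T_at_edge L2_inner_def mult.assoc)
      have "F 0 - of_real (pm s / 2) * (L2_inner Q ?f phic + of_real eps * L2_inner Q (Le (Gm ?f)) phic)
        = of_real (pm s / 2) * (L2_inner Q (h 0) phic - (L2_inner Q ?f phic + L2_inner Q (\<lambda>x. of_real eps * T Le mc 0 ?f x) phic))"
        unfolding F_def G ie by (simp only: right_diff_distrib)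
      then have "cmod (F 0 - of_real (pm s / 2) * (L2_inner Q ?f phic + of_real eps * L2_inner Q (Le (Gm ?f)) phic))
        = cmod (L2_inner Q (h 0) phic - (L2_inner Q ?f phic + L2_inner Q (\<lambda>x. of_real eps * T Le mc 0 ?f x) phic)) / 2" by (simp only: pmn)
      also have "\<dots> \<le> (2 * \<eta>\<^sup>2 * L2_norm Q ?f * L2_norm Q phic) / 2"
        by (intro divide_right_mono L2_fixpoint_second_order[OF op0 \<eta> fL phic_L2 h0]) simp
      also have "\<dots> = (eps\<^sup>2 * K\<^sup>2) * (L2_norm Q ?f * n)" by (simp add: \<eta>_def n_def power_mult_distrib)
      also have "\<dots> \<le> (eps\<^sup>2 * K\<^sup>2) * (N * n)" using fN n by (intro mult_left_mono mult_right_mono) auto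
      also have "\<dots> = eps\<^sup>2 * (K\<^sup>2 * N * n)" by simp
      also have "\<dots> \<le> eps\<^sup>2 * C" using C(5) by (intro mult_left_mono) auto
      finally show ?thesis .
    qed
    have 7: "cmod (L2_inner Q (Le (Gm ?f)) phic) \<le> C"
    proof -
      have m\<kappa>: "cmod (mc - mc) \<le> \<kappa>" using L(4) by simp
      have W: "G0 mc ?f \<in> W22 Q" using C0(2)[OF m\<kappa> fL] by blast
      have "cmod (L2_inner Q (Le (G0 mc ?f)) phic) \<le> L2_norm Q (Le (G0 mc ?f)) * n"
        unfolding n_def by (rule L2_inner_bound[OF bounded_operatorD(1)[OF Le W] phic_L2])
      also have "\<dots> \<le> (K * N) * n"
      proof (rule mult_right_mono[OF _ n])
        have "L2_norm Q (Le (G0 mc ?f)) \<le> K * L2_norm Q ?f" unfolding K_def by (rule C0(5)[OF M Le m\<kappa> fL])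
        also have "\<dots> \<le> K * N" using fN K by (rule mult_left_mono)
        finally show "L2_norm Q (Le (G0 mc ?f)) \<le> K * N" .
      qed
      finally show ?thesis unfolding G using C(6) by linarith
    qed
    show "reduction_at Le eps \<Lambda> \<rho> C"
      unfolding reduction_at_def scalar_reduction_def
      by (rule exI[of _ F], intro conjI allI impI) (fact 1 2 3 4 5 6 7)+
  qed
qed

end

section \<open>Existence and asymptotics of the eigenvalue\<close>

text \<open>Banach's theorem on the closed disc, with contraction constant
  \<open>eps\<^sup>2 * C\<close>. The same constant measures the distance from
  \<open>eps * F 0\<close> relative to |z|, which is the relative error in the first
  expansion.\<close>

lemma scalar_fixpoint:
  fixes F :: "complex \<Rightarrow> complex"
  assumes b: "\<And>z. cmod z \<le> \<rho> \<Longrightarrow> cmod (F z) \<le> C"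
    and lip: "\<And>z z'. cmod z \<le> \<rho> \<Longrightarrow> cmod z' \<le> \<rho> \<Longrightarrow> cmod (F z - F z') \<le> eps * C * cmod (z - z')"
    and eps: "0 < eps" "eps\<^sup>2 * C \<le> 1/2" "eps * C \<le> \<rho>" and \<rho>: "0 < \<rho>" and C: "0 \<le> C"
  obtains z where "cmod z \<le> \<rho>" "z = of_real eps * F z" "cmod (z - of_real eps * F 0) \<le> eps\<^sup>2 * C * cmod z" "cmod z \<le> 2 * eps * cmod (F 0)"
proof -
  have d: "cmod (of_real eps * F z - of_real eps * F z') \<le> eps\<^sup>2 * C * cmod (z - z')" if "cmod z \<le> \<rho>" "cmod z' \<le> \<rho>" for z z'
  proof -
    have "cmod (of_real eps * F z - of_real eps * F z') = eps * cmod (F z - F z')"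
      using eps(1) by (simp add: norm_mult flip: right_diff_distrib)
    also have "\<dots> \<le> eps * (eps * C * cmod (z - z'))" using lip[OF that] eps(1) by (intro mult_left_mono) auto
    finally show ?thesis by (simp add: power2_eq_square mult_ac)
  qed
  have "\<exists>!z\<in>cball 0 \<rho>. of_real eps * F z = z"
  proof (rule Banach_fix[of _ "eps\<^sup>2 * C"])
    show "(\<lambda>z. of_real eps * F z) ` cball 0 \<rho> \<subseteq> cball 0 \<rho>"
    proof clarsimp
      fix z assume z: "cmod z \<le> \<rho>"
      have "eps * cmod (F z) \<le> eps * C" using b[OF z] eps(1) by simp
      then have "eps * cmod (F z) \<le> \<rho>" using eps(3) by linarith
      then show "cmod (of_real eps * F z) \<le> \<rho>" using eps(1) by (simp add: norm_mult)
    qed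
  next
    show "complete (cball 0 \<rho> :: complex set)" by (simp add: compact_imp_complete)
    show "0 \<le> eps\<^sup>2 * C" "eps\<^sup>2 * C < 1" using C eps(2) by auto
    show "dist (of_real eps * F x) (of_real eps * F y) \<le> eps\<^sup>2 * C * dist x y" if "x \<in> cball 0 \<rho>" "y \<in> cball 0 \<rho>" for x y
      using d[of x y] that by (simp add: dist_norm)
  qed (use \<rho> in simp)
  then obtain z where z0: "z \<in> cball 0 \<rho>" "of_real eps * F z = z" by blast
  have z: "cmod z \<le> \<rho>" using z0(1) by simp
  have 1: "cmod (z - of_real eps * F 0) \<le> eps\<^sup>2 * C * cmod z" using d[OF z, of 0] \<rho> by (simp add: z0(2))
  have "eps\<^sup>2 * C * cmod z \<le> 1/2 * cmod z" using eps(2) by (intro mult_right_mono) auto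
  then have "cmod z \<le> cmod (of_real eps * F 0) + cmod z / 2"
    using 1 norm_triangle_sub[of z "of_real eps * F 0"] by linarith
  then have "cmod z \<le> 2 * eps * cmod (F 0)" using eps(1) by (simp add: norm_mult)
  then show ?thesis by (rule that[OF z z0(2)[symmetric] 1])
qed

text \<open>In both expansions z^2 is replaced by some y^2 and z^2 - y^2 = (z - y)(z + y) is
  estimated. With y = \<epsilon> a both factors are proportional to |a|, giving a relative error.
  With y built from k1 + \<epsilon> k2 the first factor is O(\<epsilon>^3) and the second is
  \<epsilon> times O(|k1| + \<epsilon>).\<close>

lemma eigenvalue_expansion_bounds:
  fixes l c z a k1 k2 :: complex
  assumes eps: "0 < eps" "eps \<le> 1" and C: "0 \<le> C" and \<kappa>: "0 \<le> \<kappa>" and d: "0 < d" and \<sigma>: "\<bar>\<sigma>\<bar> = 1"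
    and z1: "cmod (z - of_real eps * a) \<le> eps\<^sup>2 * C * cmod z" and z2: "cmod z \<le> 2 * eps * cmod a" and a1: "cmod a \<le> C"
    and aX: "cmod (a - of_real (sqrt d) * (k1 + of_real eps * k2)) \<le> eps\<^sup>2 * C" and k2: "sqrt d * cmod k2 \<le> C"
    and l: "cmod (l - c + of_real (\<sigma> / d) * (z * z)) \<le> \<kappa> * cmod z ^ 4"
  shows "cmod (l - c + of_real (\<sigma> / d) * (of_real eps * a)\<^sup>2) \<le> (16 * \<kappa> * C\<^sup>2 + 6 * C / d) * eps ^ 4 * (cmod a)\<^sup>2"
    "cmod (l - c + of_real \<sigma> * (of_real eps * (k1 + of_real eps * k2))\<^sup>2)
      \<le> (16 * \<kappa> * C ^ 3 + 3 * C * (2 * C + 1) / d) * (sqrt d + 3 * C) * (eps ^ 4 * cmod k1 + eps ^ 5)"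
proof -
  let ?e = "of_real eps :: complex"
  have sd: "cmod (of_real (\<sigma> / d) * w) = cmod w / d" for w using \<sigma> d by (simp add: norm_mult norm_divide)
  have z4: "cmod z ^ 4 \<le> 16 * eps ^ 4 * cmod a ^ 4"
    using power_mono[OF z2 norm_ge_zero, of 4] by (simp add: power_mult_distrib)
  have gen: "cmod (l - c + of_real (\<sigma> / d) * y\<^sup>2) \<le> \<kappa> * (16 * eps ^ 4 * cmod a ^ 4) + cmod (z - y) * cmod (z + y) / d" for y
  proof -
    have "l - c + of_real (\<sigma> / d) * y\<^sup>2 = (l - c + of_real (\<sigma> / d) * (z * z)) - of_real (\<sigma> / d) * ((z - y) * (z + y))"
      by (simp add: power2_eq_square algebra_simps)
    then have "cmod (l - c + of_real (\<sigma> / d) * y\<^sup>2) \<le> cmod (l - c + of_real (\<sigma> / d) * (z * z)) + cmod (of_real (\<sigma> / d) * ((z - y) * (z + y)))"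
      by (metis norm_triangle_ineq4)
    also have "\<dots> \<le> \<kappa> * (16 * eps ^ 4 * cmod a ^ 4) + cmod (z - y) * cmod (z + y) / d"
      unfolding sd norm_mult[of "z - y" "z + y"] using l mult_left_mono[OF z4 \<kappa>] by linarith
    finally show ?thesis .
  qed
  have a2: "(cmod a)\<^sup>2 \<le> C\<^sup>2" using a1 by (intro power_mono) auto
  have na: "cmod (?e * a) = eps * cmod a" using eps by (simp add: norm_mult)
  show "cmod (l - c + of_real (\<sigma> / d) * (?e * a)\<^sup>2) \<le> (16 * \<kappa> * C\<^sup>2 + 6 * C / d) * eps ^ 4 * (cmod a)\<^sup>2"
  proof -
    have "cmod (z - ?e * a) \<le> eps\<^sup>2 * C * (2 * eps * cmod a)"
      using z1 mult_left_mono[OF z2, of "eps\<^sup>2 * C"] C by simp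
    moreover have "cmod (z + ?e * a) \<le> 3 * eps * cmod a" using norm_triangle_ineq[of z "?e * a"] z2 na by linarith
    ultimately have "cmod (z - ?e * a) * cmod (z + ?e * a) \<le> (eps\<^sup>2 * C * (2 * eps * cmod a)) * (3 * eps * cmod a)"
      by (intro mult_mono) (use eps C in auto)
    also have "\<dots> = 6 * C * (eps ^ 4 * (cmod a)\<^sup>2)" by (simp add: power2_eq_square power4_eq_xxxx)
    finally have "cmod (z - ?e * a) * cmod (z + ?e * a) / d \<le> 6 * C * (eps ^ 4 * (cmod a)\<^sup>2) / d" using d by (intro divide_right_mono) auto
    moreover have "\<kappa> * (16 * eps ^ 4 * cmod a ^ 4) \<le> 16 * \<kappa> * C\<^sup>2 * (eps ^ 4 * (cmod a)\<^sup>2)"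
    proof -
      have "\<kappa> * (16 * eps ^ 4 * cmod a ^ 4) = (16 * \<kappa> * (eps ^ 4 * (cmod a)\<^sup>2)) * (cmod a)\<^sup>2" by (simp add: power2_eq_square power4_eq_xxxx)
      also have "\<dots> \<le> (16 * \<kappa> * (eps ^ 4 * (cmod a)\<^sup>2)) * C\<^sup>2" using a2 \<kappa> eps by (intro mult_left_mono) auto
      finally show ?thesis by (simp add: mult_ac)
    qed
    ultimately show ?thesis using gen[of "?e * a"] by (simp add: algebra_simps)
  qed
  define X where "X = k1 + ?e * k2"
  define y where "y = of_real (sqrt d) * (?e * X)"
  define A where "A = cmod k1 + eps"
  define s where "s = sqrt d + 3 * C"
  have nX: "sqrt d * cmod X \<le> sqrt d * cmod k1 + eps * C"
  proof -
    have "cmod X \<le> cmod k1 + eps * cmod k2" unfolding X_def using norm_triangle_ineq[of k1 "?e * k2"] eps by (simp add: norm_mult)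
    then have "sqrt d * cmod X \<le> sqrt d * (cmod k1 + eps * cmod k2)" using d by (intro mult_left_mono) auto
    also have "\<dots> = sqrt d * cmod k1 + eps * (sqrt d * cmod k2)" by (simp add: algebra_simps)
    finally show ?thesis using mult_left_mono[OF k2, of eps] eps by linarith
  qed
  have eC: "eps\<^sup>2 * C \<le> eps * C" using eps C by (intro mult_right_mono) (auto simp: power2_eq_square mult_le_cancel_left1)
  have aX': "cmod (a - of_real (sqrt d) * X) \<le> eps\<^sup>2 * C" using aX by (simp add: X_def)
  have na1: "cmod a \<le> sqrt d * cmod k1 + 2 * eps * C"
    using norm_triangle_sub[of a "of_real (sqrt d) * X"] aX' nX eC d by (simp add: norm_mult)
  have sA: "sqrt d * cmod k1 + 3 * eps * C \<le> s * A"
    unfolding s_def A_def using eps C d by (simp add: algebra_simps)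
  \<comment> \<open>This comparison with |k1| + \<epsilon> is the source of the form of the second
    remainder.\<close>
  have aA: "cmod a \<le> s * A" using na1 sA mult_nonneg_nonneg[of eps C] eps C by linarith
  have zy: "cmod (z - y) \<le> eps ^ 3 * (C * (2 * C + 1))"
  proof -
    have "cmod (?e * a - y) = eps * cmod (a - of_real (sqrt d) * X)"
      using eps by (simp add: y_def norm_mult mult.left_commute flip: right_diff_distrib)
    also have "\<dots> \<le> eps * (eps\<^sup>2 * C)" using aX' eps by (intro mult_left_mono) auto
    finally have 1: "cmod (?e * a - y) \<le> eps ^ 3 * C" by (simp add: power2_eq_square power3_eq_cube mult_ac)
    have "cmod z \<le> 2 * eps * C" using z2 mult_left_mono[OF a1, of "2 * eps"] eps by linarith
    then have "eps\<^sup>2 * C * cmod z \<le> eps\<^sup>2 * C * (2 * eps * C)" using C by (intro mult_left_mono) auto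
    then have "cmod (z - ?e * a) \<le> eps ^ 3 * (2 * C * C)" using z1 by (simp add: power2_eq_square power3_eq_cube mult_ac)
    then show ?thesis using 1 norm_triangle_ineq[of "z - ?e * a" "?e * a - y"] by (simp add: algebra_simps)
  qed
  have zy': "cmod (z + y) \<le> 3 * eps * (s * A)"
  proof -
    have "cmod y = eps * (sqrt d * cmod X)" using eps d by (simp add: y_def norm_mult)
    also have "\<dots> \<le> eps * (s * A)" using nX sA eps C mult_nonneg_nonneg[of eps C] by (intro mult_left_mono) linarith+
    finally have "cmod y \<le> eps * (s * A)" .
    moreover have "cmod z \<le> 2 * eps * (s * A)" using z2 mult_left_mono[OF aA, of "2 * eps"] eps by linarith
    ultimately show ?thesis using norm_triangle_ineq[of z y] by linarith
  qed
  have "cmod (z - y) * cmod (z + y) \<le> (eps ^ 3 * (C * (2 * C + 1))) * (3 * eps * (s * A))"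
    by (intro mult_mono zy zy') (use eps C in auto)
  also have "\<dots> = (3 * C * (2 * C + 1)) * (s * (eps ^ 4 * A))" by (simp add: power3_eq_cube power4_eq_xxxx)
  finally have p1: "cmod (z - y) * cmod (z + y) / d \<le> (3 * C * (2 * C + 1)) * (s * (eps ^ 4 * A)) / d" using d by (intro divide_right_mono) auto
  have p2: "\<kappa> * (16 * eps ^ 4 * cmod a ^ 4) \<le> (16 * \<kappa> * C ^ 3) * (s * (eps ^ 4 * A))"
  proof -
    have "cmod a ^ 3 * cmod a \<le> C ^ 3 * (s * A)" by (intro mult_mono power_mono a1 aA) (use C in auto)
    then have "(16 * \<kappa> * eps ^ 4) * (cmod a ^ 3 * cmod a) \<le> (16 * \<kappa> * eps ^ 4) * (C ^ 3 * (s * A))" using \<kappa> by (intro mult_left_mono) auto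
    then show ?thesis by (simp add: power3_eq_cube power4_eq_xxxx mult_ac)
  qed
  have y2: "of_real (\<sigma> / d) * y\<^sup>2 = of_real \<sigma> * (?e * X)\<^sup>2"
  proof -
    have "complex_of_real (sqrt d) * complex_of_real (sqrt d) = of_real d" using d by (simp flip: of_real_mult)
    then have "y\<^sup>2 = of_real d * (?e * X)\<^sup>2" by (simp add: y_def power_mult_distrib power2_eq_square)
    then show ?thesis using d by simp
  qed
  have "cmod (l - c + of_real \<sigma> * (?e * X)\<^sup>2) \<le> (16 * \<kappa> * C ^ 3) * (s * (eps ^ 4 * A)) + (3 * C * (2 * C + 1)) * (s * (eps ^ 4 * A)) / d"
    using gen[of y] p1 p2 unfolding y2 by linarith
  also have "\<dots> = (16 * \<kappa> * C ^ 3 + 3 * C * (2 * C + 1) / d) * s * (eps ^ 4 * A)" by (simp add: distrib_right mult.assoc)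
  also have "eps ^ 4 * A = eps ^ 4 * cmod k1 + eps ^ 5" by (simp add: A_def algebra_simps power_numeral_reduce)
  finally show "cmod (l - c + of_real \<sigma> * (?e * (k1 + ?e * k2))\<^sup>2)
      \<le> (16 * \<kappa> * C ^ 3 + 3 * C * (2 * C + 1) / d) * (sqrt d + 3 * C) * (eps ^ 4 * cmod k1 + eps ^ 5)"
    by (simp only: X_def s_def)
qed

section \<open>Weak coupling: emergence and absence of the eigenvalue\<close>

context edge_Q begin

lemma eigenvalue_iff_eig: "eigenvalue (W22 UNIV) (H_pert p q Q L eps) l \<longleftrightarrow> eig (L eps) eps l"
  by (simp add: eigenvalue_def H_pert_def H0_def eig_def)

abbreviation "kk L eps \<equiv> k1 Q L s dD phic eps + of_real eps * k2 Q L Gm s dD phic eps"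
abbreviation "aa L eps \<equiv> of_real (pm s / 2) * L2_inner Q (A_op Q L Gm eps (L eps phic)) phic"

text \<open>What both halves of the result need from the reduction, stated for the given family and
  with F(0) already compared with k1 + \<epsilon> k2.\<close>

definition "weak_coupling L \<Lambda> r \<rho> \<kappa> C eps0 \<longleftrightarrow> r > 0 \<and> 0 < \<rho> \<and> \<kappa> \<ge> 0 \<and> C \<ge> 0 \<and> 0 < eps0 \<and> eps0 \<le> 1 \<and>
  (\<forall>z. cmod z \<le> \<rho> \<longrightarrow> cmod (\<Lambda> (z * z) - mc + of_real (pm s / cmod dD) * (z * z)) \<le> \<kappa> * cmod z ^ 4) \<and>
  (\<forall>l. cmod (l - mc) < r \<longrightarrow> (\<exists>z. cmod z \<le> \<rho> \<and> Re z \<ge> 0 \<and> l = \<Lambda> (z * z))) \<and>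
  (\<forall>eps. 0 < eps \<and> eps < eps0 \<longrightarrow> eps\<^sup>2 * C \<le> 1/2 \<and> eps * C \<le> \<rho> \<and>
    sqrt (cmod dD) * cmod (k2 Q L Gm s dD phic eps) \<le> C \<and> cmod (aa L eps - of_real (sqrt (cmod dD)) * kk L eps) \<le> eps\<^sup>2 * C \<and>
    (\<exists>F. F 0 = aa L eps \<and> scalar_reduction (L eps) eps \<Lambda> \<rho> C F))"

lemma small_coupling:
  assumes L: "\<And>eps. 0 < eps \<Longrightarrow> eps < eps1 \<Longrightarrow> bounded_operator_W22_L2 Q M (L eps)" and eps1: "eps1 > 0"
  obtains \<Lambda> r \<rho> \<kappa> C eps0 where "weak_coupling L \<Lambda> r \<rho> \<kappa> C eps0"
proof -
  \<comment> \<open>Nothing fixes the sign of \<open>M\<close>, hence the maximum with 0.\<close>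
  obtain \<Lambda> r \<rho> \<kappa> C where R: "r > 0" "0 < \<rho>" "\<rho> \<le> 1" "\<kappa> \<ge> 0" "C \<ge> 0"
    "\<And>z. cmod z \<le> \<rho> \<Longrightarrow> cmod (\<Lambda> (z * z) - mc + of_real (pm s / cmod dD) * (z * z)) \<le> \<kappa> * cmod z ^ 4"
    "\<And>l. cmod (l - mc) < r \<Longrightarrow> \<exists>z. cmod z \<le> \<rho> \<and> Re z \<ge> 0 \<and> l = \<Lambda> (z * z)"
    and E: "\<And>Le eps. bounded_operator_W22_L2 Q (max M 0) Le \<Longrightarrow> 0 < eps \<Longrightarrow> eps * C \<le> 1/2 \<Longrightarrow> reduction_at Le eps \<Lambda> \<rho> C"
    by (rule spectral_reduction[of "max M 0"]) (simp, blast)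
  \<comment> \<open>The three upper bounds besides \<open>eps1\<close> give \<epsilon>^2 \<le>
    \<epsilon>, \<epsilon> C \<le> 1/2 and \<epsilon> C \<le> \<rho>; the summand 1 in C + 1 avoids
    division by zero.\<close>
  define eps0 where "eps0 = min eps1 (min 1 (min (1 / (2 * (C + 1))) (\<rho> / (C + 1))))"
  have dd: "cmod dD > 0" using dD_nz by simp
  have C1: "C + 1 > 0" using R(5) by simp
  show ?thesis
  proof (rule that[of \<Lambda> r \<rho> \<kappa> C eps0], unfold weak_coupling_def, intro conjI allI impI; (elim conjE)?)
    show "eps0 > 0" "eps0 \<le> 1" using eps1 C1 R(2) by (auto simp: eps0_def)
  next
    fix eps assume e: "0 < eps" "eps < eps0"
    have e1: "eps < eps1" "eps < 1" "eps < 1 / (2 * (C + 1))" "eps < \<rho> / (C + 1)" using e(2) by (auto simp: eps0_def)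
    have ec: "eps * C \<le> 1/2" "eps * C \<le> \<rho>" using e1(3,4) e(1) C1 by (simp_all add: field_simps) 
    have "eps\<^sup>2 * C \<le> eps * C" using e(1) e1(2) R(5) by (intro mult_right_mono) (auto simp: power2_eq_square)
    then have ec2: "eps\<^sup>2 * C \<le> 1/2" using ec by linarith
    have B: "bounded_operator_W22_L2 Q (max M 0) (L eps)" by (rule bounded_operator_mono[OF L[OF e(1) e1(1)]]) simp
    obtain F where F: "scalar_reduction (L eps) eps \<Lambda> \<rho> C F" "F 0 = aa L eps"
        "cmod (F 0 - of_real (pm s / 2) * (L2_inner Q (L eps phic) phic + of_real eps * L2_inner Q (L eps (Gm (L eps phic))) phic)) \<le> eps\<^sup>2 * C"
        "cmod (L2_inner Q (L eps (Gm (L eps phic))) phic) \<le> C"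
      using E[OF B e(1) ec(1)] unfolding reduction_at_def A_op_def by blast
    let ?I1 = "L2_inner Q (L eps phic) phic" and ?I2 = "L2_inner Q (L eps (Gm (L eps phic))) phic"
    have sq: "complex_of_real (sqrt (cmod dD)) * (of_real (pm s) * w / of_real (2 * sqrt (cmod dD))) = of_real (pm s / 2) * w" for w
      using dd by simp
    have kk: "of_real (sqrt (cmod dD)) * kk L eps = of_real (pm s / 2) * (?I1 + of_real eps * ?I2)"
    proof -
      have "of_real (sqrt (cmod dD)) * kk L eps
        = of_real (sqrt (cmod dD)) * k1 Q L s dD phic eps + of_real eps * (of_real (sqrt (cmod dD)) * k2 Q L Gm s dD phic eps)"
        by (simp only: distrib_left mult.left_commute)
      also have "\<dots> = of_real (pm s / 2) * ?I1 + of_real eps * (of_real (pm s / 2) * ?I2)" unfolding k1_def k2_def sq ..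
      finally show ?thesis by (simp only: distrib_left mult.left_commute)
    qed
    have "sqrt (cmod dD) * cmod (k2 Q L Gm s dD phic eps) = cmod ?I2 / 2"
      unfolding k2_def using dd pm_sq(2) by (simp add: norm_mult norm_divide)
    then have k2: "sqrt (cmod dD) * cmod (k2 Q L Gm s dD phic eps) \<le> C" using F(4) norm_ge_zero[of ?I2] by linarith
    have k: "cmod (aa L eps - of_real (sqrt (cmod dD)) * kk L eps) \<le> eps\<^sup>2 * C" using F(3) unfolding kk F(2) .
    show "eps\<^sup>2 * C \<le> 1/2" "eps * C \<le> \<rho>" "sqrt (cmod dD) * cmod (k2 Q L Gm s dD phic eps) \<le> C"
      "cmod (aa L eps - of_real (sqrt (cmod dD)) * kk L eps) \<le> eps\<^sup>2 * C" by (fact ec2 ec(2) k2 k)+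
    show "\<exists>F. F 0 = aa L eps \<and> scalar_reduction (L eps) eps \<Lambda> \<rho> C F"
      by (intro exI[of _ F] conjI F)
  qed (use R in auto)
qed

text \<open>An eigenvalue near the edge would come from a root with Re z > 0, but F(z) stays within
  O(\<epsilon>^2) of a number whose real part is below any fixed negative multiple of \<epsilon>^2.
  Hence Re z = \<epsilon> Re F(z) would be negative.\<close>

lemma no_eigenvalue:
  assumes L: "\<And>eps. 0 < eps \<Longrightarrow> eps < eps1 \<Longrightarrow> bounded_operator_W22_L2 Q M (L eps)" and eps1: "eps1 > 0"
    and Cf: "filterlim Cf at_top (at_right 0)" and neg: "\<forall>\<^sub>F eps in at_right 0. Re (kk L eps) \<le> - Cf eps * eps\<^sup>2"
  shows "\<exists>r>0. \<exists>eps0>0. \<forall>eps. 0 < eps \<and> eps < eps0 \<longrightarrow> (\<forall>l. cmod (l - mc) < r \<longrightarrow> \<not> eig (L eps) eps l)"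
proof -
  obtain \<Lambda> r \<rho> \<kappa> C eps0 where cp: "weak_coupling L \<Lambda> r \<rho> \<kappa> C eps0" by (rule small_coupling[OF L eps1])
  have R: "r > 0" "0 < \<rho>" "C \<ge> 0" "0 < eps0"
    and \<Lambda>: "\<forall>l. cmod (l - mc) < r \<longrightarrow> (\<exists>z. cmod z \<le> \<rho> \<and> Re z \<ge> 0 \<and> l = \<Lambda> (z * z))"
    and E: "\<forall>eps. 0 < eps \<and> eps < eps0 \<longrightarrow> eps\<^sup>2 * C \<le> 1/2 \<and> eps * C \<le> \<rho> \<and>
      sqrt (cmod dD) * cmod (k2 Q L Gm s dD phic eps) \<le> C \<and> cmod (aa L eps - of_real (sqrt (cmod dD)) * kk L eps) \<le> eps\<^sup>2 * C \<and>
      (\<exists>F. F 0 = aa L eps \<and> scalar_reduction (L eps) eps \<Lambda> \<rho> C F)"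
    using cp unfolding weak_coupling_def by - (elim conjE, assumption)+
  define rt where "rt = sqrt (cmod dD)"
  have rt: "rt > 0" using dD_nz by (simp add: rt_def)
  \<comment> \<open>C pays for comparing F(0) with k1 + \<epsilon> k2, C^2 for passing from F(0) to
    F(z), and 1 leaves the strict margin \<epsilon>^2.\<close>
  have "\<forall>\<^sub>F eps in at_right 0. (C + C\<^sup>2 + 1) / rt \<le> Cf eps" using Cf by (simp add: filterlim_at_top)
  then have "\<forall>\<^sub>F eps in at_right 0. (C + C\<^sup>2 + 1) / rt \<le> Cf eps \<and> Re (kk L eps) \<le> - Cf eps * eps\<^sup>2" using neg by eventually_elim simp
  then obtain e2 where e2: "e2 > 0" "\<And>eps. 0 < eps \<Longrightarrow> eps < e2 \<Longrightarrow> (C + C\<^sup>2 + 1) / rt \<le> Cf eps \<and> Re (kk L eps) \<le> - Cf eps * eps\<^sup>2"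
    unfolding eventually_at_right_field by blast
  have "\<not> eig (L eps) eps l" if e: "0 < eps" "eps < min eps0 e2" and l: "cmod (l - mc) < r" for eps l
  proof
    assume eig: "eig (L eps) eps l"
    have ee: "eps < eps0" "eps < e2" using e by auto
    obtain z where z: "cmod z \<le> \<rho>" "Re z \<ge> 0" "l = \<Lambda> (z * z)" using \<Lambda>[rule_format, OF l] by blast
    note Ee = E[rule_format, OF conjI[OF e(1) ee(1)], folded rt_def]
    obtain F where F0: "F 0 = aa L eps" "scalar_reduction (L eps) eps \<Lambda> \<rho> C F" using Ee by blast
    have k: "cmod (aa L eps - of_real rt * kk L eps) \<le> eps\<^sup>2 * C" using Ee by - (elim conjE)
    have F: "F 0 = aa L eps" "\<forall>z. cmod z \<le> \<rho> \<longrightarrow> cmod (F z) \<le> C"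
        "\<forall>z z'. cmod z \<le> \<rho> \<longrightarrow> cmod z' \<le> \<rho> \<longrightarrow> cmod (F z - F z') \<le> eps * C * cmod (z - z')"
        "\<forall>z. cmod z \<le> \<rho> \<longrightarrow> Re z > 0 \<longrightarrow> (eig (L eps) eps (\<Lambda> (z * z)) \<longleftrightarrow> z = of_real eps * F z)"
        "\<forall>z. cmod z \<le> \<rho> \<longrightarrow> Re z = 0 \<longrightarrow> \<not> eig (L eps) eps (\<Lambda> (z * z))"
      using F0 unfolding scalar_reduction_def by - (elim conjE, assumption)+
    have zp: "Re z > 0" using F(5)[rule_format, OF z(1)] z(2,3) eig by (cases "Re z = 0") auto
    have ze: "z = of_real eps * F z" using F(4)[rule_format, OF z(1) zp] z(3) eig by simp
    have cz: "cmod z \<le> eps * C"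
    proof -
      have "cmod z = eps * cmod (F z)" using arg_cong[OF ze, of cmod] e(1) by (simp add: norm_mult)
      then show ?thesis using F(2) z(1) e(1) by simp
    qed
    have "cmod (F z - F 0) \<le> eps * C * cmod z" using F(3)[rule_format, OF z(1), of 0] R(2) by simp
    also have "\<dots> \<le> eps * C * (eps * C)" using cz e(1) R(3) by (intro mult_left_mono) auto
    finally have fz: "cmod (F z - F 0) \<le> eps\<^sup>2 * C\<^sup>2" by (simp add: power2_eq_square mult_ac)
    have r1: "Re (F z) \<le> Re (F 0) + eps\<^sup>2 * C\<^sup>2" using fz complex_Re_le_cmod[of "F z - F 0"] by simp
    have rr: "Re (of_real rt * w) = rt * Re w" for w by simp
    have "Re (aa L eps - of_real rt * kk L eps) \<le> eps\<^sup>2 * C" by (rule order_trans[OF complex_Re_le_cmod k])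
    then have r2: "Re (F 0) \<le> rt * Re (kk L eps) + eps\<^sup>2 * C" unfolding F(1) minus_complex.sel rr by linarith
    have "rt * Re (kk L eps) \<le> rt * (- Cf eps * eps\<^sup>2)" using e2(2)[OF e(1) ee(2)] rt by (intro mult_left_mono) auto
    also have "\<dots> = - (rt * Cf eps) * eps\<^sup>2" by simp
    also have "\<dots> \<le> - (C + C\<^sup>2 + 1) * eps\<^sup>2"
    proof (rule mult_right_mono)
      have "C + C\<^sup>2 + 1 \<le> Cf eps * rt" using e2(2)[OF e(1) ee(2)] rt by (simp add: pos_divide_le_eq)
      then show "- (rt * Cf eps) \<le> - (C + C\<^sup>2 + 1)" by (simp add: mult.commute)
    qed simp
    finally have "Re (F z) \<le> - (eps\<^sup>2)" using r1 r2 by (simp add: algebra_simps)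
    then have "Re (F z) < 0" using e(1) by (smt (verit) zero_less_power)
    then have "Re (of_real eps * F z) < 0" using e(1) by (simp add: mult_pos_neg)
    then show False using zp ze by simp
  qed
  then show ?thesis using R(1,4) e2(1) by (intro exI[of _ r] conjI exI[of _ "min eps0 e2"]) auto
qed

text \<open>The scalar equation has a root whatever the sign; the lower bound on the real part
  places it in Re z > 0, where roots are eigenvalues. It also shows that the leading coefficient is
  non-zero, which a relative error term requires.\<close>

lemma eigenvalue_emerges:
  assumes L: "\<And>eps. 0 < eps \<Longrightarrow> eps < eps1 \<Longrightarrow> bounded_operator_W22_L2 Q M (L eps)" and eps1: "eps1 > 0"
    and Cf: "filterlim Cf at_top (at_right 0)" and pos: "\<forall>\<^sub>F eps in at_right 0. Re (kk L eps) \<ge> Cf eps * eps\<^sup>2"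
  obtains l K where "K \<ge> 0" "\<forall>\<^sub>F eps in at_right 0. 0 < eps \<and> eig (L eps) eps (l eps) \<and> aa L eps \<noteq> 0 \<and> cmod (aa L eps) \<le> K \<and>
    cmod (l eps - mc + of_real (pm s / cmod dD) * (of_real eps * aa L eps)\<^sup>2) \<le> K * eps ^ 4 * (cmod (aa L eps))\<^sup>2 \<and>
    cmod (l eps - mc + of_real (pm s) * (of_real eps * kk L eps)\<^sup>2) \<le> K * (eps ^ 4 * cmod (k1 Q L s dD phic eps) + eps ^ 5)"
proof -
  obtain \<Lambda> r \<rho> \<kappa> C eps0 where cp: "weak_coupling L \<Lambda> r \<rho> \<kappa> C eps0" by (rule small_coupling[OF L eps1])
  have R: "0 < \<rho>" "\<kappa> \<ge> 0" "C \<ge> 0" "0 < eps0" "eps0 \<le> 1"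
    and \<Lambda>: "\<forall>z. cmod z \<le> \<rho> \<longrightarrow> cmod (\<Lambda> (z * z) - mc + of_real (pm s / cmod dD) * (z * z)) \<le> \<kappa> * cmod z ^ 4"
    and E: "\<forall>eps. 0 < eps \<and> eps < eps0 \<longrightarrow> eps\<^sup>2 * C \<le> 1/2 \<and> eps * C \<le> \<rho> \<and>
      sqrt (cmod dD) * cmod (k2 Q L Gm s dD phic eps) \<le> C \<and> cmod (aa L eps - of_real (sqrt (cmod dD)) * kk L eps) \<le> eps\<^sup>2 * C \<and>
      (\<exists>F. F 0 = aa L eps \<and> scalar_reduction (L eps) eps \<Lambda> \<rho> C F)"
    using cp unfolding weak_coupling_def by - (elim conjE, assumption)+
  define d where "d = cmod dD"
  have d: "d > 0" using dD_nz by (simp add: d_def)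
  define rt where "rt = sqrt d"
  have rt: "rt > 0" using d by (simp add: rt_def)
  define K1 K2 where "K1 = 16 * \<kappa> * C\<^sup>2 + 6 * C / d" and "K2 = (16 * \<kappa> * C ^ 3 + 3 * C * (2 * C + 1) / d) * (rt + 3 * C)"
  have K: "K1 \<ge> 0" "K2 \<ge> 0" using R d rt by (auto simp: K1_def K2_def)
  define K where "K = C + K1 + K2"
  have KK: "C \<le> K" "K1 \<le> K" "K2 \<le> K" "0 \<le> K" using K R(3) by (auto simp: K_def)
  \<comment> \<open>C again compares F(0) with k1 + \<epsilon> k2; 2 C^2 covers the distance 2 C^2
    \<epsilon>^3 of the root from \<epsilon> F(0), and 1 leaves the margin \<epsilon>^3.\<close>
  have "\<forall>\<^sub>F eps in at_right 0. (C + 2 * C\<^sup>2 + 1) / rt \<le> Cf eps" using Cf by (simp add: filterlim_at_top)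
  then have "\<forall>\<^sub>F eps in at_right 0. (C + 2 * C\<^sup>2 + 1) / rt \<le> Cf eps \<and> Cf eps * eps\<^sup>2 \<le> Re (kk L eps)" using pos by eventually_elim simp
  then obtain e2 where e2: "e2 > 0" "\<And>eps. 0 < eps \<Longrightarrow> eps < e2 \<Longrightarrow> (C + 2 * C\<^sup>2 + 1) / rt \<le> Cf eps \<and> Cf eps * eps\<^sup>2 \<le> Re (kk L eps)"
    unfolding eventually_at_right_field by blast
  define good where "good eps l \<longleftrightarrow> 0 < eps \<and> eig (L eps) eps l \<and> aa L eps \<noteq> 0 \<and> cmod (aa L eps) \<le> K \<and>
    cmod (l - mc + of_real (pm s / d) * (of_real eps * aa L eps)\<^sup>2) \<le> K * eps ^ 4 * (cmod (aa L eps))\<^sup>2 \<and>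
    cmod (l - mc + of_real (pm s) * (of_real eps * kk L eps)\<^sup>2) \<le> K * (eps ^ 4 * cmod (k1 Q L s dD phic eps) + eps ^ 5)" for eps l
  have ex: "\<exists>l. good eps l" if e: "0 < eps" "eps < min eps0 e2" for eps
  proof -
    have ee: "eps < eps0" "eps < e2" "eps \<le> 1" using e R(5) by auto
    note Ee = E[rule_format, OF conjI[OF e(1) ee(1)], folded d_def rt_def]
    obtain F where F0: "F 0 = aa L eps" "scalar_reduction (L eps) eps \<Lambda> \<rho> C F" using Ee by blast
    have ec: "eps\<^sup>2 * C \<le> 1/2" "eps * C \<le> \<rho>" and k2: "rt * cmod (k2 Q L Gm s dD phic eps) \<le> C"
      and k: "cmod (aa L eps - of_real rt * kk L eps) \<le> eps\<^sup>2 * C" using Ee by - (elim conjE, assumption)+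
    have F: "\<forall>z. cmod z \<le> \<rho> \<longrightarrow> cmod (F z) \<le> C"
        "\<forall>z z'. cmod z \<le> \<rho> \<longrightarrow> cmod z' \<le> \<rho> \<longrightarrow> cmod (F z - F z') \<le> eps * C * cmod (z - z')"
        "\<forall>z. cmod z \<le> \<rho> \<longrightarrow> Re z > 0 \<longrightarrow> (eig (L eps) eps (\<Lambda> (z * z)) \<longleftrightarrow> z = of_real eps * F z)"
      using F0 unfolding scalar_reduction_def by - (elim conjE, assumption)+
    define A where "A = aa L eps"
    obtain z where z: "cmod z \<le> \<rho>" "z = of_real eps * F z" "cmod (z - of_real eps * A) \<le> eps\<^sup>2 * C * cmod z" "cmod z \<le> 2 * eps * cmod A"
      by (rule scalar_fixpoint[OF F(1)[rule_format] F(2)[rule_format] e(1) ec R(1,3), unfolded F0(1) A_def[symmetric]])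
    have AC: "cmod A \<le> C" using F(1)[rule_format, of 0] R(1) by (simp add: F0(1) A_def)
    have kA: "cmod (A - of_real rt * kk L eps) \<le> eps\<^sup>2 * C" using k by (simp only: A_def)
    have rr: "Re (of_real x * w) = x * Re w" for x w by simp
    have "- Re (A - of_real rt * kk L eps) \<le> eps\<^sup>2 * C"
      using abs_Re_le_cmod[of "A - of_real rt * kk L eps"] kA by linarith
    then have rA: "rt * Re (kk L eps) - eps\<^sup>2 * C \<le> Re A" unfolding minus_complex.sel rr by linarith
    have "(C + 2 * C\<^sup>2 + 1) * eps\<^sup>2 \<le> (rt * Cf eps) * eps\<^sup>2"
    proof (rule mult_right_mono)
      show "C + 2 * C\<^sup>2 + 1 \<le> rt * Cf eps" using e2(2)[OF e(1) ee(2)] rt by (simp add: pos_divide_le_eq mult.commute)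
    qed simp
    also have "\<dots> = rt * (Cf eps * eps\<^sup>2)" by simp
    also have "\<dots> \<le> rt * Re (kk L eps)" using e2(2)[OF e(1) ee(2)] rt by (intro mult_left_mono) auto
    finally have A1: "(2 * C\<^sup>2 + 1) * eps\<^sup>2 \<le> Re A" using rA by (simp add: algebra_simps)
    have "cmod z \<le> 2 * eps * C" using z(4) mult_left_mono[OF AC, of "2 * eps"] e(1) by linarith
    then have "eps\<^sup>2 * C * cmod z \<le> eps\<^sup>2 * C * (2 * eps * C)" using R(3) by (intro mult_left_mono) auto
    then have "cmod (z - of_real eps * A) \<le> 2 * C\<^sup>2 * eps ^ 3" using z(3) by (simp add: power2_eq_square power3_eq_cube mult_ac)
    then have "- Re (z - of_real eps * A) \<le> 2 * C\<^sup>2 * eps ^ 3" using abs_Re_le_cmod[of "z - of_real eps * A"] by linarith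
    then have "eps * Re A - 2 * C\<^sup>2 * eps ^ 3 \<le> Re z" unfolding minus_complex.sel rr by linarith
    moreover have "2 * C\<^sup>2 * eps ^ 3 + eps ^ 3 \<le> eps * Re A"
      using mult_left_mono[OF A1, of eps] e(1) by (simp add: algebra_simps power2_eq_square power3_eq_cube)
    ultimately have zp: "Re z > 0" using zero_less_power[OF e(1), of 3] by linarith
    have eig: "eig (L eps) eps (\<Lambda> (z * z))" using F(3)[rule_format, OF z(1) zp] z(2) by blast
    have A0: "A \<noteq> 0" using z(4) zp by auto
    note B = eigenvalue_expansion_bounds[OF e(1) ee(3) R(3,2) d pm_sq(2) z(3,4) AC kA[unfolded rt_def] k2[unfolded rt_def] \<Lambda>[rule_format, OF z(1), folded d_def], folded rt_def, folded K1_def K2_def]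
    have "cmod (\<Lambda> (z * z) - mc + of_real (pm s / d) * (of_real eps * A)\<^sup>2) \<le> K * eps ^ 4 * (cmod A)\<^sup>2"
      by (rule order_trans[OF B(1)]) (intro mult_right_mono KK; use e(1) in simp)
    moreover have "cmod (\<Lambda> (z * z) - mc + of_real (pm s) * (of_real eps * kk L eps)\<^sup>2) \<le> K * (eps ^ 4 * cmod (k1 Q L s dD phic eps) + eps ^ 5)"
      by (rule order_trans[OF B(2)]) (intro mult_right_mono KK; use e(1) in simp)
    ultimately show ?thesis
      unfolding good_def using e(1) eig A0 order_trans[OF AC KK(1)] by (intro exI[of _ "\<Lambda> (z * z)"] conjI) (simp_all only: A_def not_False_eq_True)
  qed
  \<comment> \<open>All conclusions are gathered in \<open>good\<close>, so that one choice of
    eigenvalue satisfies both expansions.\<close>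
  define l where "l eps = (SOME l. good eps l)" for eps
  have gl: "good eps (l eps)" if "0 < eps" "eps < min eps0 e2" for eps unfolding l_def by (rule someI_ex[OF ex[OF that]])
  have "\<forall>\<^sub>F eps in at_right 0. good eps (l eps)"
    unfolding eventually_at_right_field using gl R(4) e2(1) by (intro exI[of _ "min eps0 e2"]) auto
  then show ?thesis unfolding good_def d_def by (rule that[OF KK(4)])
qed

end

context edge_Q begin

text \<open>Passage from explicit inequalities to limits and order symbols; the factor 4 in the
  denominator comes from the 1/2 in F(0).\<close>

lemma eigenvalue_asymptotics:
  assumes L: "\<And>eps. 0 < eps \<Longrightarrow> eps < eps1 \<Longrightarrow> bounded_operator_W22_L2 Q M (L eps)" and eps1: "eps1 > 0"
    and Cf: "filterlim Cf at_top (at_right 0)" and pos: "\<forall>\<^sub>F eps in at_right 0. Re (kk L eps) \<ge> Cf eps * eps\<^sup>2"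
  shows "\<exists>l::real \<Rightarrow> complex.
     (\<forall>\<^sub>F eps in at_right 0. eig (L eps) eps (l eps)) \<and> (l \<longlongrightarrow> mc) (at_right 0) \<and>
     (\<exists>r::real \<Rightarrow> complex. r \<in> O[at_right 0](\<lambda>eps. of_real (eps\<^sup>2)) \<and>
        (\<forall>\<^sub>F eps in at_right 0. l eps = mc - of_real (pm s) * of_real (eps\<^sup>2 / (4 * cmod dD))
               * (L2_inner Q (A_op Q L Gm eps (L eps phic)) phic)\<^sup>2 * (1 + r eps))) \<and>
     (\<lambda>eps. cmod (l eps - (mc - of_real (pm s) * of_real (eps\<^sup>2) * (kk L eps)\<^sup>2)))
       \<in> O[at_right 0](\<lambda>eps. eps ^ 4 * cmod (k1 Q L s dD phic eps) + eps ^ 5)"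
proof -
  obtain l K where K: "K \<ge> 0" and ev: "\<forall>\<^sub>F eps in at_right 0. 0 < eps \<and> eig (L eps) eps (l eps) \<and> aa L eps \<noteq> 0 \<and> cmod (aa L eps) \<le> K \<and>
    cmod (l eps - mc + of_real (pm s / cmod dD) * (of_real eps * aa L eps)\<^sup>2) \<le> K * eps ^ 4 * (cmod (aa L eps))\<^sup>2 \<and>
    cmod (l eps - mc + of_real (pm s) * (of_real eps * kk L eps)\<^sup>2) \<le> K * (eps ^ 4 * cmod (k1 Q L s dD phic eps) + eps ^ 5)"
    by (rule eigenvalue_emerges[OF L eps1 Cf pos])
  define A where "A eps = aa L eps" for eps
  define X where "X eps = kk L eps" for eps
  define d where "d = cmod dD"
  have d: "d > 0" using dD_nz by (simp add: d_def)
  note ev' = ev[folded A_def X_def d_def]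
  have pmc: "of_real (pm s) * of_real (pm s) = (1 :: complex)" using pm_sq(1) by (metis of_real_1 of_real_mult)
  have sd: "cmod (of_real (pm s / d) * w) = cmod w / d" for w using pm_sq(2) d by (simp add: norm_mult norm_divide)
  \<comment> \<open>The relative error is defined by solving the expansion for it, so the formula
    holds exactly wherever the leading coefficient is non-zero; only its size remains to be
    estimated.\<close>
  define r where "r eps = - (l eps - mc) * of_real (pm s * d) / (of_real eps * A eps)\<^sup>2 - 1" for eps
  have "\<forall>\<^sub>F eps in at_right 0. eig (L eps) eps (l eps)" using ev' by eventually_elim simp
  moreover have "(l \<longlongrightarrow> mc) (at_right 0)"
    unfolding Lim_null[of l]
  proof (rule Lim_null_comparison)
    show "\<forall>\<^sub>F eps in at_right 0. norm (l eps - mc) \<le> K * eps ^ 4 * K\<^sup>2 + (eps * K)\<^sup>2 / d"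
      using ev'
    proof eventually_elim
      case (elim eps)
      then have a: "0 < eps" "cmod (A eps) \<le> K"
        and b: "cmod (l eps - mc + of_real (pm s / d) * (of_real eps * A eps)\<^sup>2) \<le> K * eps ^ 4 * (cmod (A eps))\<^sup>2" by blast+
      have "K * eps ^ 4 * (cmod (A eps))\<^sup>2 \<le> K * eps ^ 4 * K\<^sup>2" using a K by (intro mult_left_mono power_mono) auto
      moreover have "cmod (of_real (pm s / d) * (of_real eps * A eps)\<^sup>2) \<le> (eps * K)\<^sup>2 / d"
        unfolding sd norm_power using a K d by (intro divide_right_mono power_mono) (auto simp: norm_mult)
      ultimately show ?case
        using b norm_triangle_ineq4[of "l eps - mc + of_real (pm s / d) * (of_real eps * A eps)\<^sup>2" "of_real (pm s / d) * (of_real eps * A eps)\<^sup>2"]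
        unfolding add_diff_cancel_right' by linarith
    qed
    show "((\<lambda>eps. K * eps ^ 4 * K\<^sup>2 + (eps * K)\<^sup>2 / d) \<longlongrightarrow> 0) (at_right 0)" using d by (auto intro!: tendsto_eq_intros)
  qed
  moreover have "r \<in> O[at_right 0](\<lambda>eps. of_real (eps\<^sup>2))"
  proof (rule bigoI[of _ "K * d"])
    show "\<forall>\<^sub>F eps in at_right 0. norm (r eps) \<le> K * d * norm (complex_of_real (eps\<^sup>2))"
      using ev'
    proof eventually_elim
      case (elim eps)
      then have a: "0 < eps" "A eps \<noteq> 0"
        and b: "cmod (l eps - mc + of_real (pm s / d) * (of_real eps * A eps)\<^sup>2) \<le> K * eps ^ 4 * (cmod (A eps))\<^sup>2" by blast+
      define y where "y = (of_real eps * A eps)\<^sup>2"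
      have y: "y \<noteq> 0" "cmod y = eps\<^sup>2 * (cmod (A eps))\<^sup>2" using a by (simp_all add: y_def norm_power norm_mult power_mult_distrib)
      have "of_real (pm s * d) * (of_real (pm s / d) * y) = y" using d pmc by (simp add: mult.assoc[symmetric])
      moreover have "- W * c / y - 1 = - (c * (W + e * y)) / y" if "c * (e * y) = y" for W c e
        using y(1) unfolding distrib_left that by (simp add: diff_divide_distrib mult.commute)
      ultimately have "r eps = - (of_real (pm s * d) * (l eps - mc + of_real (pm s / d) * y)) / y"
        by (simp only: r_def y_def)
      then have "cmod (r eps) = d * cmod (l eps - mc + of_real (pm s / d) * y) / cmod y"
        using d pm_sq(2) by (simp only: norm_divide norm_minus_cancel norm_mult[of "of_real (pm s * d)"] norm_of_real) (simp add: abs_mult)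
      also have "\<dots> \<le> d * (K * eps ^ 4 * (cmod (A eps))\<^sup>2) / cmod y"
        using b d unfolding y_def by (intro divide_right_mono mult_left_mono) auto
      also have "\<dots> = K * d * eps\<^sup>2" unfolding y(2) using a by (simp add: power2_eq_square power4_eq_xxxx)
      finally show ?case by (simp add: norm_power)
    qed
  qed
  moreover have "\<forall>\<^sub>F eps in at_right 0. l eps = mc - of_real (pm s) * of_real (eps\<^sup>2 / (4 * cmod dD))
               * (L2_inner Q (A_op Q L Gm eps (L eps phic)) phic)\<^sup>2 * (1 + r eps)"
    using ev'
  proof eventually_elim
    case (elim eps)
    then have a: "0 < eps" "A eps \<noteq> 0" by blast+
    define I where "I = L2_inner Q (A_op Q L Gm eps (L eps phic)) phic"
    have "A eps * A eps = (of_real (pm s) * of_real (pm s)) * I * I / 4" by (simp add: A_def I_def)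
    then have I: "I\<^sup>2 = 4 * (A eps)\<^sup>2" unfolding pmc by (simp add: power2_eq_square mult.commute)
    have "of_real (pm s) * of_real (eps\<^sup>2 / (4 * d)) * I\<^sup>2 * (1 + r eps) = - (of_real (pm s) * of_real (pm s)) * (l eps - mc)"
      unfolding I r_def using a d by (simp add: field_simps power2_eq_square)
    then show ?case unfolding pmc d_def I_def by simp
  qed
  moreover have "(\<lambda>eps. cmod (l eps - (mc - of_real (pm s) * of_real (eps\<^sup>2) * (kk L eps)\<^sup>2)))
       \<in> O[at_right 0](\<lambda>eps. eps ^ 4 * cmod (k1 Q L s dD phic eps) + eps ^ 5)"
  proof (rule bigoI[of _ K])
    show "\<forall>\<^sub>F eps in at_right 0. norm (cmod (l eps - (mc - of_real (pm s) * of_real (eps\<^sup>2) * (kk L eps)\<^sup>2)))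
        \<le> K * norm (eps ^ 4 * cmod (k1 Q L s dD phic eps) + eps ^ 5)"
      using ev' unfolding X_def[symmetric]
    proof eventually_elim
      case (elim eps)
      then have a: "0 < eps" and b: "cmod (l eps - mc + of_real (pm s) * (of_real eps * X eps)\<^sup>2) \<le> K * (eps ^ 4 * cmod (k1 Q L s dD phic eps) + eps ^ 5)" by blast+
      have eq1: "l eps - (mc - of_real (pm s) * of_real (eps\<^sup>2) * (X eps)\<^sup>2) = l eps - mc + of_real (pm s) * (of_real eps * X eps)\<^sup>2"
        by (simp add: power_mult_distrib)
      have eq2: "norm (eps ^ 4 * cmod (k1 Q L s dD phic eps) + eps ^ 5) = eps ^ 4 * cmod (k1 Q L s dD phic eps) + eps ^ 5"
        using a by simp
      show ?case unfolding eq1 eq2 using b by (simp only: real_norm_def abs_norm_cancel)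
    qed
  qed
  ultimately show ?thesis by blast
qed

end

theorem theorem2p9:
  fixes p q :: "real \<Rightarrow> real"
    and p0 a b M \<epsilon>1 :: real
    and L :: "real \<Rightarrow> (real \<Rightarrow> complex) \<Rightarrow> real \<Rightarrow> complex"
    and \<theta>1 \<theta>2 :: "complex \<Rightarrow> real \<Rightarrow> complex"
    and \<mu> :: "edge \<Rightarrow> nat \<Rightarrow> real"
    and s :: edge
    and n :: nat
    and \<phi> :: "real \<Rightarrow> real"
  assumes "\<And>x. p (x + 1) = p x" and "\<And>x. q (x + 1) = q x"
    and "piecewise_C1 p" and "piecewise_continuous q"
    and "p0 > 0" and "\<And>x. p x \<ge> p0" and "p 0 = 1"
    and "a < b"
    and "\<epsilon>1 > 0"
    and "\<And>\<epsilon>. 0 < \<epsilon> \<Longrightarrow> \<epsilon> < \<epsilon>1 \<Longrightarrow> bounded_operator_W22_L2 {a<..<b} M (L \<epsilon>)"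
    and "fundamental_solutions p q \<theta>1 \<theta>2"
    and "band_edges p q \<mu>"
    and "nondegenerate_edge \<mu> s n"
    and "edge_eigenfunction p q \<theta>1 \<theta>2 n (\<mu> s n) \<phi>"
  shows
    "let Q = {a<..<b};
         m = \<mu> s n;
         \<phi>c = (\<lambda>x. complex_of_real (\<phi> x));
         dD = deriv (discriminant \<theta>1 \<theta>2) (of_real m);
         G = green_operator Q \<theta>1 \<theta>2 m;
         K1 = k1 Q L s dD \<phi>c;
         K2 = k2 Q L G s dD \<phi>c
     in
       ((\<exists>C::real \<Rightarrow> real. filterlim C at_top (at_right 0) \<and>
            (\<forall>\<^sub>F \<epsilon> in at_right 0. Re (K1 \<epsilon> + of_real \<epsilon> * K2 \<epsilon>) \<ge> C \<epsilon> * \<epsilon>\<^sup>2)) \<longrightarrow>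
          (\<exists>l::real \<Rightarrow> complex.
             (\<forall>\<^sub>F \<epsilon> in at_right 0. eigenvalue (W22 UNIV) (H_pert p q Q L \<epsilon>) (l \<epsilon>)) \<and>
             (l \<longlongrightarrow> of_real m) (at_right 0) \<and>
             (\<exists>r::real \<Rightarrow> complex. r \<in> O[at_right 0](\<lambda>\<epsilon>. of_real (\<epsilon>\<^sup>2)) \<and>
                (\<forall>\<^sub>F \<epsilon> in at_right 0.
                   l \<epsilon> = of_real m
                     - of_real (pm s) * of_real (\<epsilon>\<^sup>2 / (4 * cmod dD))
                       * (L2_inner Q (A_op Q L G \<epsilon> (L \<epsilon> \<phi>c)) \<phi>c)\<^sup>2 * (1 + r \<epsilon>))) \<and>
             (\<lambda>\<epsilon>. cmod (l \<epsilon> - (of_real m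
                     - of_real (pm s) * of_real (\<epsilon>\<^sup>2) * (K1 \<epsilon> + of_real \<epsilon> * K2 \<epsilon>)\<^sup>2)))
               \<in> O[at_right 0](\<lambda>\<epsilon>. \<epsilon> ^ 4 * cmod (K1 \<epsilon>) + \<epsilon> ^ 5)))
       \<and>
       ((\<exists>C::real \<Rightarrow> real. filterlim C at_top (at_right 0) \<and>
            (\<forall>\<^sub>F \<epsilon> in at_right 0. Re (K1 \<epsilon> + of_real \<epsilon> * K2 \<epsilon>) \<le> - C \<epsilon> * \<epsilon>\<^sup>2)) \<longrightarrow>
          (\<exists>r>0. \<exists>\<epsilon>0>0. \<forall>\<epsilon>. 0 < \<epsilon> \<and> \<epsilon> < \<epsilon>0 \<longrightarrow>
             (\<forall>l. cmod (l - of_real m) < r \<longrightarrow>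
                \<not> eigenvalue (W22 UNIV) (H_pert p q Q L \<epsilon>) l)))"
proof -
  interpret edge_Q p q p0 \<theta>1 \<theta>2 \<mu> s n \<phi> a b
    by unfold_locales (fact assms)+
  show ?thesis
    unfolding Let_def eigenvalue_iff_eig m_def[symmetric] dD_def[symmetric]
  proof ((intro conjI impI; elim exE conjE), goal_cases)
    case (1 C)
    show ?case by (rule eigenvalue_asymptotics[where L = L and M = M and ?eps1.0 = \<epsilon>1 and Cf = C, OF assms(10,9) 1])
  next
    case (2 C)
    show ?case by (rule no_eigenvalue[where L = L and M = M and ?eps1.0 = \<epsilon>1 and Cf = C, OF assms(10,9) 2])
  qed
qed

end
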